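(* Let $\mathbb K$ be an algebraically closed field of characteristic $3$. Let $\mathfrak e_6=\mathfrak g(A)$ with purely even Cartan matrix $$A=\begin{pmatrix}2&0&-1&0&0&0\\0&2&0&-1&0&0\\-1&0&2&-1&0&0\\0&-1&-1&2&-1&0\\0&0&0&-1&2&-1\\0&0&0&0&-1&2\end{pmatrix},$$ and let $\mathfrak z$ be the (one-dimensional) center of $\mathfrak e_6^{(1)}$, so that $\mathfrak e_6^{(1)}/\mathfrak z$ is a simple Lie algebra. Let $\mathfrak g(2,3)=\mathfrak g(\widetilde A)$ be the Elduque and Cunha Lie superalgebra with Cartan matrix $\widetilde A=\begin{pmatrix}0&-1&0\\-1&0&-1\\0&-1&0\end{pmatrix}$ in which all three indices are odd, and let $\mathfrak c$ be the (one-dimensional) center of $\mathfrak g(2,3)^{(1)}$. Then the semisimplification of $\mathfrak e_6^{(1)}/\mathfrak z$, as an object in $\mathrm{Rep}\,\alpha_3$ under the adjoint action of $e_1+e_2+e_6$, is (isomorphic as a Lie superalgebra to) $\mathfrak g(2,3)^{(1)}/\mathfrak c$.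
   Context: **Contragredient Lie superalgebras.** Lie superalgebras in characteristic $3$ are required to satisfy $[x,[x,x]]=0$ for odd $x$. Let $A=(a_{ij})$ be an $n\times n$ integer matrix (a Cartan matrix) with a parity $\mathrm{par}(i)\in\mathbb Z/2$ for each index; let $\overline A=(\overline a_{ij})$ be its reduction mod $3$, of rank $s$. Let $\widetilde{\mathfrak h}$ be a $\mathbb K$-vector space of dimension $2n-s$ with linearly independent $h_1,\dots,h_n\in\widetilde{\mathfrak h}$ and linearly independent $\alpha_1,\dots,\alpha_n\in\widetilde{\mathfrak h}^*$ such that $\alpha_j(h_i)=\overline a_{ij}$. $\widetilde{\mathfrak g}(A)$ is the Lie superalgebra generated by $\widetilde{\mathfrak h}$ (even) and $e_i,f_i$ ($1\le i\le n$) of parity $\mathrm{par}(i)$, with relations $[e_i,f_j]=\delta_{ij}h_i$, $[h,e_j]=\alpha_j(h)e_j$, $[h,f_j]=-\alpha_j(h)f_j$, $[\widetilde{\mathfrak h},\widetilde{\mathfrak h}]=0$. It is graded by the free abelian group $Q=\bigoplus_k\mathbb Z\alpha_k$ with $\deg e_i=\alpha_i$, $\deg f_i=-\alpha_i$, $\deg h=0$. $\mathfrak g(A)=\widetilde{\mathfrak g}(A)/\mathfrak r$, where $\mathfrak r$ is the largest $Q$-graded ideal meeting $\widetilde{\mathfrak h}$ trivially; images of $e_i,f_i,h_i$ (also in quotients) keep their names. $X^{(1)}=[X,X]$ is the derived algebra; $\mathfrak g(A)^{(1)}$ is generated by the $e_i,f_i,h_i$. If all parities are $0$, $\mathfrak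 g(A)$ is a Lie algebra. **Semisimplification.** $\mathrm{Rep}\,\alpha_3$ (representations of the Frobenius kernel of $\mathbb G_a$) is the symmetric tensor category of finite-dimensional $\mathbb K[t]/(t^3)$-modules, with $t$ acting on $V\otimes W$ by $t\otimes1+1\otimes t$ and the flip as braiding. Its indecomposables are $J_1,J_2,J_3$, where $t$ acts on $J_n=\mathbb K^n$ as one nilpotent Jordan block. A Lie algebra $\mathfrak g$ with a derivation $d$, $d^3=0$, is a Lie algebra in $\mathrm{Rep}\,\alpha_3$ with $t$ acting by $d$; "under the adjoint action of $x$" means $d=\mathrm{ad}\,x$. The semisimplification functor $V\mapsto\overline V$ is the quotient of $\mathrm{Rep}\,\alpha_3$ by negligible morphisms ($u:V\to W$ with $\mathrm{tr}(u\circ v)=0$ for all $v:W\to V$), with target the Verlinde category $\mathrm{Ver}_3$, whose simple objects are $L_1=\overline{J_1}$, $L_2=\overline{J_2}$ ($\overline{J_3}=0$); $\mathrm{Ver}_3$ is identified with super vector spaces, $L_1$ being an even line and $L_2$ an odd line, so $\overline{\mathfrak g}$ is a Lie superalgebra. Explicitly, decompose $\mathfrak g$ into Jordan blocks $x_i$ ($i\le n_1$), $x_i\mapsto x_i'$ ($n_1<i\le n_1+n_2$), and blocks $x_i\mapsto x_i'\mapsto x_i''$ (arrows are the action of $d$). Then $\overline{\mathfrak g}$ has basis $y_i$ ($i\le n_1+n_2$), even for $i\le n_1$ and odd for $i>n_1$; the coefficient of $y_k$ in $[y_i,y_j]$ is the coefficient of $x_k$ in $[x_i,x_j]$ if the parities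 of $y_i,y_j,y_k$ are compatible and $y_i,y_j$ are not both odd; it is the coefficient of $x_k$ in $-[x_i,x_j']+[x_i',x_j]$ if $i,j>n_1$, $k\le n_1$; and $0$ otherwise. *)

theory Defs
  imports
    "Jordan_Normal_Form.DL_Rank"
    "Jordan_Normal_Form.Jordan_Normal_Form"
    "HOL-Library.Poly_Mapping"
    "HOL-Library.Z2"
    "HOL-Algebra.QuotRing"
begin

(* they hide the record fields of the same name *)
hide_const (open) Multiset.mult Polynomial.smult

section \<open>Lie superalgebras\<close>

text \<open>
  The multiplication of the underlying record is the superbracket; its unit is never used.
  The field \<open>part\<close> gives the homogeneous components, indexed by \<open>\<int>/2\<close>. All vector spaces are
  over a type \<open>'k\<close> of scalars, turned into a record by \<^const>\<open>class_ring\<close>.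
\<close>

record ('k, 'v) superalg = "('k, 'v) module" +
  part :: "bit \<Rightarrow> 'v set"

definition koszul_sign :: "bit \<Rightarrow> bit \<Rightarrow> 'k :: field" where
  "koszul_sign p q = (if p = 1 \<and> q = 1 then - 1 else 1)"

text \<open>
  The elements whose vanishing turns a superalgebra into a Lie superalgebra. The last family is
  a consequence of the other two unless the characteristic is 3. Characteristic 2 would
  require further data and is not covered.
\<close>

definition lie_identities :: "('k :: field, 'v) superalg \<Rightarrow> 'v set" where
  "lie_identities L =
     {x \<otimes>\<^bsub>L\<^esub> y \<oplus>\<^bsub>L\<^esub> koszul_sign p q \<odot>\<^bsub>L\<^esub> (y \<otimes>\<^bsub>L\<^esub> x)
        | p q x y. x \<in> part L p \<and> y \<in> part L q} \<union>
     {x \<otimes>\<^bsub>L\<^esub> (y \<otimes>\<^bsub>L\<^esub> z) \<ominus>\<^bsub>L\<^esub> (x \<otimes>\<^bsub>L\<^esub> y) \<otimes>\<^bsub>L\<^esub> z \<ominus>\<^bsub>L\<^esub> koszul_sign p q \<odot>\<^bsub>L\<^esub> (y \<otimes>\<^bsub>L\<^esub> (x \<otimes>\<^bsub>L\<^esub> z))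
        | p q x y z. x \<in> part L p \<and> y \<in> part L q \<and> z \<in> carrier L} \<union>
     {x \<otimes>\<^bsub>L\<^esub> (x \<otimes>\<^bsub>L\<^esub> x) | x. x \<in> part L 1}"

locale superalgebra = vectorspace class_ring L
  for L :: "('k :: field, 'v) superalg" (structure) +
  assumes part_subspace: "VectorSpace.subspace class_ring (part L p) L"
    and part_decomposition:
      "x \<in> carrier L \<Longrightarrow> \<exists>!u. u \<in> part L 0 \<times> part L 1 \<and> x = fst u \<oplus> snd u"
    and bracket_part: "\<lbrakk>x \<in> part L p; y \<in> part L q\<rbrakk> \<Longrightarrow> x \<otimes> y \<in> part L (p + q)"
    and bracket_add_left:
      "\<lbrakk>x \<in> carrier L; y \<in> carrier L; z \<in> carrier L\<rbrakk> \<Longrightarrow> (x \<oplus> y) \<otimes> z = x \<otimes> z \<oplus> y \<otimes> z"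
    and bracket_add_right:
      "\<lbrakk>x \<in> carrier L; y \<in> carrier L; z \<in> carrier L\<rbrakk> \<Longrightarrow> x \<otimes> (y \<oplus> z) = x \<otimes> y \<oplus> x \<otimes> z"
    and bracket_smult_left:
      "\<lbrakk>x \<in> carrier L; y \<in> carrier L\<rbrakk> \<Longrightarrow> (c \<odot>\<^bsub>L\<^esub> x) \<otimes> y = c \<odot>\<^bsub>L\<^esub> (x \<otimes> y)"
    and bracket_smult_right:
      "\<lbrakk>x \<in> carrier L; y \<in> carrier L\<rbrakk> \<Longrightarrow> x \<otimes> (c \<odot>\<^bsub>L\<^esub> y) = c \<odot>\<^bsub>L\<^esub> (x \<otimes> y)"

locale lie_superalgebra = superalgebra +
  assumes lie_identities_vanish: "lie_identities L \<subseteq> {\<zero>}"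

definition superalg_iso ::
    "('k :: field, 'v) superalg \<Rightarrow> ('k, 'w) superalg \<Rightarrow> ('v \<Rightarrow> 'w) set" where
  "superalg_iso L M =
     {\<phi> \<in> LinearCombinations.module_hom class_ring L M. bij_betw \<phi> (carrier L) (carrier M) \<and>
        (\<forall>x\<in>carrier L. \<forall>y\<in>carrier L. \<phi> (x \<otimes>\<^bsub>L\<^esub> y) = \<phi> x \<otimes>\<^bsub>M\<^esub> \<phi> y) \<and>
        (\<forall>p. \<phi> ` part L p = part M p)}"

definition lie_superalgebra_isomorphic ::
    "('k :: field, 'v) superalg \<Rightarrow> ('k, 'w) superalg \<Rightarrow> bool" where
  "lie_superalgebra_isomorphic L M \<longleftrightarrow>
     lie_superalgebra L \<and> lie_superalgebra M \<and> superalg_iso L M \<noteq> {}"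

definition superalg_ideal :: "('k :: field, 'v) superalg \<Rightarrow> 'v set \<Rightarrow> bool" where
  "superalg_ideal L I \<longleftrightarrow> VectorSpace.subspace class_ring I L \<and>
     (\<forall>x\<in>carrier L. \<forall>a\<in>I. x \<otimes>\<^bsub>L\<^esub> a \<in> I \<and> a \<otimes>\<^bsub>L\<^esub> x \<in> I)"

definition superalg_genideal :: "('k :: field, 'v) superalg \<Rightarrow> 'v set \<Rightarrow> 'v set" where
  "superalg_genideal L S = \<Inter>{I. superalg_ideal L I \<and> S \<subseteq> I}"

definition coset_smult :: "('k, 'v, 'm) module_scheme \<Rightarrow> 'v set \<Rightarrow> 'k \<Rightarrow> 'v set \<Rightarrow> 'v set" where
  "coset_smult M N c X = (\<Union>x\<in>X. N +>\<^bsub>M\<^esub> (c \<odot>\<^bsub>M\<^esub> x))"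

definition quot_superalg ::
    "('k :: field, 'v) superalg \<Rightarrow> 'v set \<Rightarrow> ('k, 'v set) superalg" where
  "quot_superalg L I =
     \<lparr>carrier = a_rcosets\<^bsub>L\<^esub> I, mult = rcoset_mult L I, one = undefined, zero = I,
      add = set_add L, smult = coset_smult L I, part = (\<lambda>p. (+>\<^bsub>L\<^esub>) I ` part L p)\<rparr>"

definition derived_superalg :: "('k :: field, 'v) superalg \<Rightarrow> ('k, 'v) superalg" where
  "derived_superalg L =
     (let S = LinearCombinations.module.span class_ring L
                {x \<otimes>\<^bsub>L\<^esub> y | x y. x \<in> carrier L \<and> y \<in> carrier L}
      in L\<lparr>carrier := S, part := (\<lambda>p. part L p \<inter> S)\<rparr>)"

definition superalg_center :: "('k :: field, 'v) superalg \<Rightarrow> 'v set" where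
  "superalg_center L = {z \<in> carrier L. \<forall>x\<in>carrier L. z \<otimes>\<^bsub>L\<^esub> x = \<zero>\<^bsub>L\<^esub>}"


section \<open>Lie superalgebras given by generators and relations\<close>

text \<open>
  The free nonassociative superalgebra on a set of generators has the bracketed words as basis.
  The Lie superalgebra with given relators is its quotient by the ideal generated by the
  relators and by all values of the Lie superalgebra identities.
\<close>

datatype (gens: 'g) lie_word = Gen 'g | Brac "'g lie_word" "'g lie_word"

primrec word_degree :: "('g \<Rightarrow> 'd :: plus) \<Rightarrow> 'g lie_word \<Rightarrow> 'd" where
  "word_degree d (Gen g) = d g"
| "word_degree d (Brac u v) = word_degree d u + word_degree d v"

definition free_gen :: "'g \<Rightarrow> 'g lie_word \<Rightarrow>\<^sub>0 'k :: field" where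
  "free_gen g = Poly_Mapping.single (Gen g) 1"

definition free_brac ::
    "('g lie_word \<Rightarrow>\<^sub>0 'k :: field) \<Rightarrow> ('g lie_word \<Rightarrow>\<^sub>0 'k) \<Rightarrow> ('g lie_word \<Rightarrow>\<^sub>0 'k)" where
  "free_brac x y = (\<Sum>u\<in>Poly_Mapping.keys x. \<Sum>v\<in>Poly_Mapping.keys y.
     Poly_Mapping.single (Brac u v) (Poly_Mapping.lookup x u * Poly_Mapping.lookup y v))"

definition free_smult :: "'k :: field \<Rightarrow> ('g lie_word \<Rightarrow>\<^sub>0 'k) \<Rightarrow> ('g lie_word \<Rightarrow>\<^sub>0 'k)" where
  "free_smult c x = Poly_Mapping.map ((*) c) x"

definition free_carrier :: "'g set \<Rightarrow> ('g lie_word \<Rightarrow>\<^sub>0 'k :: field) set" where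
  "free_carrier G = {x. \<forall>w\<in>Poly_Mapping.keys x. gens w \<subseteq> G}"

definition free_homogeneous ::
    "'g set \<Rightarrow> ('g \<Rightarrow> 'd :: plus) \<Rightarrow> 'd \<Rightarrow> ('g lie_word \<Rightarrow>\<^sub>0 'k :: field) set" where
  "free_homogeneous G d \<beta> =
     {x \<in> free_carrier G. \<forall>w\<in>Poly_Mapping.keys x. word_degree d w = \<beta>}"

definition free_superalg ::
    "'g set \<Rightarrow> ('g \<Rightarrow> bit) \<Rightarrow> ('k :: field, 'g lie_word \<Rightarrow>\<^sub>0 'k) superalg" where
  "free_superalg G par =
     \<lparr>carrier = free_carrier G, mult = free_brac, one = undefined, zero = 0, add = (+),
      smult = free_smult, part = free_homogeneous G par\<rparr>"

definition presentation_ideal ::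
    "'g set \<Rightarrow> ('g \<Rightarrow> bit) \<Rightarrow> ('g lie_word \<Rightarrow>\<^sub>0 'k :: field) set \<Rightarrow> ('g lie_word \<Rightarrow>\<^sub>0 'k) set" where
  "presentation_ideal G par R =
     superalg_genideal (free_superalg G par) (lie_identities (free_superalg G par) \<union> R)"


section \<open>Contragredient Lie superalgebras\<close>

text \<open>
  All indices are counted from 0. The field \<open>cartan_space\<close> is the vector space called
  \<open>\<hh>\<close> with a tilde in the literature, \<open>coroot\<close> and \<open>root\<close> are the chosen elements
  \<open>h\<^sub>i\<close> of it and \<open>\<alpha>\<^sub>j\<close> of its dual.
\<close>

record ('k, 'h) cartan_datum =
  cartan_matrix :: "int mat"
  parity :: "nat \<Rightarrow> bit"
  cartan_space :: "('k, 'h) module"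
  coroot :: "nat \<Rightarrow> 'h"
  root :: "nat \<Rightarrow> 'h \<Rightarrow> 'k"

definition cartan_rank :: "('k :: field, 'h) cartan_datum \<Rightarrow> nat" where
  "cartan_rank D = vec_space.rank (dim_row (cartan_matrix D))
     (map_mat of_int (cartan_matrix D) :: 'k mat)"

definition cartan_realization :: "('k :: field, 'h) cartan_datum \<Rightarrow> bool" where
  "cartan_realization D \<longleftrightarrow>
     (let n = dim_row (cartan_matrix D); V = cartan_space D in
        dim_col (cartan_matrix D) = n \<and>
        vectorspace class_ring V \<and> vectorspace.fin_dim class_ring V \<and>
        vectorspace.dim class_ring V = 2 * n - cartan_rank D \<and>
        coroot D \<in> {..<n} \<rightarrow> carrier V \<and> inj_on (coroot D) {..<n} \<and>
        \<not> module.lin_dep class_ring V (coroot D ` {..<n}) \<and>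
        (\<forall>j<n. \<forall>x\<in>carrier V. \<forall>y\<in>carrier V. root D j (x \<oplus>\<^bsub>V\<^esub> y) = root D j x + root D j y) \<and>
        (\<forall>j<n. \<forall>c. \<forall>x\<in>carrier V. root D j (c \<odot>\<^bsub>V\<^esub> x) = c * root D j x) \<and>
        (\<forall>c. (\<forall>x\<in>carrier V. (\<Sum>j<n. c j * root D j x) = 0) \<longrightarrow> (\<forall>j<n. c j = 0)) \<and>
        (\<forall>i<n. \<forall>j<n. root D j (coroot D i) = of_int (cartan_matrix D $$ (i, j))))"

datatype 'h chev_gen = CartanGen 'h | EGen nat | FGen nat

definition chev_gens :: "('k :: field, 'h) cartan_datum \<Rightarrow> 'h chev_gen set" where
  "chev_gens D = CartanGen ` carrier (cartan_space D) \<union>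
     EGen ` {..<dim_row (cartan_matrix D)} \<union> FGen ` {..<dim_row (cartan_matrix D)}"

primrec chev_parity :: "('k, 'h) cartan_datum \<Rightarrow> 'h chev_gen \<Rightarrow> bit" where
  "chev_parity D (CartanGen x) = 0"
| "chev_parity D (EGen i) = parity D i"
| "chev_parity D (FGen i) = parity D i"

text \<open>The first two families make \<open>x \<mapsto> CartanGen x\<close> linear.\<close>

definition chev_relators ::
    "('k :: field, 'h) cartan_datum \<Rightarrow> ('h chev_gen lie_word \<Rightarrow>\<^sub>0 'k) set" where
  "chev_relators D =
     (let n = dim_row (cartan_matrix D); V = cartan_space D;
          h = (\<lambda>x. free_gen (CartanGen x)); e = (\<lambda>i. free_gen (EGen i));
          f = (\<lambda>i. free_gen (FGen i))
      in {h (x \<oplus>\<^bsub>V\<^esub> y) - (h x + h y) | x y. x \<in> carrier V \<and> y \<in> carrier V} \<union>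
         {h (c \<odot>\<^bsub>V\<^esub> x) - free_smult c (h x) | c x. x \<in> carrier V} \<union>
         {free_brac (e i) (f j) - (if i = j then h (coroot D i) else 0) | i j. i < n \<and> j < n} \<union>
         {free_brac (h x) (e j) - free_smult (root D j x) (e j) | x j. x \<in> carrier V \<and> j < n} \<union>
         {free_brac (h x) (f j) + free_smult (root D j x) (f j) | x j. x \<in> carrier V \<and> j < n} \<union>
         {free_brac (h x) (h y) | x y. x \<in> carrier V \<and> y \<in> carrier V})"

definition chev_free ::
    "('k :: field, 'h) cartan_datum \<Rightarrow> ('k, 'h chev_gen lie_word \<Rightarrow>\<^sub>0 'k) superalg" where
  "chev_free D = free_superalg (chev_gens D) (chev_parity D)"

definition chev_ideal ::
    "('k :: field, 'h) cartan_datum \<Rightarrow> ('h chev_gen lie_word \<Rightarrow>\<^sub>0 'k) set" where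
  "chev_ideal D = presentation_ideal (chev_gens D) (chev_parity D) (chev_relators D)"

definition big_contragredient ::
    "('k :: field, 'h) cartan_datum \<Rightarrow> ('k, ('h chev_gen lie_word \<Rightarrow>\<^sub>0 'k) set) superalg" where
  "big_contragredient D = quot_superalg (chev_free D) (chev_ideal D)"

text \<open>The free abelian group \<open>Q\<close> on the simple roots is \<^typ>\<open>nat \<Rightarrow>\<^sub>0 int\<close>.\<close>

primrec chev_degree :: "'h chev_gen \<Rightarrow> nat \<Rightarrow>\<^sub>0 int" where
  "chev_degree (CartanGen x) = 0"
| "chev_degree (EGen i) = Poly_Mapping.single i 1"
| "chev_degree (FGen i) = - Poly_Mapping.single i 1"

definition big_component ::
    "('k :: field, 'h) cartan_datum \<Rightarrow> (nat \<Rightarrow>\<^sub>0 int) \<Rightarrow> ('h chev_gen lie_word \<Rightarrow>\<^sub>0 'k) set set" where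
  "big_component D \<beta> =
     (+>\<^bsub>chev_free D\<^esub>) (chev_ideal D) ` free_homogeneous (chev_gens D) chev_degree \<beta>"

definition big_cartan ::
    "('k :: field, 'h) cartan_datum \<Rightarrow> ('h chev_gen lie_word \<Rightarrow>\<^sub>0 'k) set set" where
  "big_cartan D =
     (\<lambda>x. chev_ideal D +>\<^bsub>chev_free D\<^esub> free_gen (CartanGen x)) ` carrier (cartan_space D)"

definition root_graded ::
    "('k :: field, 'h) cartan_datum \<Rightarrow> ('h chev_gen lie_word \<Rightarrow>\<^sub>0 'k) set set \<Rightarrow> bool" where
  "root_graded D I \<longleftrightarrow>
     (\<forall>x\<in>I. \<exists>B y. finite B \<and> (\<forall>\<beta>\<in>B. y \<beta> \<in> I \<inter> big_component D \<beta>) \<and>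
        x = (\<Oplus>\<^bsub>big_contragredient D\<^esub>\<beta>\<in>B. y \<beta>))"

definition contragredient_radical ::
    "('k :: field, 'h) cartan_datum \<Rightarrow> ('h chev_gen lie_word \<Rightarrow>\<^sub>0 'k) set set" where
  "contragredient_radical D =
     (GREATEST I. superalg_ideal (big_contragredient D) I \<and> root_graded D I \<and>
        I \<inter> big_cartan D = {\<zero>\<^bsub>big_contragredient D\<^esub>})"

definition contragredient ::
    "('k :: field, 'h) cartan_datum \<Rightarrow> ('k, ('h chev_gen lie_word \<Rightarrow>\<^sub>0 'k) set set) superalg" where
  "contragredient D = quot_superalg (big_contragredient D) (contragredient_radical D)"

definition chev_e ::
    "('k :: field, 'h) cartan_datum \<Rightarrow> nat \<Rightarrow> ('h chev_gen lie_word \<Rightarrow>\<^sub>0 'k) set set" where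
  "chev_e D i = contragredient_radical D
     +>\<^bsub>big_contragredient D\<^esub> (chev_ideal D +>\<^bsub>chev_free D\<^esub> free_gen (EGen i))"

definition derived_mod_center ::
    "('k :: field, 'v) superalg \<Rightarrow> ('k, 'v set) superalg" where
  "derived_mod_center L = quot_superalg (derived_superalg L) (superalg_center (derived_superalg L))"


section \<open>The category \<open>Rep \<alpha>\<^sub>3\<close> and its semisimplification\<close>

text \<open>An object is a finite-dimensional vector space together with the action \<open>t\<close>.\<close>

definition rep_alpha3 :: "('k :: field, 'v, 'm) module_scheme \<Rightarrow> ('v \<Rightarrow> 'v) \<Rightarrow> bool" where
  "rep_alpha3 V t \<longleftrightarrow> vectorspace class_ring V \<and> vectorspace.fin_dim class_ring V \<and>
     t \<in> LinearCombinations.module_hom class_ring V V \<and> (\<forall>x\<in>carrier V. t (t (t x)) = \<zero>\<^bsub>V\<^esub>)"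

definition lie_algebra_in_rep_alpha3 :: "('k :: field, 'v) superalg \<Rightarrow> ('v \<Rightarrow> 'v) \<Rightarrow> bool" where
  "lie_algebra_in_rep_alpha3 L d \<longleftrightarrow>
     lie_superalgebra L \<and> part L 1 = {\<zero>\<^bsub>L\<^esub>} \<and> rep_alpha3 L d \<and>
     (\<forall>x\<in>carrier L. \<forall>y\<in>carrier L. d (x \<otimes>\<^bsub>L\<^esub> y) = d x \<otimes>\<^bsub>L\<^esub> y \<oplus>\<^bsub>L\<^esub> x \<otimes>\<^bsub>L\<^esub> d y)"

definition rep_hom ::
    "('k :: field, 'v, 'm) module_scheme \<Rightarrow> ('v \<Rightarrow> 'v) \<Rightarrow> ('k, 'w, 'n) module_scheme \<Rightarrow> ('w \<Rightarrow> 'w)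
     \<Rightarrow> ('v \<Rightarrow> 'w) set" where
  "rep_hom V s W t = {u \<in> LinearCombinations.module_hom class_ring V W.
     u \<in> extensional (carrier V) \<and> (\<forall>x\<in>carrier V. u (s x) = t (u x))}"

definition hom_space ::
    "('k :: field, 'v, 'm) module_scheme \<Rightarrow> ('v \<Rightarrow> 'v) \<Rightarrow> ('k, 'w, 'n) module_scheme \<Rightarrow> ('w \<Rightarrow> 'w)
     \<Rightarrow> ('k, 'v \<Rightarrow> 'w) module" where
  "hom_space V s W t =
     \<lparr>carrier = rep_hom V s W t, mult = undefined, one = undefined,
      zero = (\<lambda>x\<in>carrier V. \<zero>\<^bsub>W\<^esub>),
      add = (\<lambda>u v. \<lambda>x\<in>carrier V. u x \<oplus>\<^bsub>W\<^esub> v x),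
      smult = (\<lambda>c u. \<lambda>x\<in>carrier V. c \<odot>\<^bsub>W\<^esub> u x)\<rparr>"

definition lin_trace :: "('k :: field, 'v, 'm) module_scheme \<Rightarrow> ('v \<Rightarrow> 'v) \<Rightarrow> 'k" where
  "lin_trace V f = (THE \<tau>. \<exists>B M. finite B \<and> vectorspace.basis class_ring V B \<and>
     (\<forall>b\<in>B. f b = (\<Oplus>\<^bsub>V\<^esub>c\<in>B. M c b \<odot>\<^bsub>V\<^esub> c)) \<and> \<tau> = (\<Sum>b\<in>B. M b b))"

definition negligible ::
    "('k :: field, 'v, 'm) module_scheme \<Rightarrow> ('v \<Rightarrow> 'v) \<Rightarrow> ('k, 'w, 'n) module_scheme \<Rightarrow> ('w \<Rightarrow> 'w)
     \<Rightarrow> ('v \<Rightarrow> 'w) set" where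
  "negligible V s W t =
     {u \<in> rep_hom V s W t. \<forall>v\<in>rep_hom W t V s. lin_trace W (u \<circ> v) = 0}"

text \<open>The space of morphisms from the image of \<open>V\<close> to the image of \<open>W\<close> in the Verlinde category.\<close>

definition ver3_hom_space ::
    "('k :: field, 'v, 'm) module_scheme \<Rightarrow> ('v \<Rightarrow> 'v) \<Rightarrow> ('k, 'w, 'n) module_scheme \<Rightarrow> ('w \<Rightarrow> 'w)
     \<Rightarrow> ('k, ('v \<Rightarrow> 'w) set) module" where
  "ver3_hom_space V s W t =
     (let H = hom_space V s W t; N = negligible V s W t
      in \<lparr>carrier = a_rcosets\<^bsub>H\<^esub> N, mult = undefined, one = undefined, zero = N,
          add = set_add H, smult = coset_smult H N\<rparr>)"

text \<open>
  \<open>J\<^sub>n\<close> is \<open>\<bbbK>\<^sup>n\<close> with one nilpotent Jordan block, acting by \<open>e\<^sub>0 \<mapsto> 0\<close> and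
  \<open>e\<^sub>k \<mapsto> e\<^sub>k\<^sub>-\<^sub>1\<close> for \<open>k > 0\<close>.
\<close>

abbreviation jordan_space :: "nat \<Rightarrow> ('k :: field, 'k vec) module" where
  "jordan_space n \<equiv> module_vec TYPE('k) n"

definition jordan_action :: "nat \<Rightarrow> 'k :: field vec \<Rightarrow> 'k vec" where
  "jordan_action n v = jordan_block n 0 *\<^sub>v v"

text \<open>
  The simple objects of the Verlinde category are the images \<open>L\<^sub>1\<close> and \<open>L\<^sub>2\<close> of
  \<open>J\<^sub>1\<close> and \<open>J\<^sub>2\<close>; they correspond to the even and the odd line. So an object \<open>X\<close> corresponds to
  the super vector space \<open>Hom(L\<^sub>1, X) \<oplus> Hom(L\<^sub>2, X)\<close>.
\<close>

definition simple_dim :: "bit \<Rightarrow> nat" where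
  "simple_dim p = (if p = 0 then 1 else 2)"

definition ver3_part ::
    "('k :: field, 'v, 'm) module_scheme \<Rightarrow> ('v \<Rightarrow> 'v) \<Rightarrow> bit \<Rightarrow> ('k, ('k vec \<Rightarrow> 'v) set) module" where
  "ver3_part V t p = ver3_hom_space (jordan_space (simple_dim p)) (jordan_action (simple_dim p)) V t"

text \<open>
  Writing the elements of \<open>J\<^sub>m \<otimes> J\<^sub>n\<close> as \<open>m \<times> n\<close> coefficient matrices, this is the
  morphism from the simple object of parity \<open>p + q\<close> to the tensor product of those of parities
  \<open>p\<close> and \<open>q\<close> by which \<open>L\<^sub>1\<close> is the tensor unit and \<open>L\<^sub>2 \<otimes> L\<^sub>2\<close> is identified with \<open>L\<^sub>1\<close>. The
  latter sends \<open>1\<close> to \<open>x' \<otimes> x - x \<otimes> x'\<close>, where \<open>x = e\<^sub>1\<close> and \<open>x' = t x = e\<^sub>0\<close>.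
\<close>

definition simple_fusion :: "bit \<Rightarrow> bit \<Rightarrow> 'k :: field vec \<Rightarrow> 'k mat" where
  "simple_fusion p q v = mat (simple_dim p) (simple_dim q)
     (\<lambda>(i, j). if p = 0 then v $ j else if q = 0 then v $ i
        else if i = 0 \<and> j = 1 then v $ 0 else if i = 1 \<and> j = 0 then - (v $ 0) else 0)"

definition bracket_on_tensor ::
    "('k :: field, 'v) superalg \<Rightarrow> ('k vec \<Rightarrow> 'v) \<Rightarrow> ('k vec \<Rightarrow> 'v) \<Rightarrow> 'k mat \<Rightarrow> 'v" where
  "bracket_on_tensor L f g T = (\<Oplus>\<^bsub>L\<^esub>i\<in>{..<dim_row T}. \<Oplus>\<^bsub>L\<^esub>j\<in>{..<dim_col T}.
     T $$ (i, j) \<odot>\<^bsub>L\<^esub> (f (unit_vec (dim_row T) i) \<otimes>\<^bsub>L\<^esub> g (unit_vec (dim_col T) j)))"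

definition hom_bracket ::
    "('k :: field, 'v) superalg \<Rightarrow> bit \<Rightarrow> bit \<Rightarrow> ('k vec \<Rightarrow> 'v) \<Rightarrow> ('k vec \<Rightarrow> 'v) \<Rightarrow> 'k vec \<Rightarrow> 'v" where
  "hom_bracket L p q f g =
     (\<lambda>v\<in>carrier (jordan_space (simple_dim (p + q))). bracket_on_tensor L f g (simple_fusion p q v))"

definition ver3_bracket ::
    "('k :: field, 'v) superalg \<Rightarrow> ('v \<Rightarrow> 'v) \<Rightarrow> bit \<Rightarrow> bit
     \<Rightarrow> ('k vec \<Rightarrow> 'v) set \<Rightarrow> ('k vec \<Rightarrow> 'v) set \<Rightarrow> ('k vec \<Rightarrow> 'v) set" where
  "ver3_bracket L d p q X Y =
     (let m = simple_dim (p + q) in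
      \<Union>f\<in>X. \<Union>g\<in>Y. negligible (jordan_space m) (jordan_action m) L d
        +>\<^bsub>hom_space (jordan_space m) (jordan_action m) L d\<^esub> hom_bracket L p q f g)"

definition semisimplification ::
    "('k :: field, 'v) superalg \<Rightarrow> ('v \<Rightarrow> 'v)
     \<Rightarrow> ('k, ('k vec \<Rightarrow> 'v) set \<times> ('k vec \<Rightarrow> 'v) set) superalg" where
  "semisimplification L d =
     (let S = ver3_part L d; br = ver3_bracket L d in
      \<lparr>carrier = carrier (S 0) \<times> carrier (S 1),
       mult = (\<lambda>(X0, X1) (Y0, Y1).
         (br 0 0 X0 Y0 \<oplus>\<^bsub>S 0\<^esub> br 1 1 X1 Y1, br 0 1 X0 Y1 \<oplus>\<^bsub>S 1\<^esub> br 1 0 X1 Y0)),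
       one = undefined,
       zero = (\<zero>\<^bsub>S 0\<^esub>, \<zero>\<^bsub>S 1\<^esub>),
       add = (\<lambda>(X0, X1) (Y0, Y1). (X0 \<oplus>\<^bsub>S 0\<^esub> Y0, X1 \<oplus>\<^bsub>S 1\<^esub> Y1)),
       smult = (\<lambda>c (X0, X1). (c \<odot>\<^bsub>S 0\<^esub> X0, c \<odot>\<^bsub>S 1\<^esub> X1)),
       part = (\<lambda>p. if p = 0 then carrier (S 0) \<times> {\<zero>\<^bsub>S 1\<^esub>} else {\<zero>\<^bsub>S 0\<^esub>} \<times> carrier (S 1))\<rparr>)"

end

(*
  Both sides are identified with explicit algebras with integral structure constants modulo 3. A
  Lie superalgebra M with elements e_i, f_i and a Cartan subalgebra satisfying the Chevalley
  relations receives a homomorphism from the presented algebra; it induces an isomorphism with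
  the contragredient algebra as soon as M is generated by these elements and every graded ideal
  of M meeting the Cartan subalgebra trivially is zero. For E6 the model comes from the root
  lattice with a bilinear sign cocycle, for g(2,3) from a table of structure constants. Passing to
  the derived algebra modulo its center drops the two last Cartan elements of the model. On the
  resulting 77-dimensional algebra, ad (e_1 + e_2 + e_6) has an explicit splitting into Jordan
  blocks, with 10 blocks of size 1, 14 of size 2 and 13 of size 3, and the brackets of the block
  generators are those of the model of g(2,3).
*)
theory Submission
  imports Defs "HOL-Library.Product_Plus" "HOL-Number_Theory.Cong"
begin

(* the imports make the names hidden in Defs visible again *)
hide_const (open) Multiset.mult Polynomial.smult

text \<open>The degree 0 component of the presented algebra is the Cartan subalgebra, and in the
  models every nonzero homogeneous vector of nonzero degree has a nonzero bracket of degree 0;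
  therefore the radical is exactly the kernel of the map to the model. Both Cartan matrices have
  corank 1 modulo 3: a kernel vector z gives a central combination of the coroots, which replaces
  the last coroot as a basis vector, and the abstractly given realization has one further dimension.
  The vectors e_1, e_2, e_6 belong to pairwise orthogonal simple roots. They commute, so in
  characteristic 3 the cube of the sum of their adjoint actions is the sum of the cubes, and
  vanishes. The derivation changes a root only along these three simple roots; the other three
  coordinates survive, and they are the root of g(2,3). In the semisimplification, maps from L_1 are
  ker d modulo ker d \<inter> im d, and maps from L_2 are ker d^2 modulo the x with d x in im d^2.
  Explicit projections onto the blocks of sizes 1 and 2 label these quotients by vectors of the
  model.\<close>

abbreviation (input) sel :: "int \<Rightarrow> int \<Rightarrow> 'a \<Rightarrow> 'a \<Rightarrow> 'a" where
 "sel x n y z \<equiv> if x = n then y else z"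
abbreviation "keys \<equiv> Poly_Mapping.keys"
abbreviation "lookup \<equiv> Poly_Mapping.lookup"
abbreviation "single \<equiv> Poly_Mapping.single"

section \<open>Algebras with a bilinear bracket\<close>

text \<open>The ungraded part of \<open>superalgebra\<close>. Quotients and derived algebras are
  handled at this level; their gradings and Lie identities are recovered later from an isomorphism
  with a model.\<close>

locale bracket_algebra = vectorspace class_ring L
 for L :: "('k :: field, 'v) superalg" (structure) +
 assumes bracket_closed: "\<lbrakk>x \<in> carrier L; y \<in> carrier L\<rbrakk> \<Longrightarrow> x \<otimes> y \<in> carrier L"
  and bracket_add_left:
   "\<lbrakk>x \<in> carrier L; y \<in> carrier L; z \<in> carrier L\<rbrakk> \<Longrightarrow> (x \<oplus> y) \<otimes> z = x \<otimes> z \<oplus> y \<otimes> z"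
  and bracket_add_right:
   "\<lbrakk>x \<in> carrier L; y \<in> carrier L; z \<in> carrier L\<rbrakk> \<Longrightarrow> x \<otimes> (y \<oplus> z) = x \<otimes> y \<oplus> x \<otimes> z"
  and bracket_smult_left:
   "\<lbrakk>x \<in> carrier L; y \<in> carrier L\<rbrakk> \<Longrightarrow> (c \<odot>\<^bsub>L\<^esub> x) \<otimes> y = c \<odot>\<^bsub>L\<^esub> (x \<otimes> y)"
  and bracket_smult_right:
   "\<lbrakk>x \<in> carrier L; y \<in> carrier L\<rbrakk> \<Longrightarrow> x \<otimes> (c \<odot>\<^bsub>L\<^esub> y) = c \<odot>\<^bsub>L\<^esub> (x \<otimes> y)"
begin

lemma smult_carrier [simp, intro]: "x \<in> carrier L \<Longrightarrow> c \<odot>\<^bsub>L\<^esub> x \<in> carrier L"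
 by (rule smult_closed) simp_all

lemma zero_bracket: "x \<in> carrier L \<Longrightarrow> \<zero> \<otimes> x = \<zero>"
 using bracket_add_left[of \<zero> \<zero> x] bracket_closed[of \<zero> x]
 by (metis add.l_cancel_one' l_zero zero_closed)

lemma bracket_zero: "x \<in> carrier L \<Longrightarrow> x \<otimes> \<zero> = \<zero>"
 using bracket_add_right[of x \<zero> \<zero>] bracket_closed[of x \<zero>]
 by (metis add.l_cancel_one' l_zero zero_closed)

lemma minus_eq_smult: "x \<in> carrier L \<Longrightarrow> \<ominus> x = (- 1) \<odot>\<^bsub>L\<^esub> x"
proof -
 assume x: "x \<in> carrier L"
 have "(\<ominus>\<^bsub>class_ring\<^esub> \<one>\<^bsub>class_ring\<^esub>) \<odot>\<^bsub>L\<^esub> x = \<ominus> x"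
  by (rule smult_minus_1[OF x])
 then show ?thesis
  by (simp add: class_ring_simps)
qed

lemma smult_zero_scalar: "x \<in> carrier L \<Longrightarrow> (0 :: 'k) \<odot>\<^bsub>L\<^esub> x = \<zero>"
 using lmult_0[of x] by (simp add: class_ring_simps)

lemma smult_one_scalar: "x \<in> carrier L \<Longrightarrow> (1 :: 'k) \<odot>\<^bsub>L\<^esub> x = x"
 using smult_one[of x] by (simp add: class_ring_simps)

lemma smult_smult: "x \<in> carrier L \<Longrightarrow> a \<odot>\<^bsub>L\<^esub> (b \<odot>\<^bsub>L\<^esub> x) = (a * b) \<odot>\<^bsub>L\<^esub> x"
 using smult_assoc1[of a b x] by (simp add: class_ring_simps)

lemma smult_add_scalar: "x \<in> carrier L \<Longrightarrow> (a + b) \<odot>\<^bsub>L\<^esub> x = a \<odot>\<^bsub>L\<^esub> x \<oplus> b \<odot>\<^bsub>L\<^esub> x"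
 using smult_l_distr[of a b x] by (simp add: class_ring_simps)

lemma smult_add: "\<lbrakk>x \<in> carrier L; y \<in> carrier L\<rbrakk> \<Longrightarrow> a \<odot>\<^bsub>L\<^esub> (x \<oplus> y) = a \<odot>\<^bsub>L\<^esub> x \<oplus> a \<odot>\<^bsub>L\<^esub> y"
 using smult_r_distr[of a x y] by (simp add: class_ring_simps)

lemma subspaceI:
 assumes "W \<subseteq> carrier L" "\<zero> \<in> W" "\<And>x y. \<lbrakk>x \<in> W; y \<in> W\<rbrakk> \<Longrightarrow> x \<oplus> y \<in> W"
  "\<And>c x. x \<in> W \<Longrightarrow> c \<odot>\<^bsub>L\<^esub> x \<in> W"
 shows "VectorSpace.subspace class_ring W L"
 unfolding VectorSpace.subspace_def submodule_def
 using assms vectorspace_axioms module_axioms by auto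

lemma subspaceD:
 assumes "VectorSpace.subspace class_ring W L"
 shows "W \<subseteq> carrier L" "\<zero> \<in> W" "\<And>x y. \<lbrakk>x \<in> W; y \<in> W\<rbrakk> \<Longrightarrow> x \<oplus> y \<in> W"
  "\<And>c x. x \<in> W \<Longrightarrow> c \<odot>\<^bsub>L\<^esub> x \<in> W"
proof -
 interpret submodule class_ring W L
  using assms by (simp add: VectorSpace.subspace_def)
 show "W \<subseteq> carrier L" "\<zero> \<in> W" "\<And>x y. \<lbrakk>x \<in> W; y \<in> W\<rbrakk> \<Longrightarrow> x \<oplus> y \<in> W"
  "\<And>c x. x \<in> W \<Longrightarrow> c \<odot>\<^bsub>L\<^esub> x \<in> W"
  using subset smult_closed by auto
qed

lemma subspace_abelian_subgroup:
 assumes "VectorSpace.subspace class_ring W L"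
 shows "abelian_subgroup W L"
proof (rule abelian_subgroupI3[OF additive_subgroup.intro abelian_group_axioms])
 show "subgroup W (add_monoid L)"
 proof (rule group.subgroupI)
  show "group (add_monoid L)"
   using a_group .
  fix x y assume xy: "x \<in> W" "y \<in> W"
  then show "x \<otimes>\<^bsub>add_monoid L\<^esub> y \<in> W"
   using subspaceD[OF assms] by simp
  show "inv\<^bsub>add_monoid L\<^esub> x \<in> W"
   using subspaceD[OF assms] xy minus_eq_smult[of x] unfolding a_inv_def by auto
 qed (use subspaceD[OF assms] in auto)
qed

end

text \<open>Closure of the bracket is given on homogeneous elements only; bilinearity and the
  homogeneous decomposition of both factors extend it to the carrier.\<close>

sublocale superalgebra \<subseteq> bracket_algebra L
proof
 fix x y assume x: "x \<in> carrier L" and y: "y \<in> carrier L"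
 have sub: "part L p \<subseteq> carrier L" for p
  using part_subspace[of p] by (auto simp: VectorSpace.subspace_def dest: submodule.subset)
 obtain x0 x1 where x': "x0 \<in> part L 0" "x1 \<in> part L 1" "x = x0 \<oplus> x1"
  using ex1_implies_ex[OF part_decomposition[OF x]] by auto
 obtain y0 y1 where y': "y0 \<in> part L 0" "y1 \<in> part L 1" "y = y0 \<oplus> y1"
  using ex1_implies_ex[OF part_decomposition[OF y]] by auto
 have "a \<otimes> b \<in> carrier L" if "a \<in> part L p" "b \<in> part L q" for a b p q
  using bracket_part[OF that] sub by blast
 then show "x \<otimes> y \<in> carrier L"
  using x' y' sub
  by (simp add: bracket_add_left bracket_add_right subset_iff)
qed (use bracket_add_left bracket_add_right bracket_smult_left bracket_smult_right in auto)

section \<open>Surjective homomorphisms\<close>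

definition algebra_epi :: "('k :: field, 'v) superalg \<Rightarrow> ('k, 'w) superalg \<Rightarrow> ('v \<Rightarrow> 'w) \<Rightarrow> bool" where
 "algebra_epi L M \<phi> \<longleftrightarrow>
   \<phi> ` carrier L = carrier M \<and> \<phi> \<zero>\<^bsub>L\<^esub> = \<zero>\<^bsub>M\<^esub> \<and>
   (\<forall>x\<in>carrier L. \<forall>y\<in>carrier L. \<phi> (x \<oplus>\<^bsub>L\<^esub> y) = \<phi> x \<oplus>\<^bsub>M\<^esub> \<phi> y \<and> \<phi> (x \<otimes>\<^bsub>L\<^esub> y) = \<phi> x \<otimes>\<^bsub>M\<^esub> \<phi> y) \<and>
   (\<forall>c. \<forall>x\<in>carrier L. \<phi> (c \<odot>\<^bsub>L\<^esub> x) = c \<odot>\<^bsub>M\<^esub> \<phi> x)"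

lemma algebra_epiD:
 assumes "algebra_epi L M \<phi>"
 shows "\<phi> ` carrier L = carrier M" "\<phi> \<zero>\<^bsub>L\<^esub> = \<zero>\<^bsub>M\<^esub>"
  "\<And>x. x \<in> carrier L \<Longrightarrow> \<phi> x \<in> carrier M"
  "\<And>x y. \<lbrakk>x \<in> carrier L; y \<in> carrier L\<rbrakk> \<Longrightarrow> \<phi> (x \<oplus>\<^bsub>L\<^esub> y) = \<phi> x \<oplus>\<^bsub>M\<^esub> \<phi> y"
  "\<And>x y. \<lbrakk>x \<in> carrier L; y \<in> carrier L\<rbrakk> \<Longrightarrow> \<phi> (x \<otimes>\<^bsub>L\<^esub> y) = \<phi> x \<otimes>\<^bsub>M\<^esub> \<phi> y"
  "\<And>c x. x \<in> carrier L \<Longrightarrow> \<phi> (c \<odot>\<^bsub>L\<^esub> x) = c \<odot>\<^bsub>M\<^esub> \<phi> x"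
 using assms unfolding algebra_epi_def by blast+

lemma algebra_epi_comp:
 assumes "algebra_epi L M \<phi>" "algebra_epi M N \<psi>"
 shows "algebra_epi L N (\<lambda>x. \<psi> (\<phi> x))"
 unfolding algebra_epi_def
 using algebra_epiD[OF assms(1)] algebra_epiD[OF assms(2)]
 by (auto simp flip: image_image)

lemma algebra_epi_inv:
 assumes "bracket_algebra L" "algebra_epi L M \<phi>" "inj_on \<phi> (carrier L)"
 shows "algebra_epi M L (inv_into (carrier L) \<phi>)"
proof -
 interpret bracket_algebra L by fact
 note \<phi> = algebra_epiD[OF assms(2)]
 let ?g = "inv_into (carrier L) \<phi>"
 have g: "?g (\<phi> x) = x" if "x \<in> carrier L" for x
  using assms(3) that by simp
 have "?g ` carrier M = carrier L"
  using \<phi>(1)[symmetric] g by (force simp: image_iff)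
 moreover have "?g \<zero>\<^bsub>M\<^esub> = \<zero>\<^bsub>L\<^esub>"
  using g[of "\<zero>\<^bsub>L\<^esub>"] \<phi>(2) by simp
 ultimately show ?thesis
  unfolding algebra_epi_def \<phi>(1)[symmetric]
  by (auto simp: g bracket_closed simp flip: \<phi>(4,5,6))
qed

text \<open>Every element of M lifts along \<open>\<phi>\<close>, so each axiom of M is the image of
  the same axiom of L. Quotients, whose elements are sets, obtain their vector space structure from
  here.\<close>

lemma algebra_epi_bracket_algebra:
 fixes L :: "('k :: field, 'v) superalg" and M :: "('k, 'w) superalg"
 assumes "bracket_algebra L" "algebra_epi L M \<phi>"
 shows "bracket_algebra M"
proof -
 interpret bracket_algebra L by fact
 note \<phi> = algebra_epiD[OF assms(2)]
 have ex: "\<exists>x\<in>carrier L. v = \<phi> x" if "v \<in> carrier M" for v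
  using that \<phi>(1) by auto
 have field: "Ring.field (class_ring :: 'k ring)"
  using vectorspace_axioms by (simp add: vectorspace_def)
 have "vectorspace class_ring M"
 proof (rule vs_criteria[OF field])
  show "\<zero>\<^bsub>M\<^esub> \<in> carrier M"
   using \<phi>(2,3) by (metis zero_closed)
  show "\<forall>v w. v \<in> carrier M \<and> w \<in> carrier M \<longrightarrow> v \<oplus>\<^bsub>M\<^esub> w \<in> carrier M"
   by (metis \<phi>(3,4) a_closed ex)
  show "\<forall>v\<in>carrier M. \<exists>neg_v\<in>carrier M. v \<oplus>\<^bsub>M\<^esub> neg_v = \<zero>\<^bsub>M\<^esub>"
   by (metis \<phi>(2,3,4) a_inv_closed ex r_neg)
  show "\<forall>c v. c \<in> carrier class_ring \<and> v \<in> carrier M \<longrightarrow> c \<odot>\<^bsub>M\<^esub> v \<in> carrier M"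
   by (metis \<phi>(3,6) smult_carrier ex)
  show "\<forall>v w. v \<in> carrier M \<and> w \<in> carrier M \<longrightarrow> v \<oplus>\<^bsub>M\<^esub> w = w \<oplus>\<^bsub>M\<^esub> v"
   by (metis \<phi>(4) a_comm ex)
  show "\<forall>v w x. v \<in> carrier M \<and> w \<in> carrier M \<and> x \<in> carrier M \<longrightarrow>
    v \<oplus>\<^bsub>M\<^esub> w \<oplus>\<^bsub>M\<^esub> x = v \<oplus>\<^bsub>M\<^esub> (w \<oplus>\<^bsub>M\<^esub> x)"
  proof (intro allI impI, elim conjE)
   fix v w x assume "v \<in> carrier M" "w \<in> carrier M" "x \<in> carrier M"
   from this[THEN ex] obtain a b c where "a \<in> carrier L" "b \<in> carrier L" "c \<in> carrier L"
    "v = \<phi> a" "w = \<phi> b" "x = \<phi> c"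
    by metis
   then show "v \<oplus>\<^bsub>M\<^esub> w \<oplus>\<^bsub>M\<^esub> x = v \<oplus>\<^bsub>M\<^esub> (w \<oplus>\<^bsub>M\<^esub> x)"
    by (simp add: a_assoc flip: \<phi>(4))
  qed
  show "\<forall>v\<in>carrier M. v \<oplus>\<^bsub>M\<^esub> \<zero>\<^bsub>M\<^esub> = v"
   by (metis \<phi>(2,4) ex r_zero zero_closed)
  show "\<forall>a b v. a \<in> carrier class_ring \<and> b \<in> carrier class_ring \<and> v \<in> carrier M \<longrightarrow>
    (a \<otimes>\<^bsub>class_ring\<^esub> b) \<odot>\<^bsub>M\<^esub> v = a \<odot>\<^bsub>M\<^esub> (b \<odot>\<^bsub>M\<^esub> v)"
   by (auto dest!: ex simp: smult_smult simp flip: \<phi>(6))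
  show "\<forall>v\<in>carrier M. \<one>\<^bsub>class_ring\<^esub> \<odot>\<^bsub>M\<^esub> v = v"
   by (auto dest!: ex simp: smult_one_scalar simp flip: \<phi>(6))
  show "\<forall>a b v. a \<in> carrier class_ring \<and> b \<in> carrier class_ring \<and> v \<in> carrier M \<longrightarrow>
    (a \<oplus>\<^bsub>class_ring\<^esub> b) \<odot>\<^bsub>M\<^esub> v = a \<odot>\<^bsub>M\<^esub> v \<oplus>\<^bsub>M\<^esub> b \<odot>\<^bsub>M\<^esub> v"
   by (auto dest!: ex simp: smult_add_scalar simp flip: \<phi>(4,6))
  show "\<forall>a v w. a \<in> carrier class_ring \<and> v \<in> carrier M \<and> w \<in> carrier M \<longrightarrow>
    a \<odot>\<^bsub>M\<^esub> (v \<oplus>\<^bsub>M\<^esub> w) = a \<odot>\<^bsub>M\<^esub> v \<oplus>\<^bsub>M\<^esub> a \<odot>\<^bsub>M\<^esub> w"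
   by (auto dest!: ex simp: smult_add simp flip: \<phi>(4,6))
 qed
 moreover have "bracket_algebra_axioms M"
 proof
  fix x y assume xy: "x \<in> carrier M" "y \<in> carrier M"
  from this[THEN ex] obtain a b where ab: "a \<in> carrier L" "b \<in> carrier L" "x = \<phi> a" "y = \<phi> b"
   by metis
  show "x \<otimes>\<^bsub>M\<^esub> y \<in> carrier M"
   using ab \<phi>(3) by (simp add: bracket_closed flip: \<phi>(5))
  fix c show "(c \<odot>\<^bsub>M\<^esub> x) \<otimes>\<^bsub>M\<^esub> y = c \<odot>\<^bsub>M\<^esub> (x \<otimes>\<^bsub>M\<^esub> y)"
   "x \<otimes>\<^bsub>M\<^esub> (c \<odot>\<^bsub>M\<^esub> y) = c \<odot>\<^bsub>M\<^esub> (x \<otimes>\<^bsub>M\<^esub> y)"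
   using ab by (simp_all add: bracket_closed bracket_smult_left bracket_smult_right flip: \<phi>(5,6))
  fix z assume "z \<in> carrier M"
  then obtain d where "d \<in> carrier L" "z = \<phi> d"
   using ex by blast
  then show "(x \<oplus>\<^bsub>M\<^esub> y) \<otimes>\<^bsub>M\<^esub> z = x \<otimes>\<^bsub>M\<^esub> z \<oplus>\<^bsub>M\<^esub> y \<otimes>\<^bsub>M\<^esub> z"
   "x \<otimes>\<^bsub>M\<^esub> (y \<oplus>\<^bsub>M\<^esub> z) = x \<otimes>\<^bsub>M\<^esub> y \<oplus>\<^bsub>M\<^esub> x \<otimes>\<^bsub>M\<^esub> z"
   using ab by (simp_all add: bracket_closed bracket_add_left bracket_add_right flip: \<phi>(4,5))
 qed
 ultimately show ?thesis
  by (rule bracket_algebra.intro)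
qed

lemma algebra_epi_neg:
 assumes "bracket_algebra L" "algebra_epi L M \<phi>" "x \<in> carrier L"
 shows "\<phi> (\<ominus>\<^bsub>L\<^esub> x) = \<ominus>\<^bsub>M\<^esub> \<phi> x"
 using assms(3) algebra_epiD[OF assms(2)] bracket_algebra.minus_eq_smult[OF assms(1)]
  bracket_algebra.minus_eq_smult[OF algebra_epi_bracket_algebra[OF assms(1,2)]]
 by simp

lemma algebra_epi_minus:
 assumes "bracket_algebra L" "algebra_epi L M \<phi>" "x \<in> carrier L" "y \<in> carrier L"
 shows "\<phi> (x \<ominus>\<^bsub>L\<^esub> y) = \<phi> x \<ominus>\<^bsub>M\<^esub> \<phi> y"
proof -
 interpret bracket_algebra L by fact
 show ?thesis
  using assms algebra_epiD[OF assms(2)] by (simp add: a_minus_def algebra_epi_neg[OF assms(1,2)])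
qed

text \<open>The images of the two parts span M, but a surjection could make them overlap;
  \<open>direct\<close> excludes this and yields uniqueness of the homogeneous decomposition. Each
  value of an identity in M is the image of a value of the same identity in L.\<close>

lemma algebra_epi_lie_superalgebra:
 assumes L: "lie_superalgebra L" and epi: "algebra_epi L M \<phi>"
  and parts: "\<And>p. part M p = \<phi> ` part L p"
  and direct: "part M 0 \<inter> part M 1 \<subseteq> {\<zero>\<^bsub>M\<^esub>}"
 shows "lie_superalgebra M"
proof -
 interpret L: lie_superalgebra L by fact
 have bL: "bracket_algebra L" ..
 note \<phi> = algebra_epiD[OF epi]
 interpret M: bracket_algebra M
  using algebra_epi_bracket_algebra[OF bL epi] .
 have sub: "part L p \<subseteq> carrier L" for p
  using L.subspaceD(1)[OF L.part_subspace] .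
 have subM: "VectorSpace.subspace class_ring (part M p) M" for p
 proof (rule M.subspaceI)
  note L = L.subspaceD[OF L.part_subspace[of p]]
  show "part M p \<subseteq> carrier M"
   unfolding parts using sub \<phi>(3) by blast
  show "\<zero>\<^bsub>M\<^esub> \<in> part M p"
   unfolding parts \<phi>(2)[symmetric] using L(2) by (rule imageI)
  fix x assume "x \<in> part M p"
  then obtain x' where x': "x' \<in> part L p" "x = \<phi> x'"
   using parts by auto
  fix c show "c \<odot>\<^bsub>M\<^esub> x \<in> part M p"
   using x' L(1) L(4)[of x' c] \<phi>(6)[of x' c] parts by (metis imageI subsetD)
  fix y assume "y \<in> part M p"
  then obtain y' where "y' \<in> part L p" "y = \<phi> y'"
   using parts by auto
  then show "x \<oplus>\<^bsub>M\<^esub> y \<in> part M p"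
   using x' L(1) L(3)[of x' y'] \<phi>(4)[of x' y'] parts by (metis imageI subsetD)
 qed
 have sup: "superalgebra M"
 proof (intro superalgebra.intro superalgebra_axioms.intro)
  show "vectorspace class_ring M"
   by (rule M.vectorspace_axioms)
  fix p show "VectorSpace.subspace class_ring (part M p) M"
   by (rule subM)
 next
  fix x assume "x \<in> carrier M"
  then obtain x' where "x' \<in> carrier L" "x = \<phi> x'"
   using \<phi>(1) by auto
  moreover obtain a b where "a \<in> part L 0" "b \<in> part L 1" "x' = a \<oplus>\<^bsub>L\<^esub> b"
   using ex1_implies_ex[OF L.part_decomposition[OF \<open>x' \<in> carrier L\<close>]] by auto
  ultimately have 1: "\<phi> a \<in> part M 0" "\<phi> b \<in> part M 1" "x = \<phi> a \<oplus>\<^bsub>M\<^esub> \<phi> b"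
   using parts \<phi>(4) sub by blast+
  show "\<exists>!u. u \<in> part M 0 \<times> part M 1 \<and> x = fst u \<oplus>\<^bsub>M\<^esub> snd u"
  proof (rule ex1I[of _ "(\<phi> a, \<phi> b)"])
   fix u assume "u \<in> part M 0 \<times> part M 1 \<and> x = fst u \<oplus>\<^bsub>M\<^esub> snd u"
   then obtain c d where u: "u = (c, d)" "c \<in> part M 0" "d \<in> part M 1" "x = c \<oplus>\<^bsub>M\<^esub> d"
    by auto
   note s0 = M.subspaceD[OF subM[of 0]] and s1 = M.subspaceD[OF subM[of 1]]
   have c: "c \<in> carrier M" "d \<in> carrier M" "\<phi> a \<in> carrier M" "\<phi> b \<in> carrier M"
    using u 1 s0(1) s1(1) by auto
   \<comment> \<open>Two decompositions of x: the difference of the even components equals the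
     difference of the odd ones, so it lies in both parts.\<close>
   have "\<phi> a = (c \<oplus>\<^bsub>M\<^esub> d) \<ominus>\<^bsub>M\<^esub> \<phi> b"
    using 1 u c by (simp add: M.minus_eq M.a_assoc M.r_neg)
   also have "\<dots> = c \<oplus>\<^bsub>M\<^esub> (d \<ominus>\<^bsub>M\<^esub> \<phi> b)"
    using c by (simp add: M.minus_eq M.a_assoc)
   also have "\<dots> \<ominus>\<^bsub>M\<^esub> c = d \<ominus>\<^bsub>M\<^esub> \<phi> b"
    using c by (simp add: M.minus_eq M.a_comm[of c] M.a_assoc M.r_neg)
   finally have eq: "\<phi> a \<ominus>\<^bsub>M\<^esub> c = d \<ominus>\<^bsub>M\<^esub> \<phi> b" .
   have "\<phi> a \<ominus>\<^bsub>M\<^esub> c \<in> part M 0" "d \<ominus>\<^bsub>M\<^esub> \<phi> b \<in> part M 1"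
    using 1 u c s0 s1 by (simp_all add: M.minus_eq M.minus_eq_smult)
   then have "\<phi> a \<ominus>\<^bsub>M\<^esub> c = \<zero>\<^bsub>M\<^esub>" "d \<ominus>\<^bsub>M\<^esub> \<phi> b = \<zero>\<^bsub>M\<^esub>"
    using eq direct by auto
   then show "u = (\<phi> a, \<phi> b)"
    using u c by simp
  qed (use 1 in auto)
 next
  fix x p y q assume "x \<in> part M p" "y \<in> part M q"
  then obtain a b where "a \<in> part L p" "b \<in> part L q" "x = \<phi> a" "y = \<phi> b"
   using parts by auto
  moreover from this have "a \<in> carrier L" "b \<in> carrier L"
   using sub by auto
  ultimately show "x \<otimes>\<^bsub>M\<^esub> y \<in> part M (p + q)"
   using L.bracket_part[of a p b q] by (simp add: parts flip: \<phi>(5))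
 qed (use M.bracket_add_left M.bracket_add_right M.bracket_smult_left M.bracket_smult_right in auto)
 have "lie_identities M \<subseteq> {\<zero>\<^bsub>M\<^esub>}"
 proof
  fix w assume "w \<in> lie_identities M"
  then consider
   p q x y where "x \<in> part M p" "y \<in> part M q"
    "w = x \<otimes>\<^bsub>M\<^esub> y \<oplus>\<^bsub>M\<^esub> koszul_sign p q \<odot>\<^bsub>M\<^esub> (y \<otimes>\<^bsub>M\<^esub> x)"
  | p q x y z where "x \<in> part M p" "y \<in> part M q" "z \<in> carrier M"
    "w = x \<otimes>\<^bsub>M\<^esub> (y \<otimes>\<^bsub>M\<^esub> z) \<ominus>\<^bsub>M\<^esub> (x \<otimes>\<^bsub>M\<^esub> y) \<otimes>\<^bsub>M\<^esub> z
     \<ominus>\<^bsub>M\<^esub> koszul_sign p q \<odot>\<^bsub>M\<^esub> (y \<otimes>\<^bsub>M\<^esub> (x \<otimes>\<^bsub>M\<^esub> z))"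
  | x where "x \<in> part M 1" "w = x \<otimes>\<^bsub>M\<^esub> (x \<otimes>\<^bsub>M\<^esub> x)"
   unfolding lie_identities_def by blast
  then have "\<exists>v\<in>lie_identities L. w = \<phi> v"
  proof cases
   case 1
   then obtain a b where ab: "a \<in> part L p" "b \<in> part L q" "x = \<phi> a" "y = \<phi> b"
    using parts by auto
   have c: "a \<in> carrier L" "b \<in> carrier L"
    using ab sub by auto
   have "w = \<phi> (a \<otimes>\<^bsub>L\<^esub> b \<oplus>\<^bsub>L\<^esub> koszul_sign p q \<odot>\<^bsub>L\<^esub> (b \<otimes>\<^bsub>L\<^esub> a))"
    using 1 ab c by (simp add: L.bracket_closed \<phi>)
   then show ?thesis
    unfolding lie_identities_def using ab by blast
  next
   case 2
   then obtain a b d where ab: "a \<in> part L p" "b \<in> part L q" "x = \<phi> a" "y = \<phi> b"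
    "z = \<phi> d" "d \<in> carrier L"
    unfolding parts \<phi>(1)[symmetric] by blast
   have c: "a \<in> carrier L" "b \<in> carrier L" "d \<in> carrier L"
    using ab sub by auto
   have "w = \<phi> (a \<otimes>\<^bsub>L\<^esub> (b \<otimes>\<^bsub>L\<^esub> d) \<ominus>\<^bsub>L\<^esub> (a \<otimes>\<^bsub>L\<^esub> b) \<otimes>\<^bsub>L\<^esub> d
     \<ominus>\<^bsub>L\<^esub> koszul_sign p q \<odot>\<^bsub>L\<^esub> (b \<otimes>\<^bsub>L\<^esub> (a \<otimes>\<^bsub>L\<^esub> d)))"
    using 2 ab c by (simp add: L.bracket_closed \<phi> algebra_epi_minus[OF bL epi])
   then show ?thesis
    unfolding lie_identities_def using ab by blast
  next
   case 3
   then obtain a where ab: "a \<in> part L 1" "x = \<phi> a"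
    using parts by auto
   have c: "a \<in> carrier L"
    using ab sub by auto
   have "w = \<phi> (a \<otimes>\<^bsub>L\<^esub> (a \<otimes>\<^bsub>L\<^esub> a))"
    using 3 ab c by (simp add: L.bracket_closed \<phi>)
   then show ?thesis
    unfolding lie_identities_def using ab by blast
  qed
  then show "w \<in> {\<zero>\<^bsub>M\<^esub>}"
   using L.lie_identities_vanish \<phi>(2) by auto
 qed
 then show ?thesis
  using sup by (simp add: lie_superalgebra_def lie_superalgebra_axioms_def)
qed

section \<open>Isomorphisms with a model\<close>

definition lie_copy :: "('k :: field, 'v) superalg \<Rightarrow> ('k, 'w) superalg \<Rightarrow> ('v \<Rightarrow> 'w) \<Rightarrow> bool" where
 "lie_copy L M \<phi> \<longleftrightarrow> lie_superalgebra L \<and> lie_superalgebra M \<and> algebra_epi L M \<phi> \<and>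
   inj_on \<phi> (carrier L) \<and> (\<forall>p. \<phi> ` part L p = part M p)"

lemma lie_superalgebra_bracket_algebra:
 assumes "lie_superalgebra L"
 shows "bracket_algebra L"
proof -
 interpret lie_superalgebra L by fact
 show ?thesis ..
qed

lemma lie_superalgebra_carrier_part:
 assumes "lie_superalgebra L"
 shows "part L p \<subseteq> carrier L"
proof -
 interpret lie_superalgebra L by fact
 show ?thesis
  by (rule subspaceD(1)[OF part_subspace])
qed


lemma lie_copy_inv:
 assumes "lie_copy L M \<phi>"
 shows "lie_copy M L (inv_into (carrier L) \<phi>)"
proof -
 note c = assms[unfolded lie_copy_def]
 note \<phi> = algebra_epiD[of L M \<phi>]
 have "inj_on (inv_into (carrier L) \<phi>) (carrier M)"
  using c \<phi>(1) by (metis inj_on_inv_into order_refl)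
 moreover have "inv_into (carrier L) \<phi> ` part M p = part L p" for p
  using c lie_superalgebra_carrier_part[of L p] by (metis inv_into_image_cancel)
 ultimately show ?thesis
  using c algebra_epi_inv[OF lie_superalgebra_bracket_algebra, of L M \<phi>] by (simp add: lie_copy_def)
qed

lemma lie_copy_comp:
 assumes "lie_copy L M \<phi>" "lie_copy M N \<psi>"
 shows "lie_copy L N (\<lambda>x. \<psi> (\<phi> x))"
proof -
 have "(\<lambda>x. \<psi> (\<phi> x)) ` part L p = \<psi> ` (\<phi> ` part L p)" for p
  by (simp add: image_image)
 moreover have "inj_on (\<lambda>x. \<psi> (\<phi> x)) (carrier L)"
  using assms algebra_epiD(1)[of L M \<phi>] comp_inj_on[of \<phi> "carrier L" \<psi>]
  by (simp add: lie_copy_def comp_def)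
 ultimately show ?thesis
  using assms by (simp add: lie_copy_def algebra_epi_comp[of L M \<phi> N \<psi>])
qed

text \<open>The axioms are pulled back along the inverse of \<open>\<phi>\<close>. For L it is
  enough to know a bilinear bracket and that its parts map onto those of M, which is all that is
  directly visible for an iterated quotient.\<close>

lemma lie_copyI:
 assumes "bracket_algebra L" "lie_superalgebra M" "algebra_epi L M \<phi>" "inj_on \<phi> (carrier L)"
  and "\<And>p. part L p \<subseteq> carrier L" "\<And>p. \<phi> ` part L p = part M p"
 shows "lie_copy L M \<phi>"
proof -
 let ?g = "inv_into (carrier L) \<phi>"
 have parts: "part L p = ?g ` part M p" for p
  using assms(4,5,6) by (metis inv_into_image_cancel)
 have epi: "algebra_epi M L ?g"
  by (rule algebra_epi_inv[OF assms(1,3,4)])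
 interpret M: lie_superalgebra M by fact
 have direct: "part M 0 \<inter> part M 1 \<subseteq> {\<zero>\<^bsub>M\<^esub>}"
 proof
  fix x assume x: "x \<in> part M 0 \<inter> part M 1"
  note s0 = M.subspaceD[OF M.part_subspace[of 0]] and s1 = M.subspaceD[OF M.part_subspace[of 1]]
  \<comment> \<open>An element of both parts would have the two homogeneous decompositions x + 0 and
    0 + x.\<close>
  have "x = x \<oplus>\<^bsub>M\<^esub> \<zero>\<^bsub>M\<^esub>" "x = \<zero>\<^bsub>M\<^esub> \<oplus>\<^bsub>M\<^esub> x" "x \<in> carrier M"
   using x s0(1) by auto
  then have "(x, \<zero>\<^bsub>M\<^esub>) = (\<zero>\<^bsub>M\<^esub>, x)"
   using M.part_decomposition[OF \<open>x \<in> carrier M\<close>] x s0(2) s1(2)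
   by (metis IntD1 IntD2 SigmaI fst_conv snd_conv)
  then show "x \<in> {\<zero>\<^bsub>M\<^esub>}"
   by (metis Pair_inject singletonI)
 qed
 have "part L 0 \<inter> part L 1 \<subseteq> {\<zero>\<^bsub>L\<^esub>}"
 proof
  interpret L: bracket_algebra L by fact
  fix x assume x: "x \<in> part L 0 \<inter> part L 1"
  then have "\<phi> x \<in> part M 0 \<inter> part M 1"
   unfolding assms(6)[symmetric] by blast
  then have "\<phi> x = \<phi> \<zero>\<^bsub>L\<^esub>"
   using direct algebra_epiD(2)[OF assms(3)] by auto
  then show "x \<in> {\<zero>\<^bsub>L\<^esub>}"
   using x assms(4,5) L.zero_closed by (auto dest: inj_onD)
 qed
 then have "lie_superalgebra L"
  by (rule algebra_epi_lie_superalgebra[OF assms(2) epi parts])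
 then show ?thesis
  using assms by (simp add: lie_copy_def)
qed

lemma lie_copy_isomorphic:
 assumes "lie_copy L M \<phi>"
 shows "lie_superalgebra_isomorphic L M"
proof -
 note c = assms[unfolded lie_copy_def]
 have "\<phi> \<in> superalg_iso L M"
  using c algebra_epiD[of L M \<phi>]
  by (auto simp: superalg_iso_def LinearCombinations.module_hom_def bij_betw_def)
 then show ?thesis
  using c by (auto simp: lie_superalgebra_isomorphic_def)
qed


section \<open>Quotients\<close>

locale algebra_with_ideal = bracket_algebra +
 fixes I
 assumes ideal: "superalg_ideal L I"
begin

lemma ideal_subspace: "VectorSpace.subspace class_ring I L"
 using ideal by (simp add: superalg_ideal_def)

lemmas idealD = subspaceD[OF ideal_subspace]

lemma ideal_bracket: "\<lbrakk>x \<in> carrier L; a \<in> I\<rbrakk> \<Longrightarrow> x \<otimes> a \<in> I" "\<lbrakk>x \<in> carrier L; a \<in> I\<rbrakk> \<Longrightarrow> a \<otimes> x \<in> I"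
 using ideal by (auto simp: superalg_ideal_def)

sublocale I: abelian_subgroup I L
 by (rule subspace_abelian_subgroup[OF ideal_subspace])

lemma mem_coset_iff: "x \<in> carrier L \<Longrightarrow> y \<in> I +> x \<longleftrightarrow> y \<in> carrier L \<and> y \<ominus> x \<in> I"
 using I.a_rcos_module[of x y] a_r_coset_subset_G[OF idealD(1), of x] by (auto simp: minus_eq)

lemma coset_eq_iff:
 assumes "x \<in> carrier L" "y \<in> carrier L"
 shows "I +> x = I +> y \<longleftrightarrow> x \<ominus> y \<in> I"
proof
 assume "I +> x = I +> y"
 then show "x \<ominus> y \<in> I"
  using I.a_rcos_self[OF assms(1)] mem_coset_iff[OF assms(2)] by auto
next
 assume "x \<ominus> y \<in> I"
 then have "x \<in> I +> y"
  using mem_coset_iff assms by auto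
 then show "I +> x = I +> y"
  using a_repr_independence[OF _ assms(2) I.a_subgroup] by simp
qed

lemma coset_zero: "x \<in> I \<Longrightarrow> I +> x = I"
 using a_coset_join2[OF _ I.a_subgroup] idealD(1) by auto

text \<open>\<open>rcoset_mult\<close> is a union over all representatives. Writing them as x and y
  plus elements of I, two-sidedness of the ideal makes all cosets in this union equal.\<close>

lemma rcoset_mult_coset:
 assumes "x \<in> carrier L" "y \<in> carrier L"
 shows "rcoset_mult L I (I +> x) (I +> y) = I +> (x \<otimes> y)"
proof -
 have "I +> (a \<otimes> b) = I +> (x \<otimes> y)" if "a \<in> I +> x" "b \<in> I +> y" for a b
 proof -
  have ab: "a \<in> carrier L" "b \<in> carrier L" "a \<ominus> x \<in> I" "b \<ominus> y \<in> I"
   using that assms mem_coset_iff by auto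
  have "a = (a \<ominus> x) \<oplus> x" "b = (b \<ominus> y) \<oplus> y"
   using ab(1,2) assms by (simp_all add: minus_eq a_assoc l_neg)
  moreover have "((a \<ominus> x) \<oplus> x) \<otimes> b = (a \<ominus> x) \<otimes> b \<oplus> x \<otimes> b"
   "x \<otimes> ((b \<ominus> y) \<oplus> y) = x \<otimes> (b \<ominus> y) \<oplus> x \<otimes> y"
   using ab(1,2) assms bracket_add_left bracket_add_right by auto
  ultimately have eq: "a \<otimes> b = ((a \<ominus> x) \<otimes> b \<oplus> x \<otimes> (b \<ominus> y)) \<oplus> x \<otimes> y"
   using ab(1,2) assms bracket_closed by (metis a_assoc minus_closed)
  have "(a \<ominus> x) \<otimes> b \<oplus> x \<otimes> (b \<ominus> y) \<in> I"
   using ideal_bracket ab assms idealD(3) by auto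
  then have "a \<otimes> b \<in> I +> (x \<otimes> y)"
   unfolding eq using a_rcosI[OF _ idealD(1)] bracket_closed[OF assms] by auto
  then show ?thesis
   using a_repr_independence[OF _ bracket_closed[OF assms] I.a_subgroup] by auto
 qed
 then show ?thesis
  using I.a_rcos_self assms unfolding rcoset_mult_def by blast
qed

lemma coset_smult_coset:
 assumes "x \<in> carrier L"
 shows "coset_smult L I c (I +> x) = I +> (c \<odot>\<^bsub>L\<^esub> x)"
proof -
 have "I +> (c \<odot>\<^bsub>L\<^esub> a) = I +> (c \<odot>\<^bsub>L\<^esub> x)" if "a \<in> I +> x" for a
 proof -
  have a: "a \<in> carrier L" "a \<ominus> x \<in> I"
   using that assms mem_coset_iff by auto
  have "c \<odot>\<^bsub>L\<^esub> (a \<ominus> x) \<oplus> c \<odot>\<^bsub>L\<^esub> x = c \<odot>\<^bsub>L\<^esub> ((a \<ominus> x) \<oplus> x)"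
   using a(1) assms by (simp only: smult_add minus_closed)
  also have "(a \<ominus> x) \<oplus> x = a"
   using a(1) assms by (simp add: minus_eq a_assoc l_neg)
  finally have "c \<odot>\<^bsub>L\<^esub> a \<in> I +> (c \<odot>\<^bsub>L\<^esub> x)"
   using a_rcosI[OF idealD(4)[OF a(2)] idealD(1)] assms by (metis smult_carrier)
  then show ?thesis
   using a_repr_independence[OF _ smult_carrier[OF assms] I.a_subgroup] by auto
 qed
 then show ?thesis
  using I.a_rcos_self[OF assms] unfolding coset_smult_def by blast
qed

lemma quot_epi: "algebra_epi L (quot_superalg L I) ((+>) I)"
 unfolding algebra_epi_def quot_superalg_def
 by (auto simp: A_RCOSETS_def' rcoset_mult_coset coset_smult_coset I.a_rcos_sum coset_zero idealD(2))

lemma quot_bracket_algebra: "bracket_algebra (quot_superalg L I)"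
 by (rule algebra_epi_bracket_algebra[OF bracket_algebra_axioms quot_epi])

lemma quot_factor:
 assumes epi: "algebra_epi L M \<phi>" and kernel: "\<And>x. x \<in> I \<Longrightarrow> \<phi> x = \<zero>\<^bsub>M\<^esub>"
 obtains \<theta> where "algebra_epi (quot_superalg L I) M \<theta>"
  "\<And>x. x \<in> carrier L \<Longrightarrow> \<theta> (I +> x) = \<phi> x"
proof -
 let ?Q = "quot_superalg L I"
 \<comment> \<open>Any representative gives the same value because \<open>\<phi>\<close> vanishes on
   I.\<close>
 define \<theta> where "\<theta> X = \<phi> (SOME x. x \<in> X)" for X
 note q = algebra_epiD[OF quot_epi] and e = algebra_epiD[OF epi]
 interpret M: bracket_algebra M
  by (rule algebra_epi_bracket_algebra[OF bracket_algebra_axioms epi])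
 have \<theta>: "\<theta> (I +> x) = \<phi> x" if x: "x \<in> carrier L" for x
 proof -
  have "(SOME y. y \<in> I +> x) \<in> I +> x"
   using I.a_rcos_self[OF x] by (rule someI)
  then have y: "(SOME y. y \<in> I +> x) \<in> carrier L" "(SOME y. y \<in> I +> x) \<ominus> x \<in> I"
   using mem_coset_iff[OF x] by auto
  show ?thesis
   using kernel[OF y(2)] y(1) x e(3) by (simp add: \<theta>_def algebra_epi_minus[OF bracket_algebra_axioms epi])
 qed
 have zero: "I +> \<zero> = I"
  by (rule coset_zero[OF idealD(2)])
 have img: "\<theta> ` carrier ?Q = carrier M"
  unfolding q(1)[symmetric] e(1)[symmetric] by (simp add: image_image \<theta> cong: image_cong)
 have "algebra_epi ?Q M \<theta>"
  unfolding algebra_epi_def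
 proof (intro conjI ballI allI)
  show "\<theta> ` carrier ?Q = carrier M" "\<theta> \<zero>\<^bsub>?Q\<^esub> = \<zero>\<^bsub>M\<^esub>"
   using img \<theta>[OF zero_closed] q(2) e(2) by simp_all
  fix X Y c assume "X \<in> carrier ?Q"
  then obtain x where x: "x \<in> carrier L" "X = I +> x"
   unfolding q(1)[symmetric] by blast
  show "\<theta> (c \<odot>\<^bsub>?Q\<^esub> X) = c \<odot>\<^bsub>M\<^esub> \<theta> X"
   using x by (simp add: \<theta> e flip: q(6))
  assume "Y \<in> carrier ?Q"
  then obtain y where y: "y \<in> carrier L" "Y = I +> y"
   unfolding q(1)[symmetric] by blast
  show "\<theta> (X \<oplus>\<^bsub>?Q\<^esub> Y) = \<theta> X \<oplus>\<^bsub>M\<^esub> \<theta> Y" "\<theta> (X \<otimes>\<^bsub>?Q\<^esub> Y) = \<theta> X \<otimes>\<^bsub>M\<^esub> \<theta> Y"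
   using x y by (simp_all add: \<theta> e bracket_closed flip: q(4,5))
 qed
 then show ?thesis
  using that \<theta> by blast
qed

lemma quot_factor_inj:
 assumes "algebra_epi (quot_superalg L I) M \<theta>" "\<And>x. x \<in> carrier L \<Longrightarrow> \<theta> (I +> x) = \<phi> x"
  and kernel: "\<And>x. \<lbrakk>x \<in> carrier L; \<phi> x = \<zero>\<^bsub>M\<^esub>\<rbrakk> \<Longrightarrow> x \<in> I"
 shows "inj_on \<theta> (carrier (quot_superalg L I))"
proof (rule inj_onI)
 note e = algebra_epiD[OF assms(1)] and q = algebra_epiD[OF quot_epi]
 interpret Q: bracket_algebra "quot_superalg L I"
  by (rule quot_bracket_algebra)
 interpret M: bracket_algebra M
  by (rule algebra_epi_bracket_algebra[OF quot_bracket_algebra assms(1)])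
 fix X Y assume XY: "X \<in> carrier (quot_superalg L I)" "Y \<in> carrier (quot_superalg L I)" "\<theta> X = \<theta> Y"
 then obtain x y where xy: "x \<in> carrier L" "y \<in> carrier L" "X = I +> x" "Y = I +> y"
  unfolding q(1)[symmetric] by blast
 have "\<phi> (x \<ominus> y) = \<theta> (X \<ominus>\<^bsub>quot_superalg L I\<^esub> Y)"
  using xy assms(2)[of "x \<ominus> y"] algebra_epi_minus[OF bracket_algebra_axioms quot_epi, of x y] by simp
 also have "\<dots> = \<zero>\<^bsub>M\<^esub>"
  using XY e(3) by (simp add: algebra_epi_minus[OF quot_bracket_algebra assms(1)])
 finally show "X = Y"
  using kernel xy coset_eq_iff by simp
qed

end

lemma genideal_ideal:
 assumes "bracket_algebra L" "S \<subseteq> carrier L"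
 shows "superalg_ideal L (superalg_genideal L S)" "S \<subseteq> superalg_genideal L S"
  "\<And>I. \<lbrakk>superalg_ideal L I; S \<subseteq> I\<rbrakk> \<Longrightarrow> superalg_genideal L S \<subseteq> I"
proof -
 interpret bracket_algebra L by fact
 let ?F = "{I. superalg_ideal L I \<and> S \<subseteq> I}"
 have "VectorSpace.subspace class_ring (carrier L) L"
  by (rule subspaceI) auto
 \<comment> \<open>The whole algebra belongs to the family, which keeps the intersection inside the
   carrier.\<close>
 then have top: "carrier L \<in> ?F"
  using assms(2) bracket_closed by (auto simp: superalg_ideal_def)
 have sub: "VectorSpace.subspace class_ring I L" if "I \<in> ?F" for I
  using that by (simp add: superalg_ideal_def)
 have "VectorSpace.subspace class_ring (\<Inter>?F) L"
 proof (rule subspaceI)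
  show "\<Inter>?F \<subseteq> carrier L"
   using top by blast
  show "\<zero>\<^bsub>L\<^esub> \<in> \<Inter>?F"
   using subspaceD(2)[OF sub] by blast
  show "x \<oplus>\<^bsub>L\<^esub> y \<in> \<Inter>?F" if "x \<in> \<Inter>?F" "y \<in> \<Inter>?F" for x y
   using subspaceD(3)[OF sub] that by blast
  show "c \<odot>\<^bsub>L\<^esub> x \<in> \<Inter>?F" if "x \<in> \<Inter>?F" for c x
   using subspaceD(4)[OF sub] that by blast
 qed
 then show "superalg_ideal L (superalg_genideal L S)"
  unfolding superalg_ideal_def superalg_genideal_def by blast
 show "S \<subseteq> superalg_genideal L S" "\<And>I. \<lbrakk>superalg_ideal L I; S \<subseteq> I\<rbrakk> \<Longrightarrow> superalg_genideal L S \<subseteq> I"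
  by (auto simp: superalg_genideal_def)
qed

lemma kernel_ideal:
 assumes "bracket_algebra L" "algebra_epi L M \<phi>"
 shows "superalg_ideal L {x \<in> carrier L. \<phi> x = \<zero>\<^bsub>M\<^esub>}"
proof -
 interpret bracket_algebra L by fact
 interpret M: bracket_algebra M
  by (rule algebra_epi_bracket_algebra[OF assms])
 note e = algebra_epiD[OF assms(2)]
 have "VectorSpace.subspace class_ring {x \<in> carrier L. \<phi> x = \<zero>\<^bsub>M\<^esub>} L"
  by (rule subspaceI) (auto simp: e)
 then show ?thesis
  using e(3) by (auto simp: superalg_ideal_def e bracket_closed M.zero_bracket M.bracket_zero)
qed

section \<open>Superalgebras given by structure constants\<close>

definition pm_smult :: "'k :: field \<Rightarrow> ('a \<Rightarrow>\<^sub>0 'k) \<Rightarrow> ('a \<Rightarrow>\<^sub>0 'k)" where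
 "pm_smult c x = Poly_Mapping.map ((*) c) x"

lemma free_smult_eq_pm_smult: "free_smult = pm_smult"
 by (intro ext) (simp add: free_smult_def pm_smult_def)

lemma lookup_pm_smult [simp]: "lookup (pm_smult c x) k = c * lookup x k"
 by (simp add: pm_smult_def map.rep_eq when_def)

lemma pm_smult_add_right: "pm_smult c (x + y) = pm_smult c x + pm_smult c y"
 by (rule poly_mapping_eqI) (simp add: lookup_add algebra_simps)

lemma pm_smult_add_left: "pm_smult (c + d) x = pm_smult c x + pm_smult d x"
 by (rule poly_mapping_eqI) (simp add: lookup_add algebra_simps)

lemma pm_smult_pm_smult [simp]: "pm_smult c (pm_smult d x) = pm_smult (c * d) x"
 by (rule poly_mapping_eqI) simp

lemma pm_smult_zero [simp]: "pm_smult 0 x = 0" "pm_smult c 0 = 0"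
 by (rule poly_mapping_eqI, simp)+

lemma pm_smult_one [simp]: "pm_smult 1 x = x"
 by (rule poly_mapping_eqI) simp

lemma pm_smult_minus: "pm_smult (- c) x = - pm_smult c x" "pm_smult c (- x) = - pm_smult c x"
 by (rule poly_mapping_eqI, simp)+

lemma pm_smult_minus_one: "pm_smult (- 1) x = - x"
 by (rule poly_mapping_eqI) simp

lemma pm_smult_diff: "pm_smult c (x - y) = pm_smult c x - pm_smult c y"
 by (rule poly_mapping_eqI) (simp add: lookup_minus algebra_simps)

lemma pm_smult_sum: "pm_smult c (sum f A) = (\<Sum>a\<in>A. pm_smult c (f a))"
 by (induction A rule: infinite_finite_induct) (auto simp: pm_smult_add_right)

lemma pm_smult_single [simp]: "pm_smult c (single u d) = single u (c * d)"
 by (rule poly_mapping_eqI) (simp add: lookup_single when_def)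

lemma keys_pm_smult: "keys (pm_smult c x) \<subseteq> keys x"
 by (auto simp: in_keys_iff)

lemma keys_uminus [simp]: "keys (- x :: 'a \<Rightarrow>\<^sub>0 'b :: ab_group_add) = keys x"
 by (auto simp: in_keys_iff)

lemma keys_minus_subset:
 "keys (x - y :: 'a \<Rightarrow>\<^sub>0 'b :: ab_group_add) \<subseteq> keys x \<union> keys y"
 by (auto simp: in_keys_iff lookup_minus)

lemma keys_sum_subset: "keys (sum f A) \<subseteq> (\<Union>a\<in>A. keys (f a))"
proof (induction A rule: infinite_finite_induct)
 case (insert a A)
 then show ?case
  using keys_add[of "f a" "sum f A"] by auto
qed auto

lemma poly_mapping_sum_single:
 assumes "finite S" "keys x \<subseteq> S"
 shows "x = (\<Sum>u\<in>S. single u (lookup x u))"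
proof (rule poly_mapping_eqI)
 fix k
 have "(\<Sum>u\<in>S. (lookup x u when u = k)) = (if k \<in> S then lookup x k else 0)"
  using assms(1) by (simp add: when_def)
 then show "lookup x k =
   lookup (\<Sum>u\<in>S. single u (lookup x u)) k"
  using assms(2) by (auto simp: lookup_sum lookup_single in_keys_iff)
qed

section \<open>Linear and bilinear extension from a basis\<close>

definition pm_linear :: "(('a \<Rightarrow>\<^sub>0 'k :: field) \<Rightarrow> ('b \<Rightarrow>\<^sub>0 'k)) \<Rightarrow> bool" where
 "pm_linear f \<longleftrightarrow> (\<forall>x y. f (x + y) = f x + f y) \<and> (\<forall>c x. f (pm_smult c x) = pm_smult c (f x))"

lemma pm_linearI:
 "\<lbrakk>\<And>x y. f (x + y) = f x + f y; \<And>c x. f (pm_smult c x) = pm_smult c (f x)\<rbrakk> \<Longrightarrow> pm_linear f"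
 by (simp add: pm_linear_def)

lemma pm_linear_add: "pm_linear f \<Longrightarrow> f (x + y) = f x + f y"
 and pm_linear_smult: "pm_linear f \<Longrightarrow> f (pm_smult c x) = pm_smult c (f x)"
 by (simp_all add: pm_linear_def)

lemma pm_linear_zero: "pm_linear f \<Longrightarrow> f 0 = 0"
 using pm_linear_smult[of f 0 0] by simp

lemma pm_linear_uminus: "pm_linear f \<Longrightarrow> f (- x) = - f x"
 using pm_linear_smult[of f "- 1" x] by (simp add: pm_smult_minus_one)

lemma pm_linear_diff: "pm_linear f \<Longrightarrow> f (x - y) = f x - f y"
 using pm_linear_add[of f x "- y"] by (simp add: pm_linear_uminus)

lemma pm_linear_sum: "pm_linear f \<Longrightarrow> f (sum g A) = (\<Sum>a\<in>A. f (g a))"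
 by (induction A rule: infinite_finite_induct) (auto simp: pm_linear_add pm_linear_zero)

lemma pm_linear_id: "pm_linear (\<lambda>x. x)"
 and pm_linear_const_zero: "pm_linear (\<lambda>x. 0)"
 by (simp_all add: pm_linear_def)

lemma pm_linear_plus: "\<lbrakk>pm_linear f; pm_linear g\<rbrakk> \<Longrightarrow> pm_linear (\<lambda>x. f x + g x)"
 by (simp add: pm_linear_def algebra_simps pm_smult_add_right)

lemma pm_linear_minus: "\<lbrakk>pm_linear f; pm_linear g\<rbrakk> \<Longrightarrow> pm_linear (\<lambda>x. f x - g x)"
 by (simp add: pm_linear_def algebra_simps pm_smult_diff)

lemma pm_linear_neg: "pm_linear f \<Longrightarrow> pm_linear (\<lambda>x. - f x)"
 by (simp add: pm_linear_def pm_smult_minus)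

lemma pm_linear_scale: "pm_linear f \<Longrightarrow> pm_linear (\<lambda>x. pm_smult c (f x))"
 by (simp add: pm_linear_def pm_smult_add_right mult.commute)

lemma pm_linear_comp: "\<lbrakk>pm_linear f; pm_linear g\<rbrakk> \<Longrightarrow> pm_linear (\<lambda>x. f (g x))"
 by (simp add: pm_linear_def)

lemma pm_linear_expand:
 assumes "pm_linear f"
 shows "f x = (\<Sum>u\<in>keys x. pm_smult (lookup x u) (f (single u 1)))"
proof -
 have "f x = f (\<Sum>u\<in>keys x. pm_smult (lookup x u) (single u 1))"
  using poly_mapping_sum_single[OF finite_keys order_refl, of x] by simp
 also have "\<dots> = (\<Sum>u\<in>keys x. f (pm_smult (lookup x u) (single u 1)))"
  by (rule pm_linear_sum[OF assms])
 also have "\<dots> = (\<Sum>u\<in>keys x. pm_smult (lookup x u) (f (single u 1)))"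
  by (simp only: pm_linear_smult[OF assms])
 finally show ?thesis .
qed

text \<open>The comparison runs over the support of x only. In this way an identity that holds on a
  chosen basis, or for basis vectors of one parity, extends to the elements supported there.\<close>

lemma pm_linear_eqI:
 assumes "pm_linear f" "pm_linear g"
  and "\<And>u. u \<in> keys x \<Longrightarrow> f (single u 1) = g (single u 1)"
 shows "f x = g x"
 using pm_linear_expand[OF assms(1), of x] pm_linear_expand[OF assms(2), of x] assms(3) by simp

lemma keys_pm_linear:
 assumes "pm_linear f"
  and "\<And>u. u \<in> keys x \<Longrightarrow> keys (f (single u 1)) \<subseteq> S"
 shows "keys (f x) \<subseteq> S"
proof -
 have "keys (f x) \<subseteq>
   (\<Union>u\<in>keys x. keys (pm_smult (lookup x u) (f (single u 1))))"
  unfolding pm_linear_expand[OF assms(1), of x] by (rule keys_sum_subset)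
 also have "\<dots> \<subseteq> S"
  by (rule UN_least) (rule order_trans[OF keys_pm_smult assms(2)])
 finally show ?thesis .
qed

definition pm_ext :: "('a \<Rightarrow> ('b \<Rightarrow>\<^sub>0 'k :: field)) \<Rightarrow> ('a \<Rightarrow>\<^sub>0 'k) \<Rightarrow> ('b \<Rightarrow>\<^sub>0 'k)" where
 "pm_ext f x = (\<Sum>u\<in>keys x. pm_smult (lookup x u) (f u))"

lemma pm_ext_superset:
 assumes "finite S" "keys x \<subseteq> S"
 shows "pm_ext f x = (\<Sum>u\<in>S. pm_smult (lookup x u) (f u))"
 unfolding pm_ext_def using assms
 by (intro sum.mono_neutral_left) (auto simp: in_keys_iff)

lemma pm_ext_single [simp]: "pm_ext f (single u c) = pm_smult c (f u)"
 using pm_ext_superset[of "{u}" "single u c" f] by (simp add: keys_single)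

lemma pm_ext_linear: "pm_linear (pm_ext f)"
proof (rule pm_linearI)
 fix x y :: "'a \<Rightarrow>\<^sub>0 'b" and c
 let ?S = "keys x \<union> keys y"
 have "pm_ext f z = (\<Sum>u\<in>?S. pm_smult (lookup z u) (f u))"
  if "z \<in> {x, y, x + y}" for z
  using that keys_add[of x y] by (intro pm_ext_superset) auto
 then show "pm_ext f (x + y) = pm_ext f x + pm_ext f y"
  by (simp add: lookup_add pm_smult_add_left sum.distrib)
 show "pm_ext f (pm_smult c x) = pm_smult c (pm_ext f x)"
  using pm_ext_superset[OF finite_keys keys_pm_smult, of f c x]
  by (simp add: pm_ext_def pm_smult_sum)
qed

lemma pm_ext_linear_right: "pm_linear (\<lambda>y. pm_ext (\<lambda>u. f u y) x)" if "\<And>u. pm_linear (f u)"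
 using that unfolding pm_ext_def
 by (intro pm_linearI)
   (simp_all add: pm_linear_add pm_linear_smult pm_smult_add_right sum.distrib pm_smult_sum mult.commute)

lemma keys_pm_ext: "keys (pm_ext f x) \<subseteq> (\<Union>u\<in>keys x. keys (f u))"
 by (rule keys_pm_linear[OF pm_ext_linear]) auto

definition bi_ext :: "('a \<Rightarrow> 'b \<Rightarrow> ('c \<Rightarrow>\<^sub>0 'k :: field)) \<Rightarrow> ('a \<Rightarrow>\<^sub>0 'k) \<Rightarrow> ('b \<Rightarrow>\<^sub>0 'k) \<Rightarrow> ('c \<Rightarrow>\<^sub>0 'k)" where
 "bi_ext b x y = pm_ext (\<lambda>u. pm_ext (b u) y) x"

lemma bi_ext_linear_left: "pm_linear (\<lambda>x. bi_ext b x y)"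
 unfolding bi_ext_def by (rule pm_ext_linear)

lemma bi_ext_linear_right: "pm_linear (bi_ext b x)"
 unfolding bi_ext_def[abs_def] by (rule pm_ext_linear_right[OF pm_ext_linear])

lemma bi_ext_single [simp]:
 "bi_ext b (single u c) (single v d) = pm_smult (c * d) (b u v)"
 by (simp add: bi_ext_def)

lemmas bi_ext_linear_simps =
 pm_linear_add[OF bi_ext_linear_left] pm_linear_add[OF bi_ext_linear_right]
 pm_linear_diff[OF bi_ext_linear_left] pm_linear_diff[OF bi_ext_linear_right]
 pm_linear_smult[OF bi_ext_linear_left] pm_linear_smult[OF bi_ext_linear_right]
 pm_linear_uminus[OF bi_ext_linear_left] pm_linear_uminus[OF bi_ext_linear_right]
 pm_linear_zero[OF bi_ext_linear_left] pm_linear_zero[OF bi_ext_linear_right]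

lemmas pm_linear_intros =
 pm_linear_id pm_linear_plus pm_linear_minus pm_linear_neg pm_linear_scale
 pm_ext_linear bi_ext_linear_left bi_ext_linear_right
 pm_linear_comp[OF pm_ext_linear] pm_linear_comp[OF bi_ext_linear_left] pm_linear_comp[OF bi_ext_linear_right]

lemma keys_bi_ext:
 "keys (bi_ext b x y) \<subseteq>
   (\<Union>u\<in>keys x. \<Union>v\<in>keys y. keys (b u v))"
 unfolding bi_ext_def by (rule order_trans[OF keys_pm_ext]) (intro UN_mono order_refl keys_pm_ext)

lemma free_brac_bi_ext: "free_brac = bi_ext (\<lambda>u v. single (Brac u v) 1)"
 by (intro ext) (simp add: free_brac_def bi_ext_def pm_ext_def pm_smult_sum)

section \<open>Superalgebras with a homogeneous basis\<close>

definition basis_superalg ::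
  "'a set \<Rightarrow> ('a \<Rightarrow> bit) \<Rightarrow> ('a \<Rightarrow> 'a \<Rightarrow> ('a \<Rightarrow>\<^sub>0 'k :: field)) \<Rightarrow> ('k, 'a \<Rightarrow>\<^sub>0 'k) superalg" where
 "basis_superalg B par b =
   \<lparr>carrier = {x. keys x \<subseteq> B}, mult = bi_ext b, one = undefined, zero = 0, add = (+),
   smult = pm_smult, part = (\<lambda>p. {x. keys x \<subseteq> {u \<in> B. par u = p}})\<rparr>"

lemma basis_superalg_simps [simp]:
 "carrier (basis_superalg B par b) = {x. keys x \<subseteq> B}"
 "mult (basis_superalg B par b) = bi_ext b"
 "zero (basis_superalg B par b) = 0"
 "add (basis_superalg B par b) = (+)"
 "module.smult (basis_superalg B par b) = pm_smult"
 "part (basis_superalg B par b) p = {x. keys x \<subseteq> {u \<in> B. par u = p}}"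
 by (simp_all add: basis_superalg_def)

lemma bit_cases: "(p :: bit) = 0 \<or> p = 1"
 by (cases p) auto

locale graded_basis =
 fixes B :: "'a set" and par :: "'a \<Rightarrow> bit" and b :: "'a \<Rightarrow> 'a \<Rightarrow> ('a \<Rightarrow>\<^sub>0 'k :: field)"
 assumes keys_b: "\<lbrakk>u \<in> B; v \<in> B\<rbrakk> \<Longrightarrow> keys (b u v) \<subseteq> {w \<in> B. par w = par u + par v}"
begin

abbreviation "L \<equiv> basis_superalg B par b"

lemma keys_bracket_part:
 assumes "x \<in> part L p" "y \<in> part L q"
 shows "bi_ext b x y \<in> part L (p + q)"
proof -
 have *: "keys (b u v) \<subseteq> {w \<in> B. par w = p + q}"
  if "u \<in> keys x" "v \<in> keys y" for u v
 proof -
  have "par u = p" "par v = q" "u \<in> B" "v \<in> B"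
   using that assms by auto
  then show ?thesis
   using keys_b[of u v] by simp
 qed
 have "keys (bi_ext b x y) \<subseteq> {w \<in> B. par w = p + q}"
  by (rule order_trans[OF keys_bi_ext]) (intro UN_least *)
 then show ?thesis
  by simp
qed

lemma keys_bracket:
 assumes "keys x \<subseteq> B" "keys y \<subseteq> B"
 shows "keys (bi_ext b x y) \<subseteq> B"
 using keys_bi_ext[of b x y] keys_b assms by blast

lemma vectorspace_basis_superalg: "vectorspace class_ring L"
proof (rule vs_criteria)
 show "Ring.field (class_ring :: 'k ring)"
  by (rule class_field.field_axioms)
 show "\<forall>v\<in>carrier L. \<exists>neg_v\<in>carrier L. v \<oplus>\<^bsub>L\<^esub> neg_v = \<zero>\<^bsub>L\<^esub>"
 proof
  fix v assume "v \<in> carrier L"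
  then show "\<exists>neg_v\<in>carrier L. v \<oplus>\<^bsub>L\<^esub> neg_v = \<zero>\<^bsub>L\<^esub>"
   by (intro bexI[of _ "- v"]) auto
 qed
 show "\<forall>v w. v \<in> carrier L \<and> w \<in> carrier L \<longrightarrow> v \<oplus>\<^bsub>L\<^esub> w \<in> carrier L"
  using keys_add by fastforce
 show "\<forall>c v. c \<in> carrier class_ring \<and> v \<in> carrier L \<longrightarrow> c \<odot>\<^bsub>L\<^esub> v \<in> carrier L"
  using keys_pm_smult by fastforce
qed (simp_all add: pm_smult_add_left pm_smult_add_right algebra_simps)

lemma bracket_algebra_basis_superalg: "bracket_algebra L"
 using keys_bracket
 by (intro bracket_algebra.intro bracket_algebra_axioms.intro vectorspace_basis_superalg)
   (simp_all add: bi_ext_linear_simps)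

sublocale bracket_algebra L
 by (rule bracket_algebra_basis_superalg)

lemma a_inv_eq: "x \<in> carrier L \<Longrightarrow> \<ominus>\<^bsub>L\<^esub> x = - x"
 using minus_eq_smult[of x] by (simp add: pm_smult_minus_one)

lemma a_minus_eq: "\<lbrakk>x \<in> carrier L; y \<in> carrier L\<rbrakk> \<Longrightarrow> x \<ominus>\<^bsub>L\<^esub> y = x - y"
 using a_inv_eq[of y] by (simp add: a_minus_def)

lemma superalgebra_basis_superalg: "superalgebra L"
proof (intro superalgebra.intro superalgebra_axioms.intro vectorspace_basis_superalg)
 show "VectorSpace.subspace class_ring (part L p) L" for p
 proof (rule subspaceI)
  show "x \<oplus>\<^bsub>L\<^esub> y \<in> part L p" if "x \<in> part L p" "y \<in> part L p" for x y
   using that keys_add[of x y] by auto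
  show "c \<odot>\<^bsub>L\<^esub> x \<in> part L p" if "x \<in> part L p" for c x
   using that keys_pm_smult[of c x] by auto
 qed auto
 fix x assume x: "x \<in> carrier L"
 define f where "f p = (\<Sum>u\<in>{u \<in> keys x. par u = p}. single u (lookup x u))" for p
 have lookup_f: "lookup (f p) u = (if par u = p then lookup x u else 0)" for p u
  by (simp add: f_def lookup_sum lookup_single when_def in_keys_iff)
 show "\<exists>!u. u \<in> part L 0 \<times> part L 1 \<and> x = fst u \<oplus>\<^bsub>L\<^esub> snd u"
 proof (rule ex1I[of _ "(f 0, f 1)"])
  have "x = f 0 + f 1"
   by (rule poly_mapping_eqI) (use bit_cases in \<open>auto simp: lookup_add lookup_f\<close>)
  then show "(f 0, f 1) \<in> part L 0 \<times> part L 1 \<and> x = fst (f 0, f 1) \<oplus>\<^bsub>L\<^esub> snd (f 0, f 1)"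
   using x by (auto simp: in_keys_iff lookup_f split: if_splits)
  fix u assume u: "u \<in> part L 0 \<times> part L 1 \<and> x = fst u \<oplus>\<^bsub>L\<^esub> snd u"
  obtain y z where yz: "u = (y, z)"
   by (cases u) auto
  have 0: "lookup y k = 0" if "par k \<noteq> 0" for k
   using that u yz by (auto simp: in_keys_iff)
  have 1: "lookup z k = 0" if "par k \<noteq> 1" for k
   using that u yz by (auto simp: in_keys_iff)
  have "y = f 0" "z = f 1"
   using u yz 0 1 by (auto intro!: poly_mapping_eqI simp: lookup_f lookup_add)
  then show "u = (f 0, f 1)"
   using yz by simp
 qed
next
 show "x \<otimes>\<^bsub>L\<^esub> y \<in> part L (p + q)" if "x \<in> part L p" "y \<in> part L q" for x y p q
  using keys_bracket_part[OF that] by simp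
qed (auto simp: bi_ext_linear_simps)

end

locale lie_basis = graded_basis +
 assumes anticommutative:
  "\<lbrakk>u \<in> B; v \<in> B\<rbrakk> \<Longrightarrow> b u v = - pm_smult (koszul_sign (par u) (par v)) (b v u)"
  and jacobi: "\<lbrakk>u \<in> B; v \<in> B; w \<in> B\<rbrakk> \<Longrightarrow>
   bi_ext b (single u 1) (b v w) =
   bi_ext b (b u v) (single w 1) +
   pm_smult (koszul_sign (par u) (par v)) (bi_ext b (single v 1) (b u w))"
  and cubic: "\<lbrakk>u \<in> B; par u = 1\<rbrakk> \<Longrightarrow> bi_ext b (single u 1) (b u u) = 0"
begin

lemma anticommutative_part:
 assumes "x \<in> part L p" "y \<in> part L q"
 shows "bi_ext b x y = - pm_smult (koszul_sign p q) (bi_ext b y x)"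
proof (rule pm_linear_eqI[where x = x])
 fix u assume u: "u \<in> keys x"
 show "bi_ext b (single u 1) y = - pm_smult (koszul_sign p q) (bi_ext b y (single u 1))"
 proof (rule pm_linear_eqI[where x = y])
  fix v assume v: "v \<in> keys y"
  have "b u v = - pm_smult (koszul_sign p q) (b v u)"
   using anticommutative[of u v] u v assms by auto
  then show "bi_ext b (single u 1) (single v 1) =
    - pm_smult (koszul_sign p q) (bi_ext b (single v 1) (single u 1))"
   by simp
 qed (intro pm_linear_intros)+
qed (intro pm_linear_intros)+

lemma jacobi_part:
 assumes "x \<in> part L p" "y \<in> part L q" "z \<in> carrier L"
 shows "bi_ext b x (bi_ext b y z) =
  bi_ext b (bi_ext b x y) z + pm_smult (koszul_sign p q) (bi_ext b y (bi_ext b x z))"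
proof (rule pm_linear_eqI[where x = x])
 fix u assume u: "u \<in> keys x"
 show "bi_ext b (single u 1) (bi_ext b y z) = bi_ext b (bi_ext b (single u 1) y) z +
   pm_smult (koszul_sign p q) (bi_ext b y (bi_ext b (single u 1) z))"
 proof (rule pm_linear_eqI[where x = y])
  fix v assume v: "v \<in> keys y"
  show "bi_ext b (single u 1) (bi_ext b (single v 1) z) =
    bi_ext b (bi_ext b (single u 1) (single v 1)) z +
    pm_smult (koszul_sign p q) (bi_ext b (single v 1) (bi_ext b (single u 1) z))"
  proof (rule pm_linear_eqI[where x = z])
   fix w assume w: "w \<in> keys z"
   have "par u = p" "par v = q" "u \<in> B" "v \<in> B" "w \<in> B"
    using u v w assms by auto
   then show "bi_ext b (single u 1) (bi_ext b (single v 1) (single w 1)) =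
     bi_ext b (bi_ext b (single u 1) (single v 1)) (single w 1) +
     pm_smult (koszul_sign p q) (bi_ext b (single v 1)
      (bi_ext b (single u 1) (single w 1)))"
    using jacobi[of u v w] by simp
  qed (intro pm_linear_intros)+
 qed (intro pm_linear_intros)+
qed (intro pm_linear_intros)+

text \<open>The map sending x to [x,[x,x]] is additive on odd elements: its mixed terms are
  2[x,[x,y]] + [y,[x,x]] and the same with x and y exchanged, and both vanish by the Jacobi
  identity. Since a scalar comes out as its cube, vanishing on the basis is enough.\<close>

lemma cubic_part:
 assumes "x \<in> part L 1"
 shows "bi_ext b x (bi_ext b x x) = 0"
proof -
 let ?q = "\<lambda>x. bi_ext b x (bi_ext b x x)"
 have add: "?q (x + y) = ?q x + ?q y" if x: "x \<in> part L 1" and y: "y \<in> part L 1" for x y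
 proof -
  have sub: "x \<in> carrier L" "y \<in> carrier L"
   using x y by auto
  have comm: "bi_ext b y x = bi_ext b x y"
   using anticommutative_part[OF y x] by (simp add: koszul_sign_def pm_smult_minus_one)
  have even: "bi_ext b x x \<in> part L 0" "bi_ext b y y \<in> part L 0"
   using keys_bracket_part[OF x x] keys_bracket_part[OF y y] by simp_all
  have 1: "bi_ext b x (bi_ext b x y) + bi_ext b x (bi_ext b x y) = - bi_ext b y (bi_ext b x x)"
  proof -
   have "bi_ext b x (bi_ext b x y) = bi_ext b (bi_ext b x x) y - bi_ext b x (bi_ext b x y)"
    using jacobi_part[OF x x sub(2)] by (simp add: koszul_sign_def pm_smult_minus_one)
   moreover have "bi_ext b (bi_ext b x x) y = - bi_ext b y (bi_ext b x x)"
    using anticommutative_part[OF even(1) y] by (simp add: koszul_sign_def)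
   ultimately show ?thesis
    by (metis diff_add_cancel)
  qed
  have 2: "bi_ext b y (bi_ext b x y) + bi_ext b y (bi_ext b x y) = - bi_ext b x (bi_ext b y y)"
  proof -
   have "bi_ext b y (bi_ext b x y) = bi_ext b (bi_ext b y y) x - bi_ext b y (bi_ext b x y)"
    using jacobi_part[OF y y sub(1)] by (simp add: koszul_sign_def pm_smult_minus_one comm)
   moreover have "bi_ext b (bi_ext b y y) x = - bi_ext b x (bi_ext b y y)"
    using anticommutative_part[OF even(2) x] by (simp add: koszul_sign_def)
   ultimately show ?thesis
    by (metis diff_add_cancel)
  qed
  have "?q (x + y) = ?q x + ?q y
    + ((bi_ext b x (bi_ext b x y) + bi_ext b x (bi_ext b x y)) + bi_ext b y (bi_ext b x x))
    + ((bi_ext b y (bi_ext b x y) + bi_ext b y (bi_ext b x y)) + bi_ext b x (bi_ext b y y))"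
   by (simp add: bi_ext_linear_simps comm)
  then show ?thesis
   unfolding 1 2 by simp
 qed
 have "S \<subseteq> {u \<in> B. par u = 1} \<Longrightarrow> ?q (\<Sum>u\<in>S. single u (c u)) = 0" if "finite S" for S c
  using that
 proof (induction S)
  case empty
  then show ?case
   by (simp add: bi_ext_linear_simps)
 next
  case (insert u S)
  have "(\<Sum>u\<in>S. single u (c u)) \<in> part L 1"
   using insert.prems keys_sum_subset[of "\<lambda>u. single u (c u)" S]
   by (auto simp: keys_single split: if_splits)
  moreover have "single u (c u) \<in> part L 1"
   using insert.prems by (simp add: keys_single)
  moreover have "?q (single u (c u)) = pm_smult (c u ^ 3) (?q (single u 1))"
   using pm_linear_smult[OF bi_ext_linear_left, of b "c u" "single u 1"]
   by (simp add: bi_ext_linear_simps power3_eq_cube mult.assoc)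
  ultimately show ?case
   using insert cubic[of u] by (simp add: add)
 qed
 from this[OF finite_keys, of x "lookup x"] assms
 show ?thesis
  by (simp flip: poly_mapping_sum_single[OF finite_keys order_refl])
qed

lemma lie_superalgebra_basis_superalg: "lie_superalgebra L"
proof -
 have "lie_identities L \<subseteq> {\<zero>\<^bsub>L\<^esub>}"
 proof
  fix t assume "t \<in> lie_identities L"
  then consider
   p q x y where "x \<in> part L p" "y \<in> part L q"
    "t = x \<otimes>\<^bsub>L\<^esub> y \<oplus>\<^bsub>L\<^esub> koszul_sign p q \<odot>\<^bsub>L\<^esub> (y \<otimes>\<^bsub>L\<^esub> x)"
  | p q x y z where "x \<in> part L p" "y \<in> part L q" "z \<in> carrier L"
    "t = x \<otimes>\<^bsub>L\<^esub> (y \<otimes>\<^bsub>L\<^esub> z) \<ominus>\<^bsub>L\<^esub> (x \<otimes>\<^bsub>L\<^esub> y) \<otimes>\<^bsub>L\<^esub> z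
     \<ominus>\<^bsub>L\<^esub> koszul_sign p q \<odot>\<^bsub>L\<^esub> (y \<otimes>\<^bsub>L\<^esub> (x \<otimes>\<^bsub>L\<^esub> z))"
  | x where "x \<in> part L 1" "t = x \<otimes>\<^bsub>L\<^esub> (x \<otimes>\<^bsub>L\<^esub> x)"
   unfolding lie_identities_def by blast
  then show "t \<in> {\<zero>\<^bsub>L\<^esub>}"
  proof cases
   case 1
   then show ?thesis
    using anticommutative_part[OF 1(1,2)] by simp
  next
   case 2
   have c: "x \<in> carrier L" "y \<in> carrier L"
    using 2 by auto
   have "t = bi_ext b x (bi_ext b y z) - bi_ext b (bi_ext b x y) z
     - pm_smult (koszul_sign p q) (bi_ext b y (bi_ext b x z))"
    using 2(3,4) c bracket_closed smult_carrier minus_closed by (simp add: a_minus_eq del: basis_superalg_simps(1))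
   then show ?thesis
    using jacobi_part[OF 2(1,2,3)] by simp
  next
   case 3
   then show ?thesis
    using cubic_part[OF 3(1)] by simp
  qed
 qed
 then show ?thesis
  using superalgebra_basis_superalg by (simp add: lie_superalgebra_def lie_superalgebra_axioms_def)
qed

end

section \<open>The free algebra on words\<close>

primrec word_eval :: "('v \<Rightarrow> 'v \<Rightarrow> 'v) \<Rightarrow> ('g \<Rightarrow> 'v) \<Rightarrow> 'g lie_word \<Rightarrow> 'v" where
 "word_eval m g (Gen a) = g a"
| "word_eval m g (Brac u v) = m (word_eval m g u) (word_eval m g v)"

lemma pm_ext_word_eval_free_brac:
 "pm_ext (word_eval (bi_ext b) g) (free_brac x y) =
  bi_ext b (pm_ext (word_eval (bi_ext b) g) x) (pm_ext (word_eval (bi_ext b) g) y)"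
proof -
 let ?b = "\<lambda>u v. single (Brac u v) 1" and ?\<phi> = "pm_ext (word_eval (bi_ext b) g)"
 have "?\<phi> (bi_ext ?b x y) = bi_ext b (?\<phi> x) (?\<phi> y)"
 proof (rule pm_linear_eqI[where x = x])
  fix u
  show "?\<phi> (bi_ext ?b (single u 1) y) = bi_ext b (?\<phi> (single u 1)) (?\<phi> y)"
   by (rule pm_linear_eqI[where x = y]; (intro pm_linear_intros)?) simp
 qed (intro pm_linear_intros)+
 then show ?thesis
  by (simp add: free_brac_bi_ext)
qed

lemma free_homogeneous_eq:
 "free_homogeneous G d \<beta> = {x. keys x \<subseteq> {w \<in> {w. gens w \<subseteq> G}. word_degree d w = \<beta>}}"
 by (auto simp: free_homogeneous_def free_carrier_def)

text \<open>The free algebra is an instance of the same construction, with the words as basis and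
  \<open>Brac\<close> as structure constants, so the general facts about
  \<open>basis_superalg\<close> apply to it.\<close>

lemma free_superalg_basis: "(free_superalg G d :: ('k :: field, 'g lie_word \<Rightarrow>\<^sub>0 'k) superalg) =
  basis_superalg {w. gens w \<subseteq> G} (word_degree d) (\<lambda>u v. single (Brac u v) 1)"
proof -
 have "(free_carrier G :: ('g lie_word \<Rightarrow>\<^sub>0 'k) set) = {x. keys x \<subseteq> {w. gens w \<subseteq> G}}"
  by (auto simp: free_carrier_def)
 moreover have "(free_homogeneous G d :: bit \<Rightarrow> ('g lie_word \<Rightarrow>\<^sub>0 'k) set) =
   (\<lambda>p. {x. keys x \<subseteq> {w \<in> {w. gens w \<subseteq> G}. word_degree d w = p}})"
  by (intro ext free_homogeneous_eq)
 ultimately show ?thesis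
  by (simp only: free_superalg_def basis_superalg_def free_brac_bi_ext free_smult_eq_pm_smult)
qed

section \<open>Contragredient Lie superalgebras and their models\<close>

text \<open>One projection serves three purposes: parity components, components for the root
  grading, and the map that drops the central Cartan element of a model.\<close>

definition pm_restrict :: "'a set \<Rightarrow> ('a \<Rightarrow>\<^sub>0 'k :: field) \<Rightarrow> ('a \<Rightarrow>\<^sub>0 'k)" where
 "pm_restrict S = pm_ext (\<lambda>u. if u \<in> S then single u 1 else 0)"

lemma pm_restrict_linear: "pm_linear (pm_restrict S)"
 unfolding pm_restrict_def by (rule pm_ext_linear)

lemma lookup_pm_restrict [simp]:
 "lookup (pm_restrict S x) u = (if u \<in> S then lookup x u else 0)"
proof -
 have "lookup (pm_restrict S x) u =
   (\<Sum>v\<in>keys x. if v = u \<and> u \<in> S then lookup x v else 0)"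
  unfolding pm_restrict_def pm_ext_def lookup_sum
  by (rule sum.cong) (auto simp: lookup_single when_def)
 also have "\<dots> = (if u \<in> S then lookup x u else 0)"
  by (auto simp: in_keys_iff)
 finally show ?thesis .
qed

lemma keys_pm_restrict: "keys (pm_restrict S x) = keys x \<inter> S"
 by (auto simp: in_keys_iff simp del: lookup_not_eq_zero_eq_in_keys split: if_splits)

lemma pm_restrict_id: "keys x \<subseteq> S \<Longrightarrow> pm_restrict S x = x"
 by (rule poly_mapping_eqI) (auto simp: in_keys_iff)

text \<open>This makes a homomorphism to a Lie superalgebra kill the first family of generators of
  the defining ideal: their images are values of identities again.\<close>

lemma lie_identities_image:
 assumes L: "superalgebra L" and epi: "algebra_epi L M \<phi>"
  and parts: "\<And>p. \<phi> ` part L p \<subseteq> part M p"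
 shows "\<phi> ` lie_identities L \<subseteq> lie_identities M"
proof
 interpret superalgebra L by fact
 have bL: "bracket_algebra L" ..
 note e = algebra_epiD[OF epi]
 have sub: "part L p \<subseteq> carrier L" for p
  by (rule subspaceD(1)[OF part_subspace])
 fix t assume "t \<in> \<phi> ` lie_identities L"
 then obtain s where s: "s \<in> lie_identities L" "t = \<phi> s"
  by blast
 from s(1) consider
  p q x y where "x \<in> part L p" "y \<in> part L q"
   "s = x \<otimes>\<^bsub>L\<^esub> y \<oplus>\<^bsub>L\<^esub> koszul_sign p q \<odot>\<^bsub>L\<^esub> (y \<otimes>\<^bsub>L\<^esub> x)"
 | p q x y z where "x \<in> part L p" "y \<in> part L q" "z \<in> carrier L"
   "s = x \<otimes>\<^bsub>L\<^esub> (y \<otimes>\<^bsub>L\<^esub> z) \<ominus>\<^bsub>L\<^esub> (x \<otimes>\<^bsub>L\<^esub> y) \<otimes>\<^bsub>L\<^esub> z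
    \<ominus>\<^bsub>L\<^esub> koszul_sign p q \<odot>\<^bsub>L\<^esub> (y \<otimes>\<^bsub>L\<^esub> (x \<otimes>\<^bsub>L\<^esub> z))"
 | x where "x \<in> part L 1" "s = x \<otimes>\<^bsub>L\<^esub> (x \<otimes>\<^bsub>L\<^esub> x)"
  unfolding lie_identities_def by blast
 then show "t \<in> lie_identities M"
 proof cases
  case 1
  then have c: "x \<in> carrier L" "y \<in> carrier L" "\<phi> x \<in> part M p" "\<phi> y \<in> part M q"
   using sub parts by blast+
  have "t = \<phi> x \<otimes>\<^bsub>M\<^esub> \<phi> y \<oplus>\<^bsub>M\<^esub> koszul_sign p q \<odot>\<^bsub>M\<^esub> (\<phi> y \<otimes>\<^bsub>M\<^esub> \<phi> x)"
   using 1 c s by (simp add: e bracket_closed)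
  then show ?thesis
   unfolding lie_identities_def using c by blast
 next
  case 2
  then have c: "x \<in> carrier L" "y \<in> carrier L" "\<phi> x \<in> part M p" "\<phi> y \<in> part M q" "\<phi> z \<in> carrier M"
   using sub parts e(3) by blast+
  have "t = \<phi> x \<otimes>\<^bsub>M\<^esub> (\<phi> y \<otimes>\<^bsub>M\<^esub> \<phi> z) \<ominus>\<^bsub>M\<^esub> (\<phi> x \<otimes>\<^bsub>M\<^esub> \<phi> y) \<otimes>\<^bsub>M\<^esub> \<phi> z
    \<ominus>\<^bsub>M\<^esub> koszul_sign p q \<odot>\<^bsub>M\<^esub> (\<phi> y \<otimes>\<^bsub>M\<^esub> (\<phi> x \<otimes>\<^bsub>M\<^esub> \<phi> z))"
   using 2 c s by (simp add: e bracket_closed algebra_epi_minus[OF bL epi])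
  then show ?thesis
   unfolding lie_identities_def using c by blast
 next
  case 3
  then have c: "x \<in> carrier L" "\<phi> x \<in> part M 1"
   using sub parts by blast+
  have "t = \<phi> x \<otimes>\<^bsub>M\<^esub> (\<phi> x \<otimes>\<^bsub>M\<^esub> \<phi> x)"
   using 3 c s by (simp add: e bracket_closed)
  then show ?thesis
   unfolding lie_identities_def using c by blast
 qed
qed

lemma lie_identities_carrier:
 assumes "superalgebra L"
 shows "lie_identities L \<subseteq> carrier L"
proof -
 interpret superalgebra L by fact
 have sub: "\<And>x p. x \<in> part L p \<Longrightarrow> x \<in> carrier L"
  using subspaceD(1)[OF part_subspace] by blast
 show ?thesis
  unfolding lie_identities_def by (auto simp: bracket_closed dest!: sub)
qed

section \<open>The defining ideal of the presented algebra\<close>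

locale chev_presentation =
 fixes D :: "('k :: field, 'h) cartan_datum"
 assumes cartan_space: "vectorspace class_ring (cartan_space D)"
  and coroot_carrier: "i < dim_row (cartan_matrix D) \<Longrightarrow> coroot D i \<in> carrier (cartan_space D)"
begin

abbreviation "n \<equiv> dim_row (cartan_matrix D)"
abbreviation "V \<equiv> cartan_space D"
abbreviation "F \<equiv> chev_free D"
abbreviation "I \<equiv> chev_ideal D"
abbreviation "words \<equiv> {w. gens w \<subseteq> chev_gens D}"
abbreviation wd :: "'h chev_gen lie_word \<Rightarrow> 'h chev_gen lie_word \<Rightarrow>\<^sub>0 'k" where
 "wd w \<equiv> single w 1"
abbreviation "h x \<equiv> Gen (CartanGen x)"

lemma V_closed [simp]:
 "\<zero>\<^bsub>V\<^esub> \<in> carrier V" "\<lbrakk>x \<in> carrier V; y \<in> carrier V\<rbrakk> \<Longrightarrow> x \<oplus>\<^bsub>V\<^esub> y \<in> carrier V"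
 "x \<in> carrier V \<Longrightarrow> c \<odot>\<^bsub>V\<^esub> x \<in> carrier V"
proof -
 interpret V: vectorspace class_ring V
  by (rule cartan_space)
 show "\<zero>\<^bsub>V\<^esub> \<in> carrier V" "\<lbrakk>x \<in> carrier V; y \<in> carrier V\<rbrakk> \<Longrightarrow> x \<oplus>\<^bsub>V\<^esub> y \<in> carrier V"
  "x \<in> carrier V \<Longrightarrow> c \<odot>\<^bsub>V\<^esub> x \<in> carrier V"
  using V.smult_closed[of c x] by auto
qed

lemma F_eq: "F = basis_superalg words (word_degree (chev_parity D)) (\<lambda>u v. wd (Brac u v))"
 by (simp add: chev_free_def free_superalg_basis)

lemma graded_basis_F: "graded_basis words (word_degree (chev_parity D)) (\<lambda>u v. wd (Brac u v))"
 by unfold_locales (auto simp: keys_single)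

sublocale F: superalgebra F
 unfolding F_eq by (rule graded_basis.superalgebra_basis_superalg[OF graded_basis_F])

lemma F_simps [simp]:
 "carrier F = {x. keys x \<subseteq> words}" "mult F = free_brac" "zero F = 0" "add F = (+)"
 "module.smult F = pm_smult"
 "part F p = {x. keys x \<subseteq> {w \<in> words. word_degree (chev_parity D) w = p}}"
 by (simp_all add: F_eq free_brac_bi_ext)

lemma F_minus: "\<lbrakk>x \<in> carrier F; y \<in> carrier F\<rbrakk> \<Longrightarrow> x \<ominus>\<^bsub>F\<^esub> y = x - y"
 using graded_basis.a_minus_eq[OF graded_basis_F, of x y] by (simp add: F_eq)

lemma word_carrier: "w \<in> words \<Longrightarrow> wd w \<in> carrier F"
 by (simp add: keys_single)

lemma free_brac_wd: "free_brac (wd u) (wd v) = wd (Brac u v)"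
 by (simp add: free_brac_bi_ext)

lemma free_brac_closed: "\<lbrakk>x \<in> carrier F; y \<in> carrier F\<rbrakk> \<Longrightarrow> free_brac x y \<in> carrier F"
 using F.bracket_closed[of x y] by simp

lemma gen_words:
 "x \<in> carrier V \<Longrightarrow> h x \<in> words" "i < n \<Longrightarrow> Gen (EGen i) \<in> words" "i < n \<Longrightarrow> Gen (FGen i) \<in> words"
 "Brac u v \<in> words \<longleftrightarrow> u \<in> words \<and> v \<in> words"
 by (auto simp: chev_gens_def)

lemma gen_carrier:
 "x \<in> carrier V \<Longrightarrow> free_gen (CartanGen x) \<in> carrier F"
 "i < n \<Longrightarrow> free_gen (EGen i) \<in> carrier F" "i < n \<Longrightarrow> free_gen (FGen i) \<in> carrier F"
 using gen_words word_carrier by (simp_all add: free_gen_def)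

lemma F_closed:
 "\<lbrakk>x \<in> carrier F; y \<in> carrier F\<rbrakk> \<Longrightarrow> x + y \<in> carrier F"
 "\<lbrakk>x \<in> carrier F; y \<in> carrier F\<rbrakk> \<Longrightarrow> x - y \<in> carrier F"
 "x \<in> carrier F \<Longrightarrow> pm_smult c x \<in> carrier F" "0 \<in> carrier F"
 using F.a_closed[of x y] F.minus_closed[of x y] F_minus[of x y] F.smult_carrier[of x c] by simp_all

lemma relators_carrier: "chev_relators D \<subseteq> carrier F"
 unfolding chev_relators_def Let_def free_smult_eq_pm_smult
 by (auto simp del: F_simps
   intro!: F_closed gen_carrier free_brac_closed coroot_carrier)

lemma chev_ideal_ideal: "superalg_ideal F I"
 and chev_ideal_generators: "lie_identities F \<union> chev_relators D \<subseteq> I"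
 and chev_ideal_least: "\<lbrakk>superalg_ideal F J; lie_identities F \<union> chev_relators D \<subseteq> J\<rbrakk> \<Longrightarrow> I \<subseteq> J"
proof -
 have "lie_identities F \<union> chev_relators D \<subseteq> carrier F"
  using relators_carrier lie_identities_carrier[OF F.superalgebra_axioms] by blast
 from genideal_ideal[OF F.bracket_algebra_axioms this]
 show "superalg_ideal F I" "lie_identities F \<union> chev_relators D \<subseteq> I"
  "\<lbrakk>superalg_ideal F J; lie_identities F \<union> chev_relators D \<subseteq> J\<rbrakk> \<Longrightarrow> I \<subseteq> J"
  by (simp_all add: chev_ideal_def presentation_ideal_def chev_free_def)
qed

sublocale I: algebra_with_ideal F I
 by unfold_locales (rule chev_ideal_ideal)

lemma I_closed:
 "\<lbrakk>x \<in> I; y \<in> I\<rbrakk> \<Longrightarrow> x + y \<in> I" "\<lbrakk>x \<in> I; y \<in> I\<rbrakk> \<Longrightarrow> x - y \<in> I" "x \<in> I \<Longrightarrow> pm_smult c x \<in> I" "0 \<in> I"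
 "x \<in> I \<Longrightarrow> - x \<in> I"
proof -
 show add: "x + y \<in> I" if "x \<in> I" "y \<in> I" for x y
  using I.idealD(3)[OF that] by simp
 show smult: "pm_smult c x \<in> I" if "x \<in> I" for c x
  using I.idealD(4)[OF that] by simp
 show neg: "- x \<in> I" if "x \<in> I" for x
  using smult[OF that, of "- 1"] by (simp add: pm_smult_minus_one)
 show "x - y \<in> I" if "x \<in> I" "y \<in> I"
  using add[OF that(1) neg[OF that(2)]] by simp
 show "0 \<in> I"
  using I.idealD(2) by simp
qed

lemma I_bracket:
 assumes "x \<in> carrier F" "a \<in> I"
 shows "free_brac x a \<in> I" "free_brac a x \<in> I"
 using I.ideal_bracket[OF assms] by simp_all

text \<open>The scalar is a Koszul sign up to sign. Its value is hidden because the arguments below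
  concern spans, where only the existence of some scalar enters.\<close>

lemma I_anticommutative:
 assumes "u \<in> words" "v \<in> words"
 shows "\<exists>c. wd (Brac u v) - pm_smult c (wd (Brac v u)) \<in> I"
proof -
 let ?p = "word_degree (chev_parity D) u" and ?q = "word_degree (chev_parity D) v"
 have "wd u \<in> part F ?p" "wd v \<in> part F ?q"
  using assms by (simp_all add: keys_single)
 then have "wd u \<otimes>\<^bsub>F\<^esub> wd v \<oplus>\<^bsub>F\<^esub> koszul_sign ?p ?q \<odot>\<^bsub>F\<^esub> (wd v \<otimes>\<^bsub>F\<^esub> wd u) \<in> lie_identities F"
  unfolding lie_identities_def by blast
 then have "wd (Brac u v) + pm_smult (koszul_sign ?p ?q) (wd (Brac v u)) \<in> I"
  using chev_ideal_generators by (simp add: free_brac_wd subset_iff)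
 then show ?thesis
  by (intro exI[of _ "- koszul_sign ?p ?q"]) (simp only: pm_smult_minus diff_minus_eq_add)
qed

lemma I_jacobi:
 assumes "u \<in> words" "v \<in> words" "z \<in> carrier F"
 shows "\<exists>c. free_brac (wd u) (free_brac (wd v) z) - free_brac (wd (Brac u v)) z
  - pm_smult c (free_brac (wd v) (free_brac (wd u) z)) \<in> I"
proof -
 let ?p = "word_degree (chev_parity D) u" and ?q = "word_degree (chev_parity D) v"
 note w = word_carrier[OF assms(1)] word_carrier[OF assms(2)] assms(3)
 have "wd u \<in> part F ?p" "wd v \<in> part F ?q"
  using assms by (simp_all add: keys_single)
 then have "wd u \<otimes>\<^bsub>F\<^esub> (wd v \<otimes>\<^bsub>F\<^esub> z) \<ominus>\<^bsub>F\<^esub> (wd u \<otimes>\<^bsub>F\<^esub> wd v) \<otimes>\<^bsub>F\<^esub> z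
   \<ominus>\<^bsub>F\<^esub> koszul_sign ?p ?q \<odot>\<^bsub>F\<^esub> (wd v \<otimes>\<^bsub>F\<^esub> (wd u \<otimes>\<^bsub>F\<^esub> z)) \<in> lie_identities F"
  unfolding lie_identities_def using assms(3) by blast
 moreover have "wd u \<otimes>\<^bsub>F\<^esub> (wd v \<otimes>\<^bsub>F\<^esub> z) \<ominus>\<^bsub>F\<^esub> (wd u \<otimes>\<^bsub>F\<^esub> wd v) \<otimes>\<^bsub>F\<^esub> z
   \<ominus>\<^bsub>F\<^esub> koszul_sign ?p ?q \<odot>\<^bsub>F\<^esub> (wd v \<otimes>\<^bsub>F\<^esub> (wd u \<otimes>\<^bsub>F\<^esub> z)) =
   wd u \<otimes>\<^bsub>F\<^esub> (wd v \<otimes>\<^bsub>F\<^esub> z) - (wd u \<otimes>\<^bsub>F\<^esub> wd v) \<otimes>\<^bsub>F\<^esub> z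
   - koszul_sign ?p ?q \<odot>\<^bsub>F\<^esub> (wd v \<otimes>\<^bsub>F\<^esub> (wd u \<otimes>\<^bsub>F\<^esub> z))"
  using w F.bracket_closed F.smult_carrier F.minus_closed by (simp only: F_minus)
 ultimately show ?thesis
  using chev_ideal_generators by (intro exI[of _ "koszul_sign ?p ?q"]) (auto simp: free_brac_wd)
qed

lemma I_relators:
 "\<lbrakk>x \<in> carrier V; y \<in> carrier V\<rbrakk> \<Longrightarrow> wd (h (x \<oplus>\<^bsub>V\<^esub> y)) - (wd (h x) + wd (h y)) \<in> I"
 "x \<in> carrier V \<Longrightarrow> wd (h (c \<odot>\<^bsub>V\<^esub> x)) - pm_smult c (wd (h x)) \<in> I"
 "\<lbrakk>i < n; j < n\<rbrakk> \<Longrightarrow>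
  wd (Brac (Gen (EGen i)) (Gen (FGen j))) - (if i = j then wd (h (coroot D i)) else 0) \<in> I"
 "\<lbrakk>x \<in> carrier V; j < n\<rbrakk> \<Longrightarrow>
  wd (Brac (h x) (Gen (EGen j))) - pm_smult (root D j x) (wd (Gen (EGen j))) \<in> I"
 "\<lbrakk>x \<in> carrier V; j < n\<rbrakk> \<Longrightarrow>
  wd (Brac (h x) (Gen (FGen j))) + pm_smult (root D j x) (wd (Gen (FGen j))) \<in> I"
 "\<lbrakk>x \<in> carrier V; y \<in> carrier V\<rbrakk> \<Longrightarrow> wd (Brac (h x) (h y)) \<in> I"
proof -
 have R: "chev_relators D \<subseteq> I"
  using chev_ideal_generators by blast
 note defs = chev_relators_def Let_def free_smult_eq_pm_smult free_gen_def free_brac_wd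
 show "wd (h (x \<oplus>\<^bsub>V\<^esub> y)) - (wd (h x) + wd (h y)) \<in> I" if "x \<in> carrier V" "y \<in> carrier V"
  by (rule subsetD[OF R], unfold defs) (use that in blast)
 show "wd (h (c \<odot>\<^bsub>V\<^esub> x)) - pm_smult c (wd (h x)) \<in> I" if "x \<in> carrier V"
  by (rule subsetD[OF R], unfold defs) (use that in blast)
 show "wd (Brac (Gen (EGen i)) (Gen (FGen j))) - (if i = j then wd (h (coroot D i)) else 0) \<in> I"
  if "i < n" "j < n"
  by (rule subsetD[OF R], unfold defs) (use that in blast)
 show "wd (Brac (h x) (Gen (EGen j))) - pm_smult (root D j x) (wd (Gen (EGen j))) \<in> I"
  if "x \<in> carrier V" "j < n"
  by (rule subsetD[OF R], unfold defs) (use that in blast)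
 show "wd (Brac (h x) (Gen (FGen j))) + pm_smult (root D j x) (wd (Gen (FGen j))) \<in> I"
  if "x \<in> carrier V" "j < n"
  by (rule subsetD[OF R], unfold defs) (use that in blast)
 show "wd (Brac (h x) (h y)) \<in> I" if "x \<in> carrier V" "y \<in> carrier V"
  by (rule subsetD[OF R], unfold defs) (use that in blast)
qed

end

section \<open>Triangular decomposition\<close>

context chev_presentation
begin

text \<open>
 Modulo the defining ideal, every word is a combination of words of its own height that involve
 only the \<open>e\<^sub>i\<close>, only the \<open>f\<^sub>i\<close>, or are a single element of the Cartan subalgebra.
\<close>

definition height :: "'h chev_gen lie_word \<Rightarrow> int" where
 "height = word_degree (\<lambda>g. case g of CartanGen x \<Rightarrow> 0 | EGen i \<Rightarrow> 1 | FGen i \<Rightarrow> - 1)"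

lemma height_simps [simp]:
 "height (h x) = 0" "height (Gen (EGen i)) = 1" "height (Gen (FGen i)) = - 1"
 "height (Brac u v) = height u + height v"
 by (simp_all add: height_def)

abbreviation "Ewords \<equiv> {w. gens w \<subseteq> EGen ` {..<n}}"
abbreviation "Fwords \<equiv> {w. gens w \<subseteq> FGen ` {..<n}}"
abbreviation "Hwords \<equiv> (\<lambda>x. h x) ` carrier V"

lemma Ewords_height: "w \<in> Ewords \<Longrightarrow> height w \<ge> 1"
proof (induction w)
 case (Gen g)
 then obtain i where "g = EGen i"
  by auto
 then show ?case
  by simp
next
 case (Brac u v)
 then have "u \<in> Ewords" "v \<in> Ewords"
  by simp_all
 with Brac.IH show ?case
  by simp
qed

lemma Fwords_height: "w \<in> Fwords \<Longrightarrow> height w \<le> - 1"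
proof (induction w)
 case (Gen g)
 then obtain i where "g = FGen i"
  by auto
 then show ?case
  by simp
next
 case (Brac u v)
 then have "u \<in> Fwords" "v \<in> Fwords"
  by simp_all
 with Brac.IH show ?case
  by simp
qed

text \<open>Words in the e_i have positive height, words in the f_i negative height, and Cartan
  generators height 0. So a pure word of height 0 is a Cartan generator, and the height, the
  coordinate sum of the Q-degree, is enough to recognize the Cartan subalgebra.\<close>

definition pure :: "int \<Rightarrow> 'h chev_gen lie_word set" where
 "pure k = {w \<in> Ewords \<union> Fwords \<union> Hwords. height w = k}"

lemma pure_words: "pure k \<subseteq> words"
 by (fastforce simp: pure_def chev_gens_def)

lemma pureE:
 assumes "w \<in> pure k"
 obtains "w \<in> Ewords" "k \<ge> 1" | "w \<in> Fwords" "k \<le> - 1" | x where "x \<in> carrier V" "w = h x" "k = 0"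
 using assms Ewords_height[of w] Fwords_height[of w] by (auto simp: pure_def)

lemma pure_Ewords: "\<lbrakk>w \<in> pure k; k \<ge> 1\<rbrakk> \<Longrightarrow> w \<in> Ewords"
 and pure_Fwords: "\<lbrakk>w \<in> pure k; k \<le> - 1\<rbrakk> \<Longrightarrow> w \<in> Fwords"
 by (erule pureE; simp)+

definition T :: "int \<Rightarrow> ('h chev_gen lie_word \<Rightarrow>\<^sub>0 'k) set" where
 "T k = {x. \<exists>y. keys y \<subseteq> pure k \<and> x - y \<in> I}"

lemma T_I: "x \<in> I \<Longrightarrow> x \<in> T k"
 unfolding T_def by (intro CollectI exI[of _ 0]) simp

lemma T_pure: "keys y \<subseteq> pure k \<Longrightarrow> y \<in> T k"
 unfolding T_def by (intro CollectI exI[of _ y]) (simp add: I_closed)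

lemma T_add: "\<lbrakk>x \<in> T k; y \<in> T k\<rbrakk> \<Longrightarrow> x + y \<in> T k"
proof -
 assume "x \<in> T k" "y \<in> T k"
 then obtain x' y' where *: "keys x' \<subseteq> pure k" "x - x' \<in> I"
   "keys y' \<subseteq> pure k" "y - y' \<in> I"
  by (auto simp: T_def)
 have "(x + y) - (x' + y') = (x - x') + (y - y')"
  by simp
 then have "(x + y) - (x' + y') \<in> I"
  using I_closed(1)[OF *(2,4)] by (simp only:)
 moreover have "keys (x' + y') \<subseteq> pure k"
  using keys_add[of x' y'] * by blast
 ultimately show ?thesis
  by (auto simp: T_def)
qed

lemma T_smult: "x \<in> T k \<Longrightarrow> pm_smult c x \<in> T k"
proof -
 assume "x \<in> T k"
 then obtain x' where *: "keys x' \<subseteq> pure k" "x - x' \<in> I"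
  by (auto simp: T_def)
 have "pm_smult c x - pm_smult c x' \<in> I"
  using I_closed(3)[OF *(2), of c] by (simp add: pm_smult_diff)
 moreover have "keys (pm_smult c x') \<subseteq> pure k"
  using keys_pm_smult[of c x'] * by blast
 ultimately show ?thesis
  by (auto simp: T_def)
qed

lemma T_cong: "\<lbrakk>x - y \<in> I; y \<in> T k\<rbrakk> \<Longrightarrow> x \<in> T k"
 by (drule T_I) (drule T_add, assumption, simp)

lemma T_sum: "(\<And>a. a \<in> A \<Longrightarrow> g a \<in> T k) \<Longrightarrow> sum g A \<in> T k"
 by (induction A rule: infinite_finite_induct) (auto intro: T_add T_pure)

lemma T_linear:
 assumes "pm_linear g" "\<And>a. a \<in> I \<Longrightarrow> g a \<in> I" "\<And>w. w \<in> pure k \<Longrightarrow> g (wd w) \<in> T m" "x \<in> T k"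
 shows "g x \<in> T m"
proof -
 obtain y where y: "keys y \<subseteq> pure k" "x - y \<in> I"
  using assms(4) by (auto simp: T_def)
 have "g y \<in> T m"
  unfolding pm_linear_expand[OF assms(1), of y]
  using y(1) assms(3) by (intro T_sum T_smult) auto
 moreover have "g x - g y \<in> I"
  using assms(2)[OF y(2)] by (simp add: pm_linear_diff[OF assms(1)])
 ultimately show ?thesis
  by (rule T_cong[rotated])
qed

lemma T_bracket_left:
 assumes "a \<in> carrier F" "\<And>w. w \<in> pure k \<Longrightarrow> free_brac a (wd w) \<in> T m" "x \<in> T k"
 shows "free_brac a x \<in> T m"
proof (rule T_linear[where k = k and g = "free_brac a"])
 show "pm_linear (free_brac a)"
  by (simp add: free_brac_bi_ext bi_ext_linear_right)
qed (use assms I_bracket(1)[OF assms(1)] in blast)+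

lemma T_bracket_right:
 assumes "a \<in> carrier F" "\<And>w. w \<in> pure k \<Longrightarrow> free_brac (wd w) a \<in> T m" "x \<in> T k"
 shows "free_brac x a \<in> T m"
proof (rule T_linear[where k = k and g = "\<lambda>x. free_brac x a"])
 show "pm_linear (\<lambda>x. free_brac x a)"
  by (simp add: free_brac_bi_ext bi_ext_linear_left)
qed (use assms I_bracket(2)[OF assms(1)] in blast)+

lemma T_swap:
 assumes "u \<in> words" "v \<in> words" "wd (Brac v u) \<in> T k"
 shows "wd (Brac u v) \<in> T k"
 using I_anticommutative[OF assms(1,2)] T_cong T_smult[OF assms(3)] by blast

lemma T_jacobi_outer:
 assumes "u \<in> words" "v \<in> words" "z \<in> carrier F"
  and "free_brac (wd (Brac u v)) z \<in> T k" "free_brac (wd v) (free_brac (wd u) z) \<in> T k"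
 shows "free_brac (wd u) (free_brac (wd v) z) \<in> T k"
proof -
 obtain c where "free_brac (wd u) (free_brac (wd v) z) - free_brac (wd (Brac u v)) z
   - pm_smult c (free_brac (wd v) (free_brac (wd u) z)) \<in> I"
  using I_jacobi[OF assms(1-3)] by blast
 then have "free_brac (wd u) (free_brac (wd v) z) -
   (free_brac (wd (Brac u v)) z + pm_smult c (free_brac (wd v) (free_brac (wd u) z))) \<in> I"
  by (simp add: algebra_simps)
 then show ?thesis
  by (rule T_cong) (intro T_add T_smult assms)
qed

text \<open>The same relation solved for another term: \<open>T_jacobi_outer\<close> lets a fixed u
  act on a product [v,z] like a derivation, while here a product [u,v] acts on z through u and
  v.\<close>

lemma T_jacobi_inner:
 assumes "u \<in> words" "v \<in> words" "z \<in> carrier F"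
  and "free_brac (wd u) (free_brac (wd v) z) \<in> T k" "free_brac (wd v) (free_brac (wd u) z) \<in> T k"
 shows "free_brac (wd (Brac u v)) z \<in> T k"
proof -
 obtain c where "free_brac (wd u) (free_brac (wd v) z) - free_brac (wd (Brac u v)) z
   - pm_smult c (free_brac (wd v) (free_brac (wd u) z)) \<in> I"
  using I_jacobi[OF assms(1-3)] by blast
 from I_closed(5)[OF this] have "free_brac (wd (Brac u v)) z -
   (free_brac (wd u) (free_brac (wd v) z) + pm_smult (- c) (free_brac (wd v) (free_brac (wd u) z))) \<in> I"
  by (simp add: algebra_simps pm_smult_minus)
 then show ?thesis
  by (rule T_cong) (intro T_add T_smult assms)
qed

lemma T_EE: "\<lbrakk>u \<in> Ewords; v \<in> Ewords; k = height u + height v\<rbrakk> \<Longrightarrow> wd (Brac u v) \<in> T k"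
 and T_FF: "\<lbrakk>u \<in> Fwords; v \<in> Fwords; k = height u + height v\<rbrakk> \<Longrightarrow> wd (Brac u v) \<in> T k"
 by (intro T_pure; simp add: keys_single pure_def)+

lemma Ewords_words: "Ewords \<subseteq> words" and Fwords_words: "Fwords \<subseteq> words" and Hwords_words: "Hwords \<subseteq> words"
 by (fastforce simp: chev_gens_def)+

text \<open>An element of the Cartan space acts as a derivation, up to a scalar. The claim therefore
  passes from the generators, where it is a defining relation, to all words, and a bracket of two E
  words is an E word.\<close>

lemma T_HE:
 assumes "x \<in> carrier V"
 shows "v \<in> Ewords \<Longrightarrow> wd (Brac (h x) v) \<in> T (height v)"
proof (induction v)
 case (Gen g)
 then obtain j where g: "g = EGen j" "j < n"
  by auto
 have "pm_smult (root D j x) (wd (Gen (EGen j))) \<in> T 1"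
  using g Gen by (intro T_smult T_pure) (simp add: keys_single pure_def)
 then show ?case
  using T_cong[OF I_relators(4)[OF assms g(2)]] g by simp
next
 case (Brac u v)
 then have uv: "u \<in> Ewords" "v \<in> Ewords"
  by auto
 have w: "h x \<in> words" "u \<in> words" "v \<in> words"
  using uv Ewords_words gen_words assms by blast+
 have "free_brac (wd (Brac (h x) u)) (wd v) \<in> T (height u + height v)"
 proof (rule T_bracket_right[OF word_carrier[OF w(3)] _ Brac.IH(1)[OF uv(1)]])
  show "free_brac (wd w) (wd v) \<in> T (height u + height v)" if "w \<in> pure (height u)" for w
   using pure_Ewords[OF that Ewords_height[OF uv(1)]] uv that
   unfolding free_brac_wd by (intro T_EE) (auto simp: pure_def)
 qed
 moreover have "free_brac (wd u) (wd (Brac (h x) v)) \<in> T (height u + height v)"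
 proof (rule T_bracket_left[OF word_carrier[OF w(2)] _ Brac.IH(2)[OF uv(2)]])
  show "free_brac (wd u) (wd w) \<in> T (height u + height v)" if "w \<in> pure (height v)" for w
   using pure_Ewords[OF that Ewords_height[OF uv(2)]] uv that
   unfolding free_brac_wd by (intro T_EE) (auto simp: pure_def)
 qed
 ultimately show ?case
  using T_jacobi_outer[OF w(1,2) word_carrier[OF w(3)]] by (simp add: free_brac_wd)
qed

lemma T_HF:
 assumes "x \<in> carrier V"
 shows "v \<in> Fwords \<Longrightarrow> wd (Brac (h x) v) \<in> T (height v)"
proof (induction v)
 case (Gen g)
 then obtain j where g: "g = FGen j" "j < n"
  by auto
 have "pm_smult (- root D j x) (wd (Gen (FGen j))) \<in> T (- 1)"
  using g Gen by (intro T_smult T_pure) (simp add: keys_single pure_def)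
 moreover have "wd (Brac (h x) (Gen (FGen j))) - pm_smult (- root D j x) (wd (Gen (FGen j))) \<in> I"
  using I_relators(5)[OF assms g(2)] by (simp only: pm_smult_minus diff_minus_eq_add)
 ultimately have "wd (Brac (h x) (Gen (FGen j))) \<in> T (- 1)"
  by (rule T_cong[rotated])
 then show ?case
  using g by simp
next
 case (Brac u v)
 then have uv: "u \<in> Fwords" "v \<in> Fwords"
  by auto
 have w: "h x \<in> words" "u \<in> words" "v \<in> words"
  using uv Fwords_words gen_words assms by blast+
 have "free_brac (wd (Brac (h x) u)) (wd v) \<in> T (height u + height v)"
 proof (rule T_bracket_right[OF word_carrier[OF w(3)] _ Brac.IH(1)[OF uv(1)]])
  show "free_brac (wd w) (wd v) \<in> T (height u + height v)" if "w \<in> pure (height u)" for w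
   using pure_Fwords[OF that Fwords_height[OF uv(1)]] uv that
   unfolding free_brac_wd by (intro T_FF) (auto simp: pure_def)
 qed
 moreover have "free_brac (wd u) (wd (Brac (h x) v)) \<in> T (height u + height v)"
 proof (rule T_bracket_left[OF word_carrier[OF w(2)] _ Brac.IH(2)[OF uv(2)]])
  show "free_brac (wd u) (wd w) \<in> T (height u + height v)" if "w \<in> pure (height v)" for w
   using pure_Fwords[OF that Fwords_height[OF uv(2)]] uv that
   unfolding free_brac_wd by (intro T_FF) (auto simp: pure_def)
 qed
 ultimately show ?case
  using T_jacobi_outer[OF w(1,2) word_carrier[OF w(3)]] by (simp add: free_brac_wd)
qed

lemma T_pure_F:
 assumes "w \<in> pure k" "k \<le> 0" "v \<in> Fwords"
 shows "wd (Brac w v) \<in> T (k + height v)" "wd (Brac v w) \<in> T (k + height v)"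
proof -
 have v: "v \<in> words"
  using assms(3) Fwords_words by blast
 have w: "w \<in> words"
  using assms(1) pure_words by blast
 have "wd (Brac w v) \<in> T (k + height v)"
  using assms(1)
 proof (cases rule: pureE)
  case 2
  then show ?thesis
   using assms by (intro T_FF) (auto simp: pure_def)
 next
  case (3 x)
  then show ?thesis
   using T_HF[OF _ assms(3)] by simp
 qed (use assms(2) in simp)
 then show "wd (Brac w v) \<in> T (k + height v)" "wd (Brac v w) \<in> T (k + height v)"
  using T_swap[OF v w] by blast+
qed

text \<open>For an F word u the element [e_i, u] has height at most 0, so modulo the ideal it is a
  combination of F words or of Cartan generators; its bracket with the remaining F word is then
  covered by \<open>T_pure_F\<close>.\<close>

lemma T_E_F:
 assumes "i < n"
 shows "v \<in> Fwords \<Longrightarrow> wd (Brac (Gen (EGen i)) v) \<in> T (1 + height v)"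
proof (induction v)
 case (Gen g)
 then obtain j where g: "g = FGen j" "j < n"
  by auto
 have "(if i = j then wd (h (coroot D i)) else 0) \<in> T 0"
  using coroot_carrier[OF assms] by (intro T_pure) (auto simp: keys_single pure_def)
 then show ?case
  using T_cong[OF I_relators(3)[OF assms g(2)]] g by simp
next
 case (Brac u v)
 then have uv: "u \<in> Fwords" "v \<in> Fwords"
  by auto
 have w: "Gen (EGen i) \<in> words" "u \<in> words" "v \<in> words"
  using uv Fwords_words gen_words assms by blast+
 let ?k = "1 + (height u + height v)"
 have "free_brac (wd (Brac (Gen (EGen i)) u)) (wd v) \<in> T ?k"
 proof (rule T_bracket_right[OF word_carrier[OF w(3)] _ Brac.IH(1)[OF uv(1)]])
  show "free_brac (wd w) (wd v) \<in> T ?k" if "w \<in> pure (1 + height u)" for w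
   using T_pure_F(1)[OF that _ uv(2)] Fwords_height[OF uv(1)]
   by (simp add: free_brac_wd add.assoc)
 qed
 moreover have "free_brac (wd u) (wd (Brac (Gen (EGen i)) v)) \<in> T ?k"
 proof (rule T_bracket_left[OF word_carrier[OF w(2)] _ Brac.IH(2)[OF uv(2)]])
  show "free_brac (wd u) (wd w) \<in> T ?k" if "w \<in> pure (1 + height v)" for w
   using T_pure_F(2)[OF that _ uv(1)] Fwords_height[OF uv(2)]
   by (simp add: free_brac_wd ac_simps)
 qed
 ultimately show ?case
  using T_jacobi_outer[OF w(1,2) word_carrier[OF w(3)]] by (simp add: free_brac_wd)
qed

text \<open>Induction on the E word, with the pure word arbitrary: [u,v] acts through u and v one
  after the other, and after the first action the result is again a combination of pure
  words.\<close>

lemma T_E_pure: "\<lbrakk>u \<in> Ewords; w \<in> pure k\<rbrakk> \<Longrightarrow> wd (Brac u w) \<in> T (height u + k)"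
proof (induction u arbitrary: w k)
 case (Gen g)
 then obtain i where g: "g = EGen i" "i < n"
  by auto
 from Gen.prems(2) show ?case
 proof (cases rule: pureE)
  case 1
  then show ?thesis
   using Gen.prems by (intro T_EE) (auto simp: pure_def)
 next
  case 2
  then show ?thesis
   using T_E_F[OF g(2), of w] g Gen.prems by (simp add: pure_def)
 next
  case (3 x)
  then have "wd (Brac w (Gen g)) \<in> T (height (Gen g))"
   using T_HE[OF 3(1), of "Gen g"] g by simp
  then show ?thesis
   using T_swap[of "Gen g" w] g gen_words 3 by simp
 qed
next
 case (Brac u v)
 then have uv: "u \<in> Ewords" "v \<in> Ewords"
  by auto
 have w: "u \<in> words" "v \<in> words" "w \<in> words"
  using uv Ewords_words Brac.prems pure_words by blast+
 have "free_brac (wd u) (wd (Brac v w)) \<in> T (height u + (height v + k))"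
  using T_bracket_left[OF word_carrier[OF w(1)] _ Brac.IH(2)[OF uv(2) Brac.prems(2)]]
   Brac.IH(1)[OF uv(1)] by (simp only: free_brac_wd)
 moreover have "free_brac (wd v) (wd (Brac u w)) \<in> T (height v + (height u + k))"
  using T_bracket_left[OF word_carrier[OF w(2)] _ Brac.IH(1)[OF uv(1) Brac.prems(2)]]
   Brac.IH(2)[OF uv(2)] by (simp only: free_brac_wd)
 ultimately show ?case
  using T_jacobi_inner[OF w(1,2) word_carrier[OF w(3)], of "height u + height v + k"]
  by (simp add: free_brac_wd ac_simps)
qed

lemma T_pure_pure:
 assumes "u \<in> pure j" "w \<in> pure k"
 shows "wd (Brac u w) \<in> T (j + k)"
proof -
 have words: "u \<in> words" "w \<in> words"
  using assms pure_words by blast+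
 have height_w: "height w = k"
  using assms(2) by (simp add: pure_def)
 from assms(1) show ?thesis
 proof (cases rule: pureE)
  case 1
  then show ?thesis
   using T_E_pure[OF _ assms(2), of u] assms(1) by (simp add: pure_def)
 next
  case 2
  from assms(2) show ?thesis
  proof (cases rule: pureE)
   case 1
   then show ?thesis
    using T_swap[OF words] T_E_pure[OF _ assms(1), of w] assms(2) by (simp add: pure_def ac_simps)
  next
   case 2
   then show ?thesis
    using \<open>u \<in> Fwords\<close> assms by (intro T_FF) (auto simp: pure_def)
  next
   case (3 x)
   then show ?thesis
    using T_swap[OF words] T_HF[OF 3(1) \<open>u \<in> Fwords\<close>] assms(1) by (simp add: pure_def)
  qed
 next
  case (3 x)
  from assms(2) show ?thesis
  proof (cases rule: pureE)
   case 1
   then show ?thesis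
    using T_HE[OF 3(1) 1(1)] 3(2,3) height_w by simp
  next
   case 2
   then show ?thesis
    using T_HF[OF 3(1) 2(1)] 3(2,3) height_w by simp
  next
   case (3 y)
   then show ?thesis
    using I_relators(6)[OF \<open>x \<in> carrier V\<close> 3(1)] \<open>u = h x\<close> by (simp add: T_I)
  qed
 qed
qed

lemma T_word: "w \<in> words \<Longrightarrow> wd w \<in> T (height w)"
proof (induction w)
 case (Gen g)
 then show ?case
  by (intro T_pure) (auto simp: keys_single pure_def chev_gens_def)
next
 case (Brac u v)
 then have uv: "u \<in> words" "v \<in> words"
  by auto
 have "free_brac (wd u) (wd v) \<in> T (height u + height v)"
 proof (rule T_bracket_left[OF word_carrier[OF uv(1)] _ Brac.IH(2)[OF uv(2)]])
  fix w assume w: "w \<in> pure (height v)"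
  then have "w \<in> words"
   using pure_words by blast
  then show "free_brac (wd u) (wd w) \<in> T (height u + height v)"
   by (rule T_bracket_right[OF word_carrier _ Brac.IH(1)[OF uv(1)]])
     (simp add: free_brac_wd T_pure_pure w)
 qed
 then show ?case
  by (simp add: free_brac_wd)
qed

lemma height_chev_degree: "w \<in> words \<Longrightarrow> height w = (\<Sum>i<n. lookup (word_degree chev_degree w) i)"
proof (induction w)
 case (Gen g)
 then consider x where "g = CartanGen x" | i where "g = EGen i" "i < n" | i where "g = FGen i" "i < n"
  by (auto simp: chev_gens_def)
 then show ?case
  by cases (simp_all add: lookup_single when_def sum_negf)
next
 case (Brac u v)
 then show ?case
  by (simp add: lookup_add sum.distrib)
qed

text \<open>Only Cartan generators are pure of height 0, and the linearity relators contract a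
  combination of them into a single one. Hence the degree 0 component of the presented algebra is no
  larger than the image of the Cartan space, which gives control over ideals that meet this image
  trivially.\<close>

lemma degree_zero_cartan:
 assumes "x \<in> free_homogeneous (chev_gens D) chev_degree 0"
 shows "\<exists>v\<in>carrier V. x - wd (h v) \<in> I"
proof -
 have x: "keys x \<subseteq> {w \<in> words. word_degree chev_degree w = 0}"
  using assms by (simp add: free_homogeneous_eq)
 have "pm_smult (lookup x w) (wd w) \<in> T 0" if "w \<in> keys x" for w
  using that x T_word[of w] height_chev_degree[of w] by (intro T_smult) auto
 then have "x \<in> T 0"
  by (subst pm_linear_expand[OF pm_linear_id]) (rule T_sum)
 then obtain y where y: "keys y \<subseteq> pure 0" "x - y \<in> I"
  by (auto simp: T_def)
 let ?C = "{z. \<exists>v\<in>carrier V. z - wd (h v) \<in> I}"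
 have C_add: "a + c \<in> ?C" if ac: "a \<in> ?C" "c \<in> ?C" for a c
 proof -
  obtain v w where vw: "v \<in> carrier V" "w \<in> carrier V" "a - wd (h v) \<in> I" "c - wd (h w) \<in> I"
   using ac by auto
  have "(a + c) - wd (h (v \<oplus>\<^bsub>V\<^esub> w)) =
    ((a - wd (h v)) + (c - wd (h w))) - (wd (h (v \<oplus>\<^bsub>V\<^esub> w)) - (wd (h v) + wd (h w)))"
   by simp
  also have "\<dots> \<in> I"
   by (rule I_closed(2)[OF I_closed(1)[OF vw(3,4)] I_relators(1)[OF vw(1,2)]])
  finally show ?thesis
   using vw by auto
 qed
 have C_smult: "pm_smult c a \<in> ?C" if a: "a \<in> ?C" for a c
 proof -
  obtain v where v: "v \<in> carrier V" "a - wd (h v) \<in> I"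
   using a by auto
  have "pm_smult c a - wd (h (c \<odot>\<^bsub>V\<^esub> v)) =
    pm_smult c (a - wd (h v)) - (wd (h (c \<odot>\<^bsub>V\<^esub> v)) - pm_smult c (wd (h v)))"
   by (simp add: pm_smult_diff)
  also have "\<dots> \<in> I"
   by (rule I_closed(2)[OF I_closed(3)[OF v(2)] I_relators(2)[OF v(1)]])
  finally show ?thesis
   using v by (auto intro!: bexI[of _ "c \<odot>\<^bsub>V\<^esub> v"])
 qed
 have C_word: "wd w \<in> ?C" if "w \<in> pure 0" for w
  using that
 proof (cases rule: pureE)
  case (3 x)
  then show ?thesis
   by (auto simp: I_closed intro!: bexI[of _ x])
 qed simp_all
 have "0 \<in> ?C"
  using C_smult[OF C_word[of "h \<zero>\<^bsub>V\<^esub>"], of 0] by (simp add: pure_def)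
 then have C_sum: "sum g A \<in> ?C" if "\<And>a. a \<in> A \<Longrightarrow> g a \<in> ?C"
  for g :: "'h chev_gen lie_word \<Rightarrow> _" and A
  using that
 proof (induction A rule: infinite_finite_induct)
  case (insert a A)
  then have "g a + sum g A \<in> ?C"
   by (intro C_add) blast+
  with insert show ?case
   by simp
 qed simp_all
 have "(\<Sum>w\<in>keys y. pm_smult (lookup y w) (wd w)) \<in> ?C"
  by (rule C_sum, rule C_smult, rule C_word) (use y(1) in blast)
 then have "y \<in> ?C"
  by (subst pm_linear_expand[OF pm_linear_id])
 then obtain v where v: "v \<in> carrier V" "y - wd (h v) \<in> I"
  by auto
 have "x - wd (h v) = (x - y) + (y - wd (h v))"
  by simp
 also have "\<dots> \<in> I"
  by (rule I_closed(1)[OF y(2) v(2)])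
 finally show ?thesis
  using v(1) by blast
qed

end

text \<open>Besides the Chevalley relations, two assumptions carry the comparison.
  \<open>generated\<close> makes the map from the presented algebra surjective.
  \<open>nondegenerate\<close> lets every nonzero vector of nonzero degree be bracketed to a nonzero
  vector of degree 0, so that a graded ideal meeting the Cartan part trivially must be killed by the
  map.\<close>

locale contragredient_model = lie_basis B par b + chev_presentation D
 for B :: "'a set" and par and b :: "'a \<Rightarrow> 'a \<Rightarrow> ('a \<Rightarrow>\<^sub>0 'k :: field)"
  and D :: "('k, 'h) cartan_datum" +
 fixes \<kappa> :: "'h \<Rightarrow> ('a \<Rightarrow>\<^sub>0 'k)" and e f :: "nat \<Rightarrow> ('a \<Rightarrow>\<^sub>0 'k)" and deg :: "'a \<Rightarrow> nat \<Rightarrow>\<^sub>0 int"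
 assumes \<kappa>_add: "\<lbrakk>x \<in> carrier (cartan_space D); y \<in> carrier (cartan_space D)\<rbrakk> \<Longrightarrow>
   \<kappa> (x \<oplus>\<^bsub>cartan_space D\<^esub> y) = \<kappa> x + \<kappa> y"
  and \<kappa>_smult: "x \<in> carrier (cartan_space D) \<Longrightarrow> \<kappa> (r \<odot>\<^bsub>cartan_space D\<^esub> x) = pm_smult r (\<kappa> x)"
  and \<kappa>_inj: "\<lbrakk>x \<in> carrier (cartan_space D); \<kappa> x = 0\<rbrakk> \<Longrightarrow> x = \<zero>\<^bsub>cartan_space D\<^esub>"
  and \<kappa>_image: "\<kappa> ` carrier (cartan_space D) = {x. keys x \<subseteq> {u \<in> B. deg u = 0}}"
  and parity_zero: "\<lbrakk>u \<in> B; deg u = 0\<rbrakk> \<Longrightarrow> par u = 0"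
  and e_keys: "i < dim_row (cartan_matrix D) \<Longrightarrow>
   keys (e i) \<subseteq> {u \<in> B. deg u = single i 1 \<and> par u = parity D i}"
  and f_keys: "i < dim_row (cartan_matrix D) \<Longrightarrow>
   keys (f i) \<subseteq> {u \<in> B. deg u = - single i 1 \<and> par u = parity D i}"
  and e_f: "\<lbrakk>i < dim_row (cartan_matrix D); j < dim_row (cartan_matrix D)\<rbrakk> \<Longrightarrow>
   bi_ext b (e i) (f j) = (if i = j then \<kappa> (coroot D i) else 0)"
  and \<kappa>_e: "\<lbrakk>x \<in> carrier (cartan_space D); j < dim_row (cartan_matrix D)\<rbrakk> \<Longrightarrow>
   bi_ext b (\<kappa> x) (e j) = pm_smult (root D j x) (e j)"
  and \<kappa>_f: "\<lbrakk>x \<in> carrier (cartan_space D); j < dim_row (cartan_matrix D)\<rbrakk> \<Longrightarrow>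
   bi_ext b (\<kappa> x) (f j) = - pm_smult (root D j x) (f j)"
  and zero_abelian: "\<lbrakk>u \<in> B; v \<in> B; deg u = 0; deg v = 0\<rbrakk> \<Longrightarrow> b u v = 0"
  and degree_add: "\<lbrakk>u \<in> B; v \<in> B\<rbrakk> \<Longrightarrow> keys (b u v) \<subseteq> {w. deg w = deg u + deg v}"
  and nondegenerate: "\<lbrakk>\<beta> \<noteq> 0; a \<noteq> 0; keys a \<subseteq> {u \<in> B. deg u = \<beta>}\<rbrakk> \<Longrightarrow>
   \<exists>c. keys c \<subseteq> {u \<in> B. deg u = - \<beta>} \<and> bi_ext b a c \<noteq> 0"
  and generated: "\<lbrakk>u \<in> B; deg u \<noteq> 0; \<And>i. i < dim_row (cartan_matrix D) \<Longrightarrow> e i \<in> S \<and> f i \<in> S;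
    \<And>a t. a \<in> S \<Longrightarrow> pm_smult t a \<in> S; \<And>a c. \<lbrakk>a \<in> S; c \<in> S\<rbrakk> \<Longrightarrow> bi_ext b a c \<in> S\<rbrakk> \<Longrightarrow>
   single u 1 \<in> S"
begin

primrec gen_map :: "'h chev_gen \<Rightarrow> ('a \<Rightarrow>\<^sub>0 'k)" where
 "gen_map (CartanGen x) = \<kappa> x"
| "gen_map (EGen i) = e i"
| "gen_map (FGen i) = f i"

definition \<Phi> :: "('h chev_gen lie_word \<Rightarrow>\<^sub>0 'k) \<Rightarrow> ('a \<Rightarrow>\<^sub>0 'k)" where
 "\<Phi> = pm_ext (word_eval (bi_ext b) gen_map)"

lemma \<Phi>_linear: "pm_linear \<Phi>"
 unfolding \<Phi>_def by (rule pm_ext_linear)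

lemma \<Phi>_gen [simp]: "\<Phi> (wd (h x)) = \<kappa> x" "\<Phi> (wd (Gen (EGen i))) = e i" "\<Phi> (wd (Gen (FGen i))) = f i"
 by (simp_all add: \<Phi>_def)

lemma \<Phi>_brac: "\<Phi> (free_brac x y) = bi_ext b (\<Phi> x) (\<Phi> y)"
 unfolding \<Phi>_def by (rule pm_ext_word_eval_free_brac)

lemma \<Phi>_wd_brac: "\<Phi> (wd (Brac u v)) = bi_ext b (\<Phi> (wd u)) (\<Phi> (wd v))"
 using \<Phi>_brac[of "wd u" "wd v"] by (simp add: free_brac_wd)

lemma \<kappa>_keys: "x \<in> carrier V \<Longrightarrow> keys (\<kappa> x) \<subseteq> {u \<in> B. deg u = 0}"
 using \<kappa>_image by blast

lemma \<Phi>_word_keys: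
 "w \<in> words \<Longrightarrow> keys (\<Phi> (wd w)) \<subseteq>
   {u \<in> B. deg u = word_degree chev_degree w \<and> par u = word_degree (chev_parity D) w}"
proof (induction w)
 case (Gen g)
 then consider x where "g = CartanGen x" "x \<in> carrier V" | i where "g = EGen i" "i < n" | i where "g = FGen i" "i < n"
  by (auto simp: chev_gens_def)
 then show ?case
 proof cases
  case 1
  then show ?thesis
   using \<kappa>_keys[of x] parity_zero by auto
 next
  case 2
  then show ?thesis
   using e_keys[of i] by simp
 next
  case 3
  then show ?thesis
   using f_keys[of i] by simp
 qed
next
 case (Brac u v)
 then have IH: "keys (\<Phi> (wd u)) \<subseteq>
    {x \<in> B. deg x = word_degree chev_degree u \<and> par x = word_degree (chev_parity D) u}"
   "keys (\<Phi> (wd v)) \<subseteq>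
    {x \<in> B. deg x = word_degree chev_degree v \<and> par x = word_degree (chev_parity D) v}"
  by simp_all
 have *: "keys (b x y) \<subseteq> {w \<in> B. deg w = word_degree chev_degree (Brac u v) \<and>
   par w = word_degree (chev_parity D) (Brac u v)}"
  if "x \<in> keys (\<Phi> (wd u))" "y \<in> keys (\<Phi> (wd v))" for x y
 proof -
  have xy: "x \<in> B" "y \<in> B" "deg x = word_degree chev_degree u" "deg y = word_degree chev_degree v"
   "par x = word_degree (chev_parity D) u" "par y = word_degree (chev_parity D) v"
   using that IH by auto
  have "w \<in> B \<and> deg w = deg x + deg y \<and> par w = par x + par y" if "w \<in> keys (b x y)" for w
   using that degree_add[OF xy(1,2)] keys_b[OF xy(1,2)] by blast
  then show ?thesis
   using xy by (simp add: subset_iff)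
 qed
 show ?case
  unfolding \<Phi>_wd_brac by (rule order_trans[OF keys_bi_ext]) (intro UN_least *)
qed

lemma \<Phi>_keys: "keys x \<subseteq> words \<Longrightarrow> keys (\<Phi> x) \<subseteq> B"
 by (rule keys_pm_linear[OF \<Phi>_linear]) (use \<Phi>_word_keys in blast)

lemma \<Phi>_restrict:
 assumes "keys x \<subseteq> words"
 shows "\<Phi> (pm_restrict {w. word_degree chev_degree w = \<beta>} x) = pm_restrict {u. deg u = \<beta>} (\<Phi> x)"
  "\<Phi> (pm_restrict {w. word_degree (chev_parity D) w = p} x) = pm_restrict {u. par u = p} (\<Phi> x)"
proof -
 have r: "pm_restrict S y = 0" if "keys y \<inter> S = {}" for S and y :: "'a \<Rightarrow>\<^sub>0 'k"
 proof (rule poly_mapping_eqI)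
  fix k show "lookup (pm_restrict S y) k = lookup 0 k"
   using that by (cases "k \<in> S") (auto simp flip: not_in_keys_iff_lookup_eq_zero)
 qed
 have r': "pm_restrict S (wd w) = (if w \<in> S then wd w else 0)" for S w
  by (simp add: pm_restrict_def)
 show "\<Phi> (pm_restrict {w. word_degree chev_degree w = \<beta>} x) = pm_restrict {u. deg u = \<beta>} (\<Phi> x)"
 proof (rule pm_linear_eqI[where x = x])
  fix w assume "w \<in> keys x"
  then have "keys (\<Phi> (wd w)) \<subseteq> {u. deg u = word_degree chev_degree w}"
   using assms \<Phi>_word_keys[of w] by blast
  then have keys: "keys (\<Phi> (wd w)) \<subseteq> {u. deg u = word_degree chev_degree w}" by blast
  show "\<Phi> (pm_restrict {w. word_degree chev_degree w = \<beta>} (wd w)) = pm_restrict {u. deg u = \<beta>} (\<Phi> (wd w))"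
  proof (cases "word_degree chev_degree w = \<beta>")
   case True
   then have "pm_restrict {u. deg u = \<beta>} (\<Phi> (wd w)) = \<Phi> (wd w)"
    using keys by (intro pm_restrict_id) simp
   with True show ?thesis
    by (simp add: r')
  next
   case False
   then have "pm_restrict {u. deg u = \<beta>} (\<Phi> (wd w)) = 0"
    using keys by (intro r) auto
   with False show ?thesis
    by (simp add: r' pm_linear_zero[OF \<Phi>_linear])
  qed
 qed (intro pm_linear_comp[OF \<Phi>_linear] pm_linear_comp[OF pm_restrict_linear] \<Phi>_linear pm_restrict_linear)+
 show "\<Phi> (pm_restrict {w. word_degree (chev_parity D) w = p} x) = pm_restrict {u. par u = p} (\<Phi> x)"
 proof (rule pm_linear_eqI[where x = x])
  fix w assume "w \<in> keys x"
  then have "keys (\<Phi> (wd w)) \<subseteq> {u. par u = word_degree (chev_parity D) w}"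
   using assms \<Phi>_word_keys[of w] by blast
  then have keys: "keys (\<Phi> (wd w)) \<subseteq> {u. par u = word_degree (chev_parity D) w}" by blast
  show "\<Phi> (pm_restrict {w. word_degree (chev_parity D) w = p} (wd w)) = pm_restrict {u. par u = p} (\<Phi> (wd w))"
  proof (cases "word_degree (chev_parity D) w = p")
   case True
   then have "pm_restrict {u. par u = p} (\<Phi> (wd w)) = \<Phi> (wd w)"
    using keys by (intro pm_restrict_id) simp
   with True show ?thesis
    by (simp add: r')
  next
   case False
   then have "pm_restrict {u. par u = p} (\<Phi> (wd w)) = 0"
    using keys by (intro r) auto
   with False show ?thesis
    by (simp add: r' pm_linear_zero[OF \<Phi>_linear])
  qed
 qed (intro pm_linear_comp[OF \<Phi>_linear] pm_linear_comp[OF pm_restrict_linear] \<Phi>_linear pm_restrict_linear)+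
qed

lemma \<Phi>_image: "\<Phi> ` carrier F = {x. keys x \<subseteq> B}"
proof
 show "\<Phi> ` carrier F \<subseteq> {x. keys x \<subseteq> B}"
  using \<Phi>_keys by auto
 let ?S = "\<Phi> ` carrier F"
 have S_smult: "pm_smult c x \<in> ?S" if "x \<in> ?S" for x c
 proof -
  obtain y where "y \<in> carrier F" "x = \<Phi> y"
   using \<open>x \<in> ?S\<close> by blast
  then show ?thesis
   using F_closed(3)[of y c] by (auto simp flip: pm_linear_smult[OF \<Phi>_linear])
 qed
 have S_add: "x + y \<in> ?S" if "x \<in> ?S" "y \<in> ?S" for x y
 proof -
  obtain x' y' where "x' \<in> carrier F" "x = \<Phi> x'" "y' \<in> carrier F" "y = \<Phi> y'"
   using \<open>x \<in> ?S\<close> \<open>y \<in> ?S\<close> by blast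
  then show ?thesis
   using F_closed(1)[of x' y'] by (simp del: F_simps flip: pm_linear_add[OF \<Phi>_linear])
 qed
 have S_brac: "bi_ext b x y \<in> ?S" if "x \<in> ?S" "y \<in> ?S" for x y
 proof -
  obtain x' y' where "x' \<in> carrier F" "x = \<Phi> x'" "y' \<in> carrier F" "y = \<Phi> y'"
   using \<open>x \<in> ?S\<close> \<open>y \<in> ?S\<close> by blast
  then show ?thesis
   using free_brac_closed[of x' y'] by (simp del: F_simps flip: \<Phi>_brac)
 qed
 have S_gen: "e i \<in> ?S \<and> f i \<in> ?S" if "i < n" for i
  using gen_words(2,3)[OF that] word_carrier
  by (metis \<Phi>_gen(2,3) imageI)
 \<comment> \<open>Basis vectors of degree 0 come from the Cartan space, all others from
   \<open>generated\<close>.\<close>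
 have basis: "single u 1 \<in> ?S" if "u \<in> B" for u
 proof (cases "deg u = 0")
  case True
  then have "single u 1 \<in> \<kappa> ` carrier V"
   using \<open>u \<in> B\<close> by (simp add: \<kappa>_image keys_single)
  then obtain x where "x \<in> carrier V" "single u 1 = \<kappa> x"
   by blast
  then show ?thesis
   using word_carrier[OF gen_words(1)] by (metis \<Phi>_gen(1) imageI)
 next
  case False
  show ?thesis
   by (rule generated[OF \<open>u \<in> B\<close> False]) (use S_gen S_smult S_brac in blast)+
 qed
 have zero: "0 \<in> ?S"
  using F_closed(4) pm_linear_zero[OF \<Phi>_linear] by force
 show "{x. keys x \<subseteq> B} \<subseteq> ?S"
 proof
  fix x :: "'a \<Rightarrow>\<^sub>0 'k" assume "x \<in> {x. keys x \<subseteq> B}"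
  then have x: "\<And>u. u \<in> keys x \<Longrightarrow> pm_smult (lookup x u) (single u 1) \<in> ?S"
   using basis S_smult by blast
  have S_sum: "sum g A \<in> ?S" if "\<And>a. a \<in> A \<Longrightarrow> g a \<in> ?S" for g and A :: "'a set"
   using that
  proof (induction A rule: infinite_finite_induct)
   case (insert a A)
   then have "g a + sum g A \<in> ?S"
    by (intro S_add) blast+
   with insert show ?case
    by simp
  qed (use zero in simp_all)
  show "x \<in> ?S"
   by (subst pm_linear_expand[OF pm_linear_id]) (rule S_sum, rule x)
 qed
qed

lemma \<Phi>_epi: "algebra_epi F L \<Phi>"
 unfolding algebra_epi_def
 by (auto simp: \<Phi>_image pm_linear_add[OF \<Phi>_linear] pm_linear_smult[OF \<Phi>_linear] \<Phi>_brac
   pm_linear_zero[OF \<Phi>_linear] simp del: F_simps(1) simp flip: F_simps(1))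

lemma \<Phi>_part: "\<Phi> ` part F p = part L p"
proof
 have "keys (\<Phi> x) \<subseteq> {u \<in> B. par u = p}"
  if "keys x \<subseteq> {w \<in> words. word_degree (chev_parity D) w = p}" for x
  by (rule keys_pm_linear[OF \<Phi>_linear]) (use that \<Phi>_word_keys in blast)
 then show "\<Phi> ` part F p \<subseteq> part L p"
  by auto
 show "part L p \<subseteq> \<Phi> ` part F p"
 proof
  fix x assume "x \<in> part L p"
  then have x: "keys x \<subseteq> {u \<in> B. par u = p}"
   by simp
  then have "x \<in> \<Phi> ` carrier F"
   unfolding \<Phi>_image by blast
  then obtain y where y: "y \<in> carrier F" "x = \<Phi> y"
   by blast
  have "x = \<Phi> (pm_restrict {w. word_degree (chev_parity D) w = p} y)"
  proof -
   have "keys y \<subseteq> words"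
    using y(1) by simp
   moreover have "pm_restrict {u. par u = p} x = x"
    using x by (intro pm_restrict_id) blast
   ultimately show ?thesis
    using y(2) \<Phi>_restrict(2)[of y p] by simp
  qed
  moreover have "pm_restrict {w. word_degree (chev_parity D) w = p} y \<in> part F p"
   using y by (auto simp: keys_pm_restrict)
  ultimately show "x \<in> \<Phi> ` part F p"
   by blast
 qed
qed

text \<open>The kernel of \<open>\<Phi>\<close> is an ideal containing both families of generators,
  hence the ideal that they generate.\<close>

lemma \<Phi>_ideal: "x \<in> I \<Longrightarrow> \<Phi> x = 0"
proof -
 let ?J = "{x \<in> carrier F. \<Phi> x = \<zero>\<^bsub>L\<^esub>}"
 have "\<Phi> ` lie_identities F \<subseteq> lie_identities L"
  using \<Phi>_part by (intro lie_identities_image F.superalgebra_axioms \<Phi>_epi) simp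
 also have "\<dots> \<subseteq> {0}"
  using lie_superalgebra_basis_superalg by (simp add: lie_superalgebra_def lie_superalgebra_axioms_def)
 finally have "lie_identities F \<subseteq> ?J"
  using lie_identities_carrier[OF F.superalgebra_axioms] by auto
 moreover have "\<Phi> x = \<zero>\<^bsub>L\<^esub>" if "x \<in> chev_relators D" for x
 proof -
  have hh: "bi_ext b (\<kappa> x) (\<kappa> y) = 0" if "x \<in> carrier V" "y \<in> carrier V" for x y
  proof -
   have "keys (b u v) = {}" if "u \<in> keys (\<kappa> x)" "v \<in> keys (\<kappa> y)" for u v
    using that \<kappa>_keys[OF \<open>x \<in> carrier V\<close>] \<kappa>_keys[OF \<open>y \<in> carrier V\<close>] zero_abelian[of u v] by auto
   then have "keys (bi_ext b (\<kappa> x) (\<kappa> y)) \<subseteq> {}"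
    using keys_bi_ext[of b "\<kappa> x" "\<kappa> y"] by simp
   then show ?thesis
    by simp
  qed
  note \<Phi>_simps = pm_linear_diff[OF \<Phi>_linear] pm_linear_add[OF \<Phi>_linear] pm_linear_smult[OF \<Phi>_linear]
   pm_linear_zero[OF \<Phi>_linear] \<Phi>_wd_brac
  have single: "single u c = pm_smult c (wd u)" for u c
   by simp
  show ?thesis
   using that unfolding chev_relators_def Let_def free_smult_eq_pm_smult free_gen_def free_brac_wd
   by (elim UnE CollectE exE conjE)
     (simp_all add: \<Phi>_simps \<kappa>_add \<kappa>_smult e_f \<kappa>_e \<kappa>_f hh del: pm_smult_single)
 qed
 ultimately have "lie_identities F \<union> chev_relators D \<subseteq> ?J"
  using relators_carrier by blast
 then have "I \<subseteq> ?J"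
  by (rule chev_ideal_least[OF kernel_ideal[OF F.bracket_algebra_axioms \<Phi>_epi]])
 then show "x \<in> I \<Longrightarrow> \<Phi> x = 0"
  by auto
qed


section \<open>The radical as a kernel\<close>

abbreviation "Q \<equiv> big_contragredient D"

lemma Q_eq: "Q = quot_superalg F I"
 by (simp add: big_contragredient_def)

abbreviation \<pi> :: "('h chev_gen lie_word \<Rightarrow>\<^sub>0 'k) \<Rightarrow> ('h chev_gen lie_word \<Rightarrow>\<^sub>0 'k) set" where
 "\<pi> x \<equiv> I +>\<^bsub>F\<^esub> x"

lemma \<pi>_epi: "algebra_epi F Q \<pi>"
 unfolding Q_eq by (rule I.quot_epi)

sublocale Q: bracket_algebra Q
 unfolding Q_eq by (rule I.quot_bracket_algebra)

lemma \<pi>_simps: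
 "\<lbrakk>x \<in> carrier F; y \<in> carrier F\<rbrakk> \<Longrightarrow> \<pi> (x + y) = \<pi> x \<oplus>\<^bsub>Q\<^esub> \<pi> y"
 "\<lbrakk>x \<in> carrier F; y \<in> carrier F\<rbrakk> \<Longrightarrow> \<pi> (free_brac x y) = \<pi> x \<otimes>\<^bsub>Q\<^esub> \<pi> y"
 "x \<in> carrier F \<Longrightarrow> \<pi> x \<in> carrier Q" "\<pi> 0 = \<zero>\<^bsub>Q\<^esub>"
 using algebra_epiD[OF \<pi>_epi] by simp_all

lemma \<pi>_eq_iff: "\<lbrakk>x \<in> carrier F; y \<in> carrier F\<rbrakk> \<Longrightarrow> \<pi> x = \<pi> y \<longleftrightarrow> x - y \<in> I"
 using I.coset_eq_iff[of x y] F_minus[of x y] by simp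

lemma \<pi>_sum: "(\<And>a. a \<in> A \<Longrightarrow> g a \<in> carrier F) \<Longrightarrow> finite A \<Longrightarrow>
 \<pi> (sum g A) = (\<Oplus>\<^bsub>Q\<^esub>a\<in>A. \<pi> (g a)) \<and> sum g A \<in> carrier F"
 by (induction A rule: infinite_finite_induct)
   (simp_all add: \<pi>_simps F_closed Q.finsum_insert Pi_def del: F_simps)

lemma big_component_eq: "big_component D \<beta> = \<pi> ` free_homogeneous (chev_gens D) chev_degree \<beta>"
 by (simp add: big_component_def)

lemma big_cartan_eq: "big_cartan D = (\<lambda>x. \<pi> (wd (h x))) ` carrier V"
 by (simp add: big_cartan_def free_gen_def)

lemma homogeneous_carrier: "free_homogeneous (chev_gens D) chev_degree \<beta> \<subseteq> carrier F"
 by (auto simp: free_homogeneous_eq)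

lemma big_component_zero: "big_component D 0 \<subseteq> big_cartan D"
proof
 fix X assume "X \<in> big_component D 0"
 then obtain x where x: "x \<in> free_homogeneous (chev_gens D) chev_degree 0" "X = \<pi> x"
  by (auto simp: big_component_eq)
 then obtain v where v: "v \<in> carrier V" "x - wd (h v) \<in> I"
  using degree_zero_cartan by blast
 have "X = \<pi> (wd (h v))"
  unfolding x(2) using v x(1) homogeneous_carrier word_carrier[OF gen_words(1)]
  by (subst \<pi>_eq_iff) blast+
 then show "X \<in> big_cartan D"
  using v(1) by (auto simp: big_cartan_eq)
qed

text \<open>The radical is the kernel K of the map induced on the presented algebra. K is graded
  because the map respects degrees, it meets the Cartan part trivially because
  \<open>\<kappa>\<close> is injective, and it contains every competitor J. In particular a greatest
  ideal exists, as the definition by \<open>GREATEST\<close> requires.\<close>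

lemma contragredient_copy:
 obtains \<theta> where "lie_copy (contragredient D) L \<theta>" "\<And>i. i < n \<Longrightarrow> \<theta> (chev_e D i) = e i"
  "\<And>i. i < n \<Longrightarrow> chev_e D i \<in> carrier (contragredient D)"
proof -
 obtain \<psi> where \<psi>: "algebra_epi Q L \<psi>" "\<And>x. x \<in> carrier F \<Longrightarrow> \<psi> (\<pi> x) = \<Phi> x"
  using I.quot_factor[OF \<Phi>_epi] \<Phi>_ideal unfolding Q_eq by (metis basis_superalg_simps(3))
 note \<pi> = algebra_epiD[OF \<pi>_epi] and \<psi>' = algebra_epiD[OF \<psi>(1)]
 define K where "K = {X \<in> carrier Q. \<psi> X = \<zero>\<^bsub>L\<^esub>}"
 have K_ideal: "superalg_ideal Q K"
  unfolding K_def by (rule kernel_ideal[OF Q.bracket_algebra_axioms \<psi>(1)])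
 have hw: "wd (h v) \<in> carrier F" if "v \<in> carrier V" for v
  using word_carrier[OF gen_words(1)[OF that]] .
 have cartan_zero: "X = \<zero>\<^bsub>Q\<^esub>" if "X \<in> big_cartan D" "\<psi> X = 0" for X
 proof -
  obtain v where v: "v \<in> carrier V" "X = \<pi> (wd (h v))"
   using \<open>X \<in> big_cartan D\<close> by (auto simp: big_cartan_eq)
  then have "\<kappa> v = 0"
   using that(2) \<psi>(2)[OF hw] by simp
  then have "v = \<zero>\<^bsub>V\<^esub>"
   using \<kappa>_inj v(1) by blast
  \<comment> \<open>The additivity relator for 0 + 0 says that the generator labelled by the zero
    vector vanishes.\<close>
  have "wd (h \<zero>\<^bsub>V\<^esub>) \<in> I"
  proof -
   interpret V: vectorspace class_ring V
    by (rule cartan_space)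
   show ?thesis
    using I_relators(1)[of "\<zero>\<^bsub>V\<^esub>" "\<zero>\<^bsub>V\<^esub>"] I_closed(5) by force
  qed
  then show ?thesis
   using v \<open>v = \<zero>\<^bsub>V\<^esub>\<close> hw[OF v(1)] \<pi>_eq_iff[of "wd (h v)" 0] \<pi>_simps(4) F_closed(4) by simp
 qed
 have K_cartan: "K \<inter> big_cartan D = {\<zero>\<^bsub>Q\<^esub>}"
 proof -
  have "\<zero>\<^bsub>Q\<^esub> \<in> K"
   using \<psi>'(2) by (simp add: K_def)
  moreover have "\<zero>\<^bsub>Q\<^esub> \<in> big_cartan D"
  proof -
   have "0 \<in> free_homogeneous (chev_gens D) chev_degree 0"
    by (simp add: free_homogeneous_eq)
   then show ?thesis
    using big_component_zero \<pi>_simps(4) unfolding big_component_eq by blast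
  qed
  moreover have "X = \<zero>\<^bsub>Q\<^esub>" if "X \<in> K \<inter> big_cartan D" for X
   using that by (intro cartan_zero) (auto simp: K_def)
  ultimately show ?thesis
   by blast
 qed
 have K_graded: "root_graded D K"
  unfolding root_graded_def
 proof
  fix X assume X: "X \<in> K"
  then have "X \<in> \<pi> ` carrier F"
   unfolding \<pi>(1) by (simp add: K_def)
  then obtain y where y: "y \<in> carrier F" "X = \<pi> y"
   by blast
  have "\<Phi> y = 0"
   using X \<psi>(2)[OF y(1)] y(2) by (simp add: K_def)
  \<comment> \<open>Only finitely many degrees occur in y. Its homogeneous components lie in the
    kernel one by one because \<open>\<Phi>\<close> commutes with restriction to a degree.\<close>
  let ?B = "word_degree chev_degree ` keys y"
  let ?y = "\<lambda>\<beta>. pm_restrict {w. word_degree chev_degree w = \<beta>} y"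
  have hom: "?y \<beta> \<in> free_homogeneous (chev_gens D) chev_degree \<beta>" for \<beta>
   using y(1) by (auto simp: free_homogeneous_eq keys_pm_restrict)
  have carrier: "?y \<beta> \<in> carrier F" for \<beta>
   using hom homogeneous_carrier by blast
  have "(\<Sum>\<beta>\<in>?B. ?y \<beta>) = y"
  proof (rule poly_mapping_eqI)
   fix w
   have "(\<Sum>\<beta>\<in>?B. if word_degree chev_degree w = \<beta> then lookup y w else 0) = lookup y w"
    by (simp add: in_keys_iff image_iff) (metis in_keys_iff)
   then show "lookup (\<Sum>\<beta>\<in>?B. ?y \<beta>) w = lookup y w"
    by (simp add: lookup_sum)
  qed
  then have "X = (\<Oplus>\<^bsub>Q\<^esub>\<beta>\<in>?B. \<pi> (?y \<beta>))"
   using \<pi>_sum[of ?B ?y] carrier y(2) by simp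
  moreover have "\<pi> (?y \<beta>) \<in> K \<inter> big_component D \<beta>" for \<beta>
  proof -
   have "\<Phi> (?y \<beta>) = 0"
    using \<Phi>_restrict(1)[of y \<beta>] y(1) \<open>\<Phi> y = 0\<close> by (simp add: pm_linear_zero[OF pm_restrict_linear])
   then show ?thesis
    using hom carrier \<psi>(2)[OF carrier] \<pi>_simps(3)[OF carrier] by (auto simp: K_def big_component_eq)
  qed
  ultimately show "\<exists>B y. finite B \<and> (\<forall>\<beta>\<in>B. y \<beta> \<in> K \<inter> big_component D \<beta>) \<and> X = (\<Oplus>\<^bsub>Q\<^esub>\<beta>\<in>B. y \<beta>)"
   by (intro exI[of _ ?B] exI[of _ "\<lambda>\<beta>. \<pi> (?y \<beta>)"]) simp
 qed
 have K_greatest: "J \<subseteq> K"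
  if J: "superalg_ideal Q J" "root_graded D J" "J \<inter> big_cartan D = {\<zero>\<^bsub>Q\<^esub>}" for J
 proof
  interpret J: algebra_with_ideal Q J
   by unfold_locales (rule J(1))
  have J_cartan: "\<psi> X = 0" if "X \<in> J" "X \<in> big_cartan D" for X
   using that J(3) \<psi>'(2) by (metis IntI basis_superalg_simps(3) singletonD)
  \<comment> \<open>If a homogeneous element of J of nonzero degree had a nonzero image,
    \<open>nondegenerate\<close> would give a bracket with nonzero image in degree 0. This bracket
    lies in J and in the Cartan part, so it is zero: a contradiction.\<close>
  have hom: "\<psi> Y = 0" if "Y \<in> J" "Y \<in> big_component D \<beta>" for Y \<beta>
  proof (cases "\<beta> = 0")
   case True
   then show ?thesis
    using J_cartan that big_component_zero by blast
  next
   case False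
   obtain y where y: "y \<in> free_homogeneous (chev_gens D) chev_degree \<beta>" "Y = \<pi> y"
    using \<open>Y \<in> big_component D \<beta>\<close> by (auto simp: big_component_eq)
   have yF: "y \<in> carrier F"
    using y(1) homogeneous_carrier by blast
   have keys_y: "keys (\<Phi> y) \<subseteq> {u \<in> B. deg u = \<beta>}"
   proof (rule keys_pm_linear[OF \<Phi>_linear])
    fix w assume "w \<in> keys y"
    then have "w \<in> words" "word_degree chev_degree w = \<beta>"
     using y(1) by (auto simp: free_homogeneous_eq)
    then show "keys (\<Phi> (wd w)) \<subseteq> {u \<in> B. deg u = \<beta>}"
     using \<Phi>_word_keys[of w] by blast
   qed
   show ?thesis
   proof (rule ccontr)
    assume "\<psi> Y \<noteq> 0"
    then have "\<Phi> y \<noteq> 0"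
     using \<psi>(2)[OF yF] y(2) by simp
    then obtain c where c: "keys c \<subseteq> {u \<in> B. deg u = - \<beta>}" "bi_ext b (\<Phi> y) c \<noteq> 0"
     using nondegenerate[OF False _ keys_y] by blast
    then have "c \<in> \<Phi> ` carrier F"
     unfolding \<Phi>_image by blast
    then obtain z where z: "z \<in> carrier F" "c = \<Phi> z"
     by blast
    \<comment> \<open>The preimage z of c may be inhomogeneous; its component of degree
      \<open>- \<beta>\<close> has the same image.\<close>
    define z' where "z' = pm_restrict {w. word_degree chev_degree w = - \<beta>} z"
    have "\<Phi> z' = pm_restrict {u. deg u = - \<beta>} c"
     using \<Phi>_restrict(1)[of z "- \<beta>"] z by (simp add: z'_def)
    also have "\<dots> = c"
     using c(1) by (intro pm_restrict_id) blast
    finally have z': "\<Phi> z' = c" .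
    have z'_keys: "keys z' \<subseteq> {w \<in> words. word_degree chev_degree w = - \<beta>}"
     using z(1) by (auto simp: z'_def keys_pm_restrict)
    then have z'F: "z' \<in> carrier F"
     by auto
    have "free_brac y z' \<in> free_homogeneous (chev_gens D) chev_degree 0"
    proof -
     have *: "keys (wd (Brac u v)) \<subseteq> {w \<in> words. word_degree chev_degree w = 0}"
      if "u \<in> keys y" "v \<in> keys z'" for u v
     proof -
      have "u \<in> words" "word_degree chev_degree u = \<beta>"
       using that(1) y(1) by (auto simp: free_homogeneous_eq)
      moreover have "v \<in> words" "word_degree chev_degree v = - \<beta>"
       using that(2) z'_keys by auto
      ultimately show ?thesis
       by (simp add: keys_single)
     qed
     have "keys (free_brac y z') \<subseteq> {w \<in> words. word_degree chev_degree w = 0}"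
      unfolding free_brac_bi_ext by (rule order_trans[OF keys_bi_ext]) (intro UN_least *)
     then show ?thesis
      unfolding free_homogeneous_eq by (rule CollectI)
    qed
    then have "\<pi> (free_brac y z') \<in> big_cartan D"
     using big_component_zero by (auto simp: big_component_eq)
    moreover have "\<pi> (free_brac y z') \<in> J"
     using J.ideal_bracket(2)[OF \<pi>_simps(3)[OF z'F] \<open>Y \<in> J\<close>] \<pi>_simps(2)[OF yF z'F] y(2) by simp
    ultimately have "\<psi> (\<pi> (free_brac y z')) = 0"
     using J_cartan by blast
    then show False
     using \<psi>(2)[OF free_brac_closed[OF yF z'F]] z' c(2) by (simp add: \<Phi>_brac)
   qed
  qed
  fix X assume "X \<in> J"
  then obtain A Y where AY: "finite A" "\<And>\<beta>. \<beta> \<in> A \<Longrightarrow> Y \<beta> \<in> J \<inter> big_component D \<beta>" "X = (\<Oplus>\<^bsub>Q\<^esub>\<beta>\<in>A. Y \<beta>)"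
   using J(2) unfolding root_graded_def by metis
  interpret K: algebra_with_ideal Q K
   by unfold_locales (rule K_ideal)
  have "Y \<beta> \<in> K" if "\<beta> \<in> A" for \<beta>
  proof -
   have "Y \<beta> \<in> J" "Y \<beta> \<in> big_component D \<beta>"
    using AY(2)[OF that] by simp_all
   then show ?thesis
    using hom subsetD[OF J.idealD(1)] unfolding K_def by simp
  qed
  with AY(1) have "(\<Oplus>\<^bsub>Q\<^esub>\<beta>\<in>A. Y \<beta>) \<in> K"
  proof (induction A rule: finite_induct)
   case (insert a A)
   then have "Y a \<oplus>\<^bsub>Q\<^esub> (\<Oplus>\<^bsub>Q\<^esub>\<beta>\<in>A. Y \<beta>) \<in> K"
    by (intro K.idealD(3)) auto
   moreover have "(\<Oplus>\<^bsub>Q\<^esub>\<beta>\<in>insert a A. Y \<beta>) = Y a \<oplus>\<^bsub>Q\<^esub> (\<Oplus>\<^bsub>Q\<^esub>\<beta>\<in>A. Y \<beta>)"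
    using insert K.idealD(1) by (intro Q.finsum_insert) auto
   ultimately show ?case
    by simp
  qed (simp add: K.idealD(2))
  then show "X \<in> K"
   using AY(3) by simp
 qed
 have radical: "contragredient_radical D = K"
  unfolding contragredient_radical_def
  by (rule Greatest_equality) (use K_ideal K_graded K_cartan K_greatest in auto)
 interpret K: algebra_with_ideal Q K
  by unfold_locales (rule K_ideal)
 have G: "contragredient D = quot_superalg Q K"
  by (simp add: contragredient_def radical)
 obtain \<theta> where \<theta>: "algebra_epi (contragredient D) L \<theta>" "\<And>X. X \<in> carrier Q \<Longrightarrow> \<theta> (K +>\<^bsub>Q\<^esub> X) = \<psi> X"
  using K.quot_factor[OF \<psi>(1)] unfolding G K_def by blast
 have inj: "inj_on \<theta> (carrier (contragredient D))"
  unfolding G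
 proof (rule K.quot_factor_inj[where \<phi> = \<psi>])
  show "algebra_epi (quot_superalg Q K) L \<theta>"
   using \<theta>(1) by (simp only: G)
  show "\<theta> (K +>\<^bsub>Q\<^esub> X) = \<psi> X" if "X \<in> carrier Q" for X
   by (rule \<theta>(2)[OF that])
  show "X \<in> K" if "X \<in> carrier Q" "\<psi> X = \<zero>\<^bsub>L\<^esub>" for X
   unfolding K_def using that by (intro CollectI conjI)
 qed
 have Q_part: "part Q p = \<pi> ` part F p" for p
  unfolding Q_eq by (simp add: quot_superalg_def)
 have G_part: "part (contragredient D) p = (\<lambda>X. K +>\<^bsub>Q\<^esub> X) ` part Q p" for p
  unfolding G by (simp add: quot_superalg_def)
 have F_part: "part F p \<subseteq> carrier F" for p
  by (rule F.subspaceD(1)[OF F.part_subspace])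
 have Q_part_carrier: "part Q p \<subseteq> carrier Q" for p
  unfolding Q_part \<pi>(1)[symmetric] by (rule image_mono[OF F_part])
 have G_carrier: "carrier (contragredient D) = (\<lambda>X. K +>\<^bsub>Q\<^esub> X) ` carrier Q"
  using algebra_epiD(1)[OF K.quot_epi] by (simp only: G)
 have "part (contragredient D) p \<subseteq> carrier (contragredient D)" for p
  unfolding G_part G_carrier by (rule image_mono[OF Q_part_carrier])
 moreover have "\<theta> ` part (contragredient D) p = part L p" for p
 proof -
  have "\<theta> ` part (contragredient D) p = \<psi> ` part Q p"
   unfolding G_part image_image using \<theta>(2) Q_part_carrier by (intro image_cong) auto
  also have "\<dots> = \<Phi> ` part F p"
   unfolding Q_part image_image using \<psi>(2) F_part by (intro image_cong) blast+
  finally show ?thesis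
   using \<Phi>_part by simp
 qed
 ultimately have copy: "lie_copy (contragredient D) L \<theta>"
  using K.quot_bracket_algebra lie_superalgebra_basis_superalg \<theta>(1) inj
  by (intro lie_copyI) (simp_all add: G)
 have "\<theta> (chev_e D i) = e i" "chev_e D i \<in> carrier (contragredient D)" if "i < n" for i
 proof -
  have w: "wd (Gen (EGen i)) \<in> carrier F"
   by (rule word_carrier[OF gen_words(2)[OF that]])
  have eq: "chev_e D i = K +>\<^bsub>Q\<^esub> \<pi> (wd (Gen (EGen i)))"
   by (simp add: chev_e_def radical free_gen_def)
  show "\<theta> (chev_e D i) = e i"
   unfolding eq using \<theta>(2)[OF \<pi>_simps(3)[OF w]] \<psi>(2)[OF w] by simp
  show "chev_e D i \<in> carrier (contragredient D)"
   unfolding eq G using algebra_epiD(3)[OF K.quot_epi \<pi>_simps(3)[OF w]] .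
 qed
 then show ?thesis
  using that copy by blast
qed

end

section \<open>Semisimplification\<close>

text \<open>
 A splitting of a Lie algebra with a derivation \<open>d\<close>, \<open>d\<^sup>3 = 0\<close>, into Jordan blocks: \<open>s\<close> picks out the blocks
 of size 1 and \<open>t\<close> the generators of the blocks of size 2; \<open>r\<close> and \<open>q\<close> read off the coefficients
 of the images of \<open>s\<close> and \<open>d \<circ> t\<close>, and \<open>k\<close> maps the end of a block of size 3 to its generator.
\<close>

locale jordan_splitting =
 L: lie_basis BL "\<lambda>_. 0" bL + N: lie_basis BN parN bN
 for BL :: "'a set" and bL :: "'a \<Rightarrow> 'a \<Rightarrow> ('a \<Rightarrow>\<^sub>0 'k :: field)"
  and BN :: "'b set" and parN :: "'b \<Rightarrow> bit" and bN :: "'b \<Rightarrow> 'b \<Rightarrow> ('b \<Rightarrow>\<^sub>0 'k)" +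
 fixes d k :: "('a \<Rightarrow>\<^sub>0 'k) \<Rightarrow> ('a \<Rightarrow>\<^sub>0 'k)" and s t :: "('b \<Rightarrow>\<^sub>0 'k) \<Rightarrow> ('a \<Rightarrow>\<^sub>0 'k)"
  and r q :: "('a \<Rightarrow>\<^sub>0 'k) \<Rightarrow> ('b \<Rightarrow>\<^sub>0 'k)"
 assumes finite_BL: "finite BL"
  and two_neq_zero: "(2 :: 'k) \<noteq> 0"
  and linear: "pm_linear d" "pm_linear k" "pm_linear s" "pm_linear t" "pm_linear r" "pm_linear q"
  and closed: "x \<in> carrier L.L \<Longrightarrow> d x \<in> carrier L.L" "x \<in> carrier L.L \<Longrightarrow> k x \<in> carrier L.L"
   "a \<in> part N.L 0 \<Longrightarrow> s a \<in> carrier L.L" "a \<in> part N.L 1 \<Longrightarrow> t a \<in> carrier L.L"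
   "x \<in> carrier L.L \<Longrightarrow> r x \<in> part N.L 0" "x \<in> carrier L.L \<Longrightarrow> q x \<in> part N.L 1"
  and d_cube: "x \<in> carrier L.L \<Longrightarrow> d (d (d x)) = 0"
  and derivation: "\<lbrakk>x \<in> carrier L.L; y \<in> carrier L.L\<rbrakk> \<Longrightarrow>
   d (bi_ext bL x y) = bi_ext bL (d x) y + bi_ext bL x (d y)"
  and decomposition: "x \<in> carrier L.L \<Longrightarrow>
   x = s (r x) + t (q (d x)) + d (t (q x)) + k (d (d x)) + d (k (d x)) + d (d (k x))"
  and r_d: "x \<in> carrier L.L \<Longrightarrow> r (d x) = 0" and q_d_d: "x \<in> carrier L.L \<Longrightarrow> q (d (d x)) = 0"
  and r_s: "a \<in> part N.L 0 \<Longrightarrow> r (s a) = a" and q_d_t: "a \<in> part N.L 1 \<Longrightarrow> q (d (t a)) = a"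
  and d_s: "a \<in> part N.L 0 \<Longrightarrow> d (s a) = 0" and d_d_t: "a \<in> part N.L 1 \<Longrightarrow> d (d (t a)) = 0"
  and bracket_s_s: "\<lbrakk>a \<in> part N.L 0; c \<in> part N.L 0\<rbrakk> \<Longrightarrow> r (bi_ext bL (s a) (s c)) = bi_ext bN a c"
  and bracket_s_t: "\<lbrakk>a \<in> part N.L 0; c \<in> part N.L 1\<rbrakk> \<Longrightarrow> q (d (bi_ext bL (s a) (t c))) = bi_ext bN a c"
  and bracket_t_t: "\<lbrakk>a \<in> part N.L 1; c \<in> part N.L 1\<rbrakk> \<Longrightarrow>
   r (bi_ext bL (d (t a)) (t c) - bi_ext bL (t a) (d (t c))) = bi_ext bN a c"
begin

abbreviation br (infixl "\<bullet>" 70) where "x \<bullet> y \<equiv> bi_ext bL x y"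

lemmas br_simps = bi_ext_linear_simps
lemmas lin_simps =
 linear[THEN pm_linear_add] linear[THEN pm_linear_diff] linear[THEN pm_linear_zero]
 linear[THEN pm_linear_uminus] linear[THEN pm_linear_smult]

lemma L_closed:
 "\<lbrakk>x \<in> carrier L.L; y \<in> carrier L.L\<rbrakk> \<Longrightarrow> x + y \<in> carrier L.L"
 "\<lbrakk>x \<in> carrier L.L; y \<in> carrier L.L\<rbrakk> \<Longrightarrow> x - y \<in> carrier L.L"
 "\<lbrakk>x \<in> carrier L.L; y \<in> carrier L.L\<rbrakk> \<Longrightarrow> x \<bullet> y \<in> carrier L.L"
 using L.a_closed[of x y] L.minus_closed[of x y] L.a_minus_eq[of x y] L.bracket_closed[of x y] by simp_all

lemma br_anticommutative: "\<lbrakk>x \<in> carrier L.L; y \<in> carrier L.L\<rbrakk> \<Longrightarrow> x \<bullet> y = - (y \<bullet> x)"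
 using L.anticommutative_part[of x 0 y 0] by (simp add: koszul_sign_def)

lemma double_zero: "x + x = 0 \<Longrightarrow> x = (0 :: 'c \<Rightarrow>\<^sub>0 'k)"
proof -
 assume "x + x = 0"
 then have "2 * lookup x u = 0" for u
  by (metis lookup_add lookup_zero mult_2)
 then show ?thesis
  using two_neq_zero by (intro poly_mapping_eqI) simp
qed

text \<open>The six summands of \<open>decomposition\<close> are the components along blocks of size
  1, generators and ends of size 2, and generators, ends and middles of size 3, in the order s r, t
  q d, d t q, k d d, d d k, d k d of the maps involved. If d x = 0, only s r, d t q and d d k
  remain, and the last two have a common primitive w.\<close>

lemma ker_d:
 assumes "x \<in> carrier L.L" "d x = 0"
 obtains w where "w \<in> carrier L.L" "x = s (r x) + d w" "d (d w) = 0"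
proof
 let ?w = "t (q x) + d (k x)"
 show w: "?w \<in> carrier L.L"
  by (intro L_closed closed assms(1))
 show eq: "x = s (r x) + d ?w"
  using decomposition[OF assms(1), symmetric] assms(2) by (simp add: lin_simps add.assoc)
 have "d x = d (d ?w)"
  by (subst eq) (simp only: lin_simps d_s closed assms add_0)
 then show "d (d ?w) = 0"
  using assms(2) by simp
qed

lemma ker_d_d:
 assumes "x \<in> carrier L.L" "d (d x) = 0"
 obtains w where "w \<in> carrier L.L" "x = s (r x) + t (q (d x)) + d w"
proof
 let ?w = "t (q x) + k (d x) + d (k x)"
 show w: "?w \<in> carrier L.L"
  by (intro L_closed closed assms(1))
 show eq: "x = s (r x) + t (q (d x)) + d ?w"
  using decomposition[OF assms(1), symmetric] assms(2) by (simp add: lin_simps add.assoc)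
qed

lemma exact_iff:
 assumes "x \<in> carrier L.L" "d x = 0"
 shows "r x = 0 \<Longrightarrow> \<exists>w\<in>carrier L.L. x = d w"
 using ker_d[OF assms] by (metis add_0 linear(3) pm_linear_zero)

lemma exact_iff':
 assumes "x \<in> carrier L.L" "d (d x) = 0" "q (d x) = 0"
 shows "\<exists>w\<in>carrier L.L. d x = d (d w)"
proof -
 obtain w where w: "w \<in> carrier L.L" "x = s (r x) + t (q (d x)) + d w"
  using ker_d_d[OF assms(1,2)] by blast
 have "d x = d (s (r x) + t (q (d x)) + d w)"
  using w(2) by simp
 also have "\<dots> = d (d w)"
  using assms closed(5)[OF assms(1)] by (simp add: lin_simps d_s del: basis_superalg_simps)
 finally show ?thesis
  using w(1) by blast
qed

text \<open>The bracket of a cocycle with a coboundary is a coboundary, and r vanishes on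
  coboundaries; so only the components in the blocks of size 1 contribute.\<close>

lemma r_bracket:
 assumes "x \<in> carrier L.L" "d x = 0" "y \<in> carrier L.L" "d y = 0"
 shows "r (x \<bullet> y) = bi_ext bN (r x) (r y)"
proof -
 obtain w where w: "w \<in> carrier L.L" "x = s (r x) + d w"
  using ker_d[OF assms(1,2)] by blast
 obtain v where v: "v \<in> carrier L.L" "y = s (r y) + d v"
  using ker_d[OF assms(3,4)] by blast
 note c = closed(3)[OF closed(5)[OF assms(1)]] closed(3)[OF closed(5)[OF assms(3)]]
 have 1: "r (s (r x) \<bullet> d v) = 0"
 proof -
  have "s (r x) \<bullet> d v = d (s (r x) \<bullet> v)"
   using derivation[OF c(1) v(1)] d_s[OF closed(5)[OF assms(1)]] by (simp add: br_simps)
  then show ?thesis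
   using r_d L_closed(3)[OF c(1) v(1)] by simp
 qed
 have 2: "r (d w \<bullet> y) = 0"
 proof -
  have "d w \<bullet> y = d (w \<bullet> y)"
   using derivation[OF w(1) assms(3)] assms(4) by (simp add: br_simps)
  then show ?thesis
   using r_d L_closed(3)[OF w(1) assms(3)] by simp
 qed
 have "x \<bullet> y = s (r x) \<bullet> y + d w \<bullet> y"
  by (subst w(2)) (simp only: br_simps)
 also have "s (r x) \<bullet> y = s (r x) \<bullet> s (r y) + s (r x) \<bullet> d v"
  by (subst v(2)) (simp only: br_simps)
 finally show ?thesis
  using 1 2 bracket_s_s[OF closed(5)[OF assms(1)] closed(5)[OF assms(3)]] by (simp add: lin_simps)
qed

text \<open>Applying d turns the claim into one about [x, d y]. After splitting off the block
  components, two error terms remain; each is a multiple of an element of the image of d^2, where q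
  vanishes.\<close>

lemma q_bracket:
 assumes "x \<in> carrier L.L" "d x = 0" "y \<in> carrier L.L" "d (d y) = 0"
 shows "q (d (x \<bullet> y)) = bi_ext bN (r x) (q (d y))"
proof -
 obtain w where w: "w \<in> carrier L.L" "x = s (r x) + d w" "d (d w) = 0"
  using ker_d[OF assms(1,2)] by blast
 obtain v where v: "v \<in> carrier L.L" "y = s (r y) + t (q (d y)) + d v"
  using ker_d_d[OF assms(3,4)] by blast
 let ?a = "s (r x)" and ?c = "t (q (d y))"
 have qy: "q (d y) \<in> part N.L 1" and rx: "r x \<in> part N.L 0" and ry: "r y \<in> part N.L 0"
  using closed assms by simp_all
 note c = closed(3)[OF rx] closed(4)[OF qy]
 have dy: "d y = d ?c + d (d v)"
  by (subst v(2)) (simp only: lin_simps d_s[OF ry] add_0)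
 have "d (x \<bullet> y) = x \<bullet> d y"
  using derivation[OF assms(1,3)] assms(2) by (simp add: br_simps)
 also have "\<dots> = x \<bullet> d ?c + x \<bullet> d (d v)"
  by (subst dy) (simp only: br_simps)
 also have "x \<bullet> d ?c = ?a \<bullet> d ?c + d w \<bullet> d ?c"
  by (subst w(2)) (simp only: br_simps)
 finally have eq: "q (d (x \<bullet> y)) = q (?a \<bullet> d ?c) + q (d w \<bullet> d ?c) + q (x \<bullet> d (d v))"
  by (simp only: lin_simps)
 have "d (?a \<bullet> ?c) = ?a \<bullet> d ?c"
  using derivation[OF c] d_s[OF rx] by (simp add: br_simps)
 then have 1: "q (?a \<bullet> d ?c) = bi_ext bN (r x) (q (d y))"
  using bracket_s_t[OF rx qy] by simp
 have dc: "d ?c \<in> carrier L.L" "d w \<in> carrier L.L" "d v \<in> carrier L.L"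
  using closed(1) c w(1) v(1) by blast+
 \<comment> \<open>Both second derivatives vanish, so the Leibniz rule leaves twice the mixed term;
   dividing by 2 uses \<open>two_neq_zero\<close>.\<close>
 have "d (d (w \<bullet> ?c)) = d w \<bullet> d ?c + d w \<bullet> d ?c"
  using derivation[OF w(1) c(2)] derivation[OF dc(2) c(2)] derivation[OF w(1) dc(1)] w(3) d_d_t[OF qy]
  by (simp add: lin_simps br_simps)
 then have "q (d w \<bullet> d ?c) + q (d w \<bullet> d ?c) = 0"
  using q_d_d[OF L_closed(3)[OF w(1) c(2)]] by (simp add: lin_simps)
 then have 2: "q (d w \<bullet> d ?c) = 0"
  by (rule double_zero)
 have "d (d (x \<bullet> v)) = x \<bullet> d (d v)"
  using derivation[OF assms(1) v(1)] derivation[OF assms(1) dc(3)] assms(2) by (simp add: br_simps)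
 then have 3: "q (x \<bullet> d (d v)) = 0"
  using q_d_d[OF L_closed(3)[OF assms(1) v(1)]] by simp
 show ?thesis
  unfolding eq 1 2 3 by simp
qed

lemma q_bracket':
 assumes "x \<in> carrier L.L" "d (d x) = 0" "y \<in> carrier L.L" "d y = 0"
 shows "q (d (x \<bullet> y)) = bi_ext bN (q (d x)) (r y)"
proof -
 have parts: "q (d x) \<in> part N.L 1" "r y \<in> part N.L 0"
  using closed assms by simp_all
 have "q (d (x \<bullet> y)) = - q (d (y \<bullet> x))"
  using br_anticommutative[OF assms(1,3)] by (simp only: lin_simps)
 also have "\<dots> = - bi_ext bN (r y) (q (d x))"
  using q_bracket[OF assms(3,4,1,2)] by simp
 also have "\<dots> = bi_ext bN (q (d x)) (r y)"
  using N.anticommutative_part[OF parts] by (simp add: koszul_sign_def)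
 finally show ?thesis .
qed

text \<open>Since r vanishes on coboundaries, d moves from one factor to the other at the cost of a
  sign. So the left-hand side is twice r of [d x, y], and the same manipulation removes every
  component of x and y except the generators of blocks of size 2.\<close>

lemma r_bracket_odd:
 assumes "x \<in> carrier L.L" "d (d x) = 0" "y \<in> carrier L.L" "d (d y) = 0"
 shows "r (d x \<bullet> y - x \<bullet> d y) = bi_ext bN (q (d x)) (q (d y))"
proof -
 have exact: "r (u \<bullet> d v) = - r (d u \<bullet> v)" if "u \<in> carrier L.L" "v \<in> carrier L.L" for u v
 proof -
  have "r (d u \<bullet> v) + r (u \<bullet> d v) = 0"
   using r_d[OF L_closed(3)[OF that]] derivation[OF that] by (simp add: lin_simps)
  then show ?thesis
   by (simp add: eq_neg_iff_add_eq_0 add.commute)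
 qed
 obtain w where w: "w \<in> carrier L.L" "x = s (r x) + t (q (d x)) + d w"
  using ker_d_d[OF assms(1,2)] by blast
 obtain v where v: "v \<in> carrier L.L" "y = s (r y) + t (q (d y)) + d v"
  using ker_d_d[OF assms(3,4)] by blast
 let ?a = "t (q (d x))" and ?c = "t (q (d y))"
 have qx: "q (d x) \<in> part N.L 1" and qy: "q (d y) \<in> part N.L 1" and rx: "r x \<in> part N.L 0" and ry: "r y \<in> part N.L 0"
  using closed assms by simp_all
 note c = closed(4)[OF qx] closed(4)[OF qy] closed(3)[OF ry]
 have cl: "d w \<in> carrier L.L" "d v \<in> carrier L.L" "d y \<in> carrier L.L" "d ?a \<in> carrier L.L"
  using closed(1) w(1) v(1) assms c by blast+
 have dx: "d x = d ?a + d (d w)"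
  by (subst w(2)) (simp only: lin_simps d_s[OF rx] add_0)
 have 1: "r (d (d w) \<bullet> y) = 0"
 proof -
  have "r (d (d w) \<bullet> y) = - r (d w \<bullet> d y)"
   using exact[OF cl(1) assms(3)] by simp
  also have "r (d w \<bullet> d y) = - r (w \<bullet> d (d y))"
   using exact[OF w(1) cl(3)] by simp
  finally show ?thesis
   using assms(4) by (simp add: br_simps lin_simps)
 qed
 have 2: "r (d ?a \<bullet> s (r y)) = 0"
  using exact[OF c(1,3)] d_s[OF ry] by (simp add: br_simps lin_simps)
 have 3: "r (d ?a \<bullet> d v) = 0"
  using exact[OF cl(4) v(1)] d_d_t[OF qx] by (simp add: br_simps lin_simps)
 have "r (d x \<bullet> y) = r (d ?a \<bullet> y) + r (d (d w) \<bullet> y)"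
  by (subst dx) (simp only: br_simps lin_simps)
 then have "r (d x \<bullet> y) = r (d ?a \<bullet> y)"
  using 1 by simp
 also have "d ?a \<bullet> y = d ?a \<bullet> s (r y) + d ?a \<bullet> ?c + d ?a \<bullet> d v"
  by (subst v(2)) (simp only: br_simps)
 finally have "r (d x \<bullet> y) = r (d ?a \<bullet> ?c)"
  using 2 3 by (simp add: lin_simps)
 moreover have "r (d x \<bullet> y - x \<bullet> d y) = r (d x \<bullet> y) + r (d x \<bullet> y)"
  using exact[OF assms(1,3)] by (simp add: lin_simps)
 moreover have "r (d ?a \<bullet> ?c - ?a \<bullet> d ?c) = r (d ?a \<bullet> ?c) + r (d ?a \<bullet> ?c)"
  using exact[OF c(1,2)] by (simp add: lin_simps)
 ultimately show ?thesis
  using bracket_t_t[OF qx qy] by simp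
qed

end

section \<open>Traces of endomorphisms of rank at most two\<close>

lemma functional_finsum:
 fixes V :: "('k :: field, 'v, 'm) module_scheme" and \<phi> :: "'v \<Rightarrow> 'k"
 assumes V: "vectorspace class_ring V" and B: "finite B" "B \<subseteq> carrier V"
  and add: "\<And>x y. \<lbrakk>x \<in> carrier V; y \<in> carrier V\<rbrakk> \<Longrightarrow> \<phi> (x \<oplus>\<^bsub>V\<^esub> y) = \<phi> x + \<phi> y"
  and smult: "\<And>c x. x \<in> carrier V \<Longrightarrow> \<phi> (c \<odot>\<^bsub>V\<^esub> x) = c * \<phi> x"
 shows "\<phi> (\<Oplus>\<^bsub>V\<^esub>c\<in>B. a c \<odot>\<^bsub>V\<^esub> c) = (\<Sum>c\<in>B. a c * \<phi> c)"
proof -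
 interpret vectorspace class_ring V by fact
 have closed: "a \<odot>\<^bsub>V\<^esub> x \<in> carrier V" if "x \<in> carrier V" for a x
  using smult_closed[of a x] that by simp
 have "\<phi> \<zero>\<^bsub>V\<^esub> = \<phi> \<zero>\<^bsub>V\<^esub> + \<phi> \<zero>\<^bsub>V\<^esub>"
  using add[of "\<zero>\<^bsub>V\<^esub>" "\<zero>\<^bsub>V\<^esub>"] by simp
 then have zero: "\<phi> \<zero>\<^bsub>V\<^esub> = 0"
  by (metis add_cancel_right_right)
 show ?thesis
  using B
 proof (induction B rule: finite_induct)
  case (insert c B)
  then have "(\<Oplus>\<^bsub>V\<^esub>c\<in>insert c B. a c \<odot>\<^bsub>V\<^esub> c) = a c \<odot>\<^bsub>V\<^esub> c \<oplus>\<^bsub>V\<^esub> (\<Oplus>\<^bsub>V\<^esub>c\<in>B. a c \<odot>\<^bsub>V\<^esub> c)"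
   by (intro finsum_insert) (auto intro!: closed)
  moreover have "(\<Oplus>\<^bsub>V\<^esub>c\<in>B. a c \<odot>\<^bsub>V\<^esub> c) \<in> carrier V"
   using insert by (intro finsum_closed) (auto intro!: closed)
  ultimately show ?case
   using insert closed by (simp add: add smult)
 qed (simp add: zero)
qed

text \<open>
 For an endomorphism of finite rank, given as a sum of products of functionals and vectors, the
 trace can be read off in any basis, so its independence of the basis needs no separate proof.
\<close>

lemma lin_trace_rank_two:
 fixes V :: "('k :: field, 'v, 'm) module_scheme" and \<phi> \<psi> :: "'v \<Rightarrow> 'k"
 assumes V: "vectorspace class_ring V" and fin_dim_V: "vectorspace.fin_dim class_ring V"
  and x: "x \<in> carrier V" and y: "y \<in> carrier V"
  and \<phi>: "\<And>u v. \<lbrakk>u \<in> carrier V; v \<in> carrier V\<rbrakk> \<Longrightarrow> \<phi> (u \<oplus>\<^bsub>V\<^esub> v) = \<phi> u + \<phi> v"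
   "\<And>c u. u \<in> carrier V \<Longrightarrow> \<phi> (c \<odot>\<^bsub>V\<^esub> u) = c * \<phi> u"
  and \<psi>: "\<And>u v. \<lbrakk>u \<in> carrier V; v \<in> carrier V\<rbrakk> \<Longrightarrow> \<psi> (u \<oplus>\<^bsub>V\<^esub> v) = \<psi> u + \<psi> v"
   "\<And>c u. u \<in> carrier V \<Longrightarrow> \<psi> (c \<odot>\<^bsub>V\<^esub> u) = c * \<psi> u"
  and F: "\<And>z. z \<in> carrier V \<Longrightarrow> F z = \<phi> z \<odot>\<^bsub>V\<^esub> x \<oplus>\<^bsub>V\<^esub> \<psi> z \<odot>\<^bsub>V\<^esub> y"
 shows "lin_trace V F = \<phi> x + \<psi> y"
proof -
 interpret vectorspace class_ring V by fact
 let ?P = "\<lambda>B M. finite B \<and> basis B \<and> (\<forall>b\<in>B. F b = (\<Oplus>\<^bsub>V\<^esub>c\<in>B. M c b \<odot>\<^bsub>V\<^esub> c))"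
 have coords: "\<exists>a. w = (\<Oplus>\<^bsub>V\<^esub>c\<in>B. a c \<odot>\<^bsub>V\<^esub> c)" if B: "finite B" "basis B" and w: "w \<in> carrier V" for B w
 proof -
  have "B \<subseteq> carrier V" "w \<in> span B"
   using B(2) w by (auto simp: basis_def)
  then obtain a where "lincomb a B = w"
   using finite_in_span[OF B(1), of w] by blast
  then show ?thesis
   by (auto simp: lincomb_def)
 qed
 have matrix: "F b = (\<Oplus>\<^bsub>V\<^esub>c\<in>B. (\<phi> b * a c + \<psi> b * a' c) \<odot>\<^bsub>V\<^esub> c)"
  if B: "finite B" "basis B" and a: "x = (\<Oplus>\<^bsub>V\<^esub>c\<in>B. a c \<odot>\<^bsub>V\<^esub> c)" and a': "y = (\<Oplus>\<^bsub>V\<^esub>c\<in>B. a' c \<odot>\<^bsub>V\<^esub> c)" and b: "b \<in> carrier V"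
  for B a a' b
 proof -
  have sub: "B \<subseteq> carrier V"
   using B(2) by (simp add: basis_def)
  have "lincomb (\<lambda>c. \<phi> b * a c + \<psi> b * a' c) B = lincomb (\<lambda>c. \<phi> b * a c) B \<oplus>\<^bsub>V\<^esub> lincomb (\<lambda>c. \<psi> b * a' c) B"
   using lincomb_sum[OF B(1) sub, of "\<lambda>c. \<phi> b * a c" "\<lambda>c. \<psi> b * a' c"] by simp
  also have "lincomb (\<lambda>c. \<phi> b * a c) B = \<phi> b \<odot>\<^bsub>V\<^esub> x"
   using lincomb_smult[OF sub, of a "\<phi> b"] a by (simp add: lincomb_def)
  also have "lincomb (\<lambda>c. \<psi> b * a' c) B = \<psi> b \<odot>\<^bsub>V\<^esub> y"
   using lincomb_smult[OF sub, of a' "\<psi> b"] a' by (simp add: lincomb_def)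
  finally show ?thesis
   using F[OF b] by (simp add: lincomb_def)
 qed
 have trace: "(\<Sum>b\<in>B. \<phi> b * a b + \<psi> b * a' b) = \<phi> x + \<psi> y"
  if B: "finite B" "basis B" and a: "x = (\<Oplus>\<^bsub>V\<^esub>c\<in>B. a c \<odot>\<^bsub>V\<^esub> c)" and a': "y = (\<Oplus>\<^bsub>V\<^esub>c\<in>B. a' c \<odot>\<^bsub>V\<^esub> c)" for B a a'
 proof -
  have sub: "B \<subseteq> carrier V"
   using B(2) by (simp add: basis_def)
  have "\<phi> x = (\<Sum>b\<in>B. a b * \<phi> b)"
   unfolding a by (rule functional_finsum[OF V B(1) sub \<phi>])
  moreover have "\<psi> y = (\<Sum>b\<in>B. a' b * \<psi> b)"
   unfolding a' by (rule functional_finsum[OF V B(1) sub \<psi>])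
  ultimately show ?thesis
   by (simp add: sum.distrib mult.commute)
 qed
 \<comment> \<open>The definite description needs uniqueness. In a given basis the matrix entries
   are forced by linear independence; the diagonal sum is then found by expanding x and y in that
   basis.\<close>
 have unique: "(\<Sum>b\<in>B. M b b) = \<phi> x + \<psi> y" if P: "?P B M" for B M
 proof -
  have B: "finite B" "basis B"
   using P by auto
  then have sub: "B \<subseteq> carrier V" and indep: "lin_indpt B"
   by (simp_all add: basis_def)
  obtain a a' where a: "x = (\<Oplus>\<^bsub>V\<^esub>c\<in>B. a c \<odot>\<^bsub>V\<^esub> c)" "y = (\<Oplus>\<^bsub>V\<^esub>c\<in>B. a' c \<odot>\<^bsub>V\<^esub> c)"
   using coords[OF B] x y by metis
  have "M b b = \<phi> b * a b + \<psi> b * a' b" if b: "b \<in> B" for b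
  proof (rule ccontr)
   let ?m = "\<lambda>c. \<phi> b * a c + \<psi> b * a' c"
   assume neq: "M b b \<noteq> ?m b"
   have "lincomb (\<lambda>c. M c b) B = F b" "lincomb ?m B = F b"
    using P b matrix[OF B a, of b] sub by (auto simp: lincomb_def)
   then have "lincomb (\<lambda>c. M c b - ?m c) B = F b \<ominus>\<^bsub>V\<^esub> F b"
    using lincomb_diff[OF B(1) sub, of "\<lambda>c. M c b" ?m] by (simp add: class_ring_simps)
   moreover have "F b \<in> carrier V"
    using \<open>lincomb ?m B = F b\<close> lincomb_closed[OF sub, of ?m] by simp
   ultimately have "lincomb (\<lambda>c. M c b - ?m c) B = \<zero>\<^bsub>V\<^esub>"
    by simp
   then have "lin_dep B"
    using lin_dep_crit[OF B(1) order_refl, of "\<lambda>c. M c b - ?m c" b] b neq by simp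
   then show False
    using indep by simp
  qed
  then show ?thesis
   using trace[OF B a] by simp
 qed
 obtain B where B: "finite B" "basis B"
  using finite_basis_exists[OF fin_dim_V] by blast
 obtain a a' where a: "x = (\<Oplus>\<^bsub>V\<^esub>c\<in>B. a c \<odot>\<^bsub>V\<^esub> c)" "y = (\<Oplus>\<^bsub>V\<^esub>c\<in>B. a' c \<odot>\<^bsub>V\<^esub> c)"
  using coords[OF B] x y by metis
 have sub: "B \<subseteq> carrier V"
  using B by (simp add: basis_def)
 have P: "?P B (\<lambda>c b. \<phi> b * a c + \<psi> b * a' c)"
  using B matrix[OF B a] sub by blast
 show ?thesis
  unfolding lin_trace_def
 proof (rule the_equality)
  show "\<exists>B M. finite B \<and> basis B \<and> (\<forall>b\<in>B. F b = (\<Oplus>\<^bsub>V\<^esub>c\<in>B. M c b \<odot>\<^bsub>V\<^esub> c)) \<and> \<phi> x + \<psi> y = (\<Sum>b\<in>B. M b b)"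
   by (intro exI[of _ B] exI[of _ "\<lambda>c b. \<phi> b * a c + \<psi> b * a' c"])
     (use P unique[OF P] in simp)
  show "\<tau> = \<phi> x + \<psi> y"
   if "\<exists>B M. finite B \<and> basis B \<and> (\<forall>b\<in>B. F b = (\<Oplus>\<^bsub>V\<^esub>c\<in>B. M c b \<odot>\<^bsub>V\<^esub> c)) \<and> \<tau> = (\<Sum>b\<in>B. M b b)" for \<tau>
   using that unique by blast
 qed
qed

section \<open>Morphisms out of the simple objects\<close>

lemma simple_dim_simps [simp]: "simple_dim 0 = 1" "simple_dim 1 = 2"
 by (simp_all add: simple_dim_def)

lemma jordan_space_simps [simp]:
 "carrier (jordan_space n) = carrier_vec n" "add (jordan_space n) = (+)" "zero (jordan_space n) = 0\<^sub>v n"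
 "module.smult (jordan_space n) = (\<cdot>\<^sub>v)"
 by (simp_all add: module_vec_simps)

lemma jordan_action_carrier: "v \<in> carrier_vec n \<Longrightarrow> jordan_action n v \<in> carrier_vec n"
 by (rule carrier_vecI) (simp add: jordan_action_def)

lemma jordan_action_one:
 assumes "v \<in> carrier_vec 1"
 shows "jordan_action 1 v = 0\<^sub>v 1"
 using assms by (intro eq_vecI) (simp_all add: jordan_action_def scalar_prod_def)

lemma jordan_action_two:
 assumes "v \<in> carrier_vec 2"
 shows "jordan_action 2 v $ 0 = v $ 1" "jordan_action 2 v $ 1 = 0"
proof -
 have "{0..<2} = {0, 1 :: nat}"
  by auto
 then show "jordan_action 2 v $ 0 = v $ 1" "jordan_action 2 v $ 1 = 0"
  using assms by (simp_all add: jordan_action_def scalar_prod_def carrier_vecD)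
qed

text \<open>The splitting is formulated in coordinates, whereas the semisimplification is formed
  from an algebra of cosets. The isomorphism \<open>\<theta>\<close> connects the two and carries
  the derivation \<open>\<delta>\<close> to d.\<close>

locale jordan_splitting_copy = jordan_splitting BL bL BN parN bN d k s t r q
 for BL :: "'a set" and bL :: "'a \<Rightarrow> 'a \<Rightarrow> ('a \<Rightarrow>\<^sub>0 'k :: field)"
  and BN :: "'b set" and parN :: "'b \<Rightarrow> bit" and bN :: "'b \<Rightarrow> 'b \<Rightarrow> ('b \<Rightarrow>\<^sub>0 'k)"
  and d k s t r q +
 fixes M :: "('k, 'v) superalg" and \<theta> :: "'v \<Rightarrow> ('a \<Rightarrow>\<^sub>0 'k)" and \<delta> :: "'v \<Rightarrow> 'v"
 assumes copy: "lie_copy M L.L \<theta>"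
  and \<delta>_closed: "x \<in> carrier M \<Longrightarrow> \<delta> x \<in> carrier M"
  and \<theta>_\<delta>: "x \<in> carrier M \<Longrightarrow> \<theta> (\<delta> x) = d (\<theta> x)"
begin

sublocale M: lie_superalgebra M
 using copy by (simp add: lie_copy_def)

lemma \<theta>_epi: "algebra_epi M L.L \<theta>"
 using copy by (simp add: lie_copy_def)

lemma \<theta>_simps:
 "\<lbrakk>x \<in> carrier M; y \<in> carrier M\<rbrakk> \<Longrightarrow> \<theta> (x \<oplus>\<^bsub>M\<^esub> y) = \<theta> x + \<theta> y"
 "\<lbrakk>x \<in> carrier M; y \<in> carrier M\<rbrakk> \<Longrightarrow> \<theta> (x \<otimes>\<^bsub>M\<^esub> y) = \<theta> x \<bullet> \<theta> y"
 "x \<in> carrier M \<Longrightarrow> \<theta> (c \<odot>\<^bsub>M\<^esub> x) = pm_smult c (\<theta> x)"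
 "\<theta> \<zero>\<^bsub>M\<^esub> = 0"
 "x \<in> carrier M \<Longrightarrow> \<theta> (\<delta> x) = d (\<theta> x)"
 using algebra_epiD[OF \<theta>_epi] \<theta>_\<delta> by simp_all

lemma \<theta>_carrier: "x \<in> carrier M \<Longrightarrow> \<theta> x \<in> carrier L.L"
 by (rule algebra_epiD(3)[OF \<theta>_epi])

lemma \<theta>_minus: "\<lbrakk>x \<in> carrier M; y \<in> carrier M\<rbrakk> \<Longrightarrow> \<theta> (x \<ominus>\<^bsub>M\<^esub> y) = \<theta> x - \<theta> y"
 using algebra_epi_minus[OF M.bracket_algebra_axioms \<theta>_epi, of x y] \<theta>_carrier L.a_minus_eq by simp

lemma \<theta>_eqI: "\<lbrakk>x \<in> carrier M; y \<in> carrier M; \<theta> x = \<theta> y\<rbrakk> \<Longrightarrow> x = y"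
 using copy by (auto simp: lie_copy_def dest: inj_onD)

lemma \<theta>_surj: "a \<in> carrier L.L \<Longrightarrow> \<exists>x\<in>carrier M. \<theta> x = a"
 using algebra_epiD(1)[OF \<theta>_epi] by (metis imageE)

lemma \<theta>_finsum:
 assumes "finite A" "\<And>a. a \<in> A \<Longrightarrow> g a \<in> carrier M"
 shows "\<theta> (\<Oplus>\<^bsub>M\<^esub>a\<in>A. g a) = (\<Sum>a\<in>A. \<theta> (g a)) \<and> (\<Oplus>\<^bsub>M\<^esub>a\<in>A. g a) \<in> carrier M"
 using assms by (induction A rule: finite_induct) (auto simp: \<theta>_simps M.finsum_insert Pi_def)

lemma fin_dim_M: "vectorspace.fin_dim class_ring M"
proof -
 define g where "g u = (SOME x. x \<in> carrier M \<and> \<theta> x = single u 1)" for u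
 have g: "g u \<in> carrier M" "\<theta> (g u) = single u 1" if "u \<in> BL" for u
 proof -
  have "single u 1 \<in> carrier L.L"
   using that by (simp add: keys_single)
  then have "\<exists>x. x \<in> carrier M \<and> \<theta> x = single u 1"
   using \<theta>_surj by blast
  from someI_ex[OF this] show "g u \<in> carrier M" "\<theta> (g u) = single u 1"
   by (simp_all add: g_def)
 qed
 have sub: "g ` BL \<subseteq> carrier M"
  using g by auto
 have span: "VectorSpace.subspace class_ring (M.span (g ` BL)) M"
  by (rule M.span_is_subspace[OF sub])
 note spanD = M.subspaceD[OF span]
 have "x \<in> M.span (g ` BL)" if x: "x \<in> carrier M" for x
 proof -
  have "(\<Oplus>\<^bsub>M\<^esub>u\<in>A. c u \<odot>\<^bsub>M\<^esub> g u) \<in> M.span (g ` BL)" if "finite A" "A \<subseteq> BL" for A c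
   using that
  proof (induction A rule: finite_induct)
   case (insert u A)
   have "g u \<in> M.span (g ` BL)"
    using M.in_own_span[OF sub] insert by auto
   then have "c u \<odot>\<^bsub>M\<^esub> g u \<oplus>\<^bsub>M\<^esub> (\<Oplus>\<^bsub>M\<^esub>u\<in>A. c u \<odot>\<^bsub>M\<^esub> g u) \<in> M.span (g ` BL)"
    using insert by (intro spanD(3,4)) auto
   moreover have "(\<Oplus>\<^bsub>M\<^esub>u\<in>insert u A. c u \<odot>\<^bsub>M\<^esub> g u) = c u \<odot>\<^bsub>M\<^esub> g u \<oplus>\<^bsub>M\<^esub> (\<Oplus>\<^bsub>M\<^esub>u\<in>A. c u \<odot>\<^bsub>M\<^esub> g u)"
    using insert g by (intro M.finsum_insert) auto
   ultimately show ?case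
    by simp
  qed (simp add: spanD(2))
  from this[OF finite_BL order_refl]
  have *: "(\<Oplus>\<^bsub>M\<^esub>u\<in>BL. lookup (\<theta> x) u \<odot>\<^bsub>M\<^esub> g u) \<in> M.span (g ` BL)" .
  have "\<theta> (\<Oplus>\<^bsub>M\<^esub>u\<in>BL. lookup (\<theta> x) u \<odot>\<^bsub>M\<^esub> g u) = (\<Sum>u\<in>BL. single u (lookup (\<theta> x) u))"
   using \<theta>_finsum[OF finite_BL, of "\<lambda>u. lookup (\<theta> x) u \<odot>\<^bsub>M\<^esub> g u"] g by (simp add: \<theta>_simps)
  also have "\<dots> = \<theta> x"
   using poly_mapping_sum_single[OF finite_BL, of "\<theta> x"] \<theta>_carrier[OF x] by simp
  finally have "(\<Oplus>\<^bsub>M\<^esub>u\<in>BL. lookup (\<theta> x) u \<odot>\<^bsub>M\<^esub> g u) = x"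
   using spanD(1) * by (intro \<theta>_eqI[OF _ x]) auto
  then show ?thesis
   using * by simp
 qed
 then have "M.span (g ` BL) = carrier M"
  using spanD(1) by blast
 then show ?thesis
  unfolding M.fin_dim_def using finite_BL sub by (intro exI[of _ "g ` BL"]) auto
qed

lemma rep_alpha3_M: "rep_alpha3 M \<delta>"
proof -
 have "\<delta> \<in> LinearCombinations.module_hom class_ring M M"
  unfolding LinearCombinations.module_hom_def
  by (auto simp: \<delta>_closed \<theta>_simps lin_simps intro!: \<theta>_eqI)
 moreover have "\<delta> (\<delta> (\<delta> x)) = \<zero>\<^bsub>M\<^esub>" if "x \<in> carrier M" for x
  using that d_cube[OF \<theta>_carrier[OF that]] by (intro \<theta>_eqI) (auto simp: \<delta>_closed \<theta>_simps)
 ultimately show ?thesis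
  unfolding rep_alpha3_def using M.vectorspace_axioms fin_dim_M by blast
qed

lemma lie_algebra_in_rep_alpha3_M: "lie_algebra_in_rep_alpha3 M \<delta>"
proof -
 have "part M 1 = {\<zero>\<^bsub>M\<^esub>}"
 proof -
  have "\<theta> ` part M 1 = {0}"
   using copy by (simp add: lie_copy_def)
  moreover have "part M 1 \<subseteq> carrier M"
   using M.subspaceD(1)[OF M.part_subspace] .
  ultimately show ?thesis
   using \<theta>_eqI[of _ "\<zero>\<^bsub>M\<^esub>"] \<theta>_simps(4) M.subspaceD(2)[OF M.part_subspace[of 1]] by auto
 qed
 moreover have "\<delta> (x \<otimes>\<^bsub>M\<^esub> y) = \<delta> x \<otimes>\<^bsub>M\<^esub> y \<oplus>\<^bsub>M\<^esub> x \<otimes>\<^bsub>M\<^esub> \<delta> y" if "x \<in> carrier M" "y \<in> carrier M" for x y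
  using that derivation[OF \<theta>_carrier[OF that(1)] \<theta>_carrier[OF that(2)]]
  by (intro \<theta>_eqI) (auto simp: \<delta>_closed \<theta>_simps M.bracket_closed)
 ultimately show ?thesis
  unfolding lie_algebra_in_rep_alpha3_def using M.lie_superalgebra_axioms rep_alpha3_M by blast
qed

abbreviation J :: "bit \<Rightarrow> ('k, 'k vec) module" where
 "J p \<equiv> jordan_space (simple_dim p)"
abbreviation act :: "bit \<Rightarrow> 'k vec \<Rightarrow> 'k vec" where
 "act p \<equiv> jordan_action (simple_dim p)"

text \<open>
 A morphism from a simple object is given by the image of the generator of its Jordan block.
\<close>

definition hom_of :: "bit \<Rightarrow> 'v \<Rightarrow> 'k vec \<Rightarrow> 'v" where
 "hom_of p x = (\<lambda>v\<in>carrier (J p). if p = 0 then v $ 0 \<odot>\<^bsub>M\<^esub> x else v $ 0 \<odot>\<^bsub>M\<^esub> \<delta> x \<oplus>\<^bsub>M\<^esub> v $ 1 \<odot>\<^bsub>M\<^esub> x)"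

definition Z :: "bit \<Rightarrow> 'v set" where
 "Z p = {x \<in> carrier M. if p = 0 then \<delta> x = \<zero>\<^bsub>M\<^esub> else \<delta> (\<delta> x) = \<zero>\<^bsub>M\<^esub>}"

text \<open>The coefficients of x along the generators of the blocks of size 1, respectively 2. In
  the odd case d comes first because q reads the end of a block.\<close>

definition \<psi> :: "bit \<Rightarrow> 'v \<Rightarrow> ('b \<Rightarrow>\<^sub>0 'k)" where
 "\<psi> p x = (if p = 0 then r (\<theta> x) else q (d (\<theta> x)))"

lemma Z_carrier: "x \<in> Z p \<Longrightarrow> x \<in> carrier M"
 by (simp add: Z_def)

lemma Z_\<theta>: "x \<in> Z 0 \<Longrightarrow> d (\<theta> x) = 0" "x \<in> Z 1 \<Longrightarrow> d (d (\<theta> x)) = 0"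
 by (auto simp: Z_def \<delta>_closed simp flip: \<theta>_simps(4,5))

lemma Z_I: "\<lbrakk>x \<in> carrier M; d (\<theta> x) = 0\<rbrakk> \<Longrightarrow> x \<in> Z 0" "\<lbrakk>x \<in> carrier M; d (d (\<theta> x)) = 0\<rbrakk> \<Longrightarrow> x \<in> Z 1"
 by (auto simp: Z_def \<delta>_closed \<theta>_simps intro!: \<theta>_eqI)

lemma hom_of_closed: "\<lbrakk>x \<in> carrier M; v \<in> carrier (J p)\<rbrakk> \<Longrightarrow> hom_of p x v \<in> carrier M"
 by (simp add: hom_of_def \<delta>_closed)

lemma \<theta>_hom_of: "\<lbrakk>x \<in> carrier M; v \<in> carrier (J p)\<rbrakk> \<Longrightarrow> \<theta> (hom_of p x v) =
  (if p = 0 then pm_smult (v $ 0) (\<theta> x) else pm_smult (v $ 0) (d (\<theta> x)) + pm_smult (v $ 1) (\<theta> x))"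
 by (simp add: hom_of_def \<delta>_closed \<theta>_simps)

lemma hom_of_rep_hom:
 assumes "x \<in> Z p"
 shows "hom_of p x \<in> rep_hom (J p) (act p) M \<delta>"
proof -
 have x: "x \<in> carrier M"
  using Z_carrier[OF assms] .
 have act: "act p v \<in> carrier (J p)" if "v \<in> carrier (J p)" for v
  using that by (simp add: jordan_action_carrier)
 have comm: "hom_of p x (act p v) = \<delta> (hom_of p x v)" if v: "v \<in> carrier (J p)" for v
 proof (rule \<theta>_eqI)
  show "\<theta> (hom_of p x (act p v)) = \<theta> (\<delta> (hom_of p x v))"
  proof (cases "p = 0")
   case True
   then show ?thesis
    using v assms jordan_action_one[of v] Z_\<theta>(1)[of x] act[OF v]
    by (simp add: \<theta>_simps \<theta>_hom_of hom_of_closed x lin_simps)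
  next
   case False
   then have "p = 1"
    using bit_cases by blast
   then show ?thesis
    using v assms jordan_action_two[of v] Z_\<theta>(2)[of x] act[OF v]
    by (simp add: \<theta>_simps \<theta>_hom_of hom_of_closed x lin_simps)
  qed
 qed (use v act x hom_of_closed \<delta>_closed in auto)
 have dims: "0 < simple_dim p" "p \<noteq> 0 \<Longrightarrow> 1 < simple_dim p"
  by (simp_all add: simple_dim_def)
 have "hom_of p x \<in> LinearCombinations.module_hom class_ring (J p) M"
  unfolding LinearCombinations.module_hom_def
  using hom_of_closed[OF x] dims
  by (auto simp: \<theta>_hom_of x \<theta>_simps pm_smult_add_left pm_smult_add_right carrier_vecD intro!: \<theta>_eqI)
 then show ?thesis
  using comm by (simp add: rep_hom_def hom_of_def)
qed

text \<open>The generator of a block is its last unit vector. For J_2 the image x of the generator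
  determines the image \<open>\<delta> x\<close> of the other basis vector, and t^2 = 0 becomes the
  condition in \<open>Z\<close>.\<close>

lemma rep_hom_eq: "rep_hom (J p) (act p) M \<delta> = hom_of p ` Z p"
proof
 show "hom_of p ` Z p \<subseteq> rep_hom (J p) (act p) M \<delta>"
  using hom_of_rep_hom by auto
 show "rep_hom (J p) (act p) M \<delta> \<subseteq> hom_of p ` Z p"
 proof
  fix f assume f: "f \<in> rep_hom (J p) (act p) M \<delta>"
  then have ext: "f \<in> extensional (carrier (J p))" and comm: "\<And>v. v \<in> carrier (J p) \<Longrightarrow> f (act p v) = \<delta> (f v)"
   and hom: "\<And>v. v \<in> carrier (J p) \<Longrightarrow> f v \<in> carrier M"
    "\<And>v w. \<lbrakk>v \<in> carrier (J p); w \<in> carrier (J p)\<rbrakk> \<Longrightarrow> f (v + w) = f v \<oplus>\<^bsub>M\<^esub> f w"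
    "\<And>c v. v \<in> carrier (J p) \<Longrightarrow> f (c \<cdot>\<^sub>v v) = c \<odot>\<^bsub>M\<^esub> f v"
   by (auto simp: rep_hom_def LinearCombinations.module_hom_def)
  show "f \<in> hom_of p ` Z p"
  proof (cases "p = 0")
   case True
   let ?e = "unit_vec 1 0 :: 'k vec"
   have e: "?e \<in> carrier (J p)"
    using True by simp
   have zero: "f (0\<^sub>v 1) = \<zero>\<^bsub>M\<^esub>"
   proof -
    have "f (0 \<cdot>\<^sub>v ?e) = 0 \<odot>\<^bsub>M\<^esub> f ?e"
     using hom(3)[OF e] .
    moreover have "0 \<cdot>\<^sub>v ?e = 0\<^sub>v 1"
     by (intro eq_vecI) simp_all
    ultimately show ?thesis
     using hom(1)[OF e] by (simp add: M.smult_zero_scalar)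
   qed
   have "\<delta> (f ?e) = \<zero>\<^bsub>M\<^esub>"
    using comm[OF e] True jordan_action_one[of ?e] zero by simp
   then have "f ?e \<in> Z p"
    using True hom(1)[OF e] by (simp add: Z_def)
   moreover have "f = hom_of p (f ?e)"
   proof (rule extensionalityI[OF ext])
    show "hom_of p (f ?e) \<in> extensional (carrier (J p))"
     by (simp add: hom_of_def)
    fix v assume v: "v \<in> carrier (J p)"
    then have "v = v $ 0 \<cdot>\<^sub>v ?e"
     using True by (intro eq_vecI) simp_all
    then show "f v = hom_of p (f ?e) v"
     using v True hom(3)[OF e, of "v $ 0"] by (simp add: hom_of_def)
   qed
   ultimately show ?thesis
    by blast
  next
   case False
   then have p: "p = 1"
    using bit_cases by blast
   let ?e = "unit_vec 2 1 :: 'k vec" and ?u = "unit_vec 2 0 :: 'k vec"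
   have e: "?e \<in> carrier (J p)" "?u \<in> carrier (J p)"
    using p by simp_all
   have zero: "f (0\<^sub>v 2) = \<zero>\<^bsub>M\<^esub>"
   proof -
    have "f (0 \<cdot>\<^sub>v ?e) = 0 \<odot>\<^bsub>M\<^esub> f ?e"
     using hom(3)[OF e(1)] .
    moreover have "0 \<cdot>\<^sub>v ?e = 0\<^sub>v 2"
     by (intro eq_vecI) simp_all
    ultimately show ?thesis
     using hom(1)[OF e(1)] by (simp add: M.smult_zero_scalar)
   qed
   have less_2: "i < 2 \<longleftrightarrow> i = 0 \<or> i = 1" for i :: nat
    by auto
   have act: "jordan_action 2 ?e = ?u" "jordan_action 2 ?u = 0\<^sub>v 2"
    using jordan_action_two[of ?e] jordan_action_two[of ?u]
     jordan_action_carrier[of ?e 2] jordan_action_carrier[of ?u 2]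
    by (auto intro!: eq_vecI simp: less_2 carrier_vecD)
   have \<delta>e: "\<delta> (f ?e) = f ?u"
    using comm[OF e(1)] p act by simp
   have "\<delta> (f ?u) = \<zero>\<^bsub>M\<^esub>"
    using comm[OF e(2)] p act zero by simp
   then have "f ?e \<in> Z p"
    using p hom(1)[OF e(1)] \<delta>e by (simp add: Z_def)
   moreover have "f = hom_of p (f ?e)"
   proof (rule extensionalityI[OF ext])
    show "hom_of p (f ?e) \<in> extensional (carrier (J p))"
     by (simp add: hom_of_def)
    fix v assume v: "v \<in> carrier (J p)"
    then have "v = v $ 0 \<cdot>\<^sub>v ?u + v $ 1 \<cdot>\<^sub>v ?e"
     using p by (intro eq_vecI) (auto simp: less_2 carrier_vecD)
    then have "f v = f (v $ 0 \<cdot>\<^sub>v ?u + v $ 1 \<cdot>\<^sub>v ?e)"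
     by simp
    also have "\<dots> = v $ 0 \<odot>\<^bsub>M\<^esub> f ?u \<oplus>\<^bsub>M\<^esub> v $ 1 \<odot>\<^bsub>M\<^esub> f ?e"
     using e by (subst hom(2)) (simp_all add: hom(3))
    finally show "f v = hom_of p (f ?e) v"
     using v p by (simp add: hom_of_def \<delta>e del: One_nat_def)
   qed
   ultimately show ?thesis
    by blast
  qed
 qed
qed

end

section \<open>Negligible morphisms and their cosets\<close>

context jordan_splitting_copy
begin

lemma \<psi>_part: "x \<in> carrier M \<Longrightarrow> \<psi> p x \<in> part N.L p"
 using closed(5)[OF \<theta>_carrier] closed(6)[OF closed(1)[OF \<theta>_carrier]] bit_cases[of p] by (auto simp: \<psi>_def)

lemma \<psi>_linear:
 "\<lbrakk>x \<in> carrier M; y \<in> carrier M\<rbrakk> \<Longrightarrow> \<psi> p (x \<oplus>\<^bsub>M\<^esub> y) = \<psi> p x + \<psi> p y"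
 "\<lbrakk>x \<in> carrier M; y \<in> carrier M\<rbrakk> \<Longrightarrow> \<psi> p (x \<ominus>\<^bsub>M\<^esub> y) = \<psi> p x - \<psi> p y"
 "x \<in> carrier M \<Longrightarrow> \<psi> p (c \<odot>\<^bsub>M\<^esub> x) = pm_smult c (\<psi> p x)"
 by (simp_all add: \<psi>_def \<theta>_simps \<theta>_minus lin_simps)

lemma \<psi>_surj:
 assumes "m \<in> part N.L p"
 shows "\<exists>x\<in>Z p. \<psi> p x = m"
proof (cases "p = 0")
 case True
 then have m: "m \<in> part N.L 0"
  using assms by simp
 obtain x where x: "x \<in> carrier M" "\<theta> x = s m"
  using \<theta>_surj[OF closed(3)[OF m]] by blast
 then have "x \<in> Z 0" "\<psi> 0 x = m"
  using Z_I(1)[of x] d_s[OF m] r_s[OF m] by (simp_all add: \<psi>_def)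
 then show ?thesis
  using True by blast
next
 case False
 then have p: "p = 1"
  using bit_cases by blast
 then have m: "m \<in> part N.L 1"
  using assms by simp
 obtain x where x: "x \<in> carrier M" "\<theta> x = t m"
  using \<theta>_surj[OF closed(4)[OF m]] by blast
 then have "x \<in> Z 1" "\<psi> 1 x = m"
  using Z_I(2)[of x] d_d_t[OF m] q_d_t[OF m] by (simp_all add: \<psi>_def)
 then show ?thesis
  using p by blast
qed

lemma Z_closed:
 "\<lbrakk>x \<in> Z p; y \<in> Z p\<rbrakk> \<Longrightarrow> x \<oplus>\<^bsub>M\<^esub> y \<in> Z p" "\<lbrakk>x \<in> Z p; y \<in> Z p\<rbrakk> \<Longrightarrow> x \<ominus>\<^bsub>M\<^esub> y \<in> Z p"
 "x \<in> Z p \<Longrightarrow> c \<odot>\<^bsub>M\<^esub> x \<in> Z p"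
proof -
 have sum: "x \<oplus>\<^bsub>M\<^esub> y \<in> Z p \<and> x \<ominus>\<^bsub>M\<^esub> y \<in> Z p" if xy: "x \<in> Z p" "y \<in> Z p"
 proof (cases "p = 0")
  case True
  then show ?thesis
   using xy Z_\<theta>(1)[of x] Z_\<theta>(1)[of y] Z_carrier[OF xy(1)] Z_carrier[OF xy(2)]
   by (auto intro!: Z_I simp: \<theta>_simps \<theta>_minus lin_simps)
 next
  case False
  then have p: "p = 1"
   using bit_cases by blast
  then show ?thesis
   using xy Z_\<theta>(2)[of x] Z_\<theta>(2)[of y] Z_carrier[OF xy(1)] Z_carrier[OF xy(2)]
   by (auto intro!: Z_I simp: \<theta>_simps \<theta>_minus lin_simps)
 qed
 show "x \<oplus>\<^bsub>M\<^esub> y \<in> Z p" if "x \<in> Z p" "y \<in> Z p"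
  using sum[OF that] by simp
 show "x \<ominus>\<^bsub>M\<^esub> y \<in> Z p" if "x \<in> Z p" "y \<in> Z p"
  using sum[OF that] by simp
 show "c \<odot>\<^bsub>M\<^esub> x \<in> Z p" if x: "x \<in> Z p"
 proof (cases "p = 0")
  case True
  then show ?thesis
   using x Z_\<theta>(1)[of x] Z_carrier[OF x] by (auto intro!: Z_I simp: \<theta>_simps lin_simps)
 next
  case False
  then have p: "p = 1"
   using bit_cases by blast
  then show ?thesis
   using x Z_\<theta>(2)[of x] Z_carrier[OF x] by (auto intro!: Z_I simp: \<theta>_simps lin_simps)
 qed
qed

abbreviation "Hom p \<equiv> hom_space (J p) (act p) M \<delta>"

lemma hom_of_eqI:
 assumes "\<And>v. v \<in> carrier (J p) \<Longrightarrow> f v \<in> carrier M \<and> \<theta> (f v) = \<theta> (hom_of p x v)" "x \<in> carrier M"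
 shows "(\<lambda>v\<in>carrier (J p). f v) = hom_of p x"
proof (rule extensionalityI[of _ "carrier (J p)"])
 show "restrict f (carrier (J p)) \<in> extensional (carrier (J p))" "hom_of p x \<in> extensional (carrier (J p))"
  by (simp_all add: hom_of_def)
 fix v assume v: "v \<in> carrier (J p)"
 then show "restrict f (carrier (J p)) v = hom_of p x v"
  using assms(1)[OF v] hom_of_closed[OF assms(2) v] \<theta>_eqI by simp
qed

lemma Hom_add: "\<lbrakk>x \<in> carrier M; y \<in> carrier M\<rbrakk> \<Longrightarrow> hom_of p x \<oplus>\<^bsub>Hom p\<^esub> hom_of p y = hom_of p (x \<oplus>\<^bsub>M\<^esub> y)"
 unfolding hom_space_def
 by simp (intro hom_of_eqI[where p = p, simplified], auto simp: hom_of_closed \<theta>_simps \<theta>_hom_of lin_simps pm_smult_add_right)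

lemma Hom_smult: "x \<in> carrier M \<Longrightarrow> c \<odot>\<^bsub>Hom p\<^esub> hom_of p x = hom_of p (c \<odot>\<^bsub>M\<^esub> x)"
 unfolding hom_space_def
 by simp (intro hom_of_eqI[where p = p, simplified], auto simp: hom_of_closed \<theta>_simps \<theta>_hom_of lin_simps pm_smult_add_right mult.commute)

text \<open>Pairing the morphism of x with v gives v x for J_1, and twice the first coordinate of v
  (\<open>\<delta>\<close> x) for J_2. If \<open>\<psi>\<close> x = 0, then x, respectively
  \<open>\<delta>\<close> x, lies in the image of d, respectively d^2, and the value of v there
  vanishes since t = 0 on J_1 and t^2 = 0 on J_2. Conversely, the coordinates of r and q supply
  enough test morphisms v.\<close>

lemma negligible_eq: "negligible (J p) (act p) M \<delta> = hom_of p ` {x \<in> Z p. \<psi> p x = 0}"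
proof -
 have lookup_linear:
  "\<lbrakk>u \<in> carrier M; v \<in> carrier M\<rbrakk> \<Longrightarrow> lookup (g (\<theta> (u \<oplus>\<^bsub>M\<^esub> v))) i = lookup (g (\<theta> u)) i + lookup (g (\<theta> v)) i"
  "u \<in> carrier M \<Longrightarrow> lookup (g (\<theta> (c \<odot>\<^bsub>M\<^esub> u))) i = c * lookup (g (\<theta> u)) i"
  if "pm_linear g" for g :: "('a \<Rightarrow>\<^sub>0 'k) \<Rightarrow> ('b \<Rightarrow>\<^sub>0 'k)" and u v c i
  using that by (simp_all add: \<theta>_simps pm_linear_add pm_linear_smult lookup_add)
 have key: "hom_of p x \<in> negligible (J p) (act p) M \<delta> \<longleftrightarrow> \<psi> p x = 0" if x: "x \<in> Z p" for x
 proof (cases "p = 0")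
  case True
  have xM: "x \<in> carrier M" and dx: "d (\<theta> x) = 0"
   using x True Z_carrier Z_\<theta>(1) by auto
  have trace: "lin_trace M (hom_of 0 x \<circ> v) = v x $ 0" if v: "v \<in> rep_hom M \<delta> (J 0) (act 0)" for v
  proof -
   have v': "v z \<in> carrier_vec 1" "z \<in> carrier M \<Longrightarrow> w \<in> carrier M \<Longrightarrow> v (z \<oplus>\<^bsub>M\<^esub> w) = v z + v w"
    "v (c \<odot>\<^bsub>M\<^esub> z) = c \<cdot>\<^sub>v v z" if "z \<in> carrier M" for z w c
    using v that by (auto simp: rep_hom_def LinearCombinations.module_hom_def)
   have dim: "dim_vec (v z) = 1" if "z \<in> carrier M" for z
    using v'(1)[OF that] by (rule carrier_vecD)
   \<comment> \<open>A map through J_1 has rank at most one; the second summand of the trace formula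
     is filled with zero.\<close>
   have "lin_trace M (hom_of 0 x \<circ> v) = v x $ 0 + (\<lambda>_. 0) \<zero>\<^bsub>M\<^esub>"
   proof (rule lin_trace_rank_two[OF M.vectorspace_axioms fin_dim_M, where \<phi> = "\<lambda>z. v z $ 0" and \<psi> = "\<lambda>_. 0"])
    show "v (z \<oplus>\<^bsub>M\<^esub> w) $ 0 = v z $ 0 + v w $ 0" if "z \<in> carrier M" "w \<in> carrier M" for z w
     using that by (simp add: v'(2) dim)
    show "v (c \<odot>\<^bsub>M\<^esub> z) $ 0 = c * v z $ 0" if "z \<in> carrier M" for z c
     using that by (simp add: v'(3) dim)
    show "(hom_of 0 x \<circ> v) z = v z $ 0 \<odot>\<^bsub>M\<^esub> x \<oplus>\<^bsub>M\<^esub> 0 \<odot>\<^bsub>M\<^esub> \<zero>\<^bsub>M\<^esub>" if "z \<in> carrier M" for z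
     using v'(1)[OF that] xM by (simp add: hom_of_def M.smult_zero_scalar)
   qed (simp_all add: xM)
   then show ?thesis
    by simp
  qed
  show ?thesis
  proof
   assume "\<psi> p x = 0"
   then obtain w where w: "w \<in> carrier L.L" "\<theta> x = d w"
    using exact_iff[OF \<theta>_carrier[OF xM] dx] True by (auto simp: \<psi>_def)
   obtain w' where w': "w' \<in> carrier M" "\<theta> w' = w"
    using \<theta>_surj[OF w(1)] by blast
   have "x = \<delta> w'"
    using w w' xM by (intro \<theta>_eqI) (auto simp: \<delta>_closed \<theta>_simps)
   have "v x $ 0 = 0" if v: "v \<in> rep_hom M \<delta> (J 0) (act 0)" for v
   proof -
    have "v (\<delta> w') = jordan_action 1 (v w')" "v w' \<in> carrier_vec 1"
     using v w'(1) by (auto simp: rep_hom_def LinearCombinations.module_hom_def)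
    then show ?thesis
     using jordan_action_one[of "v w'"] \<open>x = \<delta> w'\<close> by simp
   qed
   then show "hom_of p x \<in> negligible (J p) (act p) M \<delta>"
    using hom_of_rep_hom[OF x] trace True by (simp add: negligible_def)
  next
   assume neg: "hom_of p x \<in> negligible (J p) (act p) M \<delta>"
   show "\<psi> p x = 0"
   proof (rule poly_mapping_eqI)
    fix i
    \<comment> \<open>A coordinate of r is a morphism to J_1 because r vanishes on the image of
      d.\<close>
    define v where "v = (\<lambda>z\<in>carrier M. vec 1 (\<lambda>_. lookup (r (\<theta> z)) i))"
    have "v \<in> rep_hom M \<delta> (J 0) (act 0)"
     unfolding rep_hom_def LinearCombinations.module_hom_def
    proof (intro CollectI conjI allI impI ballI)
     show "v \<in> extensional (carrier M)" "v \<in> carrier M \<rightarrow> carrier (J 0)"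
      by (auto simp: v_def)
     show "v (z \<oplus>\<^bsub>M\<^esub> w) = v z \<oplus>\<^bsub>J 0\<^esub> v w" if "z \<in> carrier M \<and> w \<in> carrier M" for z w
      using that lookup_linear(1)[OF linear(5), of z w i] by (auto simp: v_def intro!: eq_vecI)
     show "v (c \<odot>\<^bsub>M\<^esub> z) = c \<odot>\<^bsub>J 0\<^esub> v z" if "c \<in> carrier class_ring \<and> z \<in> carrier M" for c z
      using that lookup_linear(2)[OF linear(5), of z c i] by (auto simp: v_def intro!: eq_vecI)
     show "v (\<delta> z) = act 0 (v z)" if "z \<in> carrier M" for z
     proof -
      have "v z \<in> carrier_vec 1"
       using that by (simp add: v_def)
      moreover have "v (\<delta> z) = 0\<^sub>v 1"
       using that \<delta>_closed[OF that] r_d[OF \<theta>_carrier[OF that]] by (auto simp: v_def \<theta>_simps intro!: eq_vecI)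
      ultimately show ?thesis
       using jordan_action_one[of "v z"] by simp
     qed
    qed
    then have "v x $ 0 = 0"
     using neg trace True by (auto simp: negligible_def)
    then show "lookup (\<psi> p x) i = lookup 0 i"
     using xM True by (simp add: v_def \<psi>_def)
   qed
  qed
 next
  case False
  then have p: "p = 1"
   using bit_cases by blast
  have xM: "x \<in> carrier M" and dx: "d (d (\<theta> x)) = 0"
   using x p Z_carrier Z_\<theta>(2) by auto
  have v_comp: "v z \<in> carrier_vec 2" "z \<in> carrier M \<Longrightarrow> w \<in> carrier M \<Longrightarrow> v (z \<oplus>\<^bsub>M\<^esub> w) = v z + v w"
    "v (c \<odot>\<^bsub>M\<^esub> z) = c \<cdot>\<^sub>v v z" "v (\<delta> z) $ 0 = v z $ 1" "v (\<delta> z) $ 1 = 0"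
   if v: "v \<in> rep_hom M \<delta> (J 1) (act 1)" and "z \<in> carrier M" for z w c v
   using that jordan_action_two[of "v z"] by (auto simp: rep_hom_def LinearCombinations.module_hom_def)
  have trace: "lin_trace M (hom_of 1 x \<circ> v) = v (\<delta> x) $ 0 + v (\<delta> x) $ 0" if v: "v \<in> rep_hom M \<delta> (J 1) (act 1)" for v
  proof -
   have dim: "dim_vec (v z) = 2" if "z \<in> carrier M" for z
    using v_comp(1)[OF v that] by (rule carrier_vecD)
   \<comment> \<open>The composite sends z to v(z)_0 \<open>\<delta> x\<close> + v(z)_1 x. By
     equivariance the second coordinate of v x is the first coordinate of v (\<open>\<delta>\<close>
     x), so both contributions agree.\<close>
   have "lin_trace M (hom_of 1 x \<circ> v) = v (\<delta> x) $ 0 + v x $ 1"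
   proof (rule lin_trace_rank_two[OF M.vectorspace_axioms fin_dim_M, where \<phi> = "\<lambda>z. v z $ 0" and \<psi> = "\<lambda>z. v z $ 1"])
    show "v (z \<oplus>\<^bsub>M\<^esub> w) $ 0 = v z $ 0 + v w $ 0" "v (z \<oplus>\<^bsub>M\<^esub> w) $ 1 = v z $ 1 + v w $ 1"
     if "z \<in> carrier M" "w \<in> carrier M" for z w
     using that by (simp_all add: v_comp(2)[OF v] dim)
    show "v (c \<odot>\<^bsub>M\<^esub> z) $ 0 = c * v z $ 0" "v (c \<odot>\<^bsub>M\<^esub> z) $ 1 = c * v z $ 1" if "z \<in> carrier M" for z c
     using that by (simp_all add: v_comp(3)[OF v] dim)
    show "(hom_of 1 x \<circ> v) z = v z $ 0 \<odot>\<^bsub>M\<^esub> \<delta> x \<oplus>\<^bsub>M\<^esub> v z $ 1 \<odot>\<^bsub>M\<^esub> x" if "z \<in> carrier M" for z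
     using v_comp(1)[OF v that] by (simp add: hom_of_def)
   qed (simp_all add: xM \<delta>_closed)
   then show ?thesis
    using v_comp(4)[OF v xM] by simp
  qed
  show ?thesis
  proof
   assume "\<psi> p x = 0"
   then obtain w where w: "w \<in> carrier L.L" "d (\<theta> x) = d (d w)"
    using exact_iff'[OF \<theta>_carrier[OF xM] dx] p by (auto simp: \<psi>_def)
   obtain w' where w': "w' \<in> carrier M" "\<theta> w' = w"
    using \<theta>_surj[OF w(1)] by blast
   have eq: "\<delta> x = \<delta> (\<delta> w')"
    using w w' xM by (intro \<theta>_eqI) (auto simp: \<delta>_closed \<theta>_simps)
   have "v (\<delta> x) $ 0 = 0" if v: "v \<in> rep_hom M \<delta> (J 1) (act 1)" for v
    using v_comp(4)[OF v \<delta>_closed[OF w'(1)]] v_comp(5)[OF v w'(1)] eq by simp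
   then show "hom_of p x \<in> negligible (J p) (act p) M \<delta>"
    using hom_of_rep_hom[OF x] trace p by (simp add: negligible_def)
  next
   assume neg: "hom_of p x \<in> negligible (J p) (act p) M \<delta>"
   show "\<psi> p x = 0"
   proof (rule poly_mapping_eqI)
    fix i
    \<comment> \<open>The pair of a coordinate of q and of q after d is a morphism to J_2 because q
      vanishes on the image of d^2. At \<open>\<delta> x\<close> its first entry is a coordinate of
      \<open>\<psi>\<close> x.\<close>
    define v where "v = (\<lambda>z\<in>carrier M. vec 2 (\<lambda>j. lookup (q (if j = 0 then \<theta> z else d (\<theta> z))) i))"
    have less_2: "j < 2 \<longleftrightarrow> j = 0 \<or> j = 1" for j :: nat
     by auto
    have "v \<in> rep_hom M \<delta> (J 1) (act 1)"
     unfolding rep_hom_def LinearCombinations.module_hom_def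
    proof (intro CollectI conjI allI impI ballI)
     show "v \<in> extensional (carrier M)" "v \<in> carrier M \<rightarrow> carrier (J 1)"
      by (auto simp: v_def)
     note qd = lookup_linear[OF linear(6)] lookup_linear[OF pm_linear_comp[OF linear(6) linear(1)]]
     show "v (z \<oplus>\<^bsub>M\<^esub> w) = v z \<oplus>\<^bsub>J 1\<^esub> v w" if "z \<in> carrier M \<and> w \<in> carrier M" for z w
      using that by (auto simp: v_def qd less_2 intro!: eq_vecI)
     show "v (c \<odot>\<^bsub>M\<^esub> z) = c \<odot>\<^bsub>J 1\<^esub> v z" if "c \<in> carrier class_ring \<and> z \<in> carrier M" for c z
      using that by (auto simp: v_def qd less_2 intro!: eq_vecI)
     show "v (\<delta> z) = act 1 (v z)" if "z \<in> carrier M" for z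
     proof (rule eq_vecI)
      have vz: "v z \<in> carrier_vec 2"
       using that by (simp add: v_def)
      show "dim_vec (v (\<delta> z)) = dim_vec (act 1 (v z))"
       using that \<delta>_closed[OF that] carrier_vecD[OF jordan_action_carrier[OF vz]] by (simp add: v_def)
      fix j assume "j < dim_vec (act 1 (v z))"
      then have "j = 0 \<or> j = 1"
       using carrier_vecD[OF jordan_action_carrier[OF vz]] by auto
      then show "v (\<delta> z) $ j = act 1 (v z) $ j"
       using jordan_action_two[OF vz] that \<delta>_closed[OF that] q_d_d[OF \<theta>_carrier[OF that]]
       by (auto simp: v_def \<theta>_simps simp del: One_nat_def)
     qed
    qed
    then have "v (\<delta> x) $ 0 + v (\<delta> x) $ 0 = 0"
     using neg trace p by (auto simp: negligible_def)
    then have "v (\<delta> x) $ 0 = 0"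
     using two_neq_zero by (simp flip: mult_2)
    then show "lookup (\<psi> p x) i = lookup 0 i"
     using xM \<delta>_closed[OF xM] p by (simp add: v_def \<psi>_def \<theta>_simps)
   qed
  qed
 qed
 have "negligible (J p) (act p) M \<delta> \<subseteq> hom_of p ` Z p"
  unfolding rep_hom_eq[symmetric] by (auto simp: negligible_def)
 then show ?thesis
  using key by auto
qed

text \<open>The cosets modulo negligible morphisms turn out to be the fibres of
  \<open>\<psi>\<close>. Each is thus labelled by a vector of the model, and the operations on
  cosets, which are sums and unions of sets, are computed on the labels.\<close>

definition fib :: "bit \<Rightarrow> ('b \<Rightarrow>\<^sub>0 'k) \<Rightarrow> ('k vec \<Rightarrow> 'v) set" where
 "fib p m = hom_of p ` {x \<in> Z p. \<psi> p x = m}"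

lemma fib_nonempty: "m \<in> part N.L p \<Longrightarrow> \<exists>x\<in>Z p. \<psi> p x = m \<and> hom_of p x \<in> fib p m"
 using \<psi>_surj[of m p] by (auto simp: fib_def)

lemma M_diff_add: "\<lbrakk>x \<in> carrier M; y \<in> carrier M\<rbrakk> \<Longrightarrow> (x \<ominus>\<^bsub>M\<^esub> y) \<oplus>\<^bsub>M\<^esub> y = x"
 by (rule \<theta>_eqI) (auto simp: \<theta>_simps \<theta>_minus)

lemma fib_add:
 assumes "m \<in> part N.L p" "m' \<in> part N.L p"
 shows "fib p m <+>\<^bsub>Hom p\<^esub> fib p m' = fib p (m + m')"
proof
 show "fib p m <+>\<^bsub>Hom p\<^esub> fib p m' \<subseteq> fib p (m + m')"
  unfolding set_add_def' fib_def
  by (auto simp: Hom_add Z_carrier \<psi>_linear Z_closed intro!: imageI)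
 show "fib p (m + m') \<subseteq> fib p m <+>\<^bsub>Hom p\<^esub> fib p m'"
 proof
  fix f assume "f \<in> fib p (m + m')"
  then obtain x where x: "x \<in> Z p" "\<psi> p x = m + m'" "f = hom_of p x"
   by (auto simp: fib_def)
  obtain y where y: "y \<in> Z p" "\<psi> p y = m'"
   using \<psi>_surj[OF assms(2)] by blast
  note c = Z_carrier[OF x(1)] Z_carrier[OF y(1)]
  have "hom_of p (x \<ominus>\<^bsub>M\<^esub> y) \<in> fib p m" "hom_of p y \<in> fib p m'"
   using x y c Z_closed(2)[OF x(1) y(1)] by (auto simp: fib_def \<psi>_linear)
  moreover have "f = hom_of p (x \<ominus>\<^bsub>M\<^esub> y) \<oplus>\<^bsub>Hom p\<^esub> hom_of p y"
   using c x(3) by (simp add: Hom_add M_diff_add)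
  ultimately show "f \<in> fib p m <+>\<^bsub>Hom p\<^esub> fib p m'"
   unfolding set_add_def' by blast
 qed
qed

lemma fib_coset:
 assumes "x \<in> Z p"
 shows "negligible (J p) (act p) M \<delta> +>\<^bsub>Hom p\<^esub> hom_of p x = fib p (\<psi> p x)"
proof
 show "negligible (J p) (act p) M \<delta> +>\<^bsub>Hom p\<^esub> hom_of p x \<subseteq> fib p (\<psi> p x)"
  unfolding a_r_coset_def' negligible_eq fib_def using assms
  by (auto simp: Hom_add Z_carrier \<psi>_linear Z_closed intro!: imageI)
 show "fib p (\<psi> p x) \<subseteq> negligible (J p) (act p) M \<delta> +>\<^bsub>Hom p\<^esub> hom_of p x"
 proof
  fix f assume "f \<in> fib p (\<psi> p x)"
  then obtain y where y: "y \<in> Z p" "\<psi> p y = \<psi> p x" "f = hom_of p y"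
   by (auto simp: fib_def)
  note c = Z_carrier[OF assms] Z_carrier[OF y(1)]
  have "hom_of p (y \<ominus>\<^bsub>M\<^esub> x) \<in> negligible (J p) (act p) M \<delta>"
   using y c Z_closed(2)[OF y(1) assms] by (auto simp: negligible_eq \<psi>_linear)
  moreover have "f = hom_of p (y \<ominus>\<^bsub>M\<^esub> x) \<oplus>\<^bsub>Hom p\<^esub> hom_of p x"
   using c y(3) by (simp add: Hom_add M_diff_add)
  ultimately show "f \<in> negligible (J p) (act p) M \<delta> +>\<^bsub>Hom p\<^esub> hom_of p x"
   unfolding a_r_coset_def' by blast
 qed
qed

lemma fib_smult:
 assumes "m \<in> part N.L p"
 shows "coset_smult (Hom p) (negligible (J p) (act p) M \<delta>) c (fib p m) = fib p (pm_smult c m)"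
proof -
 have "negligible (J p) (act p) M \<delta> +>\<^bsub>Hom p\<^esub> (c \<odot>\<^bsub>Hom p\<^esub> f) = fib p (pm_smult c m)" if "f \<in> fib p m" for f
  using that fib_coset[OF Z_closed(3)] by (auto simp: fib_def Hom_smult Z_carrier \<psi>_linear)
 then show ?thesis
  using fib_nonempty[OF assms] unfolding coset_smult_def by auto
qed

lemma ver3_part_simps:
 "carrier (ver3_part M \<delta> p) = fib p ` part N.L p"
 "zero (ver3_part M \<delta> p) = fib p 0"
 "add (ver3_part M \<delta> p) = set_add (Hom p)"
 "module.smult (ver3_part M \<delta> p) = coset_smult (Hom p) (negligible (J p) (act p) M \<delta>)"
proof -
 have "a_rcosets\<^bsub>Hom p\<^esub> (negligible (J p) (act p) M \<delta>) = fib p ` part N.L p"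
 proof -
  have "a_rcosets\<^bsub>Hom p\<^esub> (negligible (J p) (act p) M \<delta>) = (\<lambda>x. fib p (\<psi> p x)) ` Z p"
   using fib_coset unfolding A_RCOSETS_def' by (auto simp: hom_space_def rep_hom_eq)
  also have "\<dots> = fib p ` part N.L p"
  proof -
   have "\<psi> p ` Z p = part N.L p"
    using \<psi>_part Z_carrier \<psi>_surj[of _ p] by blast
   then show ?thesis
    by (metis image_image)
  qed
  finally show ?thesis .
 qed
 then show "carrier (ver3_part M \<delta> p) = fib p ` part N.L p"
  by (simp add: ver3_part_def ver3_hom_space_def Let_def)
 show "zero (ver3_part M \<delta> p) = fib p 0"
  by (simp add: ver3_part_def ver3_hom_space_def Let_def negligible_eq fib_def)
 show "add (ver3_part M \<delta> p) = set_add (Hom p)"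
  "module.smult (ver3_part M \<delta> p) = coset_smult (Hom p) (negligible (J p) (act p) M \<delta>)"
  by (simp_all add: ver3_part_def ver3_hom_space_def Let_def)
qed


text \<open>The element whose morphism is the bracket of the morphisms of x and y. The odd case
  reflects the embedding of L_1 into L_2 \<otimes> L_2 chosen in
  \<open>simple_fusion\<close>.\<close>

definition Br :: "bit \<Rightarrow> bit \<Rightarrow> 'v \<Rightarrow> 'v \<Rightarrow> 'v" where
 "Br p p' x y = (if p = 1 \<and> p' = 1 then \<delta> x \<otimes>\<^bsub>M\<^esub> y \<ominus>\<^bsub>M\<^esub> x \<otimes>\<^bsub>M\<^esub> \<delta> y else x \<otimes>\<^bsub>M\<^esub> y)"

lemma Br_carrier: "\<lbrakk>x \<in> carrier M; y \<in> carrier M\<rbrakk> \<Longrightarrow> Br p p' x y \<in> carrier M"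
 by (simp add: Br_def \<delta>_closed M.bracket_closed)

lemma \<theta>_Br:
 "\<lbrakk>x \<in> carrier M; y \<in> carrier M\<rbrakk> \<Longrightarrow> \<theta> (Br p p' x y) =
  (if p = 1 \<and> p' = 1 then d (\<theta> x) \<bullet> \<theta> y - \<theta> x \<bullet> d (\<theta> y) else \<theta> x \<bullet> \<theta> y)"
 by (simp add: Br_def \<theta>_minus \<theta>_simps \<delta>_closed M.bracket_closed)

lemma Br_Z_\<psi>:
 assumes "x \<in> Z p" "y \<in> Z p'"
 shows "Br p p' x y \<in> Z (p + p')" "\<psi> (p + p') (Br p p' x y) = bi_ext bN (\<psi> p x) (\<psi> p' y)"
proof -
 note c = Z_carrier[OF assms(1)] Z_carrier[OF assms(2)]
 note t = \<theta>_carrier[OF c(1)] \<theta>_carrier[OF c(2)]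
 note dt = closed(1)[OF t(1)] closed(1)[OF t(2)]
 have "Br p p' x y \<in> Z (p + p') \<and> \<psi> (p + p') (Br p p' x y) = bi_ext bN (\<psi> p x) (\<psi> p' y)"
 proof (cases "p = 0"; cases "p' = 0")
  assume p: "p = 0" "p' = 0"
  then have z: "d (\<theta> x) = 0" "d (\<theta> y) = 0"
   using assms Z_\<theta> by auto
  have "d (\<theta> x \<bullet> \<theta> y) = 0"
   using derivation[OF t] z by (simp add: br_simps)
  then show ?thesis
   using p r_bracket[OF t(1) z(1) t(2) z(2)] Z_I(1)[OF Br_carrier[OF c]]
   by (simp add: \<theta>_Br[OF c] \<psi>_def)
 next
  assume p: "p = 0" "p' \<noteq> 0"
  then have p': "p' = 1"
   using bit_cases by blast
  then have z: "d (\<theta> x) = 0" "d (d (\<theta> y)) = 0"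
   using p assms Z_\<theta> by auto
  have "d (d (\<theta> x \<bullet> \<theta> y)) = 0"
   using derivation[OF t] derivation[OF t(1) dt(2)] z by (simp add: br_simps lin_simps)
  then show ?thesis
   using p p' q_bracket[OF t(1) z(1) t(2) z(2)] Z_I(2)[OF Br_carrier[OF c]]
   by (simp add: \<theta>_Br[OF c] \<psi>_def)
 next
  assume p: "p \<noteq> 0" "p' = 0"
  then have p': "p = 1"
   using bit_cases by blast
  then have z: "d (d (\<theta> x)) = 0" "d (\<theta> y) = 0"
   using p assms Z_\<theta> by auto
  have "d (d (\<theta> x \<bullet> \<theta> y)) = 0"
   using derivation[OF t] derivation[OF dt(1) t(2)] z by (simp add: br_simps lin_simps)
  then show ?thesis
   using p p' q_bracket'[OF t(1) z(1) t(2) z(2)] Z_I(2)[OF Br_carrier[OF c]]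
   by (simp add: \<theta>_Br[OF c] \<psi>_def)
 next
  assume "p \<noteq> 0" "p' \<noteq> 0"
  then have p: "p = 1" "p' = 1"
   using bit_cases by blast+
  then have z: "d (d (\<theta> x)) = 0" "d (d (\<theta> y)) = 0"
   using assms Z_\<theta> by auto
  have "d (d (\<theta> x) \<bullet> \<theta> y - \<theta> x \<bullet> d (\<theta> y)) = 0"
   using derivation[OF dt(1) t(2)] derivation[OF t(1) dt(2)] z by (simp add: br_simps lin_simps)
  then show ?thesis
   using p r_bracket_odd[OF t(1) z(1) t(2) z(2)] Z_I(1)[OF Br_carrier[OF c]]
   by (simp add: \<theta>_Br[OF c] \<psi>_def)
 qed
 then show "Br p p' x y \<in> Z (p + p')" "\<psi> (p + p') (Br p p' x y) = bi_ext bN (\<psi> p x) (\<psi> p' y)"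
  by simp_all
qed

text \<open>When one factor is even, its element is a cocycle, so d of the bracket is the bracket
  with d of the odd factor; the two coordinates of v pair exactly these two values. When both are
  odd, only the two off-diagonal entries of \<open>simple_fusion\<close> are nonzero.\<close>

lemma hom_bracket_eq:
 assumes "x \<in> Z p" "y \<in> Z p'"
 shows "hom_bracket M p p' (hom_of p x) (hom_of p' y) = hom_of (p + p') (Br p p' x y)"
proof -
 note x = Z_carrier[OF assms(1)] and y = Z_carrier[OF assms(2)]
 show ?thesis
 unfolding hom_bracket_def
proof (rule hom_of_eqI[OF _ Br_carrier[OF x y]])
 fix v :: "'k vec" assume v: "v \<in> carrier (J (p + p'))"
 let ?T = "simple_fusion p p' v" and ?f = "hom_of p x" and ?g = "hom_of p' y"
 have unit: "unit_vec (simple_dim p) i \<in> carrier (J p)" for p i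
  by simp
 have f: "?f (unit_vec (simple_dim p) i) \<in> carrier M" and g: "?g (unit_vec (simple_dim p') i) \<in> carrier M" for i
  using hom_of_closed[OF x unit] hom_of_closed[OF y unit] by blast+
 have T: "dim_row ?T = simple_dim p" "dim_col ?T = simple_dim p'"
  by (simp_all add: simple_fusion_def)
 let ?h = "\<lambda>i j. ?T $$ (i, j) \<odot>\<^bsub>M\<^esub> (?f (unit_vec (simple_dim p) i) \<otimes>\<^bsub>M\<^esub> ?g (unit_vec (simple_dim p') j))"
 have h: "?h i j \<in> carrier M" for i j
  using f g by (simp add: M.bracket_closed)
 have inner: "\<theta> (\<Oplus>\<^bsub>M\<^esub>j\<in>{..<simple_dim p'}. ?h i j) = (\<Sum>j<simple_dim p'. \<theta> (?h i j)) \<and> (\<Oplus>\<^bsub>M\<^esub>j\<in>{..<simple_dim p'}. ?h i j) \<in> carrier M" for i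
  by (rule \<theta>_finsum) (simp_all add: h)
 have outer: "\<theta> (bracket_on_tensor M ?f ?g ?T) = (\<Sum>i<simple_dim p. \<theta> (\<Oplus>\<^bsub>M\<^esub>j\<in>{..<simple_dim p'}. ?h i j)) \<and> bracket_on_tensor M ?f ?g ?T \<in> carrier M"
  unfolding bracket_on_tensor_def T by (rule \<theta>_finsum) (simp_all add: inner)
 have "\<theta> (bracket_on_tensor M ?f ?g ?T) =
   (\<Sum>i<simple_dim p. \<Sum>j<simple_dim p'. pm_smult (?T $$ (i, j)) (\<theta> (?f (unit_vec (simple_dim p) i)) \<bullet> \<theta> (?g (unit_vec (simple_dim p') j))))"
  using outer inner f g by (simp add: \<theta>_simps M.bracket_closed)
 also have "\<dots> = \<theta> (hom_of (p + p') (Br p p' x y) v)"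
 proof -
  have sum2: "sum a {..<2 :: nat} = a 0 + a 1" for a :: "nat \<Rightarrow> 'a \<Rightarrow>\<^sub>0 'k"
   by (simp add: numeral_2_eq_2)
  have sum1: "sum a {..<1 :: nat} = a 0" for a :: "nat \<Rightarrow> 'a \<Rightarrow>\<^sub>0 'k"
   by simp
  note c = closed(1)[OF \<theta>_carrier[OF x]] closed(1)[OF \<theta>_carrier[OF y]] \<theta>_carrier[OF x] \<theta>_carrier[OF y]
  have f_unit: "\<theta> (hom_of 0 z (unit_vec 1 0)) = \<theta> z" "\<theta> (hom_of 1 z (unit_vec 2 0)) = d (\<theta> z)"
   "\<theta> (hom_of 1 z (unit_vec 2 1)) = \<theta> z" if "z \<in> carrier M" for z
   using that by (subst \<theta>_hom_of; simp)+
  have rhs: "\<theta> (hom_of (p + p') (Br p p' x y) v) = (if p + p' = 0 then pm_smult (v $ 0) (\<theta> (Br p p' x y))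
    else pm_smult (v $ 0) (d (\<theta> (Br p p' x y))) + pm_smult (v $ 1) (\<theta> (Br p p' x y)))"
   by (rule \<theta>_hom_of[OF Br_carrier[OF x y] v])
  show ?thesis
  proof (cases "p = 0"; cases "p' = 0")
   assume p: "p = 0" "p' = 0"
   then show ?thesis
    unfolding rhs \<theta>_Br[OF x y] using f_unit(1)[OF x] f_unit(1)[OF y]
    by (simp add: simple_fusion_def)
  next
   assume p: "p = 0" "p' \<noteq> 0"
   then have p': "p' = 1"
    using bit_cases by blast
   have z: "d (\<theta> x) = 0"
    using assms(1) p Z_\<theta>(1) by simp
   have "d (\<theta> x \<bullet> \<theta> y) = \<theta> x \<bullet> d (\<theta> y)"
    using derivation[OF c(3,4)] z by (simp add: br_simps)
   then show ?thesis
    unfolding rhs \<theta>_Br[OF x y] using p p' f_unit(1)[OF x] f_unit(2,3)[OF y]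
    by (simp add: simple_fusion_def sum1 sum2 del: One_nat_def)
  next
   assume p: "p \<noteq> 0" "p' = 0"
   then have p': "p = 1"
    using bit_cases by blast
   have z: "d (\<theta> y) = 0"
    using assms(2) p Z_\<theta>(1) by simp
   have "d (\<theta> x \<bullet> \<theta> y) = d (\<theta> x) \<bullet> \<theta> y"
    using derivation[OF c(3,4)] z by (simp add: br_simps)
   then show ?thesis
    unfolding rhs \<theta>_Br[OF x y] using p p' f_unit(1)[OF y] f_unit(2,3)[OF x]
    by (simp add: simple_fusion_def sum1 sum2 del: One_nat_def)
  next
   assume "p \<noteq> 0" "p' \<noteq> 0"
   then have p: "p = 1" "p' = 1"
    using bit_cases by blast+
   show ?thesis
    unfolding rhs \<theta>_Br[OF x y] using p f_unit(2,3)[OF x] f_unit(2,3)[OF y]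
    by (simp add: simple_fusion_def sum1 sum2 pm_smult_diff pm_smult_minus del: One_nat_def)
  qed
 qed
 finally show "bracket_on_tensor M ?f ?g ?T \<in> carrier M \<and>
   \<theta> (bracket_on_tensor M ?f ?g ?T) = \<theta> (hom_of (p + p') (Br p p' x y) v)"
  using outer by simp
qed
qed

lemma ver3_bracket_fib:
 assumes "m \<in> part N.L p" "m' \<in> part N.L p'"
 shows "ver3_bracket M \<delta> p p' (fib p m) (fib p' m') = fib (p + p') (bi_ext bN m m')"
proof -
 have "negligible (J (p + p')) (act (p + p')) M \<delta> +>\<^bsub>Hom (p + p')\<^esub> hom_bracket M p p' f g = fib (p + p') (bi_ext bN m m')"
  if fg: "f \<in> fib p m" "g \<in> fib p' m'" for f g
 proof -
  obtain x y where xy: "x \<in> Z p" "\<psi> p x = m" "f = hom_of p x" "y \<in> Z p'" "\<psi> p' y = m'" "g = hom_of p' y"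
   using fg by (auto simp: fib_def)
  show ?thesis
   using hom_bracket_eq[OF xy(1,4)] fib_coset[OF Br_Z_\<psi>(1)[OF xy(1,4)]] Br_Z_\<psi>(2)[OF xy(1,4)] xy
   by simp
 qed
 then show ?thesis
  using fib_nonempty[OF assms(1)] fib_nonempty[OF assms(2)] unfolding ver3_bracket_def Let_def by auto
qed

lemma fib_inj:
 assumes "m \<in> part N.L p" "fib p m = fib p m'"
 shows "m = m'"
proof -
 obtain x where x: "x \<in> Z p" "\<psi> p x = m" "hom_of p x \<in> fib p m"
  using fib_nonempty[OF assms(1)] by blast
 then obtain y where y: "y \<in> Z p" "\<psi> p y = m'" "hom_of p x = hom_of p y"
  using assms(2) by (auto simp: fib_def)
 have "x = y"
 proof (rule \<theta>_eqI[OF Z_carrier[OF x(1)] Z_carrier[OF y(1)]])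
  note c = Z_carrier[OF x(1)] Z_carrier[OF y(1)]
  \<comment> \<open>The generator of the block: index 0 in J_1 and index 1 in J_2. Evaluating there
    recovers x from its morphism.\<close>
  let ?e = "unit_vec (simple_dim p) (simple_dim p - 1) :: 'k vec"
  have e: "?e \<in> carrier (J p)"
   by simp
  have "\<theta> (hom_of p z ?e) = \<theta> z" if "z \<in> carrier M" for z
   unfolding \<theta>_hom_of[OF that e] by (simp add: simple_dim_def)
  then show "\<theta> x = \<theta> y"
   using c y(3) by metis
 qed
 then show ?thesis
  using x y by simp
qed

definition \<Psi> :: "('b \<Rightarrow>\<^sub>0 'k) \<Rightarrow> ('k vec \<Rightarrow> 'v) set \<times> ('k vec \<Rightarrow> 'v) set" where
 "\<Psi> m = (fib 0 (pm_restrict {u. parN u = 0} m), fib 1 (pm_restrict {u. parN u = 1} m))"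

text \<open>Labelling makes the semisimplification a surjective image of the model, so its Lie
  superalgebra axioms are transported along \<open>\<Psi>\<close> and never have to be verified on
  sets of morphisms.\<close>

lemma semisimplification_copy: "lie_copy N.L (semisimplification M \<delta>) \<Psi>"
proof -
 let ?r = "\<lambda>p. pm_restrict {u. parN u = p} :: ('b \<Rightarrow>\<^sub>0 'k) \<Rightarrow> _"
 let ?S = "semisimplification M \<delta>"
 have part: "part N.L p = {m \<in> carrier N.L. \<forall>u\<in>keys m. parN u = p}" for p
  by auto
 have r: "?r p m \<in> part N.L p" if "m \<in> carrier N.L" for p m
  using that by (auto simp: keys_pm_restrict)
 have split: "m = ?r 0 m + ?r 1 m" for m
  by (rule poly_mapping_eqI) (use bit_cases in \<open>auto simp: lookup_add lookup_pm_restrict\<close>)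
 have rr: "?r p m = (if p = p' then m else 0)" if "m \<in> part N.L p'" for p p' m
  using that by (auto intro!: poly_mapping_eqI simp: lookup_pm_restrict in_keys_iff)
 have bracket_closed: "bi_ext bN m m' \<in> part N.L (p + p')" if "m \<in> part N.L p" "m' \<in> part N.L p'" for m m' p p'
  using N.keys_bracket_part[OF that] .
 have add: "?r p (m + m') = ?r p m + ?r p m'" for p m m'
  by (simp add: pm_linear_add[OF pm_restrict_linear])
 have bracket: "?r 0 (bi_ext bN m m') = bi_ext bN (?r 0 m) (?r 0 m') + bi_ext bN (?r 1 m) (?r 1 m')"
  "?r 1 (bi_ext bN m m') = bi_ext bN (?r 0 m) (?r 1 m') + bi_ext bN (?r 1 m) (?r 0 m')"
  if m: "m \<in> carrier N.L" and m': "m' \<in> carrier N.L" for m m'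
 proof -
  have "bi_ext bN m m' = (bi_ext bN (?r 0 m) (?r 0 m') + bi_ext bN (?r 1 m) (?r 1 m')) +
    (bi_ext bN (?r 0 m) (?r 1 m') + bi_ext bN (?r 1 m) (?r 0 m'))"
   by (subst split[of m], subst split[of m']) (simp add: bi_ext_linear_simps)
  moreover have "bi_ext bN (?r p m) (?r p' m') \<in> part N.L (p + p')" for p p'
   using bracket_closed[OF r[OF m] r[OF m']] .
  from this[of 0 0] this[of 1 1] this[of 0 1] this[of 1 0]
  have "?r p (bi_ext bN (?r 0 m) (?r 0 m')) = (if p = 0 then bi_ext bN (?r 0 m) (?r 0 m') else 0)"
   "?r p (bi_ext bN (?r 1 m) (?r 1 m')) = (if p = 0 then bi_ext bN (?r 1 m) (?r 1 m') else 0)"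
   "?r p (bi_ext bN (?r 0 m) (?r 1 m')) = (if p = 1 then bi_ext bN (?r 0 m) (?r 1 m') else 0)"
   "?r p (bi_ext bN (?r 1 m) (?r 0 m')) = (if p = 1 then bi_ext bN (?r 1 m) (?r 0 m') else 0)" for p
   by (simp_all add: rr del: basis_superalg_simps(6))
  ultimately show "?r 0 (bi_ext bN m m') = bi_ext bN (?r 0 m) (?r 0 m') + bi_ext bN (?r 1 m) (?r 1 m')"
   "?r 1 (bi_ext bN m m') = bi_ext bN (?r 0 m) (?r 1 m') + bi_ext bN (?r 1 m) (?r 0 m')"
   by (simp_all add: add)
 qed
 note simps = semisimplification_def Let_def ver3_part_simps
 have zero: "0 \<in> part N.L p" for p
  by simp
 have image: "\<Psi> ` carrier N.L = fib 0 ` part N.L 0 \<times> fib 1 ` part N.L 1"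
 proof
  show "\<Psi> ` carrier N.L \<subseteq> fib 0 ` part N.L 0 \<times> fib 1 ` part N.L 1"
   using r unfolding \<Psi>_def by blast
  have "(fib 0 m, fib 1 m') \<in> \<Psi> ` carrier N.L" if m: "m \<in> part N.L 0" "m' \<in> part N.L 1" for m m'
  proof -
   have "\<Psi> (m + m') = (fib 0 m, fib 1 m')"
    unfolding \<Psi>_def add using rr[OF m(1)] rr[OF m(2)] by simp
   moreover have "m + m' \<in> carrier N.L"
    using m keys_add[of m m'] by auto
   ultimately show ?thesis
    by (metis imageI)
  qed
  then show "fib 0 ` part N.L 0 \<times> fib 1 ` part N.L 1 \<subseteq> \<Psi> ` carrier N.L"
   by blast
 qed
 have epi: "algebra_epi N.L ?S \<Psi>"
  unfolding algebra_epi_def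
 proof (intro conjI ballI allI)
  show "\<Psi> ` carrier N.L = carrier ?S"
   unfolding image by (simp add: simps del: basis_superalg_simps(6))
  show "\<Psi> \<zero>\<^bsub>N.L\<^esub> = \<zero>\<^bsub>?S\<^esub>"
   using rr[OF zero] by (simp add: \<Psi>_def simps)
  fix m m' assume m: "m \<in> carrier N.L" "m' \<in> carrier N.L"
  have fa: "fib p (?r p m) <+>\<^bsub>Hom p\<^esub> fib p (?r p m') = fib p (?r p m + ?r p m')" for p
   by (rule fib_add[OF r[OF m(1)] r[OF m(2)]])
  show "\<Psi> (m \<oplus>\<^bsub>N.L\<^esub> m') = \<Psi> m \<oplus>\<^bsub>?S\<^esub> \<Psi> m'"
   using fa[of 0] fa[of 1] by (simp add: \<Psi>_def simps add)
  have vb: "ver3_bracket M \<delta> p p' (fib p (?r p m)) (fib p' (?r p' m')) = fib (p + p') (bi_ext bN (?r p m) (?r p' m'))" for p p'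
   by (rule ver3_bracket_fib[OF r[OF m(1)] r[OF m(2)]])
  have bc: "bi_ext bN (?r p m) (?r p' m') \<in> part N.L (p + p')" for p p'
   by (rule bracket_closed[OF r[OF m(1)] r[OF m(2)]])
  have bc': "bi_ext bN (?r 0 m) (?r 0 m') \<in> part N.L 0" "bi_ext bN (?r 1 m) (?r 1 m') \<in> part N.L 0"
   "bi_ext bN (?r 0 m) (?r 1 m') \<in> part N.L 1" "bi_ext bN (?r 1 m) (?r 0 m') \<in> part N.L 1"
   using bc[of 0 0] bc[of 1 1] bc[of 0 1] bc[of 1 0] by simp_all
  show "\<Psi> (m \<otimes>\<^bsub>N.L\<^esub> m') = \<Psi> m \<otimes>\<^bsub>?S\<^esub> \<Psi> m'"
   using fib_add[OF bc'(1,2)] fib_add[OF bc'(3,4)] vb[of 0 0] vb[of 1 1] vb[of 0 1] vb[of 1 0]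
   by (simp add: \<Psi>_def simps bracket[OF m])
 next
  fix c m assume m: "m \<in> carrier N.L"
  show "\<Psi> (c \<odot>\<^bsub>N.L\<^esub> m) = c \<odot>\<^bsub>?S\<^esub> \<Psi> m"
   using fib_smult[OF r[OF m, of 0]] fib_smult[OF r[OF m, of 1]]
   by (simp add: \<Psi>_def simps pm_linear_smult[OF pm_restrict_linear])
 qed
 have part: "part ?S p = \<Psi> ` part N.L p" for p
 proof (cases "p = 0")
  case True
  have "part ?S 0 = (\<lambda>m. (fib 0 m, fib 1 0)) ` part N.L 0"
   by (auto simp: simps)
  also have "\<dots> = \<Psi> ` part N.L 0"
   using rr by (intro image_cong) (simp_all add: \<Psi>_def del: basis_superalg_simps(6))
  finally show ?thesis
   using True by simp
 next
  case False
  then have p: "p = 1"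
   using bit_cases by blast
  have "part ?S 1 = (\<lambda>m. (fib 0 0, fib 1 m)) ` part N.L 1"
   by (auto simp: simps)
  also have "\<dots> = \<Psi> ` part N.L 1"
   using rr by (intro image_cong) (simp_all add: \<Psi>_def del: basis_superalg_simps(6))
  finally show ?thesis
   using p by simp
 qed
 have lie: "lie_superalgebra ?S"
 proof (rule algebra_epi_lie_superalgebra[OF N.lie_superalgebra_basis_superalg epi part])
  show "part ?S 0 \<inter> part ?S 1 \<subseteq> {\<zero>\<^bsub>?S\<^esub>}"
   by (auto simp: simps)
 qed
 have "inj_on \<Psi> (carrier N.L)"
 proof (rule inj_onI)
  fix m m' assume m: "m \<in> carrier N.L" "m' \<in> carrier N.L" "\<Psi> m = \<Psi> m'"
  have "?r p m = ?r p m'" for p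
   using fib_inj[OF r[OF m(1)]] m(3) bit_cases[of p] unfolding \<Psi>_def by auto
  then show "m = m'"
   using split[of m] split[of m'] by simp
 qed
 then show ?thesis
  using N.lie_superalgebra_basis_superalg lie epi part by (simp add: lie_copy_def)
qed

end

section \<open>The derived algebra modulo its center\<close>

lemma derived_superalg_simps [simp]:
 "mult (derived_superalg L) = mult L" "zero (derived_superalg L) = zero L"
 "add (derived_superalg L) = add L" "module.smult (derived_superalg L) = module.smult L"
 "part (derived_superalg L) p = part L p \<inter> carrier (derived_superalg L)"
 by (simp_all add: derived_superalg_def Let_def)

lemma (in bracket_algebra) derived_carrier:
 "VectorSpace.subspace class_ring (carrier (derived_superalg L)) L"
 "\<lbrakk>x \<in> carrier L; y \<in> carrier L\<rbrakk> \<Longrightarrow> x \<otimes> y \<in> carrier (derived_superalg L)"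
proof -
 let ?X = "{x \<otimes> y | x y. x \<in> carrier L \<and> y \<in> carrier L}"
 have X: "?X \<subseteq> carrier L"
  using bracket_closed by auto
 have eq: "carrier (derived_superalg L) = span ?X"
  unfolding derived_superalg_def Let_def by simp
 show "VectorSpace.subspace class_ring (carrier (derived_superalg L)) L"
  unfolding eq by (rule span_is_subspace[OF X])
 show "x \<otimes> y \<in> carrier (derived_superalg L)" if "x \<in> carrier L" "y \<in> carrier L"
  using in_own_span[OF X] that unfolding eq by blast
qed

lemma (in bracket_algebra) derived_bracket_algebra: "bracket_algebra (derived_superalg L)"
proof -
 let ?D = "derived_superalg L"
 note D = subspaceD[OF derived_carrier(1)]
 have sub: "x \<in> carrier L" if "x \<in> carrier ?D" for x
  using D(1) that by blast
 have "vectorspace class_ring ?D"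
 proof (rule vs_criteria[OF class_field.field_axioms])
  show "\<forall>v\<in>carrier ?D. \<exists>w\<in>carrier ?D. v \<oplus>\<^bsub>?D\<^esub> w = \<zero>\<^bsub>?D\<^esub>"
  proof
   fix v assume v: "v \<in> carrier ?D"
   then have "v \<oplus> (- 1) \<odot>\<^bsub>L\<^esub> v = \<zero>"
    using minus_eq_smult[OF sub[OF v]] r_neg[OF sub[OF v]] by simp
   then show "\<exists>w\<in>carrier ?D. v \<oplus>\<^bsub>?D\<^esub> w = \<zero>\<^bsub>?D\<^esub>"
    using D(4)[OF v] by (metis derived_superalg_simps(2,3))
  qed
 qed (use D sub in \<open>simp_all add: smult_smult smult_add_scalar smult_add a_ac smult_one_scalar\<close>)
 then show ?thesis
  using derived_carrier(2) sub
  by (simp add: bracket_algebra_def bracket_algebra_axioms_def bracket_add_left bracket_add_right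
   bracket_smult_left bracket_smult_right)
qed

lemma algebra_epi_span:
 assumes L: "bracket_algebra L" and epi: "algebra_epi L M \<phi>" and X: "X \<subseteq> carrier L"
 shows "\<phi> ` LinearCombinations.module.span class_ring L X = LinearCombinations.module.span class_ring M (\<phi> ` X)"
proof -
 interpret L: bracket_algebra L by fact
 interpret M: bracket_algebra M
  by (rule algebra_epi_bracket_algebra[OF L epi])
 note \<phi> = algebra_epiD[OF epi]
 have X': "\<phi> ` X \<subseteq> carrier M"
  using X \<phi>(3) by auto
 note spanL = L.subspaceD[OF L.span_is_subspace[OF X]] and spanM = M.subspaceD[OF M.span_is_subspace[OF X']]
 show ?thesis
 proof
  have "VectorSpace.subspace class_ring {x \<in> carrier L. \<phi> x \<in> M.span (\<phi> ` X)} L"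
   by (rule L.subspaceI) (use spanM in \<open>auto simp: \<phi>\<close>)
  then have "L.span X \<subseteq> {x \<in> carrier L. \<phi> x \<in> M.span (\<phi> ` X)}"
   using X M.in_own_span[OF X'] by (intro L.span_is_subset) (auto simp: VectorSpace.subspace_def)
  then show "\<phi> ` L.span X \<subseteq> M.span (\<phi> ` X)"
   by auto
  have "VectorSpace.subspace class_ring (\<phi> ` L.span X) M"
  proof (rule M.subspaceI)
   show "\<phi> ` L.span X \<subseteq> carrier M"
    using spanL(1) \<phi>(3) by auto
   show "\<zero>\<^bsub>M\<^esub> \<in> \<phi> ` L.span X"
    using spanL(2) \<phi>(2) by (metis imageI)
   fix x assume "x \<in> \<phi> ` L.span X"
   then obtain a where a: "a \<in> L.span X" "x = \<phi> a"
    by blast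
   then have aL: "a \<in> carrier L"
    using spanL(1) by blast
   show "c \<odot>\<^bsub>M\<^esub> x \<in> \<phi> ` L.span X" for c
    using spanL(4)[OF a(1), of c] \<phi>(6)[OF aL, of c] a(2) by (metis imageI)
   fix y assume "y \<in> \<phi> ` L.span X"
   then obtain a' where a': "a' \<in> L.span X" "y = \<phi> a'"
    by blast
   then have "a' \<in> carrier L"
    using spanL(1) by blast
   then show "x \<oplus>\<^bsub>M\<^esub> y \<in> \<phi> ` L.span X"
    using spanL(3)[OF a(1) a'(1)] \<phi>(4)[OF aL] a(2) a'(2) by (metis imageI)
  qed
  then show "M.span (\<phi> ` X) \<subseteq> \<phi> ` L.span X"
   using L.in_own_span[OF X] by (intro M.span_is_subset) (auto simp: VectorSpace.subspace_def)
 qed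
qed

text \<open>The last claim places a given element, such as a sum of Chevalley generators, in the
  derived algebra by looking at its image in the model.\<close>

lemma derived_superalg_copy:
 assumes copy: "lie_copy G L \<theta>"
 shows "algebra_epi (derived_superalg G) (derived_superalg L) \<theta>"
  "inj_on \<theta> (carrier (derived_superalg G))" "\<theta> ` part (derived_superalg G) p = part (derived_superalg L) p"
  "\<And>x. \<lbrakk>x \<in> carrier G; \<theta> x \<in> carrier (derived_superalg L)\<rbrakk> \<Longrightarrow> x \<in> carrier (derived_superalg G)"
proof -
 note c = copy[unfolded lie_copy_def]
 have epi: "algebra_epi G L \<theta>"
  using c by simp
 note \<theta> = algebra_epiD[OF epi]
 interpret G: bracket_algebra G
  using c lie_superalgebra_bracket_algebra by blast
 let ?X = "{x \<otimes>\<^bsub>G\<^esub> y | x y. x \<in> carrier G \<and> y \<in> carrier G}"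
 have X: "?X \<subseteq> carrier G"
  using G.bracket_closed by auto
 have "{x \<otimes>\<^bsub>L\<^esub> y | x y. x \<in> carrier L \<and> y \<in> carrier L} \<subseteq> \<theta> ` ?X"
 proof
  fix z assume "z \<in> {x \<otimes>\<^bsub>L\<^esub> y | x y. x \<in> carrier L \<and> y \<in> carrier L}"
  then obtain x y where "z = \<theta> x \<otimes>\<^bsub>L\<^esub> \<theta> y" and xy: "x \<in> carrier G" "y \<in> carrier G"
   unfolding \<theta>(1)[symmetric] by blast
  then have "z = \<theta> (x \<otimes>\<^bsub>G\<^esub> y)"
   by (simp add: \<theta>(5))
  then show "z \<in> \<theta> ` ?X"
   using xy by blast
 qed
 moreover have "\<theta> ` ?X \<subseteq> {x \<otimes>\<^bsub>L\<^esub> y | x y. x \<in> carrier L \<and> y \<in> carrier L}"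
  using \<theta>(3,5) by blast
 ultimately have "\<theta> ` ?X = {x \<otimes>\<^bsub>L\<^esub> y | x y. x \<in> carrier L \<and> y \<in> carrier L}"
  by (rule equalityI[rotated])
 then have image: "\<theta> ` carrier (derived_superalg G) = carrier (derived_superalg L)"
  using algebra_epi_span[OF G.bracket_algebra_axioms epi X] by (simp add: derived_superalg_def Let_def)
 have sub: "carrier (derived_superalg G) \<subseteq> carrier G"
  by (rule G.subspaceD(1)[OF G.derived_carrier(1)])
 show "algebra_epi (derived_superalg G) (derived_superalg L) \<theta>"
  unfolding algebra_epi_def using image sub \<theta>(2,4,5,6) by (auto simp: subset_iff)
 have inj: "inj_on \<theta> (carrier G)"
  using c by simp
 show "inj_on \<theta> (carrier (derived_superalg G))"
  using inj sub by (rule inj_on_subset)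
 have "part G p \<subseteq> carrier G"
  using c lie_superalgebra_carrier_part by blast
 then have "\<theta> ` (part G p \<inter> carrier (derived_superalg G)) = \<theta> ` part G p \<inter> \<theta> ` carrier (derived_superalg G)"
  using sub by (rule inj_on_image_Int[OF inj])
 then show "\<theta> ` part (derived_superalg G) p = part (derived_superalg L) p"
  using image c by simp
 show "x \<in> carrier (derived_superalg G)" if x: "x \<in> carrier G" "\<theta> x \<in> carrier (derived_superalg L)" for x
 proof -
  obtain y where y: "y \<in> carrier (derived_superalg G)" "\<theta> x = \<theta> y"
   using x(2) unfolding image[symmetric] by blast
  then have "x = y"
   using inj_onD[OF inj y(2) x(1)] sub by blast
  then show ?thesis
   using y(1) by simp
 qed
qed

lemma superalg_center_copy:
 assumes L: "bracket_algebra L" and epi: "algebra_epi L M \<phi>" and inj: "inj_on \<phi> (carrier L)"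
 shows "superalg_center L = {x \<in> carrier L. \<phi> x \<in> superalg_center M}"
proof -
 interpret L: bracket_algebra L by fact
 note \<phi> = algebra_epiD[OF epi]
 have "z \<otimes>\<^bsub>L\<^esub> x = \<zero>\<^bsub>L\<^esub> \<longleftrightarrow> \<phi> z \<otimes>\<^bsub>M\<^esub> \<phi> x = \<zero>\<^bsub>M\<^esub>" if "z \<in> carrier L" "x \<in> carrier L" for z x
  using inj_onD[OF inj _ L.bracket_closed[OF that] L.zero_closed] \<phi>(2) \<phi>(5)[OF that] by auto
 then show ?thesis
  unfolding superalg_center_def \<phi>(1)[symmetric] by (auto simp: \<phi>(3))
qed

text \<open>On the side of the model, \<open>\<rho>\<close> stands for the passage to the quotient:
  it may be any suitable surjection whose kernel is the center. The second claim follows a given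
  element to its coset, as is required for the element that defines the derivation.\<close>

lemma derived_mod_center_copy:
 assumes copy: "lie_copy G L \<theta>"
  and epi: "algebra_epi (derived_superalg L) M \<rho>" and M: "lie_superalgebra M"
  and center: "superalg_center (derived_superalg L) = {x \<in> carrier (derived_superalg L). \<rho> x = \<zero>\<^bsub>M\<^esub>}"
  and part: "\<And>p. \<rho> ` part (derived_superalg L) p = part M p"
 obtains \<xi> where "lie_copy (derived_mod_center G) M \<xi>"
  "\<And>y. \<lbrakk>y \<in> carrier G; \<theta> y \<in> carrier (derived_superalg L)\<rbrakk> \<Longrightarrow>
    \<xi> (superalg_center (derived_superalg G) +>\<^bsub>derived_superalg G\<^esub> y) = \<rho> (\<theta> y) \<and>
    superalg_center (derived_superalg G) +>\<^bsub>derived_superalg G\<^esub> y \<in> carrier (derived_mod_center G)"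
proof -
 note c = derived_superalg_copy[OF copy]
 let ?D = "derived_superalg G" and ?Z = "superalg_center (derived_superalg G)"
 have D: "bracket_algebra ?D"
  using copy bracket_algebra.derived_bracket_algebra[OF lie_superalgebra_bracket_algebra[of G]]
  by (simp add: lie_copy_def)
 have epi': "algebra_epi ?D M (\<lambda>x. \<rho> (\<theta> x))"
  by (rule algebra_epi_comp[OF c(1) epi])
 have Z: "?Z = {x \<in> carrier ?D. \<rho> (\<theta> x) = \<zero>\<^bsub>M\<^esub>}"
  using superalg_center_copy[OF D c(1,2)] algebra_epiD(3)[OF c(1)] center by auto
 interpret D: algebra_with_ideal ?D ?Z
  using D kernel_ideal[OF D epi'] by (simp add: algebra_with_ideal_def algebra_with_ideal_axioms_def Z)
 obtain \<xi> where \<xi>: "algebra_epi (quot_superalg ?D ?Z) M \<xi>" "\<And>x. x \<in> carrier ?D \<Longrightarrow> \<xi> (?Z +>\<^bsub>?D\<^esub> x) = \<rho> (\<theta> x)"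
  using D.quot_factor[OF epi'] Z by (metis (mono_tags, lifting) mem_Collect_eq)
 have inj: "inj_on \<xi> (carrier (quot_superalg ?D ?Z))"
 proof (rule D.quot_factor_inj[where \<phi> = "\<lambda>x. \<rho> (\<theta> x)"])
  show "algebra_epi (quot_superalg ?D ?Z) M \<xi>"
   by (rule \<xi>(1))
  show "x \<in> ?Z" if "x \<in> carrier ?D" "\<rho> (\<theta> x) = \<zero>\<^bsub>M\<^esub>" for x
   unfolding Z using that by simp
 qed (rule \<xi>(2))
 have parts: "\<xi> ` part (quot_superalg ?D ?Z) p = part M p" for p
 proof -
  have "\<xi> ` part (quot_superalg ?D ?Z) p = (\<lambda>x. \<xi> (?Z +>\<^bsub>?D\<^esub> x)) ` part ?D p"
   by (simp add: quot_superalg_def image_image)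
  also have "\<dots> = (\<lambda>x. \<rho> (\<theta> x)) ` part ?D p"
   using \<xi>(2) by (intro image_cong) auto
  also have "\<dots> = part M p"
   using c(3)[of p] part[of p] by (metis image_image)
  finally show ?thesis .
 qed
 have closed: "?Z +>\<^bsub>?D\<^esub> y \<in> carrier (quot_superalg ?D ?Z)" if "y \<in> carrier ?D" for y
  using algebra_epiD(3)[OF D.quot_epi that] .
 have "part (quot_superalg ?D ?Z) p \<subseteq> carrier (quot_superalg ?D ?Z)" for p
  using closed by (auto simp: quot_superalg_def)
 from lie_copyI[OF D.quot_bracket_algebra M \<xi>(1) inj this parts]
 have "lie_copy (derived_mod_center G) M \<xi>"
  by (simp add: derived_mod_center_def)
 then show ?thesis
  using that \<xi>(2) closed c(4) by (simp add: derived_mod_center_def)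
qed

section \<open>Superalgebras with a root space decomposition\<close>

text \<open>Lists with integer coefficients are the computable form of vectors: identities are
  evaluated on lists and then interpreted over \<open>'k\<close>.\<close>

definition interp :: "('a \<times> int) list \<Rightarrow> ('a \<Rightarrow>\<^sub>0 'k :: field)" where
 "interp xs = (\<Sum>(u, c)\<leftarrow>xs. single u (of_int c))"

lemma interp_simps [simp]:
 "interp [] = 0" "interp (x # xs) = single (fst x) (of_int (snd x)) + interp xs"
 "interp (xs @ ys) = interp xs + interp ys"
 by (simp_all add: interp_def case_prod_unfold)

lemma keys_interp: "keys (interp xs) \<subseteq> fst ` set xs"
proof (induction xs)
 case (Cons x xs)
 then show ?case
  using keys_add[of "single (fst x) (of_int (snd x))" "interp xs"]
  by (auto simp: keys_single split: if_splits)
qed simp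

lemma pm_smult_interp: "pm_smult (of_int c) (interp xs) = interp (map (\<lambda>(u, t). (u, c * t)) xs)"
 by (induction xs) (auto simp: pm_smult_add_right)

lemma interp_map: "interp (map f [0..<n]) = (\<Sum>i<n. single (fst (f i)) (of_int (snd (f i))))"
 by (simp add: interp_def comp_def case_prod_unfold interv_sum_list_conv_sum_set_nat lessThan_atLeast0)

lemma single_sum: "single u (sum f A) = (\<Sum>a\<in>A. single u (f a))"
 by (induction A rule: infinite_finite_induct) (auto simp: single_add)

datatype 'q ridx = H nat | R 'q

primrec ridx_parity :: "('q \<Rightarrow> bit) \<Rightarrow> 'q ridx \<Rightarrow> bit" where
 "ridx_parity par (H i) = 0"
| "ridx_parity par (R a) = par a"

definition ridx_set :: "nat \<Rightarrow> 'q set \<Rightarrow> 'q ridx set" where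
 "ridx_set n Rt = H ` {..<n} \<union> R ` Rt"

text \<open>Here \<open>ev i a\<close> is the value of the root a on H i, and \<open>cor a i\<close>
  is the coefficient of H i in the coroot of a. A list has several entries only for opposite
  roots.\<close>

fun root_bracket ::
  "('q :: ab_group_add \<Rightarrow> 'q \<Rightarrow> int) \<Rightarrow> (nat \<Rightarrow> 'q \<Rightarrow> int) \<Rightarrow> ('q \<Rightarrow> nat \<Rightarrow> int) \<Rightarrow> nat
   \<Rightarrow> 'q ridx \<Rightarrow> 'q ridx \<Rightarrow> ('q ridx \<times> int) list" where
 "root_bracket N ev cor n (H i) (H j) = []"
| "root_bracket N ev cor n (H i) (R a) = [(R a, ev i a)]"
| "root_bracket N ev cor n (R a) (H i) = [(R a, - ev i a)]"
| "root_bracket N ev cor n (R a) (R b) =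
   (if a + b = 0 then map (\<lambda>i. (H i, N a b * cor a i)) [0..<n]
   else if N a b = 0 then [] else [(R (a + b), N a b)])"

definition super_sign :: "bit \<Rightarrow> bit \<Rightarrow> int" where
 "super_sign p q = (if p = 1 \<and> q = 1 then - 1 else 1)"

text \<open>
 All structure constants are integers, and the identities hold modulo 3. The Cartan elements
 \<open>H i\<close> with \<open>i < m\<close> are coroots, \<open>H m\<close> is central and \<open>H (m + 1)\<close> lies outside the derived
 algebra.
\<close>

locale root_data =
 fixes Rt :: "'q :: ab_group_add set" and par :: "'q \<Rightarrow> bit" and N :: "'q \<Rightarrow> 'q \<Rightarrow> int"
  and ev :: "nat \<Rightarrow> 'q \<Rightarrow> int" and cor :: "'q \<Rightarrow> nat \<Rightarrow> int" and m :: nat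
 assumes zero_root: "0 \<notin> Rt" and neg_root: "a \<in> Rt \<Longrightarrow> - a \<in> Rt"
  and par_add: "par (a + b) = par a + par b"
  and ev_add: "ev i (a + b) = ev i a + ev i b" and cor_add: "cor (a + b) i = cor a i + cor b i"
  and ev_m: "ev m a = 0" and cor_ext: "cor a (Suc m) = 0"
  and N_zero: "\<lbrakk>a \<in> Rt; b \<in> Rt; a + b \<notin> Rt; a + b \<noteq> 0\<rbrakk> \<Longrightarrow> N a b = 0"
  and N_anti: "\<lbrakk>a \<in> Rt; b \<in> Rt; a + b \<in> Rt\<rbrakk> \<Longrightarrow> 3 dvd N b a + super_sign (par a) (par b) * N a b"
  and N_anti_zero: "a \<in> Rt \<Longrightarrow> 3 dvd N (- a) a - super_sign (par a) (par a) * N a (- a)"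
  and N_jacobi: "\<lbrakk>a \<in> Rt; b \<in> Rt; c \<in> Rt; a + b + c \<in> Rt\<rbrakk> \<Longrightarrow>
   3 dvd (if b + c = 0 then - N b c * (\<Sum>i<m. cor b i * ev i a) else N b c * N a (b + c))
    - (if a + b = 0 then N a b * (\<Sum>i<m. cor a i * ev i c) else N a b * N (a + b) c)
    - super_sign (par a) (par b) *
     (if a + c = 0 then - N a c * (\<Sum>i<m. cor a i * ev i b) else N a c * N b (a + c))"
  and N_jacobi_zero: "\<lbrakk>a \<in> Rt; b \<in> Rt; c \<in> Rt; a + b + c = 0\<rbrakk> \<Longrightarrow>
   3 dvd N b c * N a (- a) - N a b * N (- c) c \<and>
   3 dvd N a b * N (- c) c + super_sign (par a) (par b) * N a c * N b (- b)"
  and N_cubic: "\<lbrakk>a \<in> Rt; par a = 1\<rbrakk> \<Longrightarrow> a + a \<noteq> 0 \<and> a + (a + a) \<noteq> 0 \<and> 3 dvd N a a * N a (a + a)"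
begin

abbreviation "idx n \<equiv> ridx_set n Rt"
abbreviation "ipar \<equiv> ridx_parity par"
abbreviation "rb \<equiv> root_bracket N ev cor"

definition bb :: "nat \<Rightarrow> 'q ridx \<Rightarrow> 'q ridx \<Rightarrow> ('q ridx \<Rightarrow>\<^sub>0 'k :: field)" where
 "bb n u v = interp (rb n u v)"

text \<open>The coroot of a, truncated to n Cartan elements. For n = m the truncation drops the
  component along H m, that is, it passes to the quotient by this central element.\<close>

definition hh :: "nat \<Rightarrow> 'q \<Rightarrow> ('q ridx \<Rightarrow>\<^sub>0 'k :: field)" where
 "hh n a = (\<Sum>i<n. single (H i) (of_int (cor a i)))"

lemma bb_simps:
 "bb n (H i) (H j) = 0"
 "bb n (H i) (R a) = single (R a) (of_int (ev i a))"
 "bb n (R a) (H i) = single (R a) (- of_int (ev i a))"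
 "bb n (R a) (R b) = (if a + b = 0 then pm_smult (of_int (N a b)) (hh n a)
   else single (R (a + b)) (of_int (N a b)))"
 by (simp_all add: bb_def hh_def pm_smult_sum interp_map)

lemma ev_zero: "ev i 0 = 0" and cor_zero: "cor 0 i = 0" and par_zero: "par 0 = 0"
 using ev_add[of i 0 0] cor_add[of 0 0 i] par_add[of 0 0] by simp_all

lemma ev_neg: "ev i (- a) = - ev i a" and cor_neg: "cor (- a) i = - cor a i"
 using ev_add[of i a "- a"] cor_add[of a "- a" i] by (simp_all add: ev_zero cor_zero)

lemma par_neg: "par (- a) = par a"
proof -
 have "par a + par (- a) = 0"
  using par_add[of a "- a"] par_zero by simp
 then show ?thesis
  using bit_cases[of "par a"] bit_cases[of "par (- a)"] by auto
qed

lemma hh_add: "hh n (a + b) = hh n a + hh n b"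
 by (simp add: hh_def cor_add single_add flip: sum.distrib)

lemma hh_zero: "hh n 0 = 0"
 by (simp add: hh_def cor_zero)

lemma hh_neg: "hh n (- a) = - hh n a"
 using hh_add[of n a "- a"] by (simp add: hh_zero eq_neg_iff_add_eq_0 add.commute)

lemma keys_hh: "keys (hh n a) \<subseteq> H ` {..<n}"
 unfolding hh_def by (rule order_trans[OF keys_sum_subset]) (auto split: if_splits)

end

text \<open>In \<open>Lie_root_data\<close>, the number \<open>n\<close> selects the algebra with Cartan elements \<open>H i\<close>, \<open>i < n\<close>.\<close>

locale Lie_root_data = root_data +
 fixes n :: nat and ty :: "'k :: field itself"
 assumes char: "CHAR('k) = 3" and n: "n = m \<or> n = Suc (Suc m)"
begin

abbreviation b :: "'a ridx \<Rightarrow> 'a ridx \<Rightarrow> ('a ridx \<Rightarrow>\<^sub>0 'k)" where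
 "b \<equiv> bb n"

lemma of_int_cong: "3 dvd x - y \<Longrightarrow> (of_int x :: 'k) = of_int y"
 using of_int_eq_0_iff_char_dvd[of "x - y", where 'a = 'k] char by simp

text \<open>The sum stops at m for both admissible n: H m acts by zero, and coroots have no
  component along H (m + 1). This is why the full algebra and its quotient satisfy the Jacobi
  identity by the same congruences.\<close>

lemma hh_bracket: "bi_ext b (hh n a) (single (R c) 1) =
  single (R c) (of_int (\<Sum>i<m. cor a i * ev i c))"
proof -
 have "bi_ext b (hh n a) (single (R c) 1) =
   (\<Sum>i<n. single (R c) (of_int (cor a i * ev i c)))"
  unfolding hh_def pm_linear_sum[OF bi_ext_linear_left] by (simp add: bb_simps)
 also have "\<dots> = (\<Sum>i<m. single (R c) (of_int (cor a i * ev i c)))"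
  using n by (auto simp: ev_m cor_ext)
 also have "\<dots> = single (R c) (of_int (\<Sum>i<m. cor a i * ev i c))"
  by (simp add: of_int_sum single_sum)
 finally show ?thesis .
qed

lemma bracket_hh: "bi_ext b (single (R c) 1) (hh n a) =
  - single (R c) (of_int (\<Sum>i<m. cor a i * ev i c))"
proof -
 have "bi_ext b (single (R c) 1) (hh n a) = - bi_ext b (hh n a) (single (R c) 1)"
  unfolding hh_def pm_linear_sum[OF bi_ext_linear_left] pm_linear_sum[OF bi_ext_linear_right]
  by (simp add: bb_simps single_uminus sum_negf pm_smult_minus)
 then show ?thesis
  by (simp only: hh_bracket)
qed

lemma H_hh: "bi_ext b (single (H i) 1) (hh n a) = 0" "bi_ext b (hh n a) (single (H i) 1) = 0"
 unfolding hh_def pm_linear_sum[OF bi_ext_linear_left] pm_linear_sum[OF bi_ext_linear_right]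
 by (simp_all add: bb_simps)

lemma koszul_sign_eq: "koszul_sign p q = (of_int (super_sign p q) :: 'k)"
 by (simp add: koszul_sign_def super_sign_def)

lemma b_anticommutative:
 assumes "u \<in> idx n" "v \<in> idx n"
 shows "b u v = - pm_smult (koszul_sign (ipar u) (ipar v)) (b v u)"
proof (cases u; cases v)
  fix a c assume u: "u = R a" "v = R c"
  then have ac: "a \<in> Rt" "c \<in> Rt"
   using assms by (auto simp: ridx_set_def)
  let ?s = "super_sign (par a) (par c)"
  have s: "?s = 1 \<or> ?s = - 1"
   by (simp add: super_sign_def)
  show ?thesis
  proof (cases "a + c = 0")
   case True
   then have c: "c = - a"
    by (simp add: eq_neg_iff_add_eq_0 add.commute)
   have "(of_int (N (- a) a) :: 'k) = of_int (?s * N a (- a))"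
    using N_anti_zero[OF ac(1)] c by (intro of_int_cong) (simp add: par_neg)
   then show ?thesis
    using s u c by (auto simp: bb_simps koszul_sign_eq hh_neg pm_smult_minus)
  next
   case False
   show ?thesis
   proof (cases "a + c \<in> Rt")
    case True
    have "(of_int (N c a) :: 'k) = of_int (- ?s * N a c)"
     using N_anti[OF ac True] by (intro of_int_cong) simp
    then show ?thesis
     using s u False by (auto simp: bb_simps koszul_sign_eq add.commute single_uminus)
   next
    case no_root: False
    then show ?thesis
     using u False N_zero[OF ac] N_zero[OF ac(2,1)] by (simp add: bb_simps add.commute)
   qed
  qed
 qed (use assms in \<open>auto simp: bb_simps koszul_sign_def single_uminus\<close>)

sublocale lie_basis "idx n" ipar b
proof
 show "keys (b u v) \<subseteq> {w \<in> idx n. ipar w = ipar u + ipar v}" if "u \<in> idx n" "v \<in> idx n" for u v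
 proof (cases u; cases v)
  fix a c assume u: "u = R a" "v = R c"
  then have ac: "a \<in> Rt" "c \<in> Rt"
   using that by (auto simp: ridx_set_def)
  show ?thesis
  proof (cases "a + c = 0")
   case True
   then have "par a + par c = 0"
    using par_add[of a c] par_zero by simp
   moreover have "keys (pm_smult (of_int (N a c)) (hh n a) :: _ \<Rightarrow>\<^sub>0 'k) \<subseteq> H ` {..<n}"
    by (rule order_trans[OF keys_pm_smult keys_hh])
   ultimately show ?thesis
    using True u by (auto simp: bb_simps ridx_set_def)
  next
   case False
   show ?thesis
   proof (cases "a + c \<in> Rt")
    case True
    then show ?thesis
     using u False by (simp add: bb_simps ridx_set_def par_add)
   next
    case no_root: False
    then show ?thesis
     using u False N_zero[OF ac] by (simp add: bb_simps)
   qed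
  qed
 qed (use that in \<open>auto simp: bb_simps ridx_set_def\<close>)
 show "b u v = - pm_smult (koszul_sign (ipar u) (ipar v)) (b v u)" if "u \<in> idx n" "v \<in> idx n" for u v
  by (rule b_anticommutative[OF that])
 let ?x = "\<lambda>u. single u (1 :: 'k)"
 show "bi_ext b (?x u) (b v w) = bi_ext b (b u v) (?x w) +
   pm_smult (koszul_sign (ipar u) (ipar v)) (bi_ext b (?x v) (b u w))"
  if "u \<in> idx n" "v \<in> idx n" "w \<in> idx n" for u v w
 proof -
 show ?thesis
 proof (cases u; cases v; cases w)
  fix i a c assume u: "u = H i" "v = R a" "w = R c"
  have "(of_int (ev i (a + c)) :: 'k) = of_int (ev i a) + of_int (ev i c)"
   by (simp add: ev_add)
  moreover have "a + c = 0 \<Longrightarrow> (of_int (ev i c) :: 'k) = - of_int (ev i a)"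
   using ev_neg[of i a] by (simp add: eq_neg_iff_add_eq_0[of c a, symmetric] add.commute[of a c])
  ultimately show ?thesis
   using u ev_zero[of i]
   by (cases "a + c = 0")
     (auto simp: bb_simps H_hh koszul_sign_def bi_ext_linear_simps single_uminus pm_smult_minus
      lookup_add lookup_single when_def algebra_simps intro!: poly_mapping_eqI)
 next
  fix i a c assume u: "u = R a" "v = H i" "w = R c"
  have "(of_int (ev i (a + c)) :: 'k) = of_int (ev i a) + of_int (ev i c)"
   by (simp add: ev_add)
  moreover have "a + c = 0 \<Longrightarrow> (of_int (ev i c) :: 'k) = - of_int (ev i a)"
   using ev_neg[of i a] by (simp add: eq_neg_iff_add_eq_0[of c a, symmetric] add.commute[of a c])
  ultimately show ?thesis
   using u ev_zero[of i]
   by (cases "a + c = 0")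
     (auto simp: bb_simps H_hh koszul_sign_def bi_ext_linear_simps single_uminus pm_smult_minus
      lookup_add lookup_single when_def algebra_simps intro!: poly_mapping_eqI)
 next
  fix i a c assume u: "u = R a" "v = R c" "w = H i"
  have X: "bi_ext b (b u v) (?x w) = - pm_smult (of_int (ev i (a + c))) (b u v)"
   using u by (simp add: bb_simps H_hh ev_zero bi_ext_linear_simps single_uminus pm_smult_minus mult.commute)
  have Y: "b v u = - pm_smult (koszul_sign (par a) (par c)) (b u v)"
   using b_anticommutative[OF that(2,1)] u by (simp add: koszul_sign_def)
  have "bi_ext b (?x u) (b v w) = - pm_smult (of_int (ev i c)) (b u v)"
   "bi_ext b (?x v) (b u w) = - pm_smult (of_int (ev i a)) (b v u)"
   using u by (simp_all add: bb_simps(3) bi_ext_linear_simps single_uminus)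
  then show ?thesis
   unfolding X Y using u
   by (auto simp: koszul_sign_def ev_add pm_smult_add_left pm_smult_minus)
 next
  fix a c e assume u: "u = R a" "v = R c" "w = R e"
  then have ace: "a \<in> Rt" "c \<in> Rt" "e \<in> Rt"
   using that by (auto simp: ridx_set_def)
  let ?B = "\<lambda>a c. \<Sum>i<m. cor a i * ev i c" and ?s = "super_sign (par a) (par c)"
  have no_root: "N x y * t = 0" if "x \<in> Rt" "y \<in> Rt" "x + y \<in> Rt \<Longrightarrow> t = 0" "x + y \<noteq> 0" for x y t
   using that N_zero[of x y] by auto
  show ?thesis
  proof (cases "a + c + e = 0")
   case True
   \<comment> \<open>All three double brackets lie in the Cartan subalgebra, in the span of the
     coroots of a and c; comparing coefficients gives the two congruences of
     \<open>N_jacobi_zero\<close>.\<close>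
   have sums: "a + c = - e" "c + e = - a" "a + e = - c"
    using True by (simp_all add: eq_neg_iff_add_eq_0 algebra_simps)
   have nz: "a + c \<noteq> 0" "c + e \<noteq> 0" "a + e \<noteq> 0"
    using ace zero_root neg_root unfolding sums by auto
   have J: "(of_int (N c e * N a (- a)) :: 'k) = of_int (N a c * N (- e) e)"
    "(of_int (N a c * N (- e) e) :: 'k) = of_int (- (?s * N a e * N c (- c)))"
    using N_jacobi_zero[OF ace True] by (auto intro!: of_int_cong simp only: diff_minus_eq_add)
   have hh: "hh n (- e) = hh n a + (hh n c :: _ \<Rightarrow>\<^sub>0 'k)"
    by (simp only: hh_add flip: sums(1))
   have "bi_ext b (?x u) (b v w) = pm_smult (of_int (N c e * N a (- a))) (hh n a)"
    using u nz sums by (simp add: bb_simps)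
   moreover have "bi_ext b (b u v) (?x w) = pm_smult (of_int (N a c * N (- e) e)) (hh n a + hh n c)"
    using u nz sums by (simp add: bb_simps hh)
   moreover have "bi_ext b (?x v) (b u w) = pm_smult (of_int (N a e * N c (- c))) (hh n c)"
    using u nz sums by (simp add: bb_simps)
   moreover have "koszul_sign (ipar u) (ipar v) * (of_int (N a e * N c (- c)) :: 'k) = - of_int (N a c * N (- e) e)"
    unfolding J(2) using u by (simp add: koszul_sign_eq mult.assoc)
   then have "pm_smult (koszul_sign (ipar u) (ipar v)) (pm_smult (of_int (N a e * N c (- c))) (hh n c)) =
     - pm_smult (of_int (N a c * N (- e) e) :: 'k) (hh n c)"
    by (simp only: pm_smult_pm_smult pm_smult_minus)
   ultimately show ?thesis
    by (simp only: J(1) pm_smult_add_right add.assoc right_minus add_0_right)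
  next
   case False
   have 1: "bi_ext b (?x u) (b v w) = single (R (a + c + e))
     (of_int (if c + e = 0 then - N c e * ?B c a else N c e * N a (c + e)))"
    using u False by (auto simp: bb_simps bi_ext_linear_simps bracket_hh add.assoc single_uminus pm_smult_minus)
   have 2: "bi_ext b (b u v) (?x w) = single (R (a + c + e))
     (of_int (if a + c = 0 then N a c * ?B a e else N a c * N (a + c) e))"
    using u False by (auto simp: bb_simps bi_ext_linear_simps hh_bracket)
   have sum3: "a + c + e = c + (a + e)"
    by (simp add: algebra_simps)
   have 3: "bi_ext b (?x v) (b u w) = single (R (a + c + e))
     (of_int (if a + e = 0 then - N a e * ?B a c else N a e * N c (a + e)))"
    using u False unfolding sum3
    by (auto simp: bb_simps bi_ext_linear_simps bracket_hh single_uminus pm_smult_minus)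
   have "(of_int (if c + e = 0 then - N c e * ?B c a else N c e * N a (c + e)) :: 'k) =
     of_int ((if a + c = 0 then N a c * ?B a e else N a c * N (a + c) e) +
      ?s * (if a + e = 0 then - N a e * ?B a c else N a e * N c (a + e)))"
   proof (cases "a + c + e \<in> Rt")
    case True
    show ?thesis
     by (rule of_int_cong) (use N_jacobi[OF ace True] in \<open>simp only: diff_diff_eq\<close>)
   next
    case no: False
    \<comment> \<open>When the total is neither a root nor zero, each term has a vanishing constant:
      either the inner sum is no root, or the outer bracket leads into the total.\<close>
    have sums: "a + (c + e) \<notin> Rt" "a + (c + e) \<noteq> 0" "c + (a + e) \<notin> Rt" "c + (a + e) \<noteq> 0"
     using False no by (simp_all add: algebra_simps)
    have nz: "a + c \<noteq> 0" "c + e \<noteq> 0" "a + e \<noteq> 0"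
     using ace no sums by auto
    have "N c e * N a (c + e) = 0" "N a c * N (a + c) e = 0" "N a e * N c (a + e) = 0"
     using no_root[OF ace(2,3) _ nz(2)] no_root[OF ace(1,2) _ nz(1)] no_root[OF ace(1,3) _ nz(3)]
      N_zero[OF ace(1) _ sums(1,2)] N_zero[OF _ ace(3) no False] N_zero[OF ace(2) _ sums(3,4)]
     by blast+
    then show ?thesis
     using nz by (simp only: if_False mult_zero_right add_0_right)
   qed
   then show ?thesis
    unfolding 1 2 3 using u by (simp only: koszul_sign_eq pm_smult_single ridx_parity.simps of_int_add of_int_mult single_add)
  qed
 qed (use that in \<open>auto simp: bb_simps koszul_sign_def bi_ext_linear_simps single_uminus pm_smult_minus algebra_simps\<close>)
 qed
 show "bi_ext b (?x u) (b u u) = 0" if "u \<in> idx n" "ipar u = 1" for u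
 proof (cases u)
  case (R a)
  then have a: "a \<in> Rt" "par a = 1"
   using that by (auto simp: ridx_set_def)
  have "(of_int (N a a * N a (a + a)) :: 'k) = of_int 0"
   using N_cubic[OF a] by (intro of_int_cong) simp
  then have "(of_int (N a a) :: 'k) * of_int (N a (a + a)) = 0"
   by simp
  then show ?thesis
   using R N_cubic[OF a] by (auto simp: bb_simps)
 qed (use that in simp)
qed

end

text \<open>The coroots of the simple roots \<open>sr i\<close> with i < m are the H i themselves.
  The last simple coroot has coefficient -1 at H m, because H m is the central combination of
  coroots put in its place. \<open>cor_nonzero\<close> yields nondegeneracy,
  \<open>ev_nonzero\<close> and \<open>ev_indep\<close> determine the center, and
  \<open>root_sum\<close> gives generation by induction on \<open>ht\<close>.\<close>

locale root_model = root_data +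
 fixes ty :: "'k :: field itself" and sr :: "nat \<Rightarrow> 'a" and ht :: "'a \<Rightarrow> nat" and dg :: "'a \<Rightarrow> nat \<Rightarrow>\<^sub>0 int"
 assumes char: "CHAR('k) = 3"
  and dg_add: "dg (a + b) = dg a + dg b" and dg_inj: "dg a = dg b \<Longrightarrow> a = b"
  and sr_root: "i \<le> m \<Longrightarrow> sr i \<in> Rt" and dg_sr: "i \<le> m \<Longrightarrow> dg (sr i) = single i 1"
  and N_sr_diff: "\<lbrakk>i \<le> m; j \<le> m; i \<noteq> j\<rbrakk> \<Longrightarrow> N (sr i) (- sr j) = 0"
  and N_sr: "i \<le> m \<Longrightarrow> N (sr i) (- sr i) * N (sr i) (- sr i) = 1"
  and N_neg: "a \<in> Rt \<Longrightarrow> \<not> 3 dvd N a (- a)"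
  and cor_sr: "\<lbrakk>i < m; j \<le> m\<rbrakk> \<Longrightarrow> cor (sr i) j = (if i = j then 1 else 0)" and cor_sr_m: "cor (sr m) m = - 1"
  and cor_nonzero: "a \<in> Rt \<Longrightarrow> \<exists>i\<le>m. \<not> 3 dvd cor a i" and ev_nonzero: "a \<in> Rt \<Longrightarrow> \<exists>i<m. \<not> 3 dvd ev i a"
  and ev_indep: "\<lbrakk>\<And>a. a \<in> Rt \<Longrightarrow> (\<Sum>i<m. x i * (of_int (ev i a) :: 'k)) = 0; i < m\<rbrakk> \<Longrightarrow> x i = 0"
  and root_sum: "\<lbrakk>a \<in> Rt; \<And>i. i \<le> m \<Longrightarrow> a \<noteq> sr i \<and> a \<noteq> - sr i\<rbrakk> \<Longrightarrow>
   \<exists>b c. b \<in> Rt \<and> c \<in> Rt \<and> a = b + c \<and> ht b < ht a \<and> ht c < ht a \<and> \<not> 3 dvd N b c"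
begin

sublocale full: Lie_root_data Rt par N ev cor m "Suc (Suc m)" ty
 by unfold_locales (simp_all add: char)

sublocale quot: Lie_root_data Rt par N ev cor m m ty
 by unfold_locales (simp_all add: char)

lemma of_int_nonzero: "\<not> 3 dvd x \<Longrightarrow> (of_int x :: 'k) \<noteq> 0"
 using of_int_eq_0_iff_char_dvd[of x, where 'a = 'k] char by simp

lemma dg_zero: "dg 0 = 0"
 using dg_add[of 0 0] by simp

lemma dg_neg: "dg (- a) = - dg a"
 using dg_add[of a "- a"] by (simp add: dg_zero eq_neg_iff_add_eq_0 add.commute)

primrec ideg :: "'a ridx \<Rightarrow> nat \<Rightarrow>\<^sub>0 int" where
 "ideg (H i) = 0"
| "ideg (R a) = dg a"

lemma ideg_set: "{u \<in> idx (Suc (Suc m)). ideg u = 0} = H ` {..<Suc (Suc m)}"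
proof -
 have "dg a \<noteq> 0" if "a \<in> Rt" for a
  using dg_inj[of a 0] that zero_root by (auto simp: dg_zero)
 then show ?thesis
  by (auto simp: ridx_set_def)
qed

lemma lookup_hh: "lookup (hh n a) (H i) = (if i < n then of_int (cor a i) else 0)"
 by (simp add: hh_def lookup_sum lookup_single when_def)

definition e :: "nat \<Rightarrow> 'a ridx \<Rightarrow>\<^sub>0 'k" where
 "e i = single (R (sr i)) 1"

text \<open>Scaled by a constant whose square is 1, so that [e_i, f_i] is the coroot itself.\<close>

definition f :: "nat \<Rightarrow> 'a ridx \<Rightarrow>\<^sub>0 'k" where
 "f i = single (R (- sr i)) (of_int (N (sr i) (- sr i)))"

lemma contragredient_modelI:
 fixes D :: "('k, 'h) cartan_datum" and \<kappa> :: "'h \<Rightarrow> 'a ridx \<Rightarrow>\<^sub>0 'k"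
 assumes pres: "chev_presentation D" and dim: "dim_row (cartan_matrix D) = Suc m"
  and par_D: "\<And>i. i \<le> m \<Longrightarrow> parity D i = par (sr i)"
  and \<kappa>_add: "\<And>x y. \<lbrakk>x \<in> carrier (cartan_space D); y \<in> carrier (cartan_space D)\<rbrakk> \<Longrightarrow>
   \<kappa> (x \<oplus>\<^bsub>cartan_space D\<^esub> y) = \<kappa> x + \<kappa> y"
  and \<kappa>_smult: "\<And>x r. x \<in> carrier (cartan_space D) \<Longrightarrow> \<kappa> (r \<odot>\<^bsub>cartan_space D\<^esub> x) = pm_smult r (\<kappa> x)"
  and \<kappa>_inj: "\<And>x. \<lbrakk>x \<in> carrier (cartan_space D); \<kappa> x = 0\<rbrakk> \<Longrightarrow> x = \<zero>\<^bsub>cartan_space D\<^esub>"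
  and \<kappa>_image: "\<kappa> ` carrier (cartan_space D) = {x. keys x \<subseteq> H ` {..<Suc (Suc m)}}"
  and \<kappa>_coroot: "\<And>i. i \<le> m \<Longrightarrow> \<kappa> (coroot D i) = hh (Suc (Suc m)) (sr i)"
  and \<kappa>_root: "\<And>x j. \<lbrakk>x \<in> carrier (cartan_space D); j \<le> m\<rbrakk> \<Longrightarrow>
   root D j x = (\<Sum>i<Suc (Suc m). lookup (\<kappa> x) (H i) * of_int (ev i (sr j)))"
 shows "contragredient_model (idx (Suc (Suc m))) ipar full.b D \<kappa> e f ideg"
proof -
 interpret chev_presentation D by fact
 have less: "i < dim_row (cartan_matrix D) \<longleftrightarrow> i \<le> m" for i
  by (simp add: dim less_Suc_eq_le)
 have \<kappa>_expand: "\<kappa> x = (\<Sum>i<Suc (Suc m). single (H i) (lookup (\<kappa> x) (H i)))"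
  if "x \<in> carrier (cartan_space D)" for x
 proof -
  have "\<kappa> x = (\<Sum>u\<in>H ` {..<Suc (Suc m)}. single u (lookup (\<kappa> x) u))"
   using \<kappa>_image that by (intro poly_mapping_sum_single) auto
  then show ?thesis
   by (simp add: sum.reindex inj_on_def)
 qed
 have \<kappa>_R: "bi_ext full.b (\<kappa> x) (single (R a) t) =
   pm_smult (\<Sum>i<Suc (Suc m). lookup (\<kappa> x) (H i) * of_int (ev i a)) (single (R a) t)"
  if "x \<in> carrier (cartan_space D)" for x a t
  by (subst \<kappa>_expand[OF that], unfold pm_linear_sum[OF bi_ext_linear_left])
    (simp add: bb_simps single_sum sum_distrib_left sum_distrib_right algebra_simps del: sum.lessThan_Suc)
 show ?thesis
 proof
  show "\<kappa> ` carrier (cartan_space D) = {x. keys x \<subseteq> {u \<in> idx (Suc (Suc m)). ideg u = 0}}"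
   unfolding ideg_set by (rule \<kappa>_image)
  show "ipar u = 0" if "u \<in> idx (Suc (Suc m))" "ideg u = 0" for u
  proof -
   have "u \<in> H ` {..<Suc (Suc m)}"
    using that ideg_set by blast
   then show ?thesis
    by auto
  qed
  show "keys (e i) \<subseteq> {u \<in> idx (Suc (Suc m)). ideg u = single i 1 \<and> ipar u = parity D i}"
   if "i < dim_row (cartan_matrix D)" for i
   using that sr_root[of i] dg_sr[of i] par_D[of i] by (auto simp: less e_def ridx_set_def)
  show "keys (f i) \<subseteq> {u \<in> idx (Suc (Suc m)). ideg u = - single i 1 \<and> ipar u = parity D i}"
   if "i < dim_row (cartan_matrix D)" for i
   using that neg_root[OF sr_root[of i]] dg_sr[of i] par_D[of i]
   by (auto simp: less f_def ridx_set_def dg_neg par_neg split: if_splits)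
  show "bi_ext full.b (e i) (f j) = (if i = j then \<kappa> (coroot D i) else 0)"
   if "i < dim_row (cartan_matrix D)" "j < dim_row (cartan_matrix D)" for i j
  proof -
   have ij: "i \<le> m" "j \<le> m"
    using that by (simp_all add: less)
   have "sr i \<noteq> sr j" if "i \<noteq> j"
    using dg_sr[OF ij(1)] dg_sr[OF ij(2)] that by (metis lookup_single_eq lookup_single_not_eq zero_neq_one)
   moreover have "(of_int (N (sr i) (- sr i)) * of_int (N (sr i) (- sr i)) :: 'k) = 1"
    using N_sr[OF ij(1)] by (metis of_int_1 of_int_mult)
   ultimately show ?thesis
    using ij N_sr_diff[OF ij] by (auto simp: e_def f_def bb_simps \<kappa>_coroot)
  qed
  show "bi_ext full.b (\<kappa> x) (e j) = pm_smult (root D j x) (e j)"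
   if "x \<in> carrier (cartan_space D)" "j < dim_row (cartan_matrix D)" for x j
   using that \<kappa>_root[of x j] by (simp only: e_def \<kappa>_R less)
  show "bi_ext full.b (\<kappa> x) (f j) = - pm_smult (root D j x) (f j)"
   if "x \<in> carrier (cartan_space D)" "j < dim_row (cartan_matrix D)" for x j
   using that \<kappa>_root[of x j]
   by (simp only: f_def \<kappa>_R less ev_neg of_int_minus mult_minus_right sum_negf pm_smult_minus)
  show "full.b u v = 0" if "u \<in> idx (Suc (Suc m))" "v \<in> idx (Suc (Suc m))" "ideg u = 0" "ideg v = 0" for u v
  proof -
   have "u \<in> H ` {..<Suc (Suc m)}" "v \<in> H ` {..<Suc (Suc m)}"
    using that ideg_set by blast+
   then show ?thesis
    by (auto simp: bb_simps)
  qed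
  show "keys (full.b u v) \<subseteq> {w. ideg w = ideg u + ideg v}"
   if "u \<in> idx (Suc (Suc m))" "v \<in> idx (Suc (Suc m))" for u v
  proof (cases u; cases v)
   fix a c assume u: "u = R a" "v = R c"
   show ?thesis
   proof (cases "a + c = 0")
    case True
    have "keys (pm_smult (of_int (N a c)) (hh (Suc (Suc m)) a) :: _ \<Rightarrow>\<^sub>0 'k) \<subseteq> H ` {..<Suc (Suc m)}"
     by (rule order_trans[OF keys_pm_smult keys_hh])
    moreover have "dg a + dg c = 0"
     using dg_add[of a c] True by (simp add: dg_zero)
    ultimately show ?thesis
     using True u by (auto simp: bb_simps)
   qed (use u in \<open>auto simp: bb_simps dg_add\<close>)
  qed (auto simp: bb_simps)
  show "\<exists>c. keys c \<subseteq> {u \<in> idx (Suc (Suc m)). ideg u = - \<beta>} \<and> bi_ext full.b x c \<noteq> 0"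
   if \<beta>: "\<beta> \<noteq> 0" and x: "x \<noteq> 0" "keys x \<subseteq> {u \<in> idx (Suc (Suc m)). ideg u = \<beta>}" for \<beta> x
  proof -
   obtain u where u: "u \<in> keys x"
    using x(1) by (metis ex_in_conv keys_eq_empty)
   then have "u \<in> idx (Suc (Suc m))" "ideg u = \<beta>"
    using x(2) by auto
   then obtain a where a: "u = R a" "a \<in> Rt" "dg a = \<beta>"
    using \<beta> by (auto simp: ridx_set_def)
   \<comment> \<open>Degrees separate roots, so the homogeneous x is a multiple of one root vector.
     Its bracket with the opposite root vector is a multiple of the coroot, which is nonzero modulo
     3.\<close>
   have "keys x \<subseteq> {R a}"
   proof
    fix v assume "v \<in> keys x"
    then have "v \<in> idx (Suc (Suc m))" "ideg v = \<beta>"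
     using x(2) by auto
    then obtain c where "v = R c" "dg c = dg a"
     using \<beta> a(3) by (auto simp: ridx_set_def)
    then show "v \<in> {R a}"
     using dg_inj[of c a] by simp
   qed
   then have x_eq: "x = single (R a) (lookup x (R a))"
    using poly_mapping_sum_single[of "{R a}" x] by simp
   obtain i where i: "i \<le> m" "\<not> 3 dvd cor a i"
    using cor_nonzero[OF a(2)] by blast
   let ?c = "single (R (- a)) (1 :: 'k)"
   have "lookup (bi_ext full.b x ?c) (H i) =
     lookup x (R a) * of_int (N a (- a)) * of_int (cor a i)"
    by (subst x_eq) (use i(1) in \<open>simp add: bb_simps lookup_hh\<close>)
   also have "\<dots> \<noteq> 0"
    using u a(1) i(2) of_int_nonzero N_neg[OF a(2)] by (auto simp: in_keys_iff)
   finally have "bi_ext full.b x ?c \<noteq> 0"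
    by auto
   moreover have "keys ?c \<subseteq> {u \<in> idx (Suc (Suc m)). ideg u = - \<beta>}"
    using a neg_root by (simp add: ridx_set_def dg_neg)
   ultimately show ?thesis
    by blast
  qed
  show "single u 1 \<in> S"
   if u: "u \<in> idx (Suc (Suc m))" "ideg u \<noteq> 0"
    and gen: "\<And>i. i < dim_row (cartan_matrix D) \<Longrightarrow> e i \<in> S \<and> f i \<in> S"
    and smult: "\<And>a t. a \<in> S \<Longrightarrow> pm_smult t a \<in> S"
    and bracket: "\<And>a c. \<lbrakk>a \<in> S; c \<in> S\<rbrakk> \<Longrightarrow> bi_ext full.b a c \<in> S" for u S
  proof -
   have "single (R a) 1 \<in> S" if "a \<in> Rt" for a
    using that
   proof (induction "ht a" arbitrary: a rule: less_induct)
    case less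
    consider i where "i \<le> m" "a = sr i" | i where "i \<le> m" "a = - sr i"
     | b c where "b \<in> Rt" "c \<in> Rt" "a = b + c" "ht b < ht a" "ht c < ht a" "\<not> 3 dvd N b c"
     using root_sum[OF less.prems] by blast
    then show ?case
    proof cases
     case 1
     then show ?thesis
      using gen[of i] by (simp add: dim e_def)
    next
     case 2
     have "(of_int (N (sr i) (- sr i)) * of_int (N (sr i) (- sr i)) :: 'k) = 1"
      using N_sr[OF 2(1)] by (metis of_int_1 of_int_mult)
     then have "single (R a) 1 = pm_smult (of_int (N (sr i) (- sr i))) (f i)"
      using 2 by (simp add: f_def)
     then show ?thesis
      using gen[of i] smult 2(1) by (simp add: dim)
    next
     case 3
     have "b + c \<noteq> 0"
      using 3(3) less.prems zero_root by auto
     then have "single (R a) 1 = pm_smult (inverse (of_int (N b c)))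
       (bi_ext full.b (single (R b) 1) (single (R c) 1))"
      using of_int_nonzero[OF 3(6)] 3(3) by (simp add: bb_simps)
     then show ?thesis
      using less.hyps[OF 3(4,1)] less.hyps[OF 3(5,2)] smult bracket by metis
    qed
   qed
   then show ?thesis
    using u by (auto simp: ridx_set_def)
  qed
 qed (use \<kappa>_add \<kappa>_smult \<kappa>_inj in auto)
qed

section \<open>Derived algebra and center of the model\<close>

lemma hh_ext: "hh (Suc (Suc m)) a = hh (Suc m) a"
 by (simp add: hh_def cor_ext)

lemma keys_bracket_derived:
 assumes "u \<in> idx (Suc (Suc m))" "v \<in> idx (Suc (Suc m))"
 shows "keys (full.b u v) \<subseteq> idx (Suc m)"
proof (cases u; cases v)
 fix a c assume u: "u = R a" "v = R c"
 then have ac: "a \<in> Rt" "c \<in> Rt"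
  using assms by (auto simp: ridx_set_def)
 consider "a + c = 0" | "a + c \<in> Rt" "a + c \<noteq> 0" | "a + c \<notin> Rt" "a + c \<noteq> 0"
  by blast
 then show ?thesis
 proof cases
  case 1
  have "keys (pm_smult (of_int (N a c)) (hh (Suc m) a) :: _ \<Rightarrow>\<^sub>0 'k) \<subseteq> H ` {..<Suc m}"
   by (rule order_trans[OF keys_pm_smult keys_hh])
  then show ?thesis
   using 1 u by (auto simp: bb_simps ridx_set_def hh_ext)
 next
  case 3
  then show ?thesis
   using u N_zero[OF ac] by (simp add: bb_simps)
 qed (use u in \<open>simp add: bb_simps ridx_set_def\<close>)
qed (use assms in \<open>auto simp: bb_simps ridx_set_def\<close>)

text \<open>Every root vector is an eigenvector of some H i with nonzero eigenvalue, and the simple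
  coroots are brackets [e_i, f_i]. H m is recovered from the coroot of the last simple root, where
  its coefficient is -1.\<close>

lemma derived_full: "carrier (derived_superalg full.L) = {x. keys x \<subseteq> idx (Suc m)}"
proof
 note D = full.subspaceD[OF full.derived_carrier(1)]
 let ?W = "carrier (derived_superalg full.L)"
 let ?X = "{x \<otimes>\<^bsub>full.L\<^esub> y | x y. x \<in> carrier full.L \<and> y \<in> carrier full.L}"
 have idx_mono: "idx (Suc m) \<subseteq> idx (Suc (Suc m))"
  by (auto simp: ridx_set_def)
 have "?W = full.span ?X"
  unfolding derived_superalg_def Let_def by simp
 also have "\<dots> \<subseteq> {x. keys x \<subseteq> idx (Suc m)}"
 proof (rule full.span_is_subset)
  show "?X \<subseteq> {x. keys x \<subseteq> idx (Suc m)}"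
  proof
   fix z assume "z \<in> ?X"
   then obtain x y where z: "z = bi_ext full.b x y"
    "keys x \<subseteq> idx (Suc (Suc m))" "keys y \<subseteq> idx (Suc (Suc m))"
    by auto
   have "keys z \<subseteq> idx (Suc m)"
    unfolding z(1) by (rule order_trans[OF keys_bi_ext]) (intro UN_least keys_bracket_derived; use z in blast)
   then show "z \<in> {x. keys x \<subseteq> idx (Suc m)}"
    by simp
  qed
  have "VectorSpace.subspace class_ring {x :: _ \<Rightarrow>\<^sub>0 'k. keys x \<subseteq> idx (Suc m)} full.L"
  proof (rule full.subspaceI)
   show "x \<oplus>\<^bsub>full.L\<^esub> y \<in> {x. keys x \<subseteq> idx (Suc m)}"
    if "x \<in> {x. keys x \<subseteq> idx (Suc m)}" "y \<in> {x. keys x \<subseteq> idx (Suc m)}" for x y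
    using that keys_add[of x y] by auto
   show "c \<odot>\<^bsub>full.L\<^esub> x \<in> {x. keys x \<subseteq> idx (Suc m)}"
    if "x \<in> {x. keys x \<subseteq> idx (Suc m)}" for c x
    using that keys_pm_smult[of c x] by auto
  qed (use idx_mono in auto)
  then show "submodule class_ring {x :: _ \<Rightarrow>\<^sub>0 'k. keys x \<subseteq> idx (Suc m)} full.L"
   by (simp add: VectorSpace.subspace_def)
 qed
 finally show "?W \<subseteq> {x. keys x \<subseteq> idx (Suc m)}" .
 have bracket: "full.b u v \<in> ?W" if "u \<in> idx (Suc (Suc m))" "v \<in> idx (Suc (Suc m))" for u v
 proof -
  have "single u 1 \<otimes>\<^bsub>full.L\<^esub> single v 1 \<in> ?W"
   using that by (intro full.derived_carrier(2)) simp_all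
  then show ?thesis
   by simp
 qed
 have R: "single (R a) (1 :: 'k) \<in> ?W" if a: "a \<in> Rt" for a
 proof -
  obtain i where i: "i < m" "\<not> 3 dvd ev i a"
   using ev_nonzero[OF a] by blast
  have "full.b (H i) (R a) \<in> ?W"
   using i(1) a by (intro bracket) (auto simp: ridx_set_def)
  then have "inverse (of_int (ev i a)) \<odot>\<^bsub>full.L\<^esub> full.b (H i) (R a) \<in> ?W"
   by (rule D(4))
  then show ?thesis
   using of_int_nonzero[OF i(2)] by (simp add: bb_simps)
 qed
 have hh_W: "hh (Suc m) (sr i) \<in> ?W" if i: "i \<le> m" for i
 proof -
  have "full.b (R (sr i)) (R (- sr i)) \<in> ?W"
   using sr_root[OF i] neg_root[OF sr_root[OF i]] by (intro bracket) (auto simp: ridx_set_def)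
  then have "of_int (N (sr i) (- sr i)) \<odot>\<^bsub>full.L\<^esub> full.b (R (sr i)) (R (- sr i)) \<in> ?W"
   by (rule D(4))
  moreover have "(of_int (N (sr i) (- sr i)) * of_int (N (sr i) (- sr i)) :: 'k) = 1"
   using N_sr[OF i] by (metis of_int_1 of_int_mult)
  ultimately show ?thesis
   by (simp add: bb_simps hh_ext)
 qed
 have H: "single (H i) (1 :: 'k) \<in> ?W" if i: "i < m" for i
 proof -
  have "hh (Suc m) (sr i) = (\<Sum>j<Suc m. if j = i then single (H i) (1 :: 'k) else 0)"
   unfolding hh_def using i by (intro sum.cong) (auto simp: cor_sr)
  also have "\<dots> = single (H i) 1"
   using i by simp
  finally show ?thesis
   using hh_W[of i] i by simp
 qed
 have sums: "sum g A \<in> ?W" if "\<And>u. u \<in> A \<Longrightarrow> g u \<in> ?W" "finite A" for g and A :: "'c set"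
  using that(2,1)
 proof (induction A rule: finite_induct)
  case empty
  then show ?case
   using D(2) by simp
 next
  case (insert u A)
  then show ?case
   using D(3)[of "g u" "sum g A"] by simp
 qed
 have "single (H m) (1 :: 'k) \<in> ?W"
 proof -
  have "hh (Suc m) (sr m) = (\<Sum>i<m. single (H i) (of_int (cor (sr m) i) :: 'k)) - single (H m) 1"
   by (simp add: hh_def cor_sr_m single_uminus)
  then have "single (H m) 1 =
    (\<Sum>i<m. pm_smult (of_int (cor (sr m) i)) (single (H i) (1 :: 'k))) + pm_smult (- 1) (hh (Suc m) (sr m))"
   by (simp add: pm_smult_minus_one)
  moreover have "(\<Sum>i<m. pm_smult (of_int (cor (sr m) i)) (single (H i) (1 :: 'k))) \<in> ?W"
   using D(4)[OF H] by (intro sums) simp_all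
  ultimately show ?thesis
   using D(3)[OF _ D(4)[OF hh_W[of m]], of _ "- 1"] by simp
 qed
 then have single: "single u (1 :: 'k) \<in> ?W" if "u \<in> idx (Suc m)" for u
  using that R H by (auto simp: ridx_set_def less_Suc_eq)
 show "{x. keys x \<subseteq> idx (Suc m)} \<subseteq> ?W"
 proof
  fix x :: "'a ridx \<Rightarrow>\<^sub>0 'k" assume x: "x \<in> {x. keys x \<subseteq> idx (Suc m)}"
  have "(\<Sum>u\<in>keys x. pm_smult (lookup x u) (single u 1)) \<in> ?W"
   using x D(4)[OF single] by (intro sums) auto
  then show "x \<in> ?W"
   using poly_mapping_sum_single[OF finite_keys order_refl, of x] by simp
 qed
qed

lemma ridx_set_iff: "H i \<in> ridx_set n Rt \<longleftrightarrow> i < n" "R a \<in> ridx_set n Rt \<longleftrightarrow> a \<in> Rt"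
 by (auto simp: ridx_set_def)

abbreviation \<rho> :: "('a ridx \<Rightarrow>\<^sub>0 'k) \<Rightarrow> ('a ridx \<Rightarrow>\<^sub>0 'k)" where
 "\<rho> \<equiv> pm_restrict (idx m)"

lemma \<rho>_single: "\<rho> (single u t) = (if u \<in> idx m then single u t else 0)"
 by (rule poly_mapping_eqI) (auto simp: lookup_single when_def)

lemma \<rho>_hh: "\<rho> (hh (Suc m) a) = hh m a"
 unfolding hh_def pm_linear_sum[OF pm_restrict_linear] by (simp add: \<rho>_single ridx_set_iff)

lemma \<rho>_epi: "algebra_epi (derived_superalg full.L) quot.L \<rho>"
 unfolding algebra_epi_def
proof (intro conjI ballI allI)
 note lin = pm_linear_add[OF pm_restrict_linear] pm_linear_smult[OF pm_restrict_linear] pm_linear_zero[OF pm_restrict_linear]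
 have idx_mono: "idx m \<subseteq> idx (Suc m)"
  by (auto simp: ridx_set_def)
 show "\<rho> ` carrier (derived_superalg full.L) = carrier quot.L"
 proof
  show "\<rho> ` carrier (derived_superalg full.L) \<subseteq> carrier quot.L"
   by (auto simp: keys_pm_restrict)
  show "carrier quot.L \<subseteq> \<rho> ` carrier (derived_superalg full.L)"
  proof
   fix x assume "x \<in> carrier quot.L"
   then have x: "keys x \<subseteq> idx m"
    by simp
   then show "x \<in> \<rho> ` carrier (derived_superalg full.L)"
    using pm_restrict_id[OF x] idx_mono unfolding derived_full by (intro image_eqI[of _ _ x]) auto
  qed
 qed
 show "\<rho> (x \<otimes>\<^bsub>derived_superalg full.L\<^esub> y) = \<rho> x \<otimes>\<^bsub>quot.L\<^esub> \<rho> y"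
  if "x \<in> carrier (derived_superalg full.L)" "y \<in> carrier (derived_superalg full.L)" for x y
 proof -
  have xy: "keys x \<subseteq> idx (Suc m)" "keys y \<subseteq> idx (Suc m)"
   using that derived_full by auto
  have "\<rho> (bi_ext full.b x y) = bi_ext quot.b (\<rho> x) (\<rho> y)"
  proof (rule pm_linear_eqI[where x = x])
   show "pm_linear (\<lambda>x. \<rho> (bi_ext full.b x y))" "pm_linear (\<lambda>x. bi_ext quot.b (\<rho> x) (\<rho> y))"
    by (rule pm_linear_comp[OF pm_restrict_linear bi_ext_linear_left],
      rule pm_linear_comp[OF bi_ext_linear_left pm_restrict_linear])
   fix u assume u: "u \<in> keys x"
   show "\<rho> (bi_ext full.b (single u 1) y) = bi_ext quot.b (\<rho> (single u 1)) (\<rho> y)"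
   proof (rule pm_linear_eqI[where x = y])
    show "pm_linear (\<lambda>y. \<rho> (bi_ext full.b (single u 1) y))"
     "pm_linear (\<lambda>y. bi_ext quot.b (\<rho> (single u 1)) (\<rho> y))"
     by (rule pm_linear_comp[OF pm_restrict_linear bi_ext_linear_right],
       rule pm_linear_comp[OF bi_ext_linear_right pm_restrict_linear])
    fix v assume v: "v \<in> keys y"
    have uv: "u \<in> idx (Suc m)" "v \<in> idx (Suc m)"
     using u v xy by auto
    have "\<rho> (full.b u v) = bi_ext quot.b (\<rho> (single u 1)) (\<rho> (single v 1))"
    proof (cases u; cases v)
     fix a c assume u: "u = R a" "v = R c"
     then have ac: "a \<in> Rt" "c \<in> Rt"
      using uv by (auto simp: ridx_set_def)
     then show ?thesis
      using u N_zero[OF ac]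
      by (cases "a + c \<in> Rt") (auto simp: bb_simps \<rho>_single ridx_set_iff lin hh_ext \<rho>_hh)
    qed (use uv in \<open>auto simp: bb_simps \<rho>_single ridx_set_iff lin bi_ext_linear_simps ev_m less_Suc_eq\<close>)
    then show "\<rho> (bi_ext full.b (single u 1) (single v 1)) =
      bi_ext quot.b (\<rho> (single u 1)) (\<rho> (single v 1))"
     by simp
   qed
  qed
  then show ?thesis
   by simp
 qed
qed (simp_all add: pm_linear_add[OF pm_restrict_linear] pm_linear_smult[OF pm_restrict_linear] pm_linear_zero[OF pm_restrict_linear])

lemma lookup_bracket_right:
 fixes b :: "'c \<Rightarrow> 'd \<Rightarrow> ('e \<Rightarrow>\<^sub>0 'k)"
 assumes "\<And>u. lookup (b u v) w = (if u = u' then t else 0)"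
 shows "lookup (bi_ext b x (single v 1)) w = lookup x u' * (t :: 'k)"
proof -
 have "bi_ext b x (single v 1) = (\<Sum>u\<in>keys x. pm_smult (lookup x u) (b u v))"
  using pm_linear_expand[OF bi_ext_linear_left, of b x "single v 1"] by simp
 then have "lookup (bi_ext b x (single v 1)) w =
   (\<Sum>u\<in>keys x. if u = u' then lookup x u * t else 0)"
  by (simp add: lookup_sum assms if_distrib cong: if_cong)
 then show ?thesis
  by (simp add: in_keys_iff)
qed

text \<open>Brackets with the H i force the root components of a central element to vanish, since no
  root is zero on all of them. Brackets with root vectors then force the coefficients of H i for i <
  m to vanish by \<open>ev_indep\<close>; what remains is a multiple of H m.\<close>

lemma center_full: "superalg_center (derived_superalg full.L) = {x \<in> carrier (derived_superalg full.L). \<rho> x = \<zero>\<^bsub>quot.L\<^esub>}"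
proof
 show "{x \<in> carrier (derived_superalg full.L). \<rho> x = \<zero>\<^bsub>quot.L\<^esub>} \<subseteq> superalg_center (derived_superalg full.L)"
 proof
  fix x assume x: "x \<in> {x \<in> carrier (derived_superalg full.L). \<rho> x = \<zero>\<^bsub>quot.L\<^esub>}"
  then have "keys x \<subseteq> idx (Suc m)" "keys (\<rho> x) = {}"
   using derived_full by auto
  then have *: "u = H m" if "u \<in> keys x" for u
  proof -
   have "u \<in> idx (Suc m)" "u \<notin> idx m"
    using that \<open>keys x \<subseteq> idx (Suc m)\<close> \<open>keys (\<rho> x) = {}\<close>
    unfolding keys_pm_restrict by blast+
   then show ?thesis
    by (cases u) (auto simp: ridx_set_iff less_Suc_eq)
  qed
  have "full.b (H m) v = 0" for v
   by (cases v) (simp_all add: bb_simps ev_m)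
  then have "(\<Union>u\<in>keys x. \<Union>v\<in>keys y. keys (full.b u v)) \<subseteq> {}" for y
   using * by auto
  then have "keys (bi_ext full.b x y) \<subseteq> {}" for y
   by (rule order_trans[OF keys_bi_ext])
  then have "bi_ext full.b x y = 0" for y
   by simp
  then show "x \<in> superalg_center (derived_superalg full.L)"
   using x by (simp add: superalg_center_def)
 qed
 show "superalg_center (derived_superalg full.L) \<subseteq> {x \<in> carrier (derived_superalg full.L). \<rho> x = \<zero>\<^bsub>quot.L\<^esub>}"
 proof
  fix x assume "x \<in> superalg_center (derived_superalg full.L)"
  then have x: "x \<in> carrier (derived_superalg full.L)"
   and zero: "\<And>y. keys y \<subseteq> idx (Suc m) \<Longrightarrow> bi_ext full.b x y = 0"
   unfolding superalg_center_def by (auto simp: derived_full)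
  have keys: "keys x \<subseteq> idx (Suc m)"
   using x derived_full by auto
  have R: "lookup x (R a) = 0" if a: "a \<in> Rt" for a
  proof -
   obtain i where i: "i < m" "\<not> 3 dvd ev i a"
    using ev_nonzero[OF a] by blast
   have "lookup (bi_ext full.b x (single (H i) 1)) (R a) =
     lookup x (R a) * - of_int (ev i a)"
   proof (rule lookup_bracket_right)
    show "lookup (full.b u (H i)) (R a) = (if u = R a then - of_int (ev i a) else 0)" for u
     by (cases u) (auto simp: bb_simps lookup_single when_def)
   qed
   moreover have "bi_ext full.b x (single (H i) 1) = 0"
    using i(1) by (intro zero) (simp add: ridx_set_def)
   ultimately show ?thesis
    using of_int_nonzero[OF i(2)] by simp
  qed
  have "keys x \<subseteq> H ` {..<Suc m}"
   using keys R by (auto simp: ridx_set_def in_keys_iff)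
  then have x_eq: "x = (\<Sum>i<Suc m. single (H i) (lookup x (H i)))"
   using poly_mapping_sum_single[of "H ` {..<Suc m}" x] by (simp add: sum.reindex inj_on_def del: sum.lessThan_Suc)
  have "(\<Sum>i<m. lookup x (H i) * of_int (ev i a)) = 0" if a: "a \<in> Rt" for a
  proof -
   have "bi_ext full.b x (single (R a) 1) =
     (\<Sum>i<Suc m. single (R a) (lookup x (H i) * of_int (ev i a)))"
    by (subst x_eq, unfold pm_linear_sum[OF bi_ext_linear_left]) (simp add: bb_simps del: sum.lessThan_Suc)
   also have "\<dots> = single (R a) (\<Sum>i<m. lookup x (H i) * of_int (ev i a))"
    by (simp add: single_sum ev_m)
   finally have "single (R a) (\<Sum>i<m. lookup x (H i) * (of_int (ev i a) :: 'k)) = 0"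
    using zero[of "single (R a) 1"] a by (simp add: ridx_set_def)
   from arg_cong[OF this, of "\<lambda>x. lookup x (R a)"] show ?thesis
    by simp
  qed
  then have "lookup x (H i) = 0" if "i < m" for i
   using ev_indep[of "\<lambda>i. lookup x (H i)"] that by blast
  then have "\<rho> x = 0"
   using R by (intro poly_mapping_eqI) (auto simp: ridx_set_def)
  then show "x \<in> {x \<in> carrier (derived_superalg full.L). \<rho> x = \<zero>\<^bsub>quot.L\<^esub>}"
   using x by simp
 qed
qed

lemma derived_mod_center_model:
 assumes "lie_copy G full.L \<theta>"
 obtains \<xi> where "lie_copy (derived_mod_center G) quot.L \<xi>"
  "\<And>y. \<lbrakk>y \<in> carrier G; keys (\<theta> y) \<subseteq> idx (Suc m)\<rbrakk> \<Longrightarrow>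
    \<xi> (superalg_center (derived_superalg G) +>\<^bsub>derived_superalg G\<^esub> y) = \<rho> (\<theta> y) \<and>
    superalg_center (derived_superalg G) +>\<^bsub>derived_superalg G\<^esub> y \<in> carrier (derived_mod_center G)"
proof -
 have part: "\<rho> ` part (derived_superalg full.L) p = part quot.L p" for p
 proof
  show "\<rho> ` part (derived_superalg full.L) p \<subseteq> part quot.L p"
   by (auto simp: keys_pm_restrict)
  show "part quot.L p \<subseteq> \<rho> ` part (derived_superalg full.L) p"
  proof
   fix x assume x: "x \<in> part quot.L p"
   then have "keys x \<subseteq> idx m"
    by auto
   then have "\<rho> x = x"
    by (rule pm_restrict_id)
   moreover have "x \<in> part (derived_superalg full.L) p"
    using x unfolding derived_superalg_simps derived_full by (auto simp: ridx_set_def subset_iff)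
   ultimately show "x \<in> \<rho> ` part (derived_superalg full.L) p"
    by (metis imageI)
  qed
 qed
 show ?thesis
  using derived_mod_center_copy[OF assms \<rho>_epi quot.lie_superalgebra_basis_superalg center_full part] that
  unfolding derived_full by auto
qed

end

section \<open>Linear systems and the rank of a matrix of corank one\<close>

lemma functional_finsum_indexed:
 fixes V :: "('k :: field, 'v, 'm) module_scheme" and \<phi> :: "'v \<Rightarrow> 'k"
 assumes V: "vectorspace class_ring V" and A: "finite A" "\<And>i. i \<in> A \<Longrightarrow> g i \<in> carrier V"
  and add: "\<And>x y. \<lbrakk>x \<in> carrier V; y \<in> carrier V\<rbrakk> \<Longrightarrow> \<phi> (x \<oplus>\<^bsub>V\<^esub> y) = \<phi> x + \<phi> y"
  and smult: "\<And>c x. x \<in> carrier V \<Longrightarrow> \<phi> (c \<odot>\<^bsub>V\<^esub> x) = c * \<phi> x"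
 shows "\<phi> (\<Oplus>\<^bsub>V\<^esub>i\<in>A. a i \<odot>\<^bsub>V\<^esub> g i) = (\<Sum>i\<in>A. a i * \<phi> (g i))"
  "(\<Oplus>\<^bsub>V\<^esub>i\<in>A. a i \<odot>\<^bsub>V\<^esub> g i) \<in> carrier V"
proof -
 interpret vectorspace class_ring V by fact
 have closed: "a \<odot>\<^bsub>V\<^esub> x \<in> carrier V" if "x \<in> carrier V" for a x
  using smult_closed[of a x] that by simp
 have "\<phi> \<zero>\<^bsub>V\<^esub> = \<phi> \<zero>\<^bsub>V\<^esub> + \<phi> \<zero>\<^bsub>V\<^esub>"
  using add[of "\<zero>\<^bsub>V\<^esub>" "\<zero>\<^bsub>V\<^esub>"] by simp
 then have zero: "\<phi> \<zero>\<^bsub>V\<^esub> = 0"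
  by (metis add_cancel_right_right)
 show "(\<Oplus>\<^bsub>V\<^esub>i\<in>A. a i \<odot>\<^bsub>V\<^esub> g i) \<in> carrier V"
  using A by (intro finsum_closed) (auto intro!: closed)
 show "\<phi> (\<Oplus>\<^bsub>V\<^esub>i\<in>A. a i \<odot>\<^bsub>V\<^esub> g i) = (\<Sum>i\<in>A. a i * \<phi> (g i))"
  using A
 proof (induction A rule: finite_induct)
  case (insert c B)
  then have "(\<Oplus>\<^bsub>V\<^esub>i\<in>insert c B. a i \<odot>\<^bsub>V\<^esub> g i) = a c \<odot>\<^bsub>V\<^esub> g c \<oplus>\<^bsub>V\<^esub> (\<Oplus>\<^bsub>V\<^esub>i\<in>B. a i \<odot>\<^bsub>V\<^esub> g i)"
   by (intro finsum_insert) (auto intro!: closed)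
  moreover have "(\<Oplus>\<^bsub>V\<^esub>i\<in>B. a i \<odot>\<^bsub>V\<^esub> g i) \<in> carrier V"
   using insert by (intro finsum_closed) (auto intro!: closed)
  ultimately show ?case
   using insert closed by (simp add: add smult)
 qed (simp add: zero)
qed

lemma mat_mult_vec_sum:
 "i < n \<Longrightarrow> (mat n n' f *\<^sub>v vec n' x) $ i = (\<Sum>j<n'. f (i, j) * x j)"
 by (simp add: scalar_prod_def lessThan_atLeast0)

lemma det_nonzero_iff_sum:
 fixes f :: "nat \<Rightarrow> nat \<Rightarrow> 'k :: field"
 shows "det (mat n n (\<lambda>(i, j). f i j)) \<noteq> 0 \<longleftrightarrow>
  (\<forall>x. (\<forall>i<n. (\<Sum>j<n. f i j * x j) = 0) \<longrightarrow> (\<forall>j<n. x j = 0))"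
proof -
 let ?A = "mat n n (\<lambda>(i, j). f i j)"
 have "det ?A = 0 \<longleftrightarrow> (\<exists>v. v \<in> carrier_vec n \<and> v \<noteq> 0\<^sub>v n \<and> ?A *\<^sub>v v = 0\<^sub>v n)"
  by (rule det_0_iff_vec_prod_zero_field) simp
 also have "\<dots> \<longleftrightarrow> (\<exists>x. (\<forall>i<n. (\<Sum>j<n. f i j * x j) = 0) \<and> (\<exists>j<n. x j \<noteq> 0))"
 proof
  assume "\<exists>v. v \<in> carrier_vec n \<and> v \<noteq> 0\<^sub>v n \<and> ?A *\<^sub>v v = 0\<^sub>v n"
  then obtain v where v: "v \<in> carrier_vec n" "v \<noteq> 0\<^sub>v n" "?A *\<^sub>v v = 0\<^sub>v n"
   by blast
  have v_eq: "v = vec n (\<lambda>j. v $ j)"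
   using v(1) by auto
  then have "(\<Sum>j<n. f i j * v $ j) = 0" if "i < n" for i
   using v(3) that mat_mult_vec_sum[OF that, of n "\<lambda>(i, j). f i j" "\<lambda>j. v $ j"] by simp
  moreover have "\<exists>j<n. v $ j \<noteq> 0"
   using v(1,2) by (metis carrier_vecD eq_vecI index_zero_vec(1) index_zero_vec(2))
  ultimately show "\<exists>x. (\<forall>i<n. (\<Sum>j<n. f i j * x j) = 0) \<and> (\<exists>j<n. x j \<noteq> 0)"
   by (intro exI[of _ "\<lambda>j. v $ j"]) auto
 next
  assume "\<exists>x. (\<forall>i<n. (\<Sum>j<n. f i j * x j) = 0) \<and> (\<exists>j<n. x j \<noteq> 0)"
  then obtain x where x: "\<And>i. i < n \<Longrightarrow> (\<Sum>j<n. f i j * x j) = 0" "\<exists>j<n. x j \<noteq> 0"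
   by blast
  have "?A *\<^sub>v vec n x = 0\<^sub>v n"
  proof (rule eq_vecI)
   fix i assume "i < dim_vec (0\<^sub>v n :: 'k vec)"
   then have i: "i < n"
    by simp
   show "(?A *\<^sub>v vec n x) $ i = 0\<^sub>v n $ i"
    unfolding mat_mult_vec_sum[OF i] using x(1)[OF i] i by simp
  qed simp
  moreover have "vec n x \<noteq> 0\<^sub>v n"
   using x(2) by (metis index_vec index_zero_vec(1))
  ultimately show "\<exists>v. v \<in> carrier_vec n \<and> v \<noteq> 0\<^sub>v n \<and> ?A *\<^sub>v v = 0\<^sub>v n"
   by (intro exI[of _ "vec n x"]) simp
 qed
 finally show ?thesis
  by blast
qed

text \<open>The hypothesis is injectivity on column vectors, while the unknown multiplies from the
  left; the determinant of the transpose connects the two.\<close>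

lemma solve_linear_system:
 fixes f :: "nat \<Rightarrow> nat \<Rightarrow> 'k :: field"
 assumes "\<forall>x. (\<forall>i<n. (\<Sum>j<n. f i j * x j) = 0) \<longrightarrow> (\<forall>j<n. x j = 0)"
 obtains x where "\<And>j. j < n \<Longrightarrow> (\<Sum>i<n. x i * f i j) = b j"
proof -
 let ?A = "mat n n (\<lambda>(i, j). f i j)"
 have "det ?A \<noteq> 0"
  unfolding det_nonzero_iff_sum using assms by blast
 moreover have "transpose_mat ?A = mat n n (\<lambda>(i, j). f j i)"
  by auto
 ultimately have "det (mat n n (\<lambda>(i, j). f j i)) \<noteq> 0"
  using det_transpose[of ?A n] by simp
 then have "mat n n (\<lambda>(i, j). f j i) \<in> Units (ring_mat TYPE('k) n ())"
  by (intro det_non_zero_imp_unit) simp_all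
 then obtain C where C: "C \<in> carrier_mat n n" "mat n n (\<lambda>(i, j). f j i) * C = 1\<^sub>m n"
  by (auto simp: Units_def ring_mat_simps)
 have "mat n n (\<lambda>(i, j). f j i) *\<^sub>v (C *\<^sub>v vec n b) = (mat n n (\<lambda>(i, j). f j i) * C) *\<^sub>v vec n b"
  using C(1) by (intro assoc_mult_mat_vec[symmetric]) auto
 also have "\<dots> = vec n b"
  unfolding C(2) by simp
 finally have eq: "mat n n (\<lambda>(i, j). f j i) *\<^sub>v (C *\<^sub>v vec n b) = vec n b" .
 have "C *\<^sub>v vec n b = vec n (\<lambda>i. (C *\<^sub>v vec n b) $ i)"
  using C(1) by auto
 then have "(\<Sum>i<n. (C *\<^sub>v vec n b) $ i * f i j) = b j" if "j < n" for j
  using eq mat_mult_vec_sum[OF that, of n "\<lambda>(i, j). f j i" "\<lambda>i. (C *\<^sub>v vec n b) $ i"] that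
  by (simp add: mult.commute)
 then show ?thesis
  using that by blast
qed

text \<open>The kernel vector z makes the matrix singular, and adding the elementary matrix at (k,
  k), of rank 1, makes it invertible. Subadditivity of the rank then leaves only one value.\<close>

lemma rank_eq_pred:
 fixes f :: "nat \<Rightarrow> nat \<Rightarrow> 'k :: field"
 assumes k: "k < Suc m" and z: "\<And>i. i < Suc m \<Longrightarrow> (\<Sum>j<Suc m. f i j * z j) = 0" "z k \<noteq> 0"
  and inj: "\<forall>x. (\<forall>i<Suc m. (\<Sum>j<Suc m. f i j * x j) + (if i = k then x k else 0) = 0) \<longrightarrow> (\<forall>j<Suc m. x j = 0)"
 shows "vec_space.rank (Suc m) (mat (Suc m) (Suc m) (\<lambda>(i, j). f i j)) = m"
proof -
 interpret vec_space "TYPE('k)" "Suc m" .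
 let ?A = "mat (Suc m) (Suc m) (\<lambda>(i, j). f i j)"
 let ?E = "mat (Suc m) (Suc m) (\<lambda>(i, j). (if i = k then 1 else 0) * (if j = k then 1 else 0)) :: 'k mat"
 have "det ?A = 0"
  using det_nonzero_iff_sum[of "Suc m" f] z k by blast
 then have "rank ?A < Suc m"
  by (intro det_zero_low_rank) simp_all
 moreover have "det (?A + ?E) \<noteq> 0"
 proof -
  have sum_eq: "?A + ?E = mat (Suc m) (Suc m) (\<lambda>(i, j). f i j + (if i = k then 1 else 0) * (if j = k then 1 else 0))"
   by auto
  have expand: "(\<Sum>j<Suc m. (f i j + (if i = k then 1 else 0) * (if j = k then 1 else 0)) * x j) =
    (\<Sum>j<Suc m. f i j * x j) + (if i = k then x k else 0)" for i x
  proof -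
   have "(\<Sum>j<Suc m. (f i j + (if i = k then 1 else 0) * (if j = k then 1 else 0)) * x j) =
     (\<Sum>j<Suc m. f i j * x j) + (\<Sum>j<Suc m. if j = k then (if i = k then x k else 0) else 0)"
    unfolding sum.distrib[symmetric] by (intro sum.cong) (auto simp: algebra_simps)
   then show ?thesis
    using k by simp
  qed
  show ?thesis
   unfolding sum_eq det_nonzero_iff_sum expand using inj by blast
 qed
 then have "rank (?A + ?E) = Suc m"
  using det_rank_iff[of "?A + ?E"] by simp
 moreover have "rank (?A + ?E) \<le> rank ?A + rank ?E"
  by (rule rank_subadditive[of _ "Suc m"]) simp_all
 moreover have "rank ?E \<le> 1"
  by (rule rank_le_1_product_entries[of _ "Suc m" "\<lambda>i. if i = k then 1 else 0" "\<lambda>j. if j = k then 1 else 0"]) simp_all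
 ultimately show ?thesis
  by simp
qed

section \<open>Coordinates on an arbitrary realization\<close>

context root_model
begin

text \<open>Nothing but the axioms is known about the Cartan space, so a basis has to be found: the
  coroots together with a vector w on which the k-th simple root is 1 and the others are 0. Here z
  is a kernel vector of the Cartan matrix modulo 3 and k an index where z is nonzero; H (m + 1)
  stands for w.\<close>

lemma cartan_coordinates:
 fixes D :: "('k, 'h) cartan_datum" and z :: "nat \<Rightarrow> int"
 assumes real: "cartan_realization D" and dim: "dim_row (cartan_matrix D) = Suc m"
  and A: "\<And>i j. \<lbrakk>i \<le> m; j \<le> m\<rbrakk> \<Longrightarrow> 3 dvd cartan_matrix D $$ (i, j) - (\<Sum>k<m. cor (sr i) k * ev k (sr j))"
  and k: "k \<le> m" and ev_ext: "\<And>j. j \<le> m \<Longrightarrow> ev (Suc m) (sr j) = (if j = k then 1 else 0)"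
  and z: "\<And>i. i \<le> m \<Longrightarrow> 3 dvd (\<Sum>j<Suc m. cartan_matrix D $$ (i, j) * z j)" "\<not> 3 dvd z k"
  and inj: "\<forall>x :: nat \<Rightarrow> 'k. (\<forall>i<Suc m.
   (\<Sum>j<Suc m. of_int (cartan_matrix D $$ (i, j)) * x j) + (if i = k then x k else 0) = 0) \<longrightarrow> (\<forall>j<Suc m. x j = 0)"
 shows "\<exists>\<kappa> :: 'h \<Rightarrow> 'a ridx \<Rightarrow>\<^sub>0 'k.
  (\<forall>x\<in>carrier (cartan_space D). \<forall>y\<in>carrier (cartan_space D). \<kappa> (x \<oplus>\<^bsub>cartan_space D\<^esub> y) = \<kappa> x + \<kappa> y) \<and>
  (\<forall>x\<in>carrier (cartan_space D). \<forall>r. \<kappa> (r \<odot>\<^bsub>cartan_space D\<^esub> x) = pm_smult r (\<kappa> x)) \<and>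
  (\<forall>x\<in>carrier (cartan_space D). \<kappa> x = 0 \<longrightarrow> x = \<zero>\<^bsub>cartan_space D\<^esub>) \<and>
  \<kappa> ` carrier (cartan_space D) = {x. keys x \<subseteq> H ` {..<Suc (Suc m)}} \<and>
  (\<forall>i\<le>m. \<kappa> (coroot D i) = hh (Suc (Suc m)) (sr i)) \<and>
  (\<forall>x\<in>carrier (cartan_space D). \<forall>j\<le>m.
   root D j x = (\<Sum>i<Suc (Suc m). lookup (\<kappa> x) (H i) * of_int (ev i (sr j))))"
proof -
 let ?V = "cartan_space D" and ?h = "coroot D" and ?r = "root D" and ?n = "Suc m"
 let ?A = "\<lambda>i j. of_int (cartan_matrix D $$ (i, j)) :: 'k" and ?z = "\<lambda>j. of_int (z j) :: 'k"
 have V: "vectorspace class_ring ?V" and fd: "vectorspace.fin_dim class_ring ?V"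
  and dimV: "vectorspace.dim class_ring ?V = 2 * ?n - cartan_rank D"
  and h: "\<And>i. i < ?n \<Longrightarrow> ?h i \<in> carrier ?V" and h_inj: "inj_on ?h {..<?n}"
  and h_indep: "\<not> module.lin_dep class_ring ?V (?h ` {..<?n})"
  and r_add: "\<And>j x y. \<lbrakk>j < ?n; x \<in> carrier ?V; y \<in> carrier ?V\<rbrakk> \<Longrightarrow> ?r j (x \<oplus>\<^bsub>?V\<^esub> y) = ?r j x + ?r j y"
  and r_smult: "\<And>j c x. \<lbrakk>j < ?n; x \<in> carrier ?V\<rbrakk> \<Longrightarrow> ?r j (c \<odot>\<^bsub>?V\<^esub> x) = c * ?r j x"
  and r_indep: "\<And>c. (\<forall>x\<in>carrier ?V. (\<Sum>j<?n. c j * ?r j x) = 0) \<Longrightarrow> (\<forall>j<?n. c j = 0)"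
  and r_h: "\<And>i j. \<lbrakk>i < ?n; j < ?n\<rbrakk> \<Longrightarrow> ?r j (?h i) = ?A i j"
  and col: "dim_col (cartan_matrix D) = ?n"
  using real unfolding cartan_realization_def Let_def dim by blast+
 interpret V: vectorspace class_ring ?V by (rule V)
 have V_smult [simp, intro]: "c \<odot>\<^bsub>?V\<^esub> x \<in> carrier ?V" if "x \<in> carrier ?V" for c x
  using V.smult_closed[of c x] that by simp
 have Az: "(\<Sum>j<?n. ?A i j * ?z j) = 0" if "i < ?n" for i
 proof -
  have "(of_int (\<Sum>j<?n. cartan_matrix D $$ (i, j) * z j) :: 'k) = of_int 0"
   by (rule full.of_int_cong) (use z(1)[of i] that in simp)
  then show ?thesis
   by (simp del: sum.lessThan_Suc)
 qed
 have zk: "?z k \<noteq> 0"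
  by (rule of_int_nonzero[OF z(2)])
 have k': "k < ?n"
  using k by simp
 have "map_mat of_int (cartan_matrix D) = mat ?n ?n (\<lambda>(i, j). ?A i j)"
  using dim col by (intro eq_matI) auto
 moreover have "vec_space.rank ?n (mat ?n ?n (\<lambda>(i, j). ?A i j)) = m"
  by (rule rank_eq_pred[where f = ?A and z = ?z and k = k, OF k' Az zk inj])
 ultimately have "cartan_rank D = m"
  by (simp add: cartan_rank_def dim)
 then have dimV': "V.dim = Suc ?n"
  using dimV by simp
 \<comment> \<open>Since A z = 0, this combination of the simple roots kills every coroot, and by
   independence of the roots it is nonzero. It detects vectors outside the span of the
   coroots.\<close>
 define g where "g x = (\<Sum>j<?n. ?z j * ?r j x)" for x
 have g_add: "g (x \<oplus>\<^bsub>?V\<^esub> y) = g x + g y" if "x \<in> carrier ?V" "y \<in> carrier ?V" for x y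
  using that by (simp add: g_def r_add sum.distrib algebra_simps del: sum.lessThan_Suc)
 have g_smult: "g (c \<odot>\<^bsub>?V\<^esub> x) = c * g x" if "x \<in> carrier ?V" for c x
  using that by (simp add: g_def r_smult sum_distrib_left algebra_simps del: sum.lessThan_Suc)
 have g_h: "g (?h i) = 0" if "i < ?n" for i
  using Az[OF that] r_h[OF that] by (simp add: g_def mult.commute del: sum.lessThan_Suc)
 obtain u where u: "u \<in> carrier ?V" "g u \<noteq> 0"
 proof -
  have "\<not> (\<forall>x\<in>carrier ?V. g x = 0)"
   using r_indep[of ?z] zk k' unfolding g_def by metis
  then show ?thesis
   using that by blast
 qed
 \<comment> \<open>This choice makes the right-hand side b orthogonal to z, which is the solvability
   condition of the singular system x A = b.\<close>
 define c where "c = ?z k / g u"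
 define b where "b j = (if j = k then 1 else 0) - c * ?r j u" for j
 have "(\<Sum>j<?n. b j * ?z j) = ?z k - c * g u"
 proof -
  have "(\<Sum>j<?n. b j * ?z j) = (\<Sum>j<?n. if j = k then ?z j else 0) - (\<Sum>j<?n. c * (?z j * ?r j u))"
   unfolding sum_subtractf[symmetric] by (intro sum.cong) (auto simp: b_def algebra_simps)
  then show ?thesis
   using k' by (simp add: g_def sum_distrib_left del: sum.lessThan_Suc)
 qed
 then have bz: "(\<Sum>j<?n. b j * ?z j) = 0"
  using u(2) by (simp add: c_def del: sum.lessThan_Suc)
 let ?e = "\<lambda>i j. if i = k \<and> j = k then 1 else 0 :: 'k"
 have expand: "(\<Sum>j<?n. (?A i j + ?e i j) * x j) = (\<Sum>j<?n. ?A i j * x j) + (if i = k then x k else 0)" for i x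
 proof -
  have "(\<Sum>j<?n. (?A i j + ?e i j) * x j) = (\<Sum>j<?n. ?A i j * x j) + (\<Sum>j<?n. if j = k then (if i = k then x k else 0) else 0)"
   unfolding sum.distrib[symmetric] by (intro sum.cong) (auto simp: algebra_simps)
  then show ?thesis
   using k' by simp
 qed
 obtain x where x: "\<And>j. j < ?n \<Longrightarrow> (\<Sum>i<?n. x i * (?A i j + ?e i j)) = b j"
 proof (rule solve_linear_system[of ?n "\<lambda>i j. ?A i j + ?e i j" b])
  show "\<forall>x. (\<forall>i<?n. (\<Sum>j<?n. (?A i j + ?e i j) * x j) = 0) \<longrightarrow> (\<forall>j<?n. x j = 0)"
   unfolding expand by (rule inj)
 qed (rule that)
 \<comment> \<open>The system solved above is the invertible one, with 1 added to the entry (k, k).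
   Pairing it with z gives x_k z_k = 0, so x_k = 0 and x solves the original system.\<close>
 have "x k * ?z k = (\<Sum>i<?n. x i * (\<Sum>j<?n. (?A i j + ?e i j) * ?z j))"
 proof -
  have "(\<Sum>i<?n. x i * (\<Sum>j<?n. (?A i j + ?e i j) * ?z j)) = (\<Sum>i<?n. if i = k then x k * ?z k else 0)"
   unfolding expand by (intro sum.cong) (auto simp: Az simp del: sum.lessThan_Suc)
  then show ?thesis
   using k' by simp
 qed
 also have "\<dots> = (\<Sum>j<?n. (\<Sum>i<?n. x i * (?A i j + ?e i j)) * ?z j)"
  unfolding sum_distrib_left sum_distrib_right by (subst sum.swap) (simp add: mult.assoc del: sum.lessThan_Suc)
 also have "\<dots> = (\<Sum>j<?n. b j * ?z j)"
  by (intro sum.cong) (use x in auto)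
 finally have "x k = 0"
  using bz zk by simp
 then have xA: "(\<Sum>i<?n. x i * ?A i j) = b j" if "j < ?n" for j
 proof -
  have "(\<Sum>i<?n. x i * (?A i j + ?e i j)) = (\<Sum>i<?n. x i * ?A i j)"
   using \<open>x k = 0\<close> by (intro sum.cong) auto
  then show ?thesis
   using x[OF that] by simp
 qed
 let ?S = "\<lambda>a. \<Oplus>\<^bsub>?V\<^esub>i\<in>{..<?n}. a i \<odot>\<^bsub>?V\<^esub> ?h i"
 have S: "?S a \<in> carrier ?V" for a
  using h by (intro V.finsum_closed) auto
 have r_S: "?r j (?S a) = (\<Sum>i<?n. a i * ?A i j)" if "j < ?n" for j a
 proof -
  have "?r j (?S a) = (\<Sum>i<?n. a i * ?r j (?h i))"
   by (rule functional_finsum_indexed(1)[OF V]) (use h r_add r_smult that in auto)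
  then show ?thesis
   using that r_h by (simp del: sum.lessThan_Suc)
 qed
 define w where "w = c \<odot>\<^bsub>?V\<^esub> u \<oplus>\<^bsub>?V\<^esub> ?S x"
 have w: "w \<in> carrier ?V"
  using u S by (simp add: w_def)
 have r_w: "?r j w = (if j = k then 1 else 0)" if "j < ?n" for j
  using that u S r_S xA by (simp add: w_def r_add r_smult b_def del: sum.lessThan_Suc)
 have g_w: "g w = ?z k"
 proof -
  have "g w = (\<Sum>j<?n. if j = k then ?z j else 0)"
   unfolding g_def by (intro sum.cong) (auto simp: r_w)
  then show ?thesis
   using k' by simp
 qed
 have g_S: "g (?S a) = 0" for a
 proof -
  have "g (?S a) = (\<Sum>i<?n. a i * g (?h i))"
   by (rule functional_finsum_indexed(1)[OF V]) (use h g_add g_smult in auto)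
  then show ?thesis
   using g_h by (simp del: sum.lessThan_Suc)
 qed
 have h_S: "V.lincomb a (?h ` {..<?n}) = ?S (\<lambda>i. a (?h i))" for a
 proof -
  have "V.lincomb a (?h ` {..<?n}) = (\<Oplus>\<^bsub>?V\<^esub>v\<in>?h ` {..<?n}. a v \<odot>\<^bsub>?V\<^esub> v)"
   by (simp add: V.lincomb_def)
  also have "\<dots> = ?S (\<lambda>i. a (?h i))"
   using h by (intro V.finsum_reindex h_inj) auto
  finally show ?thesis .
 qed
 have h_sub: "?h ` {..<?n} \<subseteq> carrier ?V"
  using h by auto
 have S_zero: "a i = 0" if "?S a = \<zero>\<^bsub>?V\<^esub>" "i < ?n" for a i
 proof (rule ccontr)
  assume neq: "a i \<noteq> 0"
  let ?a = "\<lambda>v. a (inv_into {..<?n} ?h v)"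
  have "?S (\<lambda>i. ?a (?h i)) = ?S a"
   using h h_inj by (intro V.finsum_cong') auto
  then have "V.lincomb ?a (?h ` {..<?n}) = \<zero>\<^bsub>?V\<^esub>"
   using that(1) h_S by simp
  then have "V.lin_dep (?h ` {..<?n})"
   using neq that(2) h_inj V.lin_dep_crit[of "?h ` {..<?n}" "?h ` {..<?n}" ?a "?h i"] by auto
  then show False
   using h_indep by simp
 qed
 have g_span: "g v = 0" if v: "v \<in> V.span (?h ` {..<?n})" for v
 proof -
  obtain a where "V.lincomb a (?h ` {..<?n}) = v"
   using V.finite_in_span[OF _ h_sub v] by auto
  then show ?thesis
   using g_S h_S by metis
 qed
 then have w_span: "w \<notin> V.span (?h ` {..<?n})"
  using g_w zk by metis
 then have w_notin: "w \<notin> ?h ` {..<?n}"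
  using V.in_own_span[OF h_sub] by blast
 \<comment> \<open>Corank 1 makes the dimension m + 2, so the m + 1 independent coroots and w form a
   basis.\<close>
 have "V.basis (?h ` {..<?n} \<union> {w})"
 proof (rule V.dim_li_is_basis[OF fd])
  show "\<not> V.lin_dep (?h ` {..<?n} \<union> {w})"
   using V.lin_dep_iff_in_span[OF h_sub h_indep w w_notin] w_span by blast
  have "card (?h ` {..<?n} \<union> {w}) = Suc ?n"
   using w_notin card_image[OF h_inj] by (simp del: sum.lessThan_Suc)
  then show "V.dim \<le> card (?h ` {..<?n} \<union> {w})"
   using dimV' by simp
 qed (use h w in auto)
 then have span: "V.span (?h ` {..<?n} \<union> {w}) = carrier ?V"
  by (simp add: V.basis_def)
 have decomp: "\<exists>a t. v = ?S a \<oplus>\<^bsub>?V\<^esub> t \<odot>\<^bsub>?V\<^esub> w" if v: "v \<in> carrier ?V" for v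
 proof -
  have "?h ` {..<?n} \<union> {w} \<subseteq> carrier ?V" "v \<in> V.span (?h ` {..<?n} \<union> {w})"
   using h_sub w v span by auto
  then obtain a where a: "V.lincomb a (?h ` {..<?n} \<union> {w}) = v"
   using V.finite_in_span[of "?h ` {..<?n} \<union> {w}" v] by auto
  have "v = (\<Oplus>\<^bsub>?V\<^esub>v\<in>insert w (?h ` {..<?n}). a v \<odot>\<^bsub>?V\<^esub> v)"
   unfolding a[symmetric] V.lincomb_def by simp
  also have "\<dots> = a w \<odot>\<^bsub>?V\<^esub> w \<oplus>\<^bsub>?V\<^esub> (\<Oplus>\<^bsub>?V\<^esub>v\<in>?h ` {..<?n}. a v \<odot>\<^bsub>?V\<^esub> v)"
   using w_notin h w by (intro V.finsum_insert) auto
  also have "(\<Oplus>\<^bsub>?V\<^esub>v\<in>?h ` {..<?n}. a v \<odot>\<^bsub>?V\<^esub> v) = ?S (\<lambda>i. a (?h i))"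
   using h_S[of a] by (simp add: V.lincomb_def)
  finally have "v = ?S (\<lambda>i. a (?h i)) \<oplus>\<^bsub>?V\<^esub> a w \<odot>\<^bsub>?V\<^esub> w"
   using S w by (simp add: V.a_comm)
  then show ?thesis
   by (intro exI)
 qed
 have S_add: "?S (\<lambda>i. a i + b i) = ?S a \<oplus>\<^bsub>?V\<^esub> ?S b" for a b
 proof -
  have "?S (\<lambda>i. a i + b i) = (\<Oplus>\<^bsub>?V\<^esub>i\<in>{..<?n}. a i \<odot>\<^bsub>?V\<^esub> ?h i \<oplus>\<^bsub>?V\<^esub> b i \<odot>\<^bsub>?V\<^esub> ?h i)"
   using h V.smult_l_distr by (intro V.finsum_cong') auto
  also have "\<dots> = ?S a \<oplus>\<^bsub>?V\<^esub> ?S b"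
   using h by (intro V.finsum_addf) auto
  finally show ?thesis .
 qed
 have S_smult: "?S (\<lambda>i. t * a i) = t \<odot>\<^bsub>?V\<^esub> ?S a" for t a
 proof -
  have "?S (\<lambda>i. t * a i) = (\<Oplus>\<^bsub>?V\<^esub>i\<in>{..<?n}. t \<odot>\<^bsub>?V\<^esub> (a i \<odot>\<^bsub>?V\<^esub> ?h i))"
   using h V.smult_assoc1 by (intro V.finsum_cong') auto
  also have "\<dots> = t \<odot>\<^bsub>?V\<^esub> ?S a"
   using h by (intro V.finsum_smult[symmetric]) auto
  finally show ?thesis .
 qed
 have S_cong: "?S a = ?S a'" if "\<And>i. i < ?n \<Longrightarrow> a i = a' i" for a a'
  using h that by (intro V.finsum_cong') auto
 let ?P = "{p :: 'a ridx \<Rightarrow>\<^sub>0 'k. keys p \<subseteq> H ` {..<Suc ?n}}"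
 \<comment> \<open>Coefficients with respect to the coroots: H m stands for the combination of the
   first m coroots given by \<open>cor (sr m)\<close>, minus the last coroot. The map
   \<open>\<kappa>\<close> is obtained below as the inverse of the explicit map \<open>\<mu>\<close>
   from coordinates to vectors.\<close>
 define co where "co p i = (if i < m then lookup p (H i) + lookup p (H m) * of_int (cor (sr m) i)
   else - lookup p (H m))" for p :: "'a ridx \<Rightarrow>\<^sub>0 'k" and i
 define \<mu> where "\<mu> p = ?S (co p) \<oplus>\<^bsub>?V\<^esub> lookup p (H ?n) \<odot>\<^bsub>?V\<^esub> w" for p
 have \<mu>_closed: "\<mu> p \<in> carrier ?V" for p
  using S w by (simp add: \<mu>_def)
 have \<mu>_add: "\<mu> (p + q) = \<mu> p \<oplus>\<^bsub>?V\<^esub> \<mu> q" for p q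
 proof -
  have "?S (co (p + q)) = ?S (co p) \<oplus>\<^bsub>?V\<^esub> ?S (co q)"
   unfolding S_add[symmetric] by (rule S_cong) (simp add: co_def lookup_add algebra_simps)
  then show ?thesis
   using S[of "co p"] S[of "co q"] w V.smult_l_distr[of "lookup p (H ?n)" "lookup q (H ?n)" w]
   by (simp add: \<mu>_def lookup_add V.a_ac)
 qed
 have \<mu>_smult: "\<mu> (pm_smult t p) = t \<odot>\<^bsub>?V\<^esub> \<mu> p" for t p
 proof -
  have "?S (co (pm_smult t p)) = t \<odot>\<^bsub>?V\<^esub> ?S (co p)"
   unfolding S_smult[symmetric] by (rule S_cong) (simp add: co_def algebra_simps)
  then show ?thesis
   using S[of "co p"] w V.smult_r_distr[of t "?S (co p)" "lookup p (H ?n) \<odot>\<^bsub>?V\<^esub> w"]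
    V.smult_assoc1[of t "lookup p (H ?n)" w]
   by (simp add: \<mu>_def)
 qed
 have \<mu>_zero: "p = 0" if p: "p \<in> ?P" "\<mu> p = \<zero>\<^bsub>?V\<^esub>" for p
 proof -
  have "g (\<mu> p) = lookup p (H ?n) * ?z k"
   using S w g_S g_w by (simp add: \<mu>_def g_add g_smult)
  moreover have "g \<zero>\<^bsub>?V\<^esub> = 0"
   using g_smult[of "\<zero>\<^bsub>?V\<^esub>" 0] V.lmult_0[of "\<zero>\<^bsub>?V\<^esub>"] by simp
  ultimately have n: "lookup p (H ?n) = 0"
   using p(2) zk by auto
  then have "?S (co p) = \<zero>\<^bsub>?V\<^esub>"
   using p(2) S[of "co p"] w V.lmult_0[of w] by (simp add: \<mu>_def)
  then have co: "co p i = 0" if "i < ?n" for i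
   using S_zero that by blast
  have m: "lookup p (H m) = 0"
   using co[of m] by (simp add: co_def)
  then have "lookup p (H i) = 0" if "i < Suc ?n" for i
   using co[of i] n that by (cases "i < m") (auto simp: co_def less_Suc_eq)
  then show ?thesis
   using p(1) by (intro poly_mapping_eqI) (auto simp: in_keys_iff subset_iff image_iff)
 qed
 have P_sub: "p + pm_smult (- 1) q \<in> ?P" if "p \<in> ?P" "q \<in> ?P" for p q
  using that keys_add[of p "pm_smult (- 1) q"] keys_pm_smult[of "- 1" q] by blast
 have \<mu>_inj: "inj_on \<mu> ?P"
 proof (rule inj_onI)
  fix p q assume pq: "p \<in> ?P" "q \<in> ?P" "\<mu> p = \<mu> q"
  have "\<mu> (p + pm_smult (- 1) q) = (1 + - 1) \<odot>\<^bsub>?V\<^esub> \<mu> q"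
   using pq(3) \<mu>_closed[of q] V.smult_l_distr[of 1 "- 1" "\<mu> q"] V.smult_one[of "\<mu> q"] by (simp add: \<mu>_add \<mu>_smult)
  then have "\<mu> (p + pm_smult (- 1) q) = \<zero>\<^bsub>?V\<^esub>"
   using \<mu>_closed[of q] V.lmult_0[of "\<mu> q"] by simp
  from \<mu>_zero[OF P_sub[OF pq(1,2)] this] show "p = q"
   by (simp add: pm_smult_minus_one)
 qed
 have \<mu>_image: "\<mu> ` ?P = carrier ?V"
 proof
  show "carrier ?V \<subseteq> \<mu> ` ?P"
  proof
   fix v assume "v \<in> carrier ?V"
   then obtain a t where v: "v = ?S a \<oplus>\<^bsub>?V\<^esub> t \<odot>\<^bsub>?V\<^esub> w"
    using decomp by blast
   define c where "c i = (if i < m then a i + a m * of_int (cor (sr m) i) else if i = m then - a m else t)" for i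
   define p :: "'a ridx \<Rightarrow>\<^sub>0 'k" where "p = (\<Sum>i<Suc ?n. single (H i) (c i))"
   have lookup: "lookup p (H i) = c i" if "i < Suc ?n" for i
    using that by (simp add: p_def lookup_sum lookup_single when_def del: sum.lessThan_Suc)
   have "keys p \<subseteq> H ` {..<Suc ?n}"
    unfolding p_def by (rule order_trans[OF keys_sum_subset]) (auto split: if_splits)
   moreover have "?S (co p) = ?S a"
    by (rule S_cong) (auto simp: co_def lookup c_def less_Suc_eq)
   then have "\<mu> p = v"
    by (simp add: v \<mu>_def lookup c_def)
   ultimately show "v \<in> \<mu> ` ?P"
    by blast
  qed
 qed (use \<mu>_closed in auto)
 define \<kappa> where "\<kappa> = inv_into ?P \<mu>"
 have \<kappa>: "\<kappa> v \<in> ?P" "\<mu> (\<kappa> v) = v" if "v \<in> carrier ?V" for v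
  using that \<mu>_image inv_into_into[of v \<mu> ?P] f_inv_into_f[of v \<mu> ?P] unfolding \<kappa>_def by auto
 have \<kappa>_\<mu>: "\<kappa> (\<mu> p) = p" if "p \<in> ?P" for p
  unfolding \<kappa>_def using \<mu>_inj that by (rule inv_into_f_f)
 have P_add: "p + q \<in> ?P" if "p \<in> ?P" "q \<in> ?P" for p q
  using that keys_add[of p q] by blast
 have P_smult: "pm_smult t p \<in> ?P" if "p \<in> ?P" for t p
  using that keys_pm_smult[of t p] by blast
 show ?thesis
 proof (intro exI[of _ \<kappa>] conjI ballI allI impI)
  show "\<kappa> (x \<oplus>\<^bsub>?V\<^esub> y) = \<kappa> x + \<kappa> y" if "x \<in> carrier ?V" "y \<in> carrier ?V" for x y
   using \<kappa>_\<mu>[OF P_add[OF \<kappa>(1)[OF that(1)] \<kappa>(1)[OF that(2)]]] \<kappa>(2)[OF that(1)] \<kappa>(2)[OF that(2)] by (simp only: \<mu>_add)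
  show "\<kappa> (t \<odot>\<^bsub>?V\<^esub> x) = pm_smult t (\<kappa> x)" if "x \<in> carrier ?V" for x t
   using \<kappa>_\<mu>[OF P_smult[OF \<kappa>(1)[OF that]]] \<kappa>(2)[OF that] by (simp only: \<mu>_smult)
  show "x = \<zero>\<^bsub>?V\<^esub>" if "x \<in> carrier ?V" "\<kappa> x = 0" for x
  proof -
   have "\<mu> (pm_smult 0 0) = 0 \<odot>\<^bsub>?V\<^esub> \<mu> 0"
    by (rule \<mu>_smult)
   then show ?thesis
    using \<kappa>(2)[OF that(1)] that(2) \<mu>_closed[of 0] V.lmult_0[of "\<mu> 0"] by simp
  qed
  show "\<kappa> ` carrier ?V = {x. keys x \<subseteq> H ` {..<Suc ?n}}"
  proof
   show "\<kappa> ` carrier ?V \<subseteq> ?P"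
    using \<kappa>(1) by blast
   show "?P \<subseteq> \<kappa> ` carrier ?V"
   proof
    fix p assume "p \<in> ?P"
    then have "p = \<kappa> (\<mu> p)"
     by (simp only: \<kappa>_\<mu>)
    then show "p \<in> \<kappa> ` carrier ?V"
     using \<mu>_closed by (rule image_eqI)
   qed
  qed
  show "\<kappa> (?h i) = hh (Suc ?n) (sr i)" if i: "i \<le> m" for i
  proof -
   have P: "hh (Suc ?n) (sr i) \<in> ?P"
    using keys_hh[of "Suc ?n" "sr i"] by simp
   have co: "co (hh (Suc ?n) (sr i)) j = (if i = j then 1 else 0)" if "j < ?n" for j
    using that i cor_sr[of i j] cor_sr[of i m] cor_sr_m
    by (cases "i < m"; cases "j < m") (auto simp: co_def lookup_hh less_Suc_eq)
   have "?S (co (hh (Suc ?n) (sr i))) = (\<Oplus>\<^bsub>?V\<^esub>j\<in>{..<?n}. if i = j then ?h j else \<zero>\<^bsub>?V\<^esub>)"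
    using h co V.smult_one V.lmult_0 by (intro V.finsum_cong') auto
   also have "\<dots> = ?h i"
    using h i by (intro V.finsum_singleton) auto
   finally have "\<mu> (hh (Suc ?n) (sr i)) = ?h i"
    using w V.lmult_0[of w] h[of i] i by (simp add: \<mu>_def lookup_hh cor_ext)
   then show ?thesis
    using \<kappa>_\<mu>[OF P] by simp
  qed
  show "?r j x = (\<Sum>i<Suc ?n. lookup (\<kappa> x) (H i) * of_int (ev i (sr j)))"
   if x: "x \<in> carrier ?V" and j: "j \<le> m" for x j
  proof -
   let ?p = "\<kappa> x"
   have j': "j < ?n"
    using j by simp
   have A': "?A i j = (\<Sum>l<m. of_int (cor (sr i) l) * of_int (ev l (sr j)))" if "i \<le> m" for i
    using full.of_int_cong[OF A[OF that j]] by simp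
   have Am: "?A m j = (\<Sum>l<m. of_int (cor (sr m) l) * of_int (ev l (sr j)))"
    by (rule A') simp
   have Ai: "?A i j = of_int (ev i (sr j))" if "i < m" for i
   proof -
    have "?A i j = (\<Sum>l<m. if i = l then of_int (ev l (sr j)) else 0)"
     unfolding A'[OF less_imp_le[OF that]] using that by (intro sum.cong) (auto simp: cor_sr)
    then show ?thesis
     using that by simp
   qed
   have "?r j x = ?r j (\<mu> ?p)"
    using \<kappa>(2)[OF x] by simp
   also have "\<dots> = (\<Sum>i<?n. co ?p i * ?A i j) + lookup ?p (H ?n) * (if j = k then 1 else 0)"
    unfolding \<mu>_def using S w j' r_w[OF j'] r_S[OF j'] by (simp add: r_add r_smult del: sum.lessThan_Suc)
   also have "(\<Sum>i<?n. co ?p i * ?A i j) = (\<Sum>i<m. co ?p i * of_int (ev i (sr j))) - lookup ?p (H m) * ?A m j"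
    using Ai by (simp add: co_def)
   \<comment> \<open>The terms with the last row of the matrix cancel: the simple roots vanish on H
     m.\<close>
   also have "(\<Sum>i<m. co ?p i * of_int (ev i (sr j))) =
     (\<Sum>i<m. lookup ?p (H i) * of_int (ev i (sr j))) + lookup ?p (H m) * ?A m j"
    unfolding Am sum_distrib_left sum.distrib[symmetric] by (intro sum.cong) (auto simp: co_def algebra_simps)
   finally show ?thesis
    using ev_ext[OF j] by (simp add: ev_m)
  qed
 qed
qed

lemma contragredient_copy_model:
 fixes D :: "('k, 'h) cartan_datum" and z :: "nat \<Rightarrow> int"
 assumes real: "cartan_realization D" and dim: "dim_row (cartan_matrix D) = Suc m"
  and par_D: "\<And>i. i \<le> m \<Longrightarrow> parity D i = par (sr i)"
  and A: "\<And>i j. \<lbrakk>i \<le> m; j \<le> m\<rbrakk> \<Longrightarrow> 3 dvd cartan_matrix D $$ (i, j) - (\<Sum>k<m. cor (sr i) k * ev k (sr j))"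
  and k: "k \<le> m" and ev_ext: "\<And>j. j \<le> m \<Longrightarrow> ev (Suc m) (sr j) = (if j = k then 1 else 0)"
  and z: "\<And>i. i \<le> m \<Longrightarrow> 3 dvd (\<Sum>j<Suc m. cartan_matrix D $$ (i, j) * z j)" "\<not> 3 dvd z k"
  and inj: "\<forall>x :: nat \<Rightarrow> 'k. (\<forall>i<Suc m.
   (\<Sum>j<Suc m. of_int (cartan_matrix D $$ (i, j)) * x j) + (if i = k then x k else 0) = 0) \<longrightarrow> (\<forall>j<Suc m. x j = 0)"
 obtains \<xi> where "lie_copy (derived_mod_center (contragredient D)) quot.L \<xi>"
  "\<And>i j k. \<lbrakk>i \<le> m; j \<le> m; k \<le> m\<rbrakk> \<Longrightarrow>
    superalg_center (derived_superalg (contragredient D)) +>\<^bsub>derived_superalg (contragredient D)\<^esub>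
     (chev_e D i \<oplus>\<^bsub>contragredient D\<^esub> chev_e D j \<oplus>\<^bsub>contragredient D\<^esub> chev_e D k)
    \<in> carrier (derived_mod_center (contragredient D)) \<and>
    \<xi> (superalg_center (derived_superalg (contragredient D)) +>\<^bsub>derived_superalg (contragredient D)\<^esub>
     (chev_e D i \<oplus>\<^bsub>contragredient D\<^esub> chev_e D j \<oplus>\<^bsub>contragredient D\<^esub> chev_e D k)) = e i + e j + e k"
proof -
 have ex: "\<exists>\<kappa> :: 'h \<Rightarrow> 'a ridx \<Rightarrow>\<^sub>0 'k.
  (\<forall>x\<in>carrier (cartan_space D). \<forall>y\<in>carrier (cartan_space D). \<kappa> (x \<oplus>\<^bsub>cartan_space D\<^esub> y) = \<kappa> x + \<kappa> y) \<and>
  (\<forall>x\<in>carrier (cartan_space D). \<forall>r. \<kappa> (r \<odot>\<^bsub>cartan_space D\<^esub> x) = pm_smult r (\<kappa> x)) \<and>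
  (\<forall>x\<in>carrier (cartan_space D). \<kappa> x = 0 \<longrightarrow> x = \<zero>\<^bsub>cartan_space D\<^esub>) \<and>
  \<kappa> ` carrier (cartan_space D) = {x. keys x \<subseteq> H ` {..<Suc (Suc m)}} \<and>
  (\<forall>i\<le>m. \<kappa> (coroot D i) = hh (Suc (Suc m)) (sr i)) \<and>
  (\<forall>x\<in>carrier (cartan_space D). \<forall>j\<le>m.
   root D j x = (\<Sum>i<Suc (Suc m). lookup (\<kappa> x) (H i) * of_int (ev i (sr j))))"
  by (rule cartan_coordinates[where k = k and z = z, OF real dim A k ev_ext z inj])
 obtain \<kappa> where \<kappa>:
  "\<forall>x\<in>carrier (cartan_space D). \<forall>y\<in>carrier (cartan_space D). \<kappa> (x \<oplus>\<^bsub>cartan_space D\<^esub> y) = \<kappa> x + \<kappa> y"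
  "\<forall>x\<in>carrier (cartan_space D). \<forall>r. \<kappa> (r \<odot>\<^bsub>cartan_space D\<^esub> x) = pm_smult r (\<kappa> x)"
  "\<forall>x\<in>carrier (cartan_space D). \<kappa> x = 0 \<longrightarrow> x = \<zero>\<^bsub>cartan_space D\<^esub>"
  "\<kappa> ` carrier (cartan_space D) = {x. keys x \<subseteq> H ` {..<Suc (Suc m)}}"
  "\<forall>i\<le>m. \<kappa> (coroot D i) = hh (Suc (Suc m)) (sr i)"
  "\<forall>x\<in>carrier (cartan_space D). \<forall>j\<le>m.
   root D j x = (\<Sum>i<Suc (Suc m). lookup (\<kappa> x) (H i) * of_int (ev i (sr j)))"
  using ex by blast
 have "chev_presentation D"
  using real dim by (auto simp: chev_presentation_def cartan_realization_def Let_def)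
 then interpret C: contragredient_model "idx (Suc (Suc m))" ipar full.b D \<kappa> e f ideg
  by (rule contragredient_modelI[OF _ dim par_D]) (use \<kappa> in \<open>auto simp del: sum.lessThan_Suc\<close>)
 obtain \<theta> where \<theta>: "lie_copy (contragredient D) full.L \<theta>"
  "\<And>i. i \<le> m \<Longrightarrow> \<theta> (chev_e D i) = e i" "\<And>i. i \<le> m \<Longrightarrow> chev_e D i \<in> carrier (contragredient D)"
  using C.contragredient_copy unfolding dim less_Suc_eq_le by blast
 obtain \<xi> where \<xi>: "lie_copy (derived_mod_center (contragredient D)) quot.L \<xi>"
  "\<And>y. \<lbrakk>y \<in> carrier (contragredient D); keys (\<theta> y) \<subseteq> idx (Suc m)\<rbrakk> \<Longrightarrow>
    \<xi> (superalg_center (derived_superalg (contragredient D)) +>\<^bsub>derived_superalg (contragredient D)\<^esub> y) = \<rho> (\<theta> y) \<and>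
    superalg_center (derived_superalg (contragredient D)) +>\<^bsub>derived_superalg (contragredient D)\<^esub> y
     \<in> carrier (derived_mod_center (contragredient D))"
  using derived_mod_center_model[OF \<theta>(1)] by metis
 have e: "keys (e i) \<subseteq> idx m" if "i \<le> m" for i
  using sr_root[OF that] by (simp add: e_def ridx_set_iff)
 have idx_mono: "idx m \<subseteq> idx (Suc m)"
  by (auto simp: ridx_set_def)
 interpret G: bracket_algebra "contragredient D"
  using \<theta>(1) lie_superalgebra_bracket_algebra by (auto simp: lie_copy_def)
 have \<theta>_add: "\<theta> (x \<oplus>\<^bsub>contragredient D\<^esub> y) = \<theta> x + \<theta> y"
  if "x \<in> carrier (contragredient D)" "y \<in> carrier (contragredient D)" for x y
  using that algebra_epiD(4)[of "contragredient D" full.L \<theta>] \<theta>(1) by (simp add: lie_copy_def)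
 show ?thesis
 proof (rule that[OF \<xi>(1)])
  fix i j k assume i: "i \<le> m" "j \<le> m" "k \<le> m"
  let ?y = "chev_e D i \<oplus>\<^bsub>contragredient D\<^esub> chev_e D j \<oplus>\<^bsub>contragredient D\<^esub> chev_e D k"
  have y: "?y \<in> carrier (contragredient D)" "\<theta> ?y = e i + e j + e k"
   using i \<theta> by (simp_all add: \<theta>_add)
  have keys: "keys (e i + e j + e k) \<subseteq> idx m"
   using keys_add[of "e i + e j" "e k"] keys_add[of "e i" "e j"] e[OF i(1)] e[OF i(2)] e[OF i(3)] by blast
  show "superalg_center (derived_superalg (contragredient D)) +>\<^bsub>derived_superalg (contragredient D)\<^esub> ?y
    \<in> carrier (derived_mod_center (contragredient D)) \<and>
   \<xi> (superalg_center (derived_superalg (contragredient D)) +>\<^bsub>derived_superalg (contragredient D)\<^esub> ?y) = e i + e j + e k"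
   using \<xi>(2)[OF y(1)] keys idx_mono pm_restrict_id[OF keys] unfolding y(2) by auto
 qed
qed

end

section \<open>The Lie algebra of type \<open>E\<^sub>6\<close>\<close>

text \<open>
 In a simply laced root lattice, a bilinear sign \<open>eps\<close> with \<open>eps a b * eps b a = (-1)^(a, b)\<close> and
 \<open>eps a a = (-1)^((a, a) div 2)\<close> gives structure constants of the Lie algebra.
\<close>

locale root_lattice =
 fixes form :: "'q :: ab_group_add \<Rightarrow> 'q \<Rightarrow> int" and eps :: "'q \<Rightarrow> 'q \<Rightarrow> int"
 assumes form_add: "form (a + b) c = form a c + form b c" and form_sym: "form a b = form b a"
  and form_pos: "a \<noteq> 0 \<Longrightarrow> form a a > 0"
  and eps_sign: "eps a b = 1 \<or> eps a b = - 1"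
  and eps_add: "eps (a + b) c = eps a c * eps b c" "eps a (b + c) = eps a b * eps a c"
  and eps_sym: "eps a b * eps b a = (if even (form a b) then 1 else - 1)"
  and eps_self: "form a a = 2 \<Longrightarrow> eps a a = - 1"
begin

definition roots :: "'q set" where
 "roots = {a. form a a = 2}"

text \<open>For roots, the value -1 of the form means that a + b is a root and -2 that b = - a. In
  the second case the constant multiplies the coroot of a.\<close>

definition N :: "'q \<Rightarrow> 'q \<Rightarrow> int" where
 "N a b = (if form a b \<le> - 1 then eps a b else 0)"

lemma form_zero: "form 0 a = 0" "form a 0 = 0"
 using form_add[of 0 0 a] form_sym[of a 0] by simp_all

lemma form_add_right: "form a (b + c) = form a b + form a c"
 using form_add[of b c a] by (simp add: form_sym)

lemma form_neg: "form (- a) b = - form a b" "form a (- b) = - form a b"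
 using form_add[of a "- a" b] form_add_right[of a b "- b"] by (simp_all add: form_zero)

lemma eps_zero: "eps 0 a = 1" "eps a 0 = 1"
 using eps_add(1)[of 0 0 a] eps_add(2)[of a 0 0] eps_sign[of 0 a] eps_sign[of a 0] by auto

lemma eps_neg: "eps (- a) b = eps a b" "eps a (- b) = eps a b"
proof -
 have "eps a b * eps (- a) b = 1" "eps a b * eps a (- b) = 1"
  using eps_add(1)[of a "- a" b] eps_add(2)[of a b "- b"] by (simp_all add: eps_zero)
 then show "eps (- a) b = eps a b" "eps a (- b) = eps a b"
  using eps_sign[of a b] by auto
qed

text \<open>Everything is read off from the norms of a + b and a - b, namely 4 + 2(a, b) and 4 -
  2(a, b), which are nonnegative and vanish only at 0.\<close>

lemma form_bounds:
 assumes "a \<in> roots" "b \<in> roots"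
 shows "form a b \<in> {- 2, - 1, 0, 1, 2}" "form a b = - 2 \<longleftrightarrow> a + b = 0" "form a b = - 1 \<longleftrightarrow> a + b \<in> roots"
proof -
 have ab: "form a a = 2" "form b b = 2"
  using assms by (simp_all add: roots_def)
 have sum: "form (a + b) (a + b) = 4 + 2 * form a b"
  by (simp add: form_add form_add_right ab form_sym[of b a])
 have diff: "form (a + - b) (a + - b) = 4 - 2 * form a b"
  unfolding form_add form_add_right form_neg by (simp add: ab form_sym[of b a])
 have nonneg: "form c c \<ge> 0" for c
  using form_pos[of c] by (cases "c = 0") (auto simp: form_zero)
 show "form a b \<in> {- 2, - 1, 0, 1, 2}"
 proof -
  have "0 \<le> 4 + 2 * x \<Longrightarrow> 0 \<le> 4 - 2 * x \<Longrightarrow> x = - 2 \<or> x = - 1 \<or> x = 0 \<or> x = 1 \<or> x = 2" for x :: int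
   by presburger
  from this[OF nonneg[of "a + b", unfolded sum] nonneg[of "a + - b", unfolded diff]] show ?thesis
   by (simp only: insert_iff empty_iff simp_thms)
 qed
 show "form a b = - 2 \<longleftrightarrow> a + b = 0"
 proof
  assume "form a b = - 2"
  then have "form (a + b) (a + b) = 0"
   using sum by simp
  then show "a + b = 0"
   using form_pos[of "a + b"] by fastforce
 next
  assume "a + b = 0"
  then have "4 + 2 * form a b = 0"
   using sum form_zero(1)[of 0] by simp
  then show "form a b = - 2"
   by simp
 qed
 show "form a b = - 1 \<longleftrightarrow> a + b \<in> roots"
  using sum by (auto simp: roots_def)
qed

lemma zero_not_root: "0 \<notin> roots" and neg_root: "a \<in> roots \<Longrightarrow> - a \<in> roots"
 by (simp_all add: roots_def form_zero form_neg)

lemma N_no_root: "\<lbrakk>a \<in> roots; b \<in> roots; a + b \<notin> roots; a + b \<noteq> 0\<rbrakk> \<Longrightarrow> N a b = 0"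
 using form_bounds[of a b] by (auto simp: N_def)

lemma N_anti: "\<lbrakk>a \<in> roots; b \<in> roots; a + b \<in> roots\<rbrakk> \<Longrightarrow> N b a = - N a b"
 using form_bounds(3)[of a b] eps_sym[of a b] eps_sign[of a b] eps_sign[of b a] form_sym[of a b]
 by (auto simp: N_def)

lemma N_anti_zero: "N (- a) a = N a (- a)"
 by (simp add: N_def form_neg eps_neg)

lemma N_neg: "a \<in> roots \<Longrightarrow> N a (- a) = - 1"
 by (simp add: N_def form_neg eps_neg roots_def eps_self)

lemma form_three:
 assumes "a \<in> roots" "b \<in> roots" "c \<in> roots"
 shows "form (a + b + c) (a + b + c) = 6 + 2 * (form a b + form b c + form a c)"
 using assms by (simp add: roots_def form_add form_add_right form_sym[of b a] form_sym[of c a] form_sym[of c b])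

lemma eps_two:
 assumes a: "a \<in> roots" and b: "b \<in> roots" and form: "form a b = - 2 \<or> form a b = 2"
 shows "eps a b = - 1"
proof -
 have "b = - a \<or> b = a"
  using form form_bounds(2)[OF a b] form_bounds(2)[OF a neg_root[OF b]]
  by (auto simp: form_neg eq_neg_iff_add_eq_0 add.commute)
 then show ?thesis
  using a by (auto simp: eps_neg roots_def eps_self)
qed

text \<open>If a, b, c and a + b + c are roots, their three inner products add up to -2. This turns
  the Jacobi identity into six cases, those with a value -2 being the ones with a pair of opposite
  roots.\<close>

lemma sum_minus_two_cases:
 fixes x y z :: int
 assumes "x + y + z = - 2" "x \<in> {- 2, - 1, 0, 1, 2}" "y \<in> {- 2, - 1, 0, 1, 2}" "z \<in> {- 2, - 1, 0, 1, 2}"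
 obtains "y = - 2" | "x = - 2" | "z = - 2" | "x = - 1" "y = - 1" "z = 0" | "x = - 1" "y = 0" "z = - 1"
  | "x = 0" "y = - 1" "z = - 1"
proof -
 have bound: "u \<ge> - 2 \<and> u \<le> 2" if "u \<in> {- 2, - 1, 0, 1, 2}" for u :: int
  using that by auto
 have "y = - 2 \<or> x = - 2 \<or> z = - 2 \<or> (x = - 1 \<and> y = - 1 \<and> z = 0) \<or> (x = - 1 \<and> y = 0 \<and> z = - 1) \<or>
   (x = 0 \<and> y = - 1 \<and> z = - 1)"
  using assms(1) bound[OF assms(2)] bound[OF assms(3)] bound[OF assms(4)] by presburger
 then show ?thesis
  using that by blast
qed

lemma N_jacobi:
 assumes a: "a \<in> roots" and b: "b \<in> roots" and c: "c \<in> roots" and abc: "a + b + c \<in> roots"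
 shows "(if b + c = 0 then - N b c * form b a else N b c * N a (b + c)) =
  (if a + b = 0 then N a b * form a c else N a b * N (a + b) c) +
  (if a + c = 0 then - N a c * form a b else N a c * N b (a + c))"
proof -
 have sum: "form a b + form b c + form a c = - 2"
  using form_three[OF a b c] abc by (simp add: roots_def)
 note ab = form_bounds(1)[OF a b] and ac = form_bounds(1)[OF a c]
 note zero = form_bounds(2)[OF a b, symmetric] form_bounds(2)[OF b c, symmetric] form_bounds(2)[OF a c, symmetric]
 note signs = eps_sign[of a b] eps_sign[of b a] eps_sign[of b c] eps_sign[of a c]
 from sum ab form_bounds(1)[OF b c] ac show ?thesis
 proof (cases rule: sum_minus_two_cases)
  case 1
  \<comment> \<open>With c = - b all inner products and signs are expressed by those of a and b,
    which leaves the five possible values of the form.\<close>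
  then have c': "c = - b"
   using zero(2) by (simp add: eq_neg_iff_add_eq_0 add.commute)
  have f: "form b c = - 2" "form a c = - form a b"
   using 1 by (simp_all add: c' form_neg)
  have e: "eps b c = - 1" "eps a c = eps a b"
   using eps_two[OF b c] 1 by (simp_all add: c' eps_neg)
  show ?thesis
   unfolding zero N_def form_add form_add_right eps_add f e form_sym[of b a]
   using ab signs(1,2) eps_sym[of a b] eps_two[OF a b] unfolding insert_iff empty_iff
   by (elim disjE) simp_all
 next
  case 2
  then have b': "b = - a"
   using zero(1) by (simp add: eq_neg_iff_add_eq_0 add.commute)
  have f: "form a b = - 2" "form b c = - form a c"
   using 2 by (simp_all add: b' form_neg)
  have e: "eps a b = - 1" "eps b a = - 1" "eps b c = eps a c"
   using eps_two[OF a b] eps_two[OF b a] 2 form_sym[of b a] by (simp_all add: b' eps_neg)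
  show ?thesis
   unfolding zero N_def form_add form_add_right form_sym[of b a] eps_add f e
   using ac signs(4) eps_two[OF a c] unfolding insert_iff empty_iff
   by (elim disjE) simp_all
 next
  case 3
  then have c': "c = - a"
   using zero(3) by (simp add: eq_neg_iff_add_eq_0 add.commute)
  have f: "form a c = - 2" "form b c = - form a b"
   using 3 form_sym[of b a] by (simp_all add: c' form_neg)
  have e: "eps a c = - 1" "eps b c = eps b a"
   using eps_two[OF a c] 3 by (simp_all add: c' eps_neg)
  show ?thesis
   unfolding zero N_def form_add form_add_right form_sym[of b a] eps_add f e
   using ab signs(1,2) eps_sym[of a b] eps_two[OF a b] eps_two[OF b a] form_sym[of b a] unfolding insert_iff empty_iff
   by (elim disjE) simp_all
 next
  case 4
  then show ?thesis
   unfolding zero N_def form_add form_add_right form_sym[of b a] eps_add by simp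
 next
  case 5
  then show ?thesis
   unfolding zero N_def form_add form_add_right form_sym[of b a] eps_add
   using eps_sym[of a b] signs by (elim disjE) simp_all
 next
  case 6
  then show ?thesis
   unfolding zero N_def form_add form_add_right form_sym[of b a] form_sym[of c b] eps_add
   using eps_sym[of a b] signs by (elim disjE) simp_all
 qed
qed

text \<open>If a + b + c = 0, all three inner products are -1, and bilinearity expresses every sign
  by \<open>eps a b\<close>.\<close>

lemma N_jacobi_zero:
 assumes a: "a \<in> roots" and b: "b \<in> roots" and c: "c \<in> roots" and abc: "a + b + c = 0"
 shows "N b c * N a (- a) = N a b * N (- c) c" "N a b * N (- c) c = - (N a c * N b (- b))"
proof -
 have c': "c = - a + - b"
  using abc by (simp add: algebra_simps eq_neg_iff_add_eq_0)
 have "form a b + form b c + form a c = - 3"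
  using form_three[OF a b c] abc by (simp add: form_zero)
 moreover have "form a c = - 2 - form a b" "form b c = - 2 - form a b"
  using a b unfolding c' form_add_right form_neg by (simp_all add: roots_def form_sym[of b a])
 ultimately have forms: "form a b = - 1" "form b c = - 1" "form a c = - 1"
  by simp_all
 have "eps b c = - eps b a" "eps a c = - eps a b"
  using a b unfolding c' eps_add eps_neg by (simp_all add: roots_def eps_self)
 moreover have "eps b a = - eps a b"
  using eps_sym[of a b] eps_sign[of a b] eps_sign[of b a] forms by auto
 ultimately have "N b c = eps a b" "N a c = - eps a b" "N a b = eps a b"
  using forms by (simp_all add: N_def)
 moreover have "N (- c) c = - 1"
  using N_neg[OF c] N_anti_zero[of c] by simp
 ultimately show "N b c * N a (- a) = N a b * N (- c) c" "N a b * N (- c) c = - (N a c * N b (- b))"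
  using N_neg[OF a] N_neg[OF b] by simp_all
qed

end

section \<open>The root lattice of type E6\<close>

type_synonym e6 = "int \<times> int \<times> int \<times> int \<times> int \<times> int"

definition e6_form :: "e6 \<Rightarrow> e6 \<Rightarrow> int" where
 "e6_form = (\<lambda>(a0, a1, a2, a3, a4, a5) (b0, b1, b2, b3, b4, b5).
   a0 * (2 * b0 - b2) + a1 * (2 * b1 - b3) + a2 * (2 * b2 - b0 - b3) +
   a3 * (2 * b3 - b1 - b2 - b4) + a4 * (2 * b4 - b3 - b5) + a5 * (2 * b5 - b4))"

text \<open>The diagonal together with one orientation of each edge of the Dynkin diagram. Modulo 2,
  where signs do not matter, its symmetrization is the form and its diagonal is half the norm; these
  are the two properties required of the sign cocycle.\<close>

definition e6_half_form :: "e6 \<Rightarrow> e6 \<Rightarrow> int" where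
 "e6_half_form = (\<lambda>(a0, a1, a2, a3, a4, a5) (b0, b1, b2, b3, b4, b5).
   a0 * b0 + a1 * b1 + a2 * (b0 + b2 + b3) + a3 * (b1 + b3 + b4) + a4 * (b4 + b5) + a5 * b5)"

definition e6_eps :: "e6 \<Rightarrow> e6 \<Rightarrow> int" where
 "e6_eps a b = (if even (e6_half_form a b) then 1 else - 1)"

text \<open>Completing squares from the ends of the three arms towards the branch node, which has
  index 3; the positive remainder at that node proves definiteness.\<close>

lemma e6_form_squares: "6 * e6_form (a0, a1, a2, a3, a4, a5) (a0, a1, a2, a3, a4, a5) =
  3 * (2 * a0 - a2)\<^sup>2 + 3 * (2 * a1 - a3)\<^sup>2 + 3 * (2 * a5 - a4)\<^sup>2 + (3 * a2 - 2 * a3)\<^sup>2 + (3 * a4 - 2 * a3)\<^sup>2 + a3\<^sup>2"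
 by (simp add: e6_form_def power2_eq_square algebra_simps)

lemma e6_cases: obtains a0 a1 a2 a3 a4 a5 where "(a :: e6) = (a0, a1, a2, a3, a4, a5)"
 by (cases a) auto

lemma e6_form_add: "e6_form (a + b) c = e6_form a c + e6_form b c"
 by (cases a rule: e6_cases; cases b rule: e6_cases; cases c rule: e6_cases) (simp add: e6_form_def algebra_simps)

lemma e6_form_sym: "e6_form a b = e6_form b a"
 by (cases a rule: e6_cases; cases b rule: e6_cases) (simp add: e6_form_def algebra_simps)

lemma e6_half_form_add: "e6_half_form (a + b) c = e6_half_form a c + e6_half_form b c"
 "e6_half_form c (a + b) = e6_half_form c a + e6_half_form c b"
 by (cases a rule: e6_cases; cases b rule: e6_cases; cases c rule: e6_cases; simp add: e6_half_form_def algebra_simps)+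

text \<open>The witness contains each edge in both orientations, so it is even for a = b. This
  evenness yields half the norm modulo 2, not only the norm.\<close>

lemma e6_half_form_sym: "\<exists>n. e6_half_form a b + e6_half_form b a = e6_form a b + 2 * n \<and> (a = b \<longrightarrow> even n)"
proof -
 obtain a0 a1 a2 a3 a4 a5 where a: "a = (a0, a1, a2, a3, a4, a5)"
  using e6_cases[of a] by blast
 obtain b0 b1 b2 b3 b4 b5 where b: "b = (b0, b1, b2, b3, b4, b5)"
  using e6_cases[of b] by blast
 show ?thesis
  by (intro exI[of _ "a0 * b2 + a2 * b0 + (a1 * b3 + a3 * b1) + (a2 * b3 + a3 * b2) + (a3 * b4 + a4 * b3) + (a4 * b5 + a5 * b4)"])
    (auto simp: a b e6_half_form_def e6_form_def algebra_simps)
qed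

lemma e6_form_pos:
 assumes "a \<noteq> 0"
 shows "e6_form a a > 0"
proof (rule ccontr)
 obtain a0 a1 a2 a3 a4 a5 where a: "a = (a0, a1, a2, a3, a4, a5)"
  using e6_cases[of a] by blast
 have squares: "p1 = 0 \<and> p2 = 0 \<and> p3 = 0 \<and> p4 = 0 \<and> p5 = 0 \<and> p6 = 0"
  if "6 * f = 3 * p1 + 3 * p2 + 3 * p3 + p4 + p5 + p6" "f \<le> 0"
   "p1 \<ge> 0" "p2 \<ge> 0" "p3 \<ge> 0" "p4 \<ge> 0" "p5 \<ge> 0" "p6 \<ge> 0" for f p1 p2 p3 p4 p5 p6 :: int
  using that by linarith
 assume "\<not> e6_form a a > 0"
 then have "e6_form a a \<le> 0"
  by simp
 from squares[OF e6_form_squares this[unfolded a]]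
 have "(2 * a0 - a2)\<^sup>2 = 0 \<and> (2 * a1 - a3)\<^sup>2 = 0 \<and> (2 * a5 - a4)\<^sup>2 = 0 \<and>
   (3 * a2 - 2 * a3)\<^sup>2 = 0 \<and> (3 * a4 - 2 * a3)\<^sup>2 = 0 \<and> a3\<^sup>2 = 0"
  by (simp only: zero_le_power2)
 then have "a3 = 0 \<and> 3 * a2 = 2 * a3 \<and> 3 * a4 = 2 * a3 \<and> 2 * a0 = a2 \<and> 2 * a1 = a3 \<and> 2 * a5 = a4"
  by simp
 then show False
  using assms by (simp add: a zero_prod_def)
qed

interpretation e6: root_lattice e6_form e6_eps
proof
 show "e6_eps (a + b) c = e6_eps a c * e6_eps b c" "e6_eps a (b + c) = e6_eps a b * e6_eps a c" for a b c
  by (simp_all add: e6_eps_def e6_half_form_add)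
 show "e6_eps a b * e6_eps b a = (if even (e6_form a b) then 1 else - 1)" for a b
 proof -
  obtain n where "e6_half_form a b + e6_half_form b a = e6_form a b + 2 * n"
   using e6_half_form_sym[of a b] by blast
  then have "even (e6_half_form a b + e6_half_form b a) \<longleftrightarrow> even (e6_form a b)"
   by simp
  then show ?thesis
   by (auto simp: e6_eps_def)
 qed
 show "e6_eps a a = - 1" if "e6_form a a = 2" for a
 proof -
  obtain n where "e6_half_form a a + e6_half_form a a = e6_form a a + 2 * n" "even n"
   using e6_half_form_sym[of a a] by blast
  then have "e6_half_form a a = 1 + n" "even n"
   using that by simp_all
  then show ?thesis
   by (simp add: e6_eps_def)
 qed
qed (simp_all add: e6_form_add e6_form_pos e6_eps_def, rule e6_form_sym)

text \<open>For i < 5 this is the inner product with the simple root i. Index 5 belongs to the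
  central element and gives 0; index 6 belongs to the additional Cartan element, dual to the simple
  root 2.\<close>

definition e6_ev :: "nat \<Rightarrow> e6 \<Rightarrow> int" where
 "e6_ev i = (\<lambda>(a0, a1, a2, a3, a4, a5). if i = 0 then 2 * a0 - a2 else if i = 1 then 2 * a1 - a3
   else if i = 2 then 2 * a2 - a0 - a3 else if i = 3 then 2 * a3 - a1 - a2 - a4
   else if i = 4 then 2 * a4 - a3 - a5 else if i = 6 then a2 else 0)"

text \<open>Modulo 3 the vector (1, 0, -1, 0, 1, -1) spans the kernel of the Cartan matrix. The
  central element H 5 is the corresponding combination of coroots, so the coroot of the simple root
  5 becomes H 0 - H 2 + H 4 - H 5.\<close>

definition e6_cor :: "e6 \<Rightarrow> nat \<Rightarrow> int" where
 "e6_cor = (\<lambda>(a0, a1, a2, a3, a4, a5) i. if i = 0 then a0 + a5 else if i = 1 then a1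
   else if i = 2 then a2 - a5 else if i = 3 then a3 else if i = 4 then a4 + a5
   else if i = 5 then - a5 else 0)"

definition e6_simple :: "nat \<Rightarrow> e6" where
 "e6_simple i = (of_bool (i = 0), of_bool (i = 1), of_bool (i = 2), of_bool (i = 3), of_bool (i = 4), of_bool (i = 5))"

definition e6_degree :: "e6 \<Rightarrow> nat \<Rightarrow>\<^sub>0 int" where
 "e6_degree = (\<lambda>(a0, a1, a2, a3, a4, a5). single 0 a0 + single 1 a1 +
   single 2 a2 + single 3 a3 + single 4 a4 + single 5 a5)"

definition nat_abs :: "int \<Rightarrow> nat" where
 "nat_abs x = nat \<bar>x\<bar>"

definition e6_height :: "e6 \<Rightarrow> nat" where
 "e6_height = (\<lambda>(a0, a1, a2, a3, a4, a5). nat_abs a0 + nat_abs a1 + nat_abs a2 + nat_abs a3 + nat_abs a4 + nat_abs a5)"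

lemma less_5: "(i :: nat) < 5 \<longleftrightarrow> i = 0 \<or> i = 1 \<or> i = 2 \<or> i = 3 \<or> i = 4"
 and le_5: "(i :: nat) \<le> 5 \<longleftrightarrow> i = 0 \<or> i = 1 \<or> i = 2 \<or> i = 3 \<or> i = 4 \<or> i = 5"
 by auto

lemma sum_less_5: "(\<Sum>i<5. g i) = g 0 + g 1 + g 2 + g 3 + (g (4 :: nat) :: 'c :: comm_monoid_add)"
 by (simp add: eval_nat_numeral add_ac)

text \<open>Discarding the central component of the coroot replaces the last coroot by a combination
  of the others that agrees with it only modulo 3; hence a congruence and no equality.\<close>

lemma e6_sum_ev: "3 dvd (\<Sum>i<5. e6_cor a i * e6_ev i b) - e6_form a b"
proof -
 obtain a0 a1 a2 a3 a4 a5 where a: "a = (a0, a1, a2, a3, a4, a5)"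
  using e6_cases[of a] by blast
 obtain b0 b1 b2 b3 b4 b5 where b: "b = (b0, b1, b2, b3, b4, b5)"
  using e6_cases[of b] by blast
 have "(\<Sum>i<5. e6_cor a i * e6_ev i b) - e6_form a b = 3 * (a5 * (b0 - b2 + b4 - b5))"
  by (simp add: a b sum_less_5 e6_cor_def e6_ev_def e6_form_def algebra_simps)
 then show ?thesis
  by simp
qed

lemma e6_simple_form: "i \<le> 5 \<Longrightarrow> j \<le> 5 \<Longrightarrow> e6_form (e6_simple i) (e6_simple j) =
  (if i = j then 2 else if (i, j) \<in> {(0, 2), (2, 0), (1, 3), (3, 1), (2, 3), (3, 2), (3, 4), (4, 3), (4, 5), (5, 4)} then - 1 else 0)"
 unfolding le_5 by (elim disjE) (simp_all add: e6_simple_def e6_form_def)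

text \<open>The norm is the sum of a_i (a, \<alpha>_i), so for some i the two factors have the same
  sign. Removing \<alpha>_i with that sign lowers the height by one, and the result is a root
  because the inner product is 1: the value 2 would make a itself simple up to sign. Positive and
  negative roots are treated alike.\<close>

lemma e6_root_sum:
 assumes a: "a \<in> e6.roots" and not_simple: "\<And>i. i \<le> 5 \<Longrightarrow> a \<noteq> e6_simple i \<and> a \<noteq> - e6_simple i"
 shows "\<exists>b c. b \<in> e6.roots \<and> c \<in> e6.roots \<and> a = b + c \<and> e6_height b < e6_height a \<and> e6_height c < e6_height a \<and>
  e6.N b c \<noteq> 0 \<and> (\<exists>i\<le>5. c = e6_simple i \<or> c = - e6_simple i)"
proof -
 have simple: "e6_simple i \<in> e6.roots" if "i \<le> 5" for i
  using e6_simple_form[OF that that] by (simp add: e6.roots_def)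
 have step: ?thesis if i: "i \<le> 5" and c: "c = e6_simple i \<or> c = - e6_simple i" and form: "e6_form a c \<ge> 1"
  and height: "e6_height (a - c) + 1 = e6_height a" for i c
 proof -
  have c_root: "c \<in> e6.roots"
   using simple[OF i] c e6.neg_root[OF simple[OF i]] by auto
  have "e6_form a (- c) \<noteq> - 2"
   using e6.form_bounds(2)[OF a e6.neg_root[OF c_root]] not_simple[OF i] c by auto
  then have form': "e6_form a c = 1"
   using e6.form_bounds(1)[OF a c_root] form by (auto simp: e6.form_neg)
  then have root: "a - c \<in> e6.roots"
   using e6.form_bounds(3)[OF a e6.neg_root[OF c_root]] by (simp add: e6.form_neg)
  have "e6_form (a - c) c = - 1"
   using form' c_root e6.form_add[of a "- c" c] by (simp add: e6.form_neg e6.roots_def)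
  then have "e6.N (a - c) c \<noteq> 0"
   using e6.eps_sign[of "a - c" c] by (auto simp: e6.N_def)
  moreover have "e6_height c = 1"
   using i c unfolding le_5 by (elim disjE) (simp_all add: e6_simple_def e6_height_def nat_abs_def)
  \<comment> \<open>A nonzero remainder has positive height; therefore c, of height 1, is strictly
    shorter than a as well.\<close>
  moreover have "e6_height (a - c) \<noteq> 0"
   using root e6.zero_not_root by (cases "a - c" rule: e6_cases) (auto simp: e6_height_def nat_abs_def zero_prod_def)
  ultimately show ?thesis
   using root c_root height i c by (intro exI[of _ "a - c"] exI[of _ c]) auto
 qed
 obtain a0 a1 a2 a3 a4 a5 where a': "a = (a0, a1, a2, a3, a4, a5)"
  using e6_cases[of a] by blast
 have "a0 * e6_form a (e6_simple 0) + a1 * e6_form a (e6_simple 1) + a2 * e6_form a (e6_simple 2) +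
   a3 * e6_form a (e6_simple 3) + a4 * e6_form a (e6_simple 4) + a5 * e6_form a (e6_simple 5) = e6_form a a"
  by (simp add: a' e6_form_def e6_simple_def algebra_simps)
 then have "\<exists>(x, i) \<in> {(a0, 0), (a1, 1), (a2, 2), (a3, 3), (a4, 4), (a5, 5)}. x * e6_form a (e6_simple i) > 0"
  using a by (auto simp: e6.roots_def)
 then obtain x i where x: "(x, i) \<in> {(a0, 0), (a1, 1), (a2, 2), (a3, 3), (a4, 4), (a5, 5)}" "x * e6_form a (e6_simple i) > 0"
  by blast
 then have i: "i \<le> 5"
  by auto
 consider "x \<ge> 1" "e6_form a (e6_simple i) \<ge> 1" | "x \<le> - 1" "e6_form a (e6_simple i) \<le> - 1"
  using x(2) by (auto simp: zero_less_mult_iff)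
 then show ?thesis
 proof cases
  case 1
  then have "nat_abs x = Suc (nat_abs (x - 1))"
   unfolding nat_abs_def by arith
  then have "e6_height (a - e6_simple i) + 1 = e6_height a"
   using x(1) by (simp add: a' e6_simple_def e6_height_def) (elim disjE conjE; simp)
  then show ?thesis
   using 1 by (intro step[OF i, of "e6_simple i"]) simp_all
 next
  case 2
  then have "nat_abs x = Suc (nat_abs (x + 1))"
   unfolding nat_abs_def by arith
  then have "e6_height (a - - e6_simple i) + 1 = e6_height a"
   using x(1) by (simp add: a' e6_simple_def e6_height_def) (elim disjE conjE; simp)
  then show ?thesis
   using 2 by (intro step[OF i, of "- e6_simple i"]) (simp_all add: e6.form_neg)
 qed
qed

lemma e6_root_data: "root_data e6.roots (\<lambda>_. 0) e6.N e6_ev e6_cor 5"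
proof
 show "3 dvd (if b + c = 0 then - e6.N b c * (\<Sum>i<5. e6_cor b i * e6_ev i a) else e6.N b c * e6.N a (b + c))
   - (if a + b = 0 then e6.N a b * (\<Sum>i<5. e6_cor a i * e6_ev i c) else e6.N a b * e6.N (a + b) c)
   - super_sign 0 0 *
    (if a + c = 0 then - e6.N a c * (\<Sum>i<5. e6_cor a i * e6_ev i b) else e6.N a c * e6.N b (a + c))"
  (is "3 dvd ?t1 - ?t2 - _ * ?t3")
  if "a \<in> e6.roots" "b \<in> e6.roots" "c \<in> e6.roots" "a + b + c \<in> e6.roots" for a b c
 proof -
  \<comment> \<open>The exact identity for the form is available. Replacing the form by the sums
    over Cartan elements changes each of the three terms by a multiple of 3.\<close>
  let ?u1 = "if b + c = 0 then - e6.N b c * e6_form b a else e6.N b c * e6.N a (b + c)"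
  let ?u2 = "if a + b = 0 then e6.N a b * e6_form a c else e6.N a b * e6.N (a + b) c"
  let ?u3 = "if a + c = 0 then - e6.N a c * e6_form a b else e6.N a c * e6.N b (a + c)"
  have "3 dvd x * (\<Sum>i<5. e6_cor a i * e6_ev i b) - x * e6_form a b" for x a b
   using dvd_mult[OF e6_sum_ev[of a b], of x] by (simp add: right_diff_distrib)
  moreover from this have "3 dvd x * e6_form a b - x * (\<Sum>i<5. e6_cor a i * e6_ev i b)" for x a b
   by (simp add: dvd_diff_commute)
  ultimately have "3 dvd ?t1 - ?u1" "3 dvd ?t2 - ?u2" "3 dvd ?t3 - ?u3"
   by simp_all
  moreover have "?t1 - ?t2 - super_sign 0 0 * ?t3 = (?t1 - ?u1) - (?t2 - ?u2) - (?t3 - ?u3)"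
   using e6.N_jacobi[OF that] by (simp only: super_sign_def) simp
  ultimately show ?thesis
   by (simp only: dvd_diff)
 qed
 show "3 dvd e6.N b c * e6.N a (- a) - e6.N a b * e6.N (- c) c \<and>
   3 dvd e6.N a b * e6.N (- c) c + super_sign 0 0 * e6.N a c * e6.N b (- b)"
  if "a \<in> e6.roots" "b \<in> e6.roots" "c \<in> e6.roots" "a + b + c = 0" for a b c
  using e6.N_jacobi_zero[OF that] by (simp add: super_sign_def)
 show "e6_ev i (a + b) = e6_ev i a + e6_ev i b" for i a b
  by (cases a rule: e6_cases; cases b rule: e6_cases) (simp add: e6_ev_def)
 show "e6_cor (a + b) i = e6_cor a i + e6_cor b i" for i a b
  by (cases a rule: e6_cases; cases b rule: e6_cases) (simp add: e6_cor_def)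
 show "e6_ev 5 a = 0" "e6_cor a (Suc 5) = 0" for a
  by (cases a rule: e6_cases, simp add: e6_ev_def e6_cor_def)+
 show "3 dvd e6.N b a + super_sign 0 0 * e6.N a b" if "a \<in> e6.roots" "b \<in> e6.roots" "a + b \<in> e6.roots" for a b
  unfolding e6.N_anti[OF that] by (simp add: super_sign_def)
 show "3 dvd e6.N (- a) a - super_sign 0 0 * e6.N a (- a)" for a
  unfolding e6.N_anti_zero[of a] by (simp add: super_sign_def)
qed (rule e6.zero_not_root, rule e6.neg_root, assumption, simp, rule e6.N_no_root, assumption+, simp_all)

lemma e6_root_model:
 assumes "CHAR('k :: field) = 3"
 shows "root_model TYPE('k) e6.roots (\<lambda>_. 0) e6.N e6_ev e6_cor 5 e6_simple e6_height e6_degree"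
proof (rule root_model.intro[OF e6_root_data], rule root_model_axioms.intro)
 have simple: "e6_simple i \<in> e6.roots" if "i \<le> 5" for i
  using e6_simple_form[OF that that] by (simp add: e6.roots_def)
 have three: "(3 :: 'k) = 0"
  using of_nat_CHAR[where 'a = 'k] assms by simp
 show "e6_simple i \<in> e6.roots" if "i \<le> 5" for i
  by (rule simple[OF that])
 show "e6_degree (a + b) = e6_degree a + e6_degree b" for a b
  by (cases a rule: e6_cases; cases b rule: e6_cases) (auto simp: e6_degree_def single_add)
 show "a = b" if "e6_degree a = e6_degree b" for a b
 proof -
  have "lookup (e6_degree a) i = lookup (e6_degree b) i" for i
   using that by simp
  from this[of 0] this[of 1] this[of 2] this[of 3] this[of 4] this[of 5] show ?thesis
   by (cases a rule: e6_cases; cases b rule: e6_cases) (auto simp: e6_degree_def lookup_add lookup_single when_def)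
 qed
 show "e6_degree (e6_simple i) = single i 1" if "i \<le> 5" for i
  using that unfolding le_5 by (elim disjE) (simp_all add: e6_degree_def e6_simple_def)
 show "e6.N (e6_simple i) (- e6_simple j) = 0" if "i \<le> 5" "j \<le> 5" "i \<noteq> j" for i j
  using e6_simple_form[OF that(1,2)] that(3) by (simp add: e6.N_def e6.form_neg)
 show "e6.N (e6_simple i) (- e6_simple i) * e6.N (e6_simple i) (- e6_simple i) = 1" if "i \<le> 5" for i
  using e6.N_neg[OF simple[OF that]] by simp
 show "\<not> 3 dvd e6.N a (- a)" if "a \<in> e6.roots" for a
  using e6.N_neg[OF that] by simp
 show "e6_cor (e6_simple i) j = (if i = j then 1 else 0)" if "i < 5" "j \<le> 5" for i j
  using that unfolding less_5 le_5 by (elim disjE) (simp_all add: e6_cor_def e6_simple_def)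
 show "e6_cor (e6_simple 5) 5 = - 1"
  by (simp add: e6_cor_def e6_simple_def)
 show "\<exists>i\<le>5. \<not> 3 dvd e6_cor a i" if "a \<in> e6.roots" for a
 proof (rule ccontr)
  obtain a0 a1 a2 a3 a4 a5 where a: "a = (a0, a1, a2, a3, a4, a5)"
   using e6_cases[of a] by blast
  assume "\<not> (\<exists>i\<le>5. \<not> 3 dvd e6_cor a i)"
  then have *: "3 dvd e6_cor a i" if "i \<le> 5" for i
   using that by blast
  \<comment> \<open>A coroot that vanishes modulo 3 would make all coordinates of the root, and then
    its norm 2, divisible by 3.\<close>
  have "3 dvd a0 + a5" "3 dvd a1" "3 dvd a2 - a5" "3 dvd a3" "3 dvd a4 + a5" "3 dvd a5"
   using *[of 0] *[of 1] *[of 2] *[of 3] *[of 4] *[of 5] by (simp_all add: a e6_cor_def)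
  then have "3 dvd a0" "3 dvd a1" "3 dvd a2" "3 dvd a3" "3 dvd a4" "3 dvd a5"
   by presburger+
  then have "3 dvd e6_form a a"
   by (simp add: a e6_form_def)
  then show False
   using that by (simp add: e6.roots_def)
 qed
 show "\<exists>i<5. \<not> 3 dvd e6_ev i a" if "a \<in> e6.roots" for a
 proof (rule ccontr)
  obtain a0 a1 a2 a3 a4 a5 where a: "a = (a0, a1, a2, a3, a4, a5)"
   using e6_cases[of a] by blast
  assume "\<not> (\<exists>i<5. \<not> 3 dvd e6_ev i a)"
  \<comment> \<open>This sum is congruent to the norm 2.\<close>
  then have "3 dvd (\<Sum>i<5. e6_cor a i * e6_ev i a)"
   by (intro dvd_sum) auto
  then have "3 dvd e6_form a a"
   using e6_sum_ev[of a a] by presburger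
  then show False
   using that by (simp add: e6.roots_def)
 qed
 show "x i = 0" if *: "\<And>a. a \<in> e6.roots \<Longrightarrow> (\<Sum>i<5. x i * (of_int (e6_ev i a) :: 'k)) = 0" and "i < 5" for x i
 proof -
  \<comment> \<open>Evaluated at the simple roots 5, 4, 1, 3, 0 in this order, the system is
    triangular; the coefficient 2 is invertible because 3 = 0.\<close>
  note eqs = *[OF simple, unfolded sum_less_5]
  have 4: "x 4 = 0"
   using eqs[of 5] by (simp add: e6_ev_def e6_simple_def)
  have two: "y = 0" if "2 * y = 0" for y :: 'k
  proof -
   have "3 * y = 2 * y + y"
    by simp
   then show ?thesis
    using three that by simp
  qed
  have 3: "x 3 = 0"
   using eqs[of 4] 4 by (simp add: e6_ev_def e6_simple_def)
  have 1: "x 1 = 0"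
   using eqs[of 1] 3 two[of "x 1"] by (simp add: e6_ev_def e6_simple_def mult.commute)
  have 2: "x 2 = 0"
   using eqs[of 3] 1 3 4 by (simp add: e6_ev_def e6_simple_def)
  have 0: "x 0 = 0"
   using eqs[of 0] 2 two[of "x 0"] by (simp add: e6_ev_def e6_simple_def mult.commute)
  show ?thesis
   using \<open>i < 5\<close> 0 1 2 3 4 unfolding less_5 by auto
 qed
 show "\<exists>b c. b \<in> e6.roots \<and> c \<in> e6.roots \<and> a = b + c \<and> e6_height b < e6_height a \<and> e6_height c < e6_height a \<and> \<not> 3 dvd e6.N b c"
  if "a \<in> e6.roots" "\<And>i. i \<le> 5 \<Longrightarrow> a \<noteq> e6_simple i \<and> a \<noteq> - e6_simple i" for a
 proof -
  have "\<not> 3 dvd e6.N b c" if "e6.N b c \<noteq> 0" for b c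
   using that e6.eps_sign[of b c] by (auto simp: e6.N_def split: if_splits)
  then show ?thesis
   using e6_root_sum[OF that] by blast
 qed
qed (rule assms)

section \<open>The Lie superalgebra \<open>\<gg>(2, 3)\<close>\<close>

type_synonym g23 = "int \<times> int \<times> int"

definition g23_roots :: "g23 list" where
 "g23_roots = [(0,0,1), (0,1,0), (1,0,0), (0,1,1), (1,1,0), (1,1,1), (1,2,1), (1,2,2), (2,2,1), (2,2,2), (2,3,2),
 (0,0,-1), (0,-1,0), (-1,0,0), (0,-1,-1), (-1,-1,0), (-1,-1,-1), (-1,-2,-1), (-1,-2,-2), (-2,-2,-1), (-2,-2,-2),
 (-2,-3,-2)]"

text \<open>Membership as a decision tree on the coordinates, so that an evaluation takes a few
  integer comparisons; \<open>g23_N\<close> is tabulated in the same way. The equivalence with the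
  list is \<open>g23_root_iff\<close>.\<close>

definition g23_root :: "g23 \<Rightarrow> bool" where
 "g23_root = (\<lambda>(a0, a1, a2). sel a0 (-2) (sel a1 (-3) (sel a2 (-2) True False) (sel a1 (-2) (sel a2 (-2) True
 (sel a2 (-1) True False)) False)) (sel a0 (-1) (sel a1 (-2) (sel a2 (-2) True (sel a2 (-1) True False)) (sel a1 (-1)
 (sel a2 (-1) True (sel a2 0 True False)) (sel a1 0 (sel a2 0 True False) False))) (sel a0 0 (sel a1 (-1) (sel a2
 (-1) True (sel a2 0 True False)) (sel a1 0 (sel a2 (-1) True (sel a2 1 True False)) (sel a1 1 (sel a2 0 True (sel a2
 1 True False)) False))) (sel a0 1 (sel a1 0 (sel a2 0 True False) (sel a1 1 (sel a2 0 True (sel a2 1 True False))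
 (sel a1 2 (sel a2 1 True (sel a2 2 True False)) False))) (sel a0 2 (sel a1 2 (sel a2 1 True (sel a2 2 True False))
 (sel a1 3 (sel a2 2 True False) False)) False)))))"

text \<open>
 The structure constants were computed from the semisimplification, with a choice of generators
 of the Jordan blocks for which the constants of the simple roots and their negatives are 1.
\<close>

definition g23_N :: "g23 \<Rightarrow> g23 \<Rightarrow> int" where
 "g23_N = (\<lambda>(a0, a1, a2) (b0, b1, b2). sel a0 (-2) (sel a1 (-3) (sel a2 (-2) (sel b0 0 (sel b1 1 (sel b2 0 1
 (sel b2 1 1 0)) 0) (sel b0 1 (sel b1 1 (sel b2 0 1 (sel b2 1 (- 1) 0)) (sel b1 2 (sel b2 1 (- 1) (sel b2 2 1 0)) 0))
 (sel b0 2 (sel b1 2 (sel b2 1 1 (sel b2 2 (- 1) 0)) (sel b1 3 (sel b2 2 1 0) 0)) 0))) 0) (sel a1 (-2) (sel a2 (-2)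
 (sel b0 0 (sel b1 (-1) (sel b2 0 (- 1) 0) (sel b1 0 (sel b2 1 1 0) 0)) (sel b0 1 (sel b1 0 (sel b2 0 1 0) (sel b1 1
 (sel b2 1 (- 1) 0) (sel b1 2 (sel b2 2 1 0) 0))) (sel b0 2 (sel b1 2 (sel b2 1 1 (sel b2 2 (- 1) 0)) (sel b1 3 (sel
 b2 2 (- 1) 0) 0)) 0))) (sel a2 (-1) (sel b0 0 (sel b1 (-1) (sel b2 (-1) (- 1) 0) (sel b1 0 (sel b2 (-1) 1 0) 0))
 (sel b0 1 (sel b1 0 (sel b2 0 1 0) (sel b1 1 (sel b2 0 1 (sel b2 1 1 0)) (sel b1 2 (sel b2 1 1 0) 0))) (sel b0 2
 (sel b1 2 (sel b2 1 (- 1) (sel b2 2 1 0)) (sel b1 3 (sel b2 2 1 0) 0)) 0))) 0)) 0)) (sel a0 (-1) (sel a1 (-2) (sel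
 a2 (-2) (sel b0 (-1) (sel b1 (-1) (sel b2 0 (- 1) 0) (sel b1 0 (sel b2 0 1 0) 0)) (sel b0 0 (sel b1 0 (sel b2 1 (-
 1) 0) (sel b1 1 (sel b2 1 (- 1) 0) 0)) (sel b0 1 (sel b1 1 (sel b2 1 (- 1) 0) (sel b1 2 (sel b2 1 (- 1) (sel b2 2 (-
 1) 0)) 0)) (sel b0 2 (sel b1 2 (sel b2 2 1 0) (sel b1 3 (sel b2 2 1 0) 0)) 0)))) (sel a2 (-1) (sel b0 (-1) (sel b1
 (-1) (sel b2 (-1) 1 0) (sel b1 0 (sel b2 0 1 0) 0)) (sel b0 0 (sel b1 0 (sel b2 (-1) (- 1) 0) (sel b1 1 (sel b2 0 1
 (sel b2 1 1 0)) 0)) (sel b0 1 (sel b1 1 (sel b2 0 (- 1) (sel b2 1 1 0)) (sel b1 2 (sel b2 1 1 (sel b2 2 1 0)) 0))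
 (sel b0 2 (sel b1 2 (sel b2 1 (- 1) 0) (sel b1 3 (sel b2 2 1 0) 0)) 0)))) 0)) (sel a1 (-1) (sel a2 (-1) (sel b0 (-1)
 (sel b1 (-2) (sel b2 (-1) (- 1) 0) (sel b1 (-1) (sel b2 (-1) (- 1) (sel b2 0 1 0)) 0)) (sel b0 0 (sel b1 (-1) (sel
 b2 (-1) (- 1) (sel b2 0 1 0)) (sel b1 0 (sel b2 1 1 0) (sel b1 1 (sel b2 1 (- 1) 0) 0))) (sel b0 1 (sel b1 0 (sel b2
 0 (- 1) 0) (sel b1 1 (sel b2 0 1 (sel b2 1 (- 1) 0)) (sel b1 2 (sel b2 1 (- 1) (sel b2 2 (- 1) 0)) 0))) (sel b0 2
 (sel b1 2 (sel b2 1 1 (sel b2 2 (- 1) 0)) (sel b1 3 (sel b2 2 1 0) 0)) 0)))) (sel a2 0 (sel b0 (-1) (sel b1 (-2)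
 (sel b2 (-2) 1 0) (sel b1 (-1) (sel b2 (-1) (- 1) 0) 0)) (sel b0 0 (sel b1 (-1) (sel b2 (-1) (- 1) 0) (sel b1 0 (sel
 b2 (-1) (- 1) 0) (sel b1 1 (sel b2 0 (- 1) 0) 0))) (sel b0 1 (sel b1 0 (sel b2 0 (- 1) 0) (sel b1 1 (sel b2 0 1 (sel
 b2 1 1 0)) (sel b1 2 (sel b2 1 1 0) 0))) (sel b0 2 (sel b1 2 (sel b2 1 1 0) (sel b1 3 (sel b2 2 1 0) 0)) 0)))) 0))
 (sel a1 0 (sel a2 0 (sel b0 (-1) (sel b1 (-2) (sel b2 (-2) 1 (sel b2 (-1) (- 1) 0)) 0) (sel b0 0 (sel b1 (-1) (sel
 b2 (-1) (- 1) (sel b2 0 1 0)) 0) (sel b0 1 (sel b1 0 (sel b2 0 (- 1) 0) (sel b1 1 (sel b2 0 (- 1) (sel b2 1 (- 1)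
 0)) 0)) (sel b0 2 (sel b1 2 (sel b2 1 (- 1) (sel b2 2 1 0)) 0) 0)))) 0) 0))) (sel a0 0 (sel a1 (-1) (sel a2 (-1)
 (sel b0 (-2) (sel b1 (-2) (sel b2 (-1) 1 0) 0) (sel b0 (-1) (sel b1 (-1) (sel b2 (-1) 1 (sel b2 0 1 0)) (sel b1 0
 (sel b2 0 1 0) 0)) (sel b0 0 (sel b1 0 (sel b2 1 (- 1) 0) (sel b1 1 (sel b2 0 (- 1) (sel b2 1 1 0)) 0)) (sel b0 1
 (sel b1 1 (sel b2 1 (- 1) 0) (sel b1 2 (sel b2 1 (- 1) (sel b2 2 (- 1) 0)) 0)) (sel b0 2 (sel b1 3 (sel b2 2 1 0) 0)
 0))))) (sel a2 0 (sel b0 (-2) (sel b1 (-2) (sel b2 (-2) 1 0) 0) (sel b0 (-1) (sel b1 (-1) (sel b2 (-1) 1 0) (sel b1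
 0 (sel b2 0 1 0) 0)) (sel b0 0 (sel b1 0 (sel b2 (-1) 1 0) (sel b1 1 (sel b2 0 (- 1) (sel b2 1 (- 1) 0)) 0)) (sel b0
 1 (sel b1 1 (sel b2 0 (- 1) 0) (sel b1 2 (sel b2 1 (- 1) 0) 0)) (sel b0 2 (sel b1 3 (sel b2 2 1 0) 0) 0))))) 0))
 (sel a1 0 (sel a2 (-1) (sel b0 (-2) (sel b1 (-2) (sel b2 (-1) 1 0) 0) (sel b0 (-1) (sel b1 (-2) (sel b2 (-1) 1 0)
 (sel b1 (-1) (sel b2 0 1 0) 0)) (sel b0 0 (sel b1 (-1) (sel b2 0 1 0) (sel b1 0 (sel b2 1 (- 1) 0) (sel b1 1 (sel b2
 1 (- 1) 0) 0))) (sel b0 1 (sel b1 1 (sel b2 1 1 0) (sel b1 2 (sel b2 2 1 0) 0)) (sel b0 2 (sel b1 2 (sel b2 2 1 0)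
 0) 0))))) (sel a2 1 (sel b0 (-2) (sel b1 (-2) (sel b2 (-2) (- 1) 0) 0) (sel b0 (-1) (sel b1 (-2) (sel b2 (-2) (- 1)
 0) (sel b1 (-1) (sel b2 (-1) 1 0) 0)) (sel b0 0 (sel b1 (-1) (sel b2 (-1) 1 0) (sel b1 0 (sel b2 (-1) 1 0) (sel b1 1
 (sel b2 0 1 0) 0))) (sel b0 1 (sel b1 1 (sel b2 0 (- 1) 0) (sel b1 2 (sel b2 1 1 0) 0)) (sel b0 2 (sel b1 2 (sel b2
 1 1 0) 0) 0))))) 0)) (sel a1 1 (sel a2 0 (sel b0 (-2) (sel b1 (-3) (sel b2 (-2) 1 0) 0) (sel b0 (-1) (sel b1 (-2)
 (sel b2 (-1) (- 1) 0) (sel b1 (-1) (sel b2 0 1 0) 0)) (sel b0 0 (sel b1 (-1) (sel b2 (-1) 1 (sel b2 0 1 0)) (sel b1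
 0 (sel b2 1 1 0) 0)) (sel b0 1 (sel b1 0 (sel b2 0 1 0) (sel b1 1 (sel b2 1 (- 1) 0) 0)) (sel b0 2 (sel b1 2 (sel b2
 2 (- 1) 0) 0) 0))))) (sel a2 1 (sel b0 (-2) (sel b1 (-3) (sel b2 (-2) (- 1) 0) 0) (sel b0 (-1) (sel b1 (-2) (sel b2
 (-2) 1 (sel b2 (-1) (- 1) 0)) (sel b1 (-1) (sel b2 (-1) 1 0) 0)) (sel b0 0 (sel b1 (-1) (sel b2 (-1) 1 (sel b2 0 1
 0)) (sel b1 0 (sel b2 (-1) 1 0) 0)) (sel b0 1 (sel b1 0 (sel b2 0 (- 1) 0) (sel b1 1 (sel b2 0 1 (sel b2 1 (- 1) 0))
 0)) (sel b0 2 (sel b1 2 (sel b2 1 (- 1) 0) 0) 0))))) 0)) 0))) (sel a0 1 (sel a1 0 (sel a2 0 (sel b0 (-2) (sel b1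
 (-2) (sel b2 (-2) (- 1) (sel b2 (-1) 1 0)) 0) (sel b0 (-1) (sel b1 (-1) (sel b2 (-1) (- 1) (sel b2 0 1 0)) (sel b1 0
 (sel b2 0 1 0) 0)) (sel b0 0 (sel b1 1 (sel b2 0 1 (sel b2 1 1 0)) 0) (sel b0 1 (sel b1 2 (sel b2 1 (- 1) (sel b2 2
 1 0)) 0) 0)))) 0) (sel a1 1 (sel a2 0 (sel b0 (-2) (sel b1 (-3) (sel b2 (-2) (- 1) 0) (sel b1 (-2) (sel b2 (-1) (-
 1) 0) 0)) (sel b0 (-1) (sel b1 (-2) (sel b2 (-1) 1 0) (sel b1 (-1) (sel b2 (-1) (- 1) (sel b2 0 1 0)) (sel b1 0 (sel
 b2 0 1 0) 0))) (sel b0 0 (sel b1 (-1) (sel b2 0 1 0) (sel b1 0 (sel b2 1 1 0) (sel b1 1 (sel b2 1 (- 1) 0) 0))) (sel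
 b0 1 (sel b1 1 (sel b2 1 1 0) (sel b1 2 (sel b2 2 (- 1) 0) 0)) 0)))) (sel a2 1 (sel b0 (-2) (sel b1 (-3) (sel b2
 (-2) (- 1) 0) (sel b1 (-2) (sel b2 (-2) 1 (sel b2 (-1) 1 0)) 0)) (sel b0 (-1) (sel b1 (-2) (sel b2 (-2) (- 1) (sel
 b2 (-1) (- 1) 0)) (sel b1 (-1) (sel b2 (-1) 1 (sel b2 0 (- 1) 0)) (sel b1 0 (sel b2 0 (- 1) 0) 0))) (sel b0 0 (sel
 b1 (-1) (sel b2 (-1) 1 0) (sel b1 0 (sel b2 (-1) 1 0) (sel b1 1 (sel b2 0 (- 1) (sel b2 1 1 0)) 0))) (sel b0 1 (sel
 b1 1 (sel b2 0 (- 1) (sel b2 1 (- 1) 0)) (sel b1 2 (sel b2 1 (- 1) 0) 0)) 0)))) 0)) (sel a1 2 (sel a2 1 (sel b0 (-2)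
 (sel b1 (-3) (sel b2 (-2) 1 0) (sel b1 (-2) (sel b2 (-1) (- 1) 0) 0)) (sel b0 (-1) (sel b1 (-2) (sel b2 (-2) 1 (sel
 b2 (-1) 1 0)) (sel b1 (-1) (sel b2 (-1) 1 (sel b2 0 (- 1) 0)) 0)) (sel b0 0 (sel b1 (-1) (sel b2 (-1) 1 (sel b2 0 1
 0)) (sel b1 0 (sel b2 1 (- 1) 0) 0)) (sel b0 1 (sel b1 0 (sel b2 0 1 0) (sel b1 1 (sel b2 1 1 0) 0)) 0)))) (sel a2 2
 (sel b0 (-2) (sel b1 (-3) (sel b2 (-2) 1 0) (sel b1 (-2) (sel b2 (-2) (- 1) 0) 0)) (sel b0 (-1) (sel b1 (-2) (sel b2
 (-2) 1 (sel b2 (-1) (- 1) 0)) (sel b1 (-1) (sel b2 (-1) (- 1) 0) 0)) (sel b0 0 (sel b1 (-1) (sel b2 (-1) 1 0) (sel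
 b1 0 (sel b2 (-1) 1 0) 0)) (sel b0 1 (sel b1 0 (sel b2 0 1 0) (sel b1 1 (sel b2 0 1 0) 0)) 0)))) 0)) 0))) (sel a0 2
 (sel a1 2 (sel a2 1 (sel b0 (-2) (sel b1 (-3) (sel b2 (-2) 1 0) (sel b1 (-2) (sel b2 (-2) (- 1) (sel b2 (-1) 1 0))
 0)) (sel b0 (-1) (sel b1 (-2) (sel b2 (-1) 1 0) (sel b1 (-1) (sel b2 (-1) 1 (sel b2 0 (- 1) 0)) (sel b1 0 (sel b2 0
 (- 1) 0) 0))) (sel b0 0 (sel b1 0 (sel b2 1 1 0) (sel b1 1 (sel b2 1 1 0) 0)) 0))) (sel a2 2 (sel b0 (-2) (sel b1
 (-3) (sel b2 (-2) 1 0) (sel b1 (-2) (sel b2 (-2) (- 1) (sel b2 (-1) (- 1) 0)) 0)) (sel b0 (-1) (sel b1 (-2) (sel b2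
 (-2) (- 1) 0) (sel b1 (-1) (sel b2 (-1) 1 0) (sel b1 0 (sel b2 0 (- 1) 0) 0))) (sel b0 0 (sel b1 0 (sel b2 (-1) (-
 1) 0) (sel b1 1 (sel b2 0 1 0) 0)) 0))) 0)) (sel a1 3 (sel a2 2 (sel b0 (-2) (sel b1 (-3) (sel b2 (-2) (- 1) 0) (sel
 b1 (-2) (sel b2 (-2) 1 (sel b2 (-1) 1 0)) 0)) (sel b0 (-1) (sel b1 (-2) (sel b2 (-2) 1 (sel b2 (-1) (- 1) 0)) (sel
 b1 (-1) (sel b2 (-1) 1 (sel b2 0 (- 1) 0)) 0)) (sel b0 0 (sel b1 (-1) (sel b2 (-1) (- 1) (sel b2 0 1 0)) 0) 0))) 0)
 0)) 0)))))"

definition g23_form :: "g23 \<Rightarrow> g23 \<Rightarrow> int" where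
 "g23_form = (\<lambda>(a0, a1, a2) (b0, b1, b2). - (a0 * b1 + a1 * b0 + a1 * b2 + a2 * b1))"

definition g23_odd :: "g23 \<Rightarrow> bool" where
 "g23_odd = (\<lambda>(a0, a1, a2). odd (a0 + a1 + a2))"

definition g23_sign :: "g23 \<Rightarrow> g23 \<Rightarrow> int" where
 "g23_sign a b = (if g23_odd a \<and> g23_odd b then - 1 else 1)"

definition g23_parity :: "g23 \<Rightarrow> bit" where
 "g23_parity a = (if g23_odd a then 1 else 0)"

definition g23_ev :: "nat \<Rightarrow> g23 \<Rightarrow> int" where
 "g23_ev i = (\<lambda>(a0, a1, a2). if i = 0 then - a1 else if i = 1 then - a0 - a2 else if i = 3 then a0 else 0)"

text \<open>The kernel vector (1, 0, -1) of the Cartan matrix makes the difference of the first and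
  the last coroot central. This difference is H 2, so the last simple coroot is H 0 - H 2. In
  \<open>g23_ev\<close>, index 3 belongs to the additional Cartan element, dual to the simple root
  0.\<close>

definition g23_cor :: "g23 \<Rightarrow> nat \<Rightarrow> int" where
 "g23_cor = (\<lambda>(a0, a1, a2) i. if i = 0 then a0 + a2 else if i = 1 then a1 else if i = 2 then - a2 else 0)"

definition g23_simple :: "nat \<Rightarrow> g23" where
 "g23_simple i = (of_bool (i = 0), of_bool (i = 1), of_bool (i = 2))"

definition g23_degree :: "g23 \<Rightarrow> nat \<Rightarrow>\<^sub>0 int" where
 "g23_degree = (\<lambda>(a0, a1, a2). single 0 a0 + single 1 a1 + single 2 a2)"

definition g23_height :: "g23 \<Rightarrow> nat" where
 "g23_height = (\<lambda>(a0, a1, a2). nat \<bar>a0\<bar> + nat \<bar>a1\<bar> + nat \<bar>a2\<bar>)"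

text \<open>The three checks collect, according to the number of roots involved, conditions of
  \<open>root_data\<close> and \<open>root_model\<close> that are evaluated on the tables.\<close>

definition g23_pair_check :: "g23 \<Rightarrow> g23 \<Rightarrow> bool" where
 "g23_pair_check a b \<longleftrightarrow>
   (if a + b = 0 then (g23_N b a - g23_sign a b * g23_N a b) mod 3 = 0 \<and> g23_N a b mod 3 \<noteq> 0
   else if g23_root (a + b) then (g23_N b a + g23_sign a b * g23_N a b) mod 3 = 0
   else g23_N a b = 0)"

definition g23_single_check :: "g23 \<Rightarrow> bool" where
 "g23_single_check a \<longleftrightarrow> a \<noteq> 0 \<and> g23_root a \<and> g23_root (- a) \<and>
   (g23_odd a \<longrightarrow> a + a \<noteq> 0 \<and> a + (a + a) \<noteq> 0 \<and> (g23_N a a * g23_N a (a + a)) mod 3 = 0) \<and>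
   \<not> (g23_cor a 0 mod 3 = 0 \<and> g23_cor a 1 mod 3 = 0 \<and> g23_cor a 2 mod 3 = 0) \<and>
   \<not> (g23_ev 0 a mod 3 = 0 \<and> g23_ev 1 a mod 3 = 0) \<and>
   (let simple = [g23_simple 0, g23_simple 1, g23_simple 2, - g23_simple 0, - g23_simple 1, - g23_simple 2] in
    list_ex (\<lambda>c. a = c) simple \<or>
    list_ex (\<lambda>c. g23_root (a - c) \<and> g23_height (a - c) < g23_height a \<and> g23_height c < g23_height a \<and>
     g23_N (a - c) c mod 3 \<noteq> 0) simple)"

text \<open>The sums over Cartan elements are already replaced by \<open>g23_form\<close>, and a + b
  with its constant is shared by the inner loop. The first root is an argument, so the evaluation
  splits into one run per root.\<close>

definition g23_jacobi_check :: "g23 \<Rightarrow> bool" where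
 "g23_jacobi_check a \<longleftrightarrow> list_all (\<lambda>b. let ab = a + b; n = g23_N a b in list_all (\<lambda>c. let abc = ab + c in
   if abc = 0 then
    (g23_N b c * g23_N a (- a) - n * g23_N (- c) c) mod 3 = 0 \<and>
    (n * g23_N (- c) c + g23_sign a b * g23_N a c * g23_N b (- b)) mod 3 = 0
   else if g23_root abc then
    ((if b + c = 0 then - g23_N b c * g23_form b a else g23_N b c * g23_N a (b + c))
    - (if ab = 0 then n * g23_form a c else n * g23_N ab c)
    - g23_sign a b *
     (if a + c = 0 then - g23_N a c * g23_form a b else g23_N a c * g23_N b (a + c))) mod 3 = 0
   else True) g23_roots) g23_roots"

lemma g23_pair_checks: "list_all (\<lambda>a. list_all (g23_pair_check a) g23_roots) g23_roots"
 by code_simp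

lemma g23_single_checks: "list_all g23_single_check g23_roots"
 by code_simp

lemma g23_jacobi_check_0: "g23_jacobi_check (0, 0, 1)"
 by code_simp

lemma g23_jacobi_check_1: "g23_jacobi_check (0, 1, 0)"
 by code_simp

lemma g23_jacobi_check_2: "g23_jacobi_check (1, 0, 0)"
 by code_simp

lemma g23_jacobi_check_3: "g23_jacobi_check (0, 1, 1)"
 by code_simp

lemma g23_jacobi_check_4: "g23_jacobi_check (1, 1, 0)"
 by code_simp

lemma g23_jacobi_check_5: "g23_jacobi_check (1, 1, 1)"
 by code_simp

lemma g23_jacobi_check_6: "g23_jacobi_check (1, 2, 1)"
 by code_simp

lemma g23_jacobi_check_7: "g23_jacobi_check (1, 2, 2)"
 by code_simp

lemma g23_jacobi_check_8: "g23_jacobi_check (2, 2, 1)"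
 by code_simp

lemma g23_jacobi_check_9: "g23_jacobi_check (2, 2, 2)"
 by code_simp

lemma g23_jacobi_check_10: "g23_jacobi_check (2, 3, 2)"
 by code_simp

lemma g23_jacobi_check_11: "g23_jacobi_check (0, 0, -1)"
 by code_simp

lemma g23_jacobi_check_12: "g23_jacobi_check (0, -1, 0)"
 by code_simp

lemma g23_jacobi_check_13: "g23_jacobi_check (-1, 0, 0)"
 by code_simp

lemma g23_jacobi_check_14: "g23_jacobi_check (0, -1, -1)"
 by code_simp

lemma g23_jacobi_check_15: "g23_jacobi_check (-1, -1, 0)"
 by code_simp

lemma g23_jacobi_check_16: "g23_jacobi_check (-1, -1, -1)"
 by code_simp

lemma g23_jacobi_check_17: "g23_jacobi_check (-1, -2, -1)"
 by code_simp

lemma g23_jacobi_check_18: "g23_jacobi_check (-1, -2, -2)"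
 by code_simp

lemma g23_jacobi_check_19: "g23_jacobi_check (-2, -2, -1)"
 by code_simp

lemma g23_jacobi_check_20: "g23_jacobi_check (-2, -2, -2)"
 by code_simp

lemma g23_jacobi_check_21: "g23_jacobi_check (-2, -3, -2)"
 by code_simp

lemma g23_jacobi_checks: "a \<in> set g23_roots \<Longrightarrow> g23_jacobi_check a"
 unfolding g23_roots_def list.set insert_iff empty_iff
 by (elim disjE FalseE; simp only: g23_jacobi_check_0 g23_jacobi_check_1 g23_jacobi_check_2 g23_jacobi_check_3 g23_jacobi_check_4 g23_jacobi_check_5 g23_jacobi_check_6 g23_jacobi_check_7 g23_jacobi_check_8 g23_jacobi_check_9 g23_jacobi_check_10 g23_jacobi_check_11 g23_jacobi_check_12 g23_jacobi_check_13 g23_jacobi_check_14 g23_jacobi_check_15 g23_jacobi_check_16 g23_jacobi_check_17 g23_jacobi_check_18 g23_jacobi_check_19 g23_jacobi_check_20 g23_jacobi_check_21)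

lemma g23_cases: obtains a0 a1 a2 where "(a :: g23) = (a0, a1, a2)"
 by (cases a) auto

lemma g23_root_iff: "g23_root a \<longleftrightarrow> a \<in> set g23_roots"
proof
 show "a \<in> set g23_roots" if "g23_root a"
  using that by (cases a rule: g23_cases) (auto simp: g23_root_def g23_roots_def split: if_splits)
 show "g23_root a" if "a \<in> set g23_roots"
  using g23_single_checks that by (simp add: list_all_iff g23_single_check_def)
qed

lemma g23_single: "a \<in> set g23_roots \<Longrightarrow> g23_single_check a"
 using g23_single_checks by (simp add: list_all_iff)

lemma g23_pair: "\<lbrakk>a \<in> set g23_roots; b \<in> set g23_roots\<rbrakk> \<Longrightarrow> g23_pair_check a b"
 using g23_pair_checks by (simp add: list_all_iff)

lemma g23_super_sign: "super_sign (g23_parity a) (g23_parity b) = g23_sign a b"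
 by (simp add: super_sign_def g23_parity_def g23_sign_def)

lemma sum_less_2: "(\<Sum>i<2. g i) = g 0 + (g (1 :: nat) :: 'c :: comm_monoid_add)"
 by (simp add: eval_nat_numeral)

text \<open>In contrast to type E6, the kernel vector is a kernel vector over the integers, so there
  is equality and not only a congruence.\<close>

lemma g23_sum_ev: "(\<Sum>i<2. g23_cor a i * g23_ev i b) = g23_form a b"
 by (cases a rule: g23_cases; cases b rule: g23_cases)
   (simp add: sum_less_2 g23_cor_def g23_ev_def g23_form_def algebra_simps)

lemma g23_zero: "(0 :: g23) \<notin> set g23_roots"
 using g23_single[of 0] by (auto simp: g23_single_check_def)

lemma g23_root_data: "root_data (set g23_roots) g23_parity g23_N g23_ev g23_cor 2"
proof
 show "0 \<notin> set g23_roots"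
  by (rule g23_zero)
 show "- a \<in> set g23_roots" if "a \<in> set g23_roots" for a
  using g23_single[OF that] unfolding g23_root_iff[symmetric] g23_single_check_def by blast
 show "g23_parity (a + b) = g23_parity a + g23_parity b" for a b
  by (cases a rule: g23_cases; cases b rule: g23_cases) (auto simp: g23_parity_def g23_odd_def)
 show "g23_ev i (a + b) = g23_ev i a + g23_ev i b" for i a b
  by (cases a rule: g23_cases; cases b rule: g23_cases) (simp add: g23_ev_def)
 show "g23_cor (a + b) i = g23_cor a i + g23_cor b i" for i a b
  by (cases a rule: g23_cases; cases b rule: g23_cases) (simp add: g23_cor_def)
 show "g23_ev 2 a = 0" "g23_cor a (Suc 2) = 0" for a
  by (cases a rule: g23_cases, simp add: g23_ev_def g23_cor_def)+
 fix a b c assume a: "a \<in> set g23_roots"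
 show "3 dvd g23_N (- a) a - super_sign (g23_parity a) (g23_parity a) * g23_N a (- a)"
 proof -
  have "- a \<in> set g23_roots"
   using g23_single[OF a] unfolding g23_root_iff[symmetric] g23_single_check_def by blast
  then have "(g23_N (- a) a - g23_sign a (- a) * g23_N a (- a)) mod 3 = 0"
   using g23_pair[OF a, of "- a"] unfolding g23_pair_check_def by simp
  moreover have "g23_sign a (- a) = g23_sign a a"
   by (cases a rule: g23_cases) (simp add: g23_sign_def g23_odd_def)
  ultimately show ?thesis
   by (simp add: g23_super_sign dvd_eq_mod_eq_0)
 qed
 show "a + a \<noteq> 0 \<and> a + (a + a) \<noteq> 0 \<and> 3 dvd g23_N a a * g23_N a (a + a)" if "g23_parity a = 1"
  using g23_single[OF a] that unfolding g23_single_check_def g23_parity_def dvd_eq_mod_eq_0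
  by (auto split: if_splits)
 assume b: "b \<in> set g23_roots"
 note pair = g23_pair[OF a b, unfolded g23_pair_check_def]
 show "g23_N a b = 0" if "a + b \<notin> set g23_roots" "a + b \<noteq> 0"
  using pair that unfolding g23_root_iff by simp
 show "3 dvd g23_N b a + super_sign (g23_parity a) (g23_parity b) * g23_N a b" if "a + b \<in> set g23_roots"
 proof -
  have "a + b \<noteq> 0"
   using that g23_zero by metis
  then show ?thesis
   using pair that unfolding g23_root_iff g23_super_sign dvd_eq_mod_eq_0 by simp
 qed
 assume c: "c \<in> set g23_roots"
 have jacobi: "if a + b + c = 0 then
    (g23_N b c * g23_N a (- a) - g23_N a b * g23_N (- c) c) mod 3 = 0 \<and>
    (g23_N a b * g23_N (- c) c + g23_sign a b * g23_N a c * g23_N b (- b)) mod 3 = 0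
   else if g23_root (a + b + c) then
    ((if b + c = 0 then - g23_N b c * g23_form b a else g23_N b c * g23_N a (b + c))
    - (if a + b = 0 then g23_N a b * g23_form a c else g23_N a b * g23_N (a + b) c)
    - g23_sign a b *
     (if a + c = 0 then - g23_N a c * g23_form a b else g23_N a c * g23_N b (a + c))) mod 3 = 0
   else True"
  using g23_jacobi_checks[OF a] b c unfolding g23_jacobi_check_def list_all_iff Let_def by blast
 show "3 dvd (if b + c = 0 then - g23_N b c * (\<Sum>i<2. g23_cor b i * g23_ev i a) else g23_N b c * g23_N a (b + c))
   - (if a + b = 0 then g23_N a b * (\<Sum>i<2. g23_cor a i * g23_ev i c) else g23_N a b * g23_N (a + b) c)
   - super_sign (g23_parity a) (g23_parity b) *
    (if a + c = 0 then - g23_N a c * (\<Sum>i<2. g23_cor a i * g23_ev i b) else g23_N a c * g23_N b (a + c))"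
  if "a + b + c \<in> set g23_roots"
 proof -
  have "a + b + c \<noteq> 0"
   using that g23_zero by metis
  then show ?thesis
   using jacobi that unfolding g23_root_iff g23_super_sign dvd_eq_mod_eq_0 g23_sum_ev by (simp only: if_True if_False)
 qed
 show "3 dvd g23_N b c * g23_N a (- a) - g23_N a b * g23_N (- c) c \<and>
   3 dvd g23_N a b * g23_N (- c) c + super_sign (g23_parity a) (g23_parity b) * g23_N a c * g23_N b (- b)"
  if "a + b + c = 0"
  using jacobi that unfolding g23_super_sign dvd_eq_mod_eq_0 by (simp only: if_True)
qed

lemma le_2: "(i :: nat) \<le> 2 \<longleftrightarrow> i = 0 \<or> i = 1 \<or> i = 2" and less_2: "(i :: nat) < 2 \<longleftrightarrow> i = 0 \<or> i = 1"
 by auto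

lemma g23_simple_root: "i \<le> 2 \<Longrightarrow> g23_simple i \<in> set g23_roots"
 unfolding le_2 by (elim disjE) (simp_all add: g23_simple_def g23_roots_def)

lemma g23_root_model:
 assumes "CHAR('k :: field) = 3"
 shows "root_model TYPE('k) (set g23_roots) g23_parity g23_N g23_ev g23_cor 2 g23_simple g23_height g23_degree"
proof (rule root_model.intro[OF g23_root_data], rule root_model_axioms.intro)
 show "g23_simple i \<in> set g23_roots" if "i \<le> 2" for i
  by (rule g23_simple_root[OF that])
 show "g23_degree (a + b) = g23_degree a + g23_degree b" for a b
  by (cases a rule: g23_cases; cases b rule: g23_cases) (simp add: g23_degree_def single_add)
 show "a = b" if "g23_degree a = g23_degree b" for a b
 proof -
  have "lookup (g23_degree a) i = lookup (g23_degree b) i" for i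
   using that by simp
  from this[of 0] this[of 1] this[of 2] show ?thesis
   by (cases a rule: g23_cases; cases b rule: g23_cases) (simp add: g23_degree_def lookup_add lookup_single)
 qed
 show "g23_degree (g23_simple i) = single i 1" if "i \<le> 2" for i
  using that unfolding le_2 by (elim disjE) (simp_all add: g23_degree_def g23_simple_def)
 show "g23_N (g23_simple i) (- g23_simple j) = 0" if "i \<le> 2" "j \<le> 2" "i \<noteq> j" for i j
  using that unfolding le_2 by (elim disjE) (simp_all add: g23_simple_def g23_N_def)
 show "g23_N (g23_simple i) (- g23_simple i) * g23_N (g23_simple i) (- g23_simple i) = 1" if "i \<le> 2" for i
  using that unfolding le_2 by (elim disjE) (simp_all add: g23_simple_def g23_N_def)
 show "\<not> 3 dvd g23_N a (- a)" if "a \<in> set g23_roots" for a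
 proof -
  have "- a \<in> set g23_roots"
   using g23_single[OF that] unfolding g23_root_iff[symmetric] g23_single_check_def by blast
  then show ?thesis
   using g23_pair[OF that, of "- a"] unfolding g23_pair_check_def dvd_eq_mod_eq_0 by simp
 qed
 show "g23_cor (g23_simple i) j = (if i = j then 1 else 0)" if "i < 2" "j \<le> 2" for i j
  using that unfolding le_2 less_2 by (elim disjE) (simp_all add: g23_simple_def g23_cor_def)
 show "g23_cor (g23_simple 2) 2 = - 1"
  by (simp add: g23_simple_def g23_cor_def)
 show "\<exists>i\<le>2. \<not> 3 dvd g23_cor a i" if "a \<in> set g23_roots" for a
 proof -
  have "\<not> (g23_cor a 0 mod 3 = 0 \<and> g23_cor a 1 mod 3 = 0 \<and> g23_cor a 2 mod 3 = 0)"
   using g23_single[OF that] unfolding g23_single_check_def by (elim conjE) assumption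
  then show ?thesis
   unfolding le_2 dvd_eq_mod_eq_0 by blast
 qed
 show "\<exists>i<2. \<not> 3 dvd g23_ev i a" if "a \<in> set g23_roots" for a
 proof -
  have "\<not> (g23_ev 0 a mod 3 = 0 \<and> g23_ev 1 a mod 3 = 0)"
   using g23_single[OF that] unfolding g23_single_check_def by (elim conjE) assumption
  then show ?thesis
   unfolding less_2 dvd_eq_mod_eq_0 by blast
 qed
 show "x i = 0" if *: "\<And>a. a \<in> set g23_roots \<Longrightarrow> (\<Sum>i<2. x i * (of_int (g23_ev i a) :: 'k)) = 0" and "i < 2" for x i
  using *[OF g23_simple_root[of 0]] *[OF g23_simple_root[of 1]] \<open>i < 2\<close> unfolding less_2
  by (auto simp: sum_less_2 g23_ev_def g23_simple_def)
 show "\<exists>b c. b \<in> set g23_roots \<and> c \<in> set g23_roots \<and> a = b + c \<and> g23_height b < g23_height a \<and>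
   g23_height c < g23_height a \<and> \<not> 3 dvd g23_N b c"
  if a: "a \<in> set g23_roots" and not_simple: "\<And>i. i \<le> 2 \<Longrightarrow> a \<noteq> g23_simple i \<and> a \<noteq> - g23_simple i" for a
 proof -
  let ?simple = "[g23_simple 0, g23_simple 1, g23_simple 2, - g23_simple 0, - g23_simple 1, - g23_simple 2]"
  have "list_ex (\<lambda>c. a = c) ?simple \<or>
    list_ex (\<lambda>c. g23_root (a - c) \<and> g23_height (a - c) < g23_height a \<and> g23_height c < g23_height a \<and>
     g23_N (a - c) c mod 3 \<noteq> 0) ?simple"
   using g23_single[OF a] unfolding g23_single_check_def Let_def by blast
  moreover have "\<not> list_ex (\<lambda>c. a = c) ?simple"
   using not_simple[of 0] not_simple[of 1] not_simple[of 2] by simp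
  ultimately obtain c where c: "c \<in> set ?simple" "g23_root (a - c)" "g23_height (a - c) < g23_height a"
   "g23_height c < g23_height a" "g23_N (a - c) c mod 3 \<noteq> 0"
   unfolding list_ex_iff by blast
  have neg: "- g23_simple i \<in> set g23_roots" if "i \<le> 2" for i
   using g23_single[OF g23_simple_root[OF that]] unfolding g23_root_iff[symmetric] g23_single_check_def by blast
  have "c \<in> set g23_roots"
   using c(1) g23_simple_root[of 0] g23_simple_root[of 1] g23_simple_root[of 2] neg[of 0] neg[of 1] neg[of 2] by auto
  then show ?thesis
   using c unfolding g23_root_iff dvd_eq_mod_eq_0 by (intro exI[of _ "a - c"] exI[of _ c]) simp
 qed
qed (rule assms)

section \<open>The Jordan blocks\<close>

primrec coef :: "'a \<Rightarrow> ('a \<times> int) list \<Rightarrow> int" where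
 "coef u [] = 0"
| "coef u (x # xs) = (if fst x = u then snd x else 0) + coef u xs"

text \<open>It suffices to compare at indices that occur in one of the lists: at all others both
  coefficients are 0.\<close>

definition same_mod_3 :: "('a \<times> int) list \<Rightarrow> ('a \<times> int) list \<Rightarrow> bool" where
 "same_mod_3 xs ys \<longleftrightarrow> list_all (\<lambda>u. (coef u xs - coef u ys) mod 3 = 0) (map fst (xs @ ys))"

text \<open>Entries with coefficient 0 are skipped, which keeps iterated applications short.\<close>

primrec list_apply :: "('a \<Rightarrow> ('b \<times> int) list) \<Rightarrow> ('a \<times> int) list \<Rightarrow> ('b \<times> int) list" where
 "list_apply f [] = []"
| "list_apply f (x # xs) =
   (if snd x = 0 then [] else map (\<lambda>(v, t). (v, snd x * t)) (f (fst x))) @ list_apply f xs"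

definition list_bracket ::
  "('a \<Rightarrow> 'a \<Rightarrow> ('b \<times> int) list) \<Rightarrow> ('a \<times> int) list \<Rightarrow> ('a \<times> int) list \<Rightarrow> ('b \<times> int) list" where
 "list_bracket b xs ys = list_apply (\<lambda>u. list_apply (b u) ys) xs"

lemma interp_list_apply: "interp (list_apply f xs) = pm_ext (\<lambda>u. interp (f u)) (interp xs)"
 by (induction xs)
   (auto simp: pm_linear_add[OF pm_ext_linear] pm_linear_zero[OF pm_ext_linear] simp flip: pm_smult_interp)

lemma interp_list_bracket: "interp (list_bracket b xs ys) = bi_ext (\<lambda>u v. interp (b u v)) (interp xs) (interp ys)"
 by (simp add: list_bracket_def interp_list_apply bi_ext_def)

lemma lookup_interp: "lookup (interp xs) u = of_int (coef u xs)"
 by (induction xs) (auto simp: lookup_add lookup_single when_def)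

lemma coef_zero: "u \<notin> fst ` set xs \<Longrightarrow> coef u xs = 0"
 by (induction xs) auto

lemma interp_same_mod_3:
 assumes "CHAR('k :: field) = 3" "same_mod_3 xs ys"
 shows "(interp xs :: 'a \<Rightarrow>\<^sub>0 'k) = interp ys"
proof (rule poly_mapping_eqI)
 fix u
 have "3 dvd coef u xs - coef u ys"
 proof (cases "u \<in> set (map fst (xs @ ys))")
  case True
  then show ?thesis
   using assms(2) unfolding same_mod_3_def list_all_iff dvd_eq_mod_eq_0 by blast
 next
  case False
  then show ?thesis
   by (simp add: coef_zero)
 qed
 then have "(of_int (coef u xs - coef u ys) :: 'k) = 0"
  using of_int_eq_0_iff_char_dvd[of "coef u xs - coef u ys", where 'a = 'k] assms(1) by simp
 then show "lookup (interp xs) u = lookup (interp ys :: 'a \<Rightarrow>\<^sub>0 'k) u"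
  by (simp add: lookup_interp)
qed

text \<open>
 \<open>block_one\<close> gives the Jordan blocks of size 1, \<open>block_two\<close> the generators of those of size 2, and
 \<open>block_three\<close> sends the end of a block of size 3 to its generator; \<open>coord_one\<close> and \<open>coord_two\<close>
 are the coordinates with respect to the blocks of size 1 and the ends of the blocks of size 2.
\<close>

definition e6_root_list :: "e6 list" where
 "e6_root_list = [(0,0,0,0,0,1), (0,0,0,0,1,0), (0,0,0,1,0,0), (0,0,1,0,0,0), (0,1,0,0,0,0), (1,0,0,0,0,0),
 (0,0,0,0,1,1), (0,0,0,1,1,0), (0,0,1,1,0,0), (0,1,0,1,0,0), (1,0,1,0,0,0), (0,0,0,1,1,1), (0,0,1,1,1,0),
 (0,1,0,1,1,0), (0,1,1,1,0,0), (1,0,1,1,0,0), (0,0,1,1,1,1), (0,1,0,1,1,1), (0,1,1,1,1,0), (1,0,1,1,1,0),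
 (1,1,1,1,0,0), (0,1,1,1,1,1), (0,1,1,2,1,0), (1,0,1,1,1,1), (1,1,1,1,1,0), (0,1,1,2,1,1), (1,1,1,1,1,1),
 (1,1,1,2,1,0), (0,1,1,2,2,1), (1,1,1,2,1,1), (1,1,2,2,1,0), (1,1,1,2,2,1), (1,1,2,2,1,1), (1,1,2,2,2,1),
 (1,1,2,3,2,1), (1,2,2,3,2,1), (0,0,0,0,0,-1), (0,0,0,0,-1,0), (0,0,0,-1,0,0), (0,0,-1,0,0,0), (0,-1,0,0,0,0),
 (-1,0,0,0,0,0), (0,0,0,0,-1,-1), (0,0,0,-1,-1,0), (0,0,-1,-1,0,0), (0,-1,0,-1,0,0), (-1,0,-1,0,0,0),
 (0,0,0,-1,-1,-1), (0,0,-1,-1,-1,0), (0,-1,0,-1,-1,0), (0,-1,-1,-1,0,0), (-1,0,-1,-1,0,0), (0,0,-1,-1,-1,-1),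
 (0,-1,0,-1,-1,-1), (0,-1,-1,-1,-1,0), (-1,0,-1,-1,-1,0), (-1,-1,-1,-1,0,0), (0,-1,-1,-1,-1,-1), (0,-1,-1,-2,-1,0),
 (-1,0,-1,-1,-1,-1), (-1,-1,-1,-1,-1,0), (0,-1,-1,-2,-1,-1), (-1,-1,-1,-1,-1,-1), (-1,-1,-1,-2,-1,0),
 (0,-1,-1,-2,-2,-1), (-1,-1,-1,-2,-1,-1), (-1,-1,-2,-2,-1,0), (-1,-1,-1,-2,-2,-1), (-1,-1,-2,-2,-1,-1),
 (-1,-1,-2,-2,-2,-1), (-1,-1,-2,-3,-2,-1), (-1,-2,-2,-3,-2,-1)]"

text \<open>The two Cartan entries span the common kernel of the simple roots 0, 1, 5 modulo 3. In
  the root entries the coordinates 2, 3, 4 of the E6 roots form the given root of g(2,3). The root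
  vectors with these coordinates fixed make up a tensor product of copies of J_2, one for each
  simple root 0, 1, 5 that can be added or subtracted. Two-term entries arise from J_2 \<otimes> J_2
  = J_1 \<oplus> J_3, and in \<open>block_two\<close> from the triple product, which is J_2 plus two
  copies of J_3.\<close>

fun block_one :: "g23 ridx \<Rightarrow> (e6 ridx \<times> int) list" where
 "block_one (H i) = (if i = 0 then [(H 0, - 1), (H 2,1)] else if i = 1 then [(H 1, - 1), (H 3,1)] else [])"
| "block_one (R (a0, a1, a2)) = sel a0 (-2) (sel a1 (-2) (sel a2 (-2) [(R (-1,-1,-2,-2,-2,-1),1)] []) []) (sel a0 (-1)
 (sel a1 (-2) (sel a2 (-1) [(R (-1,-1,-1,-2,-1,0), - 1), (R (0,-1,-1,-2,-1,-1),1)] []) (sel a1 (-1) (sel a2 0 [(R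
 (-1,0,-1,-1,0,0), - 1), (R (0,-1,-1,-1,0,0),1)] []) [])) (sel a0 0 (sel a1 (-1) (sel a2 (-1) [(R (0,-1,0,-1,-1,0), -
 1), (R (0,0,0,-1,-1,-1),1)] []) (sel a1 1 (sel a2 1 [(R (0,0,0,1,1,1),1), (R (0,1,0,1,1,0), - 1)] []) [])) (sel a0 1
 (sel a1 1 (sel a2 0 [(R (0,1,1,1,0,0),1), (R (1,0,1,1,0,0), - 1)] []) (sel a1 2 (sel a2 1 [(R (0,1,1,2,1,1),1), (R
 (1,1,1,2,1,0), - 1)] []) [])) (sel a0 2 (sel a1 2 (sel a2 2 [(R (1,1,2,2,2,1),1)] []) []) []))))"

fun block_two :: "g23 ridx \<Rightarrow> (e6 ridx \<times> int) list" where
 "block_two (H i) = ([])"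
| "block_two (R (a0, a1, a2)) = sel a0 (-2) (sel a1 (-3) (sel a2 (-2) [(R (-1,-2,-2,-3,-2,-1),1)] []) (sel a1 (-2)
 (sel a2 (-1) [(R (-1,-1,-2,-2,-1,-1),1)] []) [])) (sel a0 (-1) (sel a1 (-2) (sel a2 (-2) [(R (-1,-1,-1,-2,-2,-1),1)]
 []) (sel a1 (-1) (sel a2 (-1) [(R (-1,-1,-1,-1,-1,0), - 1), (R (-1,0,-1,-1,-1,-1),1)] []) (sel a1 0 (sel a2 0 [(R
 (-1,0,-1,0,0,0),1)] []) []))) (sel a0 0 (sel a1 (-1) (sel a2 0 [(R (0,-1,0,-1,0,0),1)] []) (sel a1 0 (sel a2 (-1)
 [(R (0,0,0,0,-1,-1),1)] (sel a2 1 [(R (0,0,0,0,1,0),1)] [])) (sel a1 1 (sel a2 0 [(R (0,0,0,1,0,0),1)] []) [])))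
 (sel a0 1 (sel a1 0 (sel a2 0 [(R (0,0,1,0,0,0),1)] []) (sel a1 1 (sel a2 1 [(R (0,0,1,1,1,1), - 1), (R
 (0,1,1,1,1,0),1)] []) (sel a1 2 (sel a2 2 [(R (0,1,1,2,2,1),1)] []) []))) (sel a0 2 (sel a1 2 (sel a2 1 [(R
 (1,1,2,2,1,0),1)] []) (sel a1 3 (sel a2 2 [(R (1,1,2,3,2,1),1)] []) [])) []))))"

fun coord_one :: "e6 ridx \<Rightarrow> (g23 ridx \<times> int) list" where
 "coord_one (H i) = (if i = 2 then [(H 0,1)] else if i = 3 then [(H 1,1)] else if i = 4 then [(H 0,1)] else [])"
| "coord_one (R (a0, a1, a2, a3, a4, a5)) = sel a0 (-1) (sel a1 (-1) (sel a2 (-2) (sel a3 (-2) (sel a4 (-2) (sel a5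
 (-1) [(R (-2,-2,-2),1)] []) []) []) (sel a2 (-1) (sel a3 (-2) (sel a4 (-1) (sel a5 0 [(R (-1,-2,-1),1)] []) []) [])
 [])) (sel a1 0 (sel a2 (-1) (sel a3 (-1) (sel a4 0 (sel a5 0 [(R (-1,-1,0),1)] []) []) []) []) [])) (sel a0 0 (sel
 a1 (-1) (sel a2 (-1) (sel a3 (-2) (sel a4 (-1) (sel a5 (-1) [(R (-1,-2,-1), - 1)] []) []) (sel a3 (-1) (sel a4 0
 (sel a5 0 [(R (-1,-1,0), - 1)] []) []) [])) (sel a2 0 (sel a3 (-1) (sel a4 (-1) (sel a5 0 [(R (0,-1,-1),1)] []) [])
 []) [])) (sel a1 0 (sel a2 0 (sel a3 (-1) (sel a4 (-1) (sel a5 (-1) [(R (0,-1,-1), - 1)] []) []) (sel a3 1 (sel a4 1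
 (sel a5 1 [(R (0,1,1), - 1)] []) []) [])) []) (sel a1 1 (sel a2 0 (sel a3 1 (sel a4 1 (sel a5 0 [(R (0,1,1),1)] [])
 []) []) (sel a2 1 (sel a3 1 (sel a4 0 (sel a5 0 [(R (1,1,0), - 1)] []) []) (sel a3 2 (sel a4 1 (sel a5 1 [(R
 (1,2,1), - 1)] []) []) [])) [])) []))) (sel a0 1 (sel a1 0 (sel a2 1 (sel a3 1 (sel a4 0 (sel a5 0 [(R (1,1,0),1)]
 []) []) []) []) (sel a1 1 (sel a2 1 (sel a3 2 (sel a4 1 (sel a5 0 [(R (1,2,1),1)] []) []) []) (sel a2 2 (sel a3 2
 (sel a4 2 (sel a5 1 [(R (2,2,2),1)] []) []) []) [])) [])) []))"

fun coord_two :: "e6 ridx \<Rightarrow> (g23 ridx \<times> int) list" where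
 "coord_two (H i) = ([])"
| "coord_two (R (a0, a1, a2, a3, a4, a5)) = sel a0 (-1) (sel a1 (-1) (sel a2 (-2) (sel a3 (-3) (sel a4 (-2) (sel a5
 (-1) [(R (-2,-3,-2),1)] []) []) (sel a3 (-2) (sel a4 (-1) (sel a5 0 [(R (-2,-2,-1), - 1)] []) []) [])) []) []) (sel
 a0 0 (sel a1 (-1) (sel a2 (-1) (sel a3 (-2) (sel a4 (-2) (sel a5 (-1) [(R (-1,-2,-2), - 1)] []) []) (sel a3 (-1)
 (sel a4 (-1) (sel a5 0 [(R (-1,-1,-1), - 1)] []) []) [])) []) (sel a1 0 (sel a2 (-1) (sel a3 (-1) (sel a4 (-1) (sel
 a5 (-1) [(R (-1,-1,-1),1)] []) []) (sel a3 0 (sel a4 0 (sel a5 0 [(R (-1,0,0), - 1)] []) []) [])) (sel a2 0 (sel a3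
 (-1) (sel a4 0 (sel a5 0 [(R (0,-1,0), - 1)] []) []) (sel a3 0 (sel a4 (-1) (sel a5 0 [(R (0,0,-1), - 1)] []) (sel
 a4 1 (sel a5 1 [(R (0,0,1),1)] []) [])) [])) [])) (sel a1 1 (sel a2 0 (sel a3 1 (sel a4 0 (sel a5 0 [(R (0,1,0),1)]
 []) []) []) []) []))) (sel a0 1 (sel a1 0 (sel a2 1 (sel a3 0 (sel a4 0 (sel a5 0 [(R (1,0,0),1)] []) []) (sel a3 1
 (sel a4 1 (sel a5 1 [(R (1,1,1),1)] []) []) [])) []) (sel a1 1 (sel a2 1 (sel a3 1 (sel a4 1 (sel a5 0 [(R (1,1,1),
 - 1)] []) []) (sel a3 2 (sel a4 2 (sel a5 1 [(R (1,2,2),1)] []) []) [])) (sel a2 2 (sel a3 2 (sel a4 1 (sel a5 1 [(R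
 (2,2,1),1)] []) []) []) [])) (sel a1 2 (sel a2 2 (sel a3 3 (sel a4 2 (sel a5 1 [(R (2,3,2), - 1)] []) []) []) [])
 []))) []))"

fun block_three :: "e6 ridx \<Rightarrow> (e6 ridx \<times> int) list" where
 "block_three (H i) = ([])"
| "block_three (R (a0, a1, a2, a3, a4, a5)) = sel a0 (-1) (sel a1 0 (sel a2 (-1) (sel a3 (-1) (sel a4 (-1) (sel a5 0
 [(R (-1,-1,-1,-1,-1,-1), - 1)] []) []) []) []) []) (sel a0 0 (sel a1 (-1) (sel a2 (-1) (sel a3 (-2) (sel a4 (-1)
 (sel a5 0 [(R (-1,-1,-1,-2,-1,-1), - 1)] []) []) []) []) (sel a1 0 (sel a2 (-1) (sel a3 (-1) (sel a4 (-1) (sel a5 0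
 [(R (0,-1,-1,-1,-1,-1), - 1)] []) (sel a4 0 (sel a5 0 [(R (-1,-1,-1,-1,0,0), - 1)] []) [])) []) (sel a2 0 (sel a3
 (-1) (sel a4 (-1) (sel a5 0 [(R (0,-1,0,-1,-1,-1), - 1)] []) []) (sel a3 0 (sel a4 0 (sel a5 1 [(R (0,0,0,0,0,-1), -
 1)] []) []) [])) [])) (sel a1 1 (sel a2 0 (sel a3 0 (sel a4 0 (sel a5 0 [(R (0,-1,0,0,0,0), - 1)] []) []) (sel a3 1
 (sel a4 1 (sel a5 1 [(R (0,0,0,1,1,0), - 1)] []) []) [])) (sel a2 1 (sel a3 1 (sel a4 1 (sel a5 1 [(R (0,0,1,1,1,0),
 - 1)] []) []) []) [])) []))) (sel a0 1 (sel a1 0 (sel a2 0 (sel a3 0 (sel a4 0 (sel a5 0 [(R (-1,0,0,0,0,0), - 1)]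
 []) []) []) []) (sel a1 1 (sel a2 1 (sel a3 1 (sel a4 0 (sel a5 0 [(R (0,0,1,1,0,0), - 1)] []) (sel a4 1 (sel a5 1
 [(R (1,0,1,1,1,0), - 1)] []) [])) (sel a3 2 (sel a4 1 (sel a5 1 [(R (0,1,1,2,1,0), - 1)] []) []) [])) []) [])) []))"

text \<open>The constant of the lattice interpretation once more, as a definition that can be
  evaluated directly; \<open>e6_N_eq\<close> identifies the two.\<close>

definition e6_N :: "e6 \<Rightarrow> e6 \<Rightarrow> int" where
 "e6_N a b = (if e6_form a b \<le> - 1 then e6_eps a b else 0)"

abbreviation "e6_bracket \<equiv> root_bracket e6_N e6_ev e6_cor 5"
abbreviation "g23_bracket \<equiv> root_bracket g23_N g23_ev g23_cor 2"

definition e6_d :: "(e6 ridx \<times> int) list \<Rightarrow> (e6 ridx \<times> int) list" where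
 "e6_d xs = list_bracket e6_bracket [(R (e6_simple 0), 1), (R (e6_simple 1), 1), (R (e6_simple 5), 1)] xs"

fun e6_index :: "e6 ridx \<Rightarrow> bool" where
 "e6_index (H i) \<longleftrightarrow> i < 5"
| "e6_index (R a) \<longleftrightarrow> e6_form a a = 2"

fun g23_index :: "bool \<Rightarrow> g23 ridx \<Rightarrow> bool" where
 "g23_index p (H i) \<longleftrightarrow> i < 2 \<and> \<not> p"
| "g23_index p (R a) \<longleftrightarrow> g23_root a \<and> g23_odd a = p"

definition e6_check :: "e6 ridx \<Rightarrow> bool" where
 "e6_check u \<longleftrightarrow> (let x = [(u, 1)]; dx = e6_d x; ddx = e6_d dx in
   same_mod_3 (e6_d ddx) [] \<and> same_mod_3 (list_apply coord_one dx) [] \<and>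
   same_mod_3 (list_apply coord_two ddx) [] \<and>
   list_all (\<lambda>v. g23_index False (fst v)) (coord_one u) \<and> list_all (\<lambda>v. g23_index True (fst v)) (coord_two u) \<and>
   list_all (\<lambda>v. e6_index (fst v)) (block_three u) \<and>
   same_mod_3 x (list_apply block_one (coord_one u) @ list_apply block_two (list_apply coord_two dx) @
    e6_d (list_apply block_two (coord_two u)) @ list_apply block_three ddx @
    e6_d (list_apply block_three dx) @ e6_d (e6_d (block_three u))))"

definition g23_basis :: "g23 ridx list" where
 "g23_basis = [H 0, H 1] @ map R g23_roots"

definition g23_check :: "g23 ridx \<Rightarrow> bool" where
 "g23_check u \<longleftrightarrow>
   (if g23_index False u then same_mod_3 (list_apply coord_one (block_one u)) [(u, 1)] \<and> same_mod_3 (e6_d (block_one u)) [] \<and>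
    list_all (\<lambda>v. e6_index (fst v)) (block_one u)
   else let dx = e6_d (block_two u) in same_mod_3 (list_apply coord_two dx) [(u, 1)] \<and> same_mod_3 (e6_d dx) [] \<and>
    list_all (\<lambda>v. e6_index (fst v)) (block_two u))"

text \<open>Pairs of an odd and an even vector, in this order, are left to anticommutativity. For
  two odd vectors the subtracted term is moved to the right-hand side, so that concatenation of
  lists is the only addition.\<close>

definition bracket_check :: "g23 ridx \<Rightarrow> bool" where
 "bracket_check u \<longleftrightarrow>
   (if g23_index False u then list_all (\<lambda>v. if g23_index False v
     then same_mod_3 (list_apply coord_one (list_bracket e6_bracket (block_one u) (block_one v))) (g23_bracket u v)
     else same_mod_3 (list_apply coord_two (e6_d (list_bracket e6_bracket (block_one u) (block_two v)))) (g23_bracket u v))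
    g23_basis
   else let du = e6_d (block_two u) in list_all (\<lambda>v. g23_index True v \<longrightarrow>
     same_mod_3 (list_apply coord_one (list_bracket e6_bracket du (block_two v)))
      (g23_bracket u v @ list_apply coord_one (list_bracket e6_bracket (block_two u) (e6_d (block_two v)))))
    g23_basis)"

section \<open>Evaluation of the tables on the bases\<close>

lemma e6_root_list_closed:
 "list_all (\<lambda>b. list_all (\<lambda>i. (e6_form (b + e6_simple i) (b + e6_simple i) = 2 \<longrightarrow> List.member e6_root_list (b + e6_simple i)) \<and>
   (e6_form (b - e6_simple i) (b - e6_simple i) = 2 \<longrightarrow> List.member e6_root_list (b - e6_simple i)))
   [0, 1, 2, 3, 4, 5]) e6_root_list"
 by code_simp

lemma e6_simple_list: "list_all (\<lambda>i. List.member e6_root_list (e6_simple i) \<and> List.member e6_root_list (- e6_simple i)) [0, 1, 2, 3, 4, 5]"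
 by code_simp

lemma e6_check_H: "list_all (\<lambda>i. e6_check (H i)) [0, 1, 2, 3, 4]"
 by code_simp

lemma e6_check_R_0: "list_all (\<lambda>a. e6_check (R a)) (take 8 (drop 0 e6_root_list))"
 by code_simp

lemma e6_check_R_1: "list_all (\<lambda>a. e6_check (R a)) (take 8 (drop 8 e6_root_list))"
 by code_simp

lemma e6_check_R_2: "list_all (\<lambda>a. e6_check (R a)) (take 8 (drop 16 e6_root_list))"
 by code_simp

lemma e6_check_R_3: "list_all (\<lambda>a. e6_check (R a)) (take 8 (drop 24 e6_root_list))"
 by code_simp

lemma e6_check_R_4: "list_all (\<lambda>a. e6_check (R a)) (take 8 (drop 32 e6_root_list))"
 by code_simp

lemma e6_check_R_5: "list_all (\<lambda>a. e6_check (R a)) (take 8 (drop 40 e6_root_list))"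
 by code_simp

lemma e6_check_R_6: "list_all (\<lambda>a. e6_check (R a)) (take 8 (drop 48 e6_root_list))"
 by code_simp

lemma e6_check_R_7: "list_all (\<lambda>a. e6_check (R a)) (take 8 (drop 56 e6_root_list))"
 by code_simp

lemma e6_check_R_8: "list_all (\<lambda>a. e6_check (R a)) (take 8 (drop 64 e6_root_list))"
 by code_simp

lemma g23_checks: "list_all g23_check g23_basis"
 by code_simp

lemma bracket_check_0: "bracket_check (g23_basis ! 0)"
 by code_simp

lemma bracket_check_1: "bracket_check (g23_basis ! 1)"
 by code_simp

lemma bracket_check_2: "bracket_check (g23_basis ! 2)"
 by code_simp

lemma bracket_check_3: "bracket_check (g23_basis ! 3)"
 by code_simp

lemma bracket_check_4: "bracket_check (g23_basis ! 4)"
 by code_simp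

lemma bracket_check_5: "bracket_check (g23_basis ! 5)"
 by code_simp

lemma bracket_check_6: "bracket_check (g23_basis ! 6)"
 by code_simp

lemma bracket_check_7: "bracket_check (g23_basis ! 7)"
 by code_simp

lemma bracket_check_8: "bracket_check (g23_basis ! 8)"
 by code_simp

lemma bracket_check_9: "bracket_check (g23_basis ! 9)"
 by code_simp

lemma bracket_check_10: "bracket_check (g23_basis ! 10)"
 by code_simp

lemma bracket_check_11: "bracket_check (g23_basis ! 11)"
 by code_simp

lemma bracket_check_12: "bracket_check (g23_basis ! 12)"
 by code_simp

lemma bracket_check_13: "bracket_check (g23_basis ! 13)"
 by code_simp

lemma bracket_check_14: "bracket_check (g23_basis ! 14)"
 by code_simp

lemma bracket_check_15: "bracket_check (g23_basis ! 15)"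
 by code_simp

lemma bracket_check_16: "bracket_check (g23_basis ! 16)"
 by code_simp

lemma bracket_check_17: "bracket_check (g23_basis ! 17)"
 by code_simp

lemma bracket_check_18: "bracket_check (g23_basis ! 18)"
 by code_simp

lemma bracket_check_19: "bracket_check (g23_basis ! 19)"
 by code_simp

lemma bracket_check_20: "bracket_check (g23_basis ! 20)"
 by code_simp

lemma bracket_check_21: "bracket_check (g23_basis ! 21)"
 by code_simp

lemma bracket_check_22: "bracket_check (g23_basis ! 22)"
 by code_simp

lemma bracket_check_23: "bracket_check (g23_basis ! 23)"
 by code_simp

lemma e6_N_eq: "e6.N = e6_N"
 by (intro ext) (simp add: e6.N_def e6_N_def)

text \<open>Completeness of the list by induction on the height: a root that is not simple up to
  sign is a shorter root plus or minus a simple one, and the list is closed under such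
  steps.\<close>

lemma e6_root_list:
 assumes "a \<in> e6.roots"
 shows "a \<in> set e6_root_list"
 using assms
proof (induction "e6_height a" arbitrary: a rule: less_induct)
 case less
 have simple: "e6_simple i \<in> set e6_root_list \<and> - e6_simple i \<in> set e6_root_list" if "i \<le> 5" for i
  using e6_simple_list that unfolding le_5 list_all_iff List.member_iff by auto
 show ?case
 proof (cases "\<exists>i\<le>5. a = e6_simple i \<or> a = - e6_simple i")
  case True
  then show ?thesis
   using simple by blast
 next
  case False
  then obtain b c i where bc: "b \<in> e6.roots" "a = b + c" "e6_height b < e6_height a" "i \<le> 5"
   "c = e6_simple i \<or> c = - e6_simple i"
   using e6_root_sum[OF less.prems] by blast
  have b: "b \<in> set e6_root_list"
   using less.hyps[OF bc(3,1)] .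
  have i: "i \<in> set [0, 1, 2, 3, 4, 5]"
   using bc(4) unfolding le_5 by auto
  have "(e6_form (b + e6_simple i) (b + e6_simple i) = 2 \<longrightarrow> b + e6_simple i \<in> set e6_root_list) \<and>
    (e6_form (b - e6_simple i) (b - e6_simple i) = 2 \<longrightarrow> b - e6_simple i \<in> set e6_root_list)"
   using e6_root_list_closed b i unfolding list_all_iff List.member_iff by blast
  then show ?thesis
   using less.prems bc(2,5) unfolding e6.roots_def by (auto simp del: plus_prod_def)
 qed
qed

lemma e6_checks:
 assumes "u \<in> ridx_set 5 e6.roots"
 shows "e6_check u"
proof (cases u)
 case (H i)
 then have "i \<in> set [0, 1, 2, 3, 4]"
  using assms by (auto simp: ridx_set_def less_5)
 then show ?thesis
  using H e6_check_H unfolding list_all_iff by blast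
next
 case (R a)
 have split: "e6_root_list = take 8 (drop 0 e6_root_list) @ take 8 (drop 8 e6_root_list) @ take 8 (drop 16 e6_root_list) @
   take 8 (drop 24 e6_root_list) @ take 8 (drop 32 e6_root_list) @ take 8 (drop 40 e6_root_list) @
   take 8 (drop 48 e6_root_list) @ take 8 (drop 56 e6_root_list) @ take 8 (drop 64 e6_root_list)"
  by (simp add: e6_root_list_def)
 have "list_all (\<lambda>a. e6_check (R a)) e6_root_list"
  by (subst split, simp only: list_all_append e6_check_R_0 e6_check_R_1 e6_check_R_2 e6_check_R_3 e6_check_R_4
   e6_check_R_5 e6_check_R_6 e6_check_R_7 e6_check_R_8)
 moreover have "a \<in> set e6_root_list"
  using assms R by (intro e6_root_list) (auto simp: ridx_set_def)
 ultimately show ?thesis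
  using R unfolding list_all_iff by blast
qed

lemma g23_basis_set: "set g23_basis = ridx_set 2 (set g23_roots)"
 by (auto simp: g23_basis_def ridx_set_def less_2)

lemma g23_index_iff:
 "u \<in> ridx_set 2 (set g23_roots) \<and> ridx_parity g23_parity u = 0 \<longleftrightarrow> g23_index False u"
 "u \<in> ridx_set 2 (set g23_roots) \<and> ridx_parity g23_parity u = 1 \<longleftrightarrow> g23_index True u"
 by (cases u; auto simp: ridx_set_def g23_root_iff g23_parity_def)+

lemma e6_index_iff: "u \<in> ridx_set 5 e6.roots \<longleftrightarrow> e6_index u"
 by (cases u) (auto simp: ridx_set_def e6.roots_def)

lemma g23_basis_checks:
 assumes "u \<in> ridx_set 2 (set g23_roots)"
 shows "g23_check u" "bracket_check u"
proof -
 have u: "u \<in> set g23_basis"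
  using assms g23_basis_set by simp
 then show "g23_check u"
  using g23_checks unfolding list_all_iff by blast
 obtain i where i: "i < length g23_basis" "u = g23_basis ! i"
  using u by (metis in_set_conv_nth)
 have "length g23_basis = 24"
  by (simp add: g23_basis_def g23_roots_def)
 then have "i \<in> {0, 1, 2, 3, 4, 5, 6, 7, 8, 9, 10, 11, 12, 13, 14, 15, 16, 17, 18, 19, 20, 21, 22, 23}"
  using i(1) unfolding insert_iff empty_iff by arith
 then show "bracket_check u"
  unfolding i(2) insert_iff empty_iff
  by (elim disjE FalseE) (simp_all only: bracket_check_0 bracket_check_1 bracket_check_2 bracket_check_3 bracket_check_4
   bracket_check_5 bracket_check_6 bracket_check_7 bracket_check_8 bracket_check_9 bracket_check_10 bracket_check_11
   bracket_check_12 bracket_check_13 bracket_check_14 bracket_check_15 bracket_check_16 bracket_check_17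
   bracket_check_18 bracket_check_19 bracket_check_20 bracket_check_21 bracket_check_22 bracket_check_23)
qed

lemma bilinear_eqI:
 fixes F G :: "('a \<Rightarrow>\<^sub>0 'k :: field) \<Rightarrow> ('b \<Rightarrow>\<^sub>0 'k) \<Rightarrow> ('c \<Rightarrow>\<^sub>0 'k)"
 assumes "\<And>y. pm_linear (\<lambda>x. F x y)" "\<And>x. pm_linear (F x)" "\<And>y. pm_linear (\<lambda>x. G x y)" "\<And>x. pm_linear (G x)"
  and "\<And>u v. \<lbrakk>u \<in> keys x; v \<in> keys y\<rbrakk> \<Longrightarrow>
   F (single u 1) (single v 1) = G (single u 1) (single v 1)"
 shows "F x y = G x y"
 using pm_linear_eqI[of "\<lambda>x. F x y" "\<lambda>x. G x y" x, OF assms(1,3)] pm_linear_eqI[OF assms(2,4)] assms(5) by blast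

lemma keys_pm_ext_interp:
 assumes "\<And>u. u \<in> keys x \<Longrightarrow> list_all (\<lambda>v. fst v \<in> S) (f u)"
 shows "keys (pm_ext (\<lambda>u. interp (f u)) x) \<subseteq> S"
proof (rule order_trans[OF keys_pm_ext], rule UN_least)
 fix u assume "u \<in> keys x"
 then have "fst ` set (f u) \<subseteq> S"
  using assms by (auto simp: list_all_iff)
 then show "keys (interp (f u)) \<subseteq> S"
  using keys_interp by (rule order_trans[rotated])
qed

text \<open>The maps k, s, t, r, q of \<open>jordan_splitting\<close> are linear extensions of
  tables, and d is the bracket with a fixed list. So most of the required identities need checking
  on basis vectors only, where they are equalities of lists modulo 3; the Leibniz rule is the Jacobi
  identity.\<close>

lemma e6_semisimplification:
 fixes M :: "('k :: field, 'v) superalg"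
 assumes char: "CHAR('k) = 3"
  and copy: "lie_copy M (basis_superalg (ridx_set 5 e6.roots) (\<lambda>_. 0) (\<lambda>u v. interp (e6_bracket u v))) \<theta>"
  and \<delta>: "\<And>x. x \<in> carrier M \<Longrightarrow> \<delta> x \<in> carrier M"
  and \<theta>_\<delta>: "\<And>x. x \<in> carrier M \<Longrightarrow> \<theta> (\<delta> x) = bi_ext (\<lambda>u v. interp (e6_bracket u v))
   (interp [(R (e6_simple 0), 1), (R (e6_simple 1), 1), (R (e6_simple 5), 1)]) (\<theta> x)"
 shows "lie_algebra_in_rep_alpha3 M \<delta>"
  "\<exists>\<Psi>. lie_copy (basis_superalg (ridx_set 2 (set g23_roots)) (ridx_parity g23_parity) (\<lambda>u v. interp (g23_bracket u v)))
    (semisimplification M \<delta>) \<Psi>"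
proof -
 interpret E: root_model e6.roots "\<lambda>_. 0" e6.N e6_ev e6_cor 5 "TYPE('k)" e6_simple e6_height e6_degree
  by (rule e6_root_model[OF char])
 interpret G: root_model "set g23_roots" g23_parity g23_N g23_ev g23_cor 2 "TYPE('k)" g23_simple g23_height g23_degree
  by (rule g23_root_model[OF char])
 define bL :: "e6 ridx \<Rightarrow> e6 ridx \<Rightarrow> (e6 ridx \<Rightarrow>\<^sub>0 'k)" where "bL u v = interp (e6_bracket u v)" for u v
 define bN :: "g23 ridx \<Rightarrow> g23 ridx \<Rightarrow> (g23 ridx \<Rightarrow>\<^sub>0 'k)" where "bN u v = interp (g23_bracket u v)" for u v
 have bL: "E.quot.b = bL"
 proof (intro ext)
  fix u v
  have "E.quot.b u v = interp (root_bracket e6.N e6_ev e6_cor 5 u v)"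
   by (rule E.bb_def)
  then show "E.quot.b u v = bL u v"
   unfolding bL_def e6_N_eq .
 qed
 have bN: "G.quot.b = bN"
  by (intro ext) (simp only: G.bb_def bN_def)
 have par0: "ridx_parity (\<lambda>_ :: e6. 0) = (\<lambda>_. 0)"
 proof
  show "ridx_parity (\<lambda>_. 0) u = 0" for u :: "e6 ridx"
   by (cases u) auto
 qed
 let ?BL = "ridx_set 5 e6.roots" and ?BN = "ridx_set 2 (set g23_roots)" and ?pN = "ridx_parity g23_parity"
 interpret L: lie_basis ?BL "\<lambda>_. 0" bL
  using E.quot.lie_basis_axioms unfolding bL par0 .
 interpret N: lie_basis ?BN ?pN bN
  using G.quot.lie_basis_axioms unfolding bN .
 let ?x0 = "[(R (e6_simple 0), 1), (R (e6_simple 1), 1), (R (e6_simple 5), 1)]"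
 define d where "d = bi_ext bL (interp ?x0)"
 define k :: "(e6 ridx \<Rightarrow>\<^sub>0 'k) \<Rightarrow> _" where "k = pm_ext (\<lambda>u. interp (block_three u))"
 define s :: "(g23 ridx \<Rightarrow>\<^sub>0 'k) \<Rightarrow> _" where "s = pm_ext (\<lambda>u. interp (block_one u))"
 define t :: "(g23 ridx \<Rightarrow>\<^sub>0 'k) \<Rightarrow> _" where "t = pm_ext (\<lambda>u. interp (block_two u))"
 define r :: "(e6 ridx \<Rightarrow>\<^sub>0 'k) \<Rightarrow> _" where "r = pm_ext (\<lambda>u. interp (coord_one u))"
 define q :: "(e6 ridx \<Rightarrow>\<^sub>0 'k) \<Rightarrow> _" where "q = pm_ext (\<lambda>u. interp (coord_two u))"
 have lin: "pm_linear d" "pm_linear k" "pm_linear s" "pm_linear t" "pm_linear r" "pm_linear q"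
  unfolding d_def k_def s_def t_def r_def q_def by (rule bi_ext_linear_right pm_ext_linear)+
 note comp = pm_linear_comp
 have app: "d (interp xs) = interp (e6_d xs)" "k (interp xs) = interp (list_apply block_three xs)"
  "r (interp xs) = interp (list_apply coord_one xs)" "q (interp xs) = interp (list_apply coord_two xs)"
  "s (interp ys) = interp (list_apply block_one ys)" "t (interp ys) = interp (list_apply block_two ys)"
  "bi_ext bL (interp xs) (interp xs') = interp (list_bracket e6_bracket xs xs')" for xs xs' ys
  by (simp_all only: d_def k_def s_def t_def r_def q_def interp_list_apply interp_list_bracket e6_d_def bL_def[abs_def])
 have single: "single u (1 :: 'k) = interp [(u, 1)]" for u :: "'c"
  by simp
 have app1: "k (single u 1) = interp (block_three u)" "r (single u 1) = interp (coord_one u)"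
  "q (single u 1) = interp (coord_two u)" "s (single w 1) = interp (block_one w)"
  "t (single w 1) = interp (block_two w)" "d (single u 1) = interp (e6_d [(u, 1)])" for u w
 proof -
  show "k (single u 1) = interp (block_three u)" "r (single u 1) = interp (coord_one u)"
   "q (single u 1) = interp (coord_two u)" "s (single w 1) = interp (block_one w)"
   "t (single w 1) = interp (block_two w)"
   by (simp_all add: k_def r_def q_def s_def t_def)
  show "d (single u 1) = interp (e6_d [(u, 1)])"
   unfolding single by (rule app(1))
 qed
 have same_eq: "interp xs = (interp ys :: 'c \<Rightarrow>\<^sub>0 'k)" if "same_mod_3 xs ys" for xs ys :: "('c \<times> int) list"
  by (rule interp_same_mod_3[OF char that])
 have same_zero: "interp xs = (0 :: 'c \<Rightarrow>\<^sub>0 'k)" if "same_mod_3 xs []" for xs :: "('c \<times> int) list"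
  using same_eq[OF that] by simp
 have keys: "u \<in> keys x \<Longrightarrow> x \<in> carrier L.L \<Longrightarrow> u \<in> ?BL" for u x
  by auto
 have check: "e6_check u" if "u \<in> ?BL" for u
  by (rule e6_checks[OF that])
 have keys_even: "u \<in> ?BN" "g23_index False u" if "u \<in> keys a" "a \<in> part N.L 0" for u a
  using that g23_index_iff(1)[of u] by auto
 have keys_odd: "u \<in> ?BN" "g23_index True u" "\<not> g23_index False u" if "u \<in> keys a" "a \<in> part N.L 1" for u a
  using that g23_index_iff(2)[of u] g23_index_iff(1)[of u] by auto
 have even: "same_mod_3 (list_apply coord_one (block_one u)) [(u, 1)]" "same_mod_3 (e6_d (block_one u)) []"
  "list_all (\<lambda>v. e6_index (fst v)) (block_one u)" if "u \<in> ?BN" "g23_index False u" for u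
  using g23_basis_checks(1)[OF that(1)] that(2) unfolding g23_check_def by simp_all
 have odd: "same_mod_3 (list_apply coord_two (e6_d (block_two u))) [(u, 1)]" "same_mod_3 (e6_d (e6_d (block_two u))) []"
  "list_all (\<lambda>v. e6_index (fst v)) (block_two u)" if "u \<in> ?BN" "\<not> g23_index False u" for u
  using g23_basis_checks(1)[OF that(1)] that(2) unfolding g23_check_def Let_def by simp_all
 have x0: "interp ?x0 \<in> part L.L 0" "interp ?x0 \<in> carrier L.L"
 proof -
  have "fst ` set ?x0 \<subseteq> ?BL"
   using E.sr_root[of 0] E.sr_root[of 1] E.sr_root[of 5] by (auto simp: ridx_set_def)
  then have "keys (interp ?x0 :: _ \<Rightarrow>\<^sub>0 'k) \<subseteq> ?BL"
   using keys_interp by (rule order_trans[rotated])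
  then show "interp ?x0 \<in> part L.L 0" "interp ?x0 \<in> carrier L.L"
   by auto
 qed
 have d_closed: "d x \<in> carrier L.L" if "x \<in> carrier L.L" for x
  using L.bracket_closed[OF x0(2) that] unfolding d_def by simp
 have js: "jordan_splitting ?BL bL ?BN ?pN bN d k s t r q"
 proof unfold_locales
  show "finite ?BL"
   using finite_subset[OF subsetI[OF e6_root_list] finite_set] by (simp add: ridx_set_def)
  have three: "(3 :: 'k) = 0"
   using of_nat_CHAR[where 'a = 'k] char by simp
  show "(2 :: 'k) \<noteq> 0"
  proof
   assume two: "(2 :: 'k) = 0"
   have "(1 :: 'k) = 3 - 2"
    by simp
   then show False
    unfolding three two by simp
  qed
  show "pm_linear d" "pm_linear k" "pm_linear s" "pm_linear t" "pm_linear r" "pm_linear q"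
   by (rule lin)+
  fix x y assume x: "x \<in> carrier L.L"
  show "d x \<in> carrier L.L"
   by (rule d_closed[OF x])
  show "k x \<in> carrier L.L" "r x \<in> part N.L 0" "q x \<in> part N.L 1"
  proof -
   have c: "list_all (\<lambda>v. fst v \<in> ?BL) (block_three u)"
    "list_all (\<lambda>v. fst v \<in> {u \<in> ?BN. ?pN u = 0}) (coord_one u)"
    "list_all (\<lambda>v. fst v \<in> {u \<in> ?BN. ?pN u = 1}) (coord_two u)" if "u \<in> keys x" for u
    using check[OF keys[OF that x]] unfolding e6_check_def Let_def e6_index_iff mem_Collect_eq g23_index_iff by blast+
   show "k x \<in> carrier L.L" "r x \<in> part N.L 0" "q x \<in> part N.L 1"
    unfolding k_def r_def q_def basis_superalg_simps mem_Collect_eq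
    by (rule keys_pm_ext_interp, rule c, assumption)+
  qed
  have basis: "d (d (d (single u 1))) = 0" "r (d (single u 1)) = 0"
   "q (d (d (single u 1))) = 0"
   "single u 1 = s (r (single u 1)) + t (q (d (single u 1))) +
    d (t (q (single u 1))) + k (d (d (single u 1))) + d (k (d (single u 1))) +
    d (d (k (single u 1)))" if "u \<in> ?BL" for u
  proof -
   note c = check[OF that, unfolded e6_check_def Let_def]
   show "d (d (d (single u 1))) = 0" "r (d (single u 1)) = 0"
    "q (d (d (single u 1))) = 0"
    unfolding app1 app using c by (blast intro: same_zero)+
   have "interp [(u, 1)] = (interp (list_apply block_one (coord_one u) @ list_apply block_two (list_apply coord_two (e6_d [(u, 1)])) @
     e6_d (list_apply block_two (coord_two u)) @ list_apply block_three (e6_d (e6_d [(u, 1)])) @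
     e6_d (list_apply block_three (e6_d [(u, 1)])) @ e6_d (e6_d (block_three u))) :: _ \<Rightarrow>\<^sub>0 'k)"
    using c by (intro same_eq) blast
   then show "single u 1 = s (r (single u 1)) + t (q (d (single u 1))) +
    d (t (q (single u 1))) + k (d (d (single u 1))) + d (k (d (single u 1))) +
    d (d (k (single u 1)))"
    unfolding app1 app by (simp add: add.assoc)
  qed
  show "d (d (d x)) = 0"
   by (rule pm_linear_eqI[OF comp[OF lin(1) comp[OF lin(1) lin(1)]] pm_linear_const_zero, of x])
    (rule basis(1)[OF keys[OF _ x]])
  show "r (d x) = 0"
   by (rule pm_linear_eqI[OF comp[OF lin(5) lin(1)] pm_linear_const_zero, of x]) (rule basis(2)[OF keys[OF _ x]])
  show "q (d (d x)) = 0"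
   by (rule pm_linear_eqI[OF comp[OF lin(6) comp[OF lin(1) lin(1)]] pm_linear_const_zero, of x])
    (rule basis(3)[OF keys[OF _ x]])
  have "pm_linear (\<lambda>x. s (r x) + t (q (d x)) + d (t (q x)) + k (d (d x)) + d (k (d x)) + d (d (k x)))"
   by (intro pm_linear_plus comp[OF lin(3) lin(5)] comp[OF lin(4) comp[OF lin(6) lin(1)]]
    comp[OF lin(1) comp[OF lin(4) lin(6)]] comp[OF lin(2) comp[OF lin(1) lin(1)]]
    comp[OF lin(1) comp[OF lin(2) lin(1)]] comp[OF lin(1) comp[OF lin(1) lin(2)]])
  from pm_linear_eqI[OF pm_linear_id this, of x] basis(4)[OF keys[OF _ x]]
  show "x = s (r x) + t (q (d x)) + d (t (q x)) + k (d (d x)) + d (k (d x)) + d (d (k x))"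
   by blast
  assume y: "y \<in> carrier L.L"
  show "d (bi_ext bL x y) = bi_ext bL (d x) y + bi_ext bL x (d y)"
  proof -
   have "x \<in> part L.L 0"
    using x by simp
   then show ?thesis
    using L.jacobi_part[OF x0(1) _ y, of x 0] by (simp add: d_def koszul_sign_def)
  qed
 next
  fix a assume a: "a \<in> part N.L 0"
  have "list_all (\<lambda>v. fst v \<in> ?BL) (block_one u)" if "u \<in> keys a" for u
   using even(3)[OF keys_even[OF that a]] unfolding e6_index_iff .
  then show "s a \<in> carrier L.L"
   using keys_pm_ext_interp[of a ?BL block_one] by (simp add: s_def)
  show "r (s a) = a"
  proof (rule pm_linear_eqI[OF comp[OF lin(5) lin(3)] pm_linear_id])
   fix u assume "u \<in> keys a"
   from same_eq[OF even(1)[OF keys_even[OF this a]]] show "r (s (single u 1)) = single u 1"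
    unfolding app1 app by simp
  qed
  show "d (s a) = 0"
  proof (rule pm_linear_eqI[OF comp[OF lin(1) lin(3)] pm_linear_const_zero, of a])
   fix u assume "u \<in> keys a"
   from same_zero[OF even(2)[OF keys_even[OF this a]]] show "d (s (single u 1)) = 0"
    unfolding app1 app .
  qed
  fix c
  show "r (bi_ext bL (s a) (s c)) = bi_ext bN a c" if c: "c \<in> part N.L 0"
  proof (rule bilinear_eqI[where F = "\<lambda>a c. r (bi_ext bL (s a) (s c))" and G = "bi_ext bN"])
   fix u v assume u: "u \<in> keys a" "v \<in> keys c"
   note u' = keys_even[OF u(1) a] and v' = keys_even[OF u(2) c]
   have "same_mod_3 (list_apply coord_one (list_bracket e6_bracket (block_one u) (block_one v))) (g23_bracket u v)"
    using g23_basis_checks(2)[OF u'(1)] u'(2) v' g23_basis_set unfolding bracket_check_def list_all_iff by auto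
   from same_eq[OF this]
   show "r (bi_ext bL (s (single u 1)) (s (single v 1))) =
     bi_ext bN (single u 1) (single v 1)"
    unfolding app1 app by (simp add: bN_def)
  qed (rule comp[OF lin(5) comp[OF bi_ext_linear_left lin(3)]] comp[OF lin(5) comp[OF bi_ext_linear_right lin(3)]]
   bi_ext_linear_left bi_ext_linear_right)+
  show "q (d (bi_ext bL (s a) (t c))) = bi_ext bN a c" if c: "c \<in> part N.L 1"
  proof (rule bilinear_eqI[where F = "\<lambda>a c. q (d (bi_ext bL (s a) (t c)))" and G = "bi_ext bN"])
   fix u v assume u: "u \<in> keys a" "v \<in> keys c"
   note u' = keys_even[OF u(1) a] and v' = keys_odd[OF u(2) c]
   have "same_mod_3 (list_apply coord_two (e6_d (list_bracket e6_bracket (block_one u) (block_two v)))) (g23_bracket u v)"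
    using g23_basis_checks(2)[OF u'(1)] u'(2) v' g23_basis_set unfolding bracket_check_def list_all_iff by auto
   from same_eq[OF this]
   show "q (d (bi_ext bL (s (single u 1)) (t (single v 1)))) =
     bi_ext bN (single u 1) (single v 1)"
    unfolding app1 app by (simp add: bN_def)
  qed (rule comp[OF lin(6) comp[OF lin(1) comp[OF bi_ext_linear_left lin(3)]]]
   comp[OF lin(6) comp[OF lin(1) comp[OF bi_ext_linear_right lin(4)]]] bi_ext_linear_left bi_ext_linear_right)+
 next
  fix a assume a: "a \<in> part N.L 1"
  have "list_all (\<lambda>v. fst v \<in> ?BL) (block_two u)" if "u \<in> keys a" for u
   using odd(3)[OF keys_odd(1,3)[OF that a]] unfolding e6_index_iff .
  then show "t a \<in> carrier L.L"
   using keys_pm_ext_interp[of a ?BL block_two] by (simp add: t_def)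
  show "q (d (t a)) = a"
  proof (rule pm_linear_eqI[OF comp[OF lin(6) comp[OF lin(1) lin(4)]] pm_linear_id])
   fix u assume "u \<in> keys a"
   from same_eq[OF odd(1)[OF keys_odd(1,3)[OF this a]]] show "q (d (t (single u 1))) = single u 1"
    unfolding app1 app by simp
  qed
  show "d (d (t a)) = 0"
  proof (rule pm_linear_eqI[OF comp[OF lin(1) comp[OF lin(1) lin(4)]] pm_linear_const_zero, of a])
   fix u assume "u \<in> keys a"
   from same_zero[OF odd(2)[OF keys_odd(1,3)[OF this a]]] show "d (d (t (single u 1))) = 0"
    unfolding app1 app .
  qed
  fix c assume c: "c \<in> part N.L 1"
  show "r (bi_ext bL (d (t a)) (t c) - bi_ext bL (t a) (d (t c))) = bi_ext bN a c"
  proof (rule bilinear_eqI[where F = "\<lambda>a c. r (bi_ext bL (d (t a)) (t c) - bi_ext bL (t a) (d (t c)))" and G = "bi_ext bN"])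
   fix u v assume u: "u \<in> keys a" "v \<in> keys c"
   note u' = keys_odd[OF u(1) a] and v' = keys_odd[OF u(2) c]
   have "same_mod_3 (list_apply coord_one (list_bracket e6_bracket (e6_d (block_two u)) (block_two v)))
     (g23_bracket u v @ list_apply coord_one (list_bracket e6_bracket (block_two u) (e6_d (block_two v))))"
    using g23_basis_checks(2)[OF u'(1)] u'(3) v'(1,2) g23_basis_set unfolding bracket_check_def list_all_iff Let_def by auto
   from same_eq[OF this]
   have "r (bi_ext bL (d (t (single u 1))) (t (single v 1))) =
     bN u v + r (bi_ext bL (t (single u 1)) (d (t (single v 1))))"
    unfolding app1 app by (simp add: bN_def)
   then show "r (bi_ext bL (d (t (single u 1))) (t (single v 1)) -
     bi_ext bL (t (single u 1)) (d (t (single v 1)))) =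
     bi_ext bN (single u 1) (single v 1)"
    by (simp add: pm_linear_diff[OF lin(5)])
  next
   show "pm_linear (\<lambda>a. r (bi_ext bL (d (t a)) (t c) - bi_ext bL (t a) (d (t c))))" for c
    by (rule comp[OF lin(5) pm_linear_minus[OF comp[OF bi_ext_linear_left comp[OF lin(1) lin(4)]] comp[OF bi_ext_linear_left lin(4)]]])
   show "pm_linear (\<lambda>c. r (bi_ext bL (d (t a)) (t c) - bi_ext bL (t a) (d (t c))))" for a
    by (rule comp[OF lin(5) pm_linear_minus[OF comp[OF bi_ext_linear_right lin(4)] comp[OF bi_ext_linear_right comp[OF lin(1) lin(4)]]]])
  qed (rule bi_ext_linear_left bi_ext_linear_right)+
 qed
 have "jordan_splitting_copy ?BL bL ?BN ?pN bN d k s t r q M \<theta> \<delta>"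
 proof (rule jordan_splitting_copy.intro[OF js], rule jordan_splitting_copy_axioms.intro)
  show "lie_copy M L.L \<theta>"
   using copy unfolding bL_def[abs_def] .
  show "\<theta> (\<delta> x) = d (\<theta> x)" if "x \<in> carrier M" for x
   using \<theta>_\<delta>[OF that] unfolding d_def bL_def[abs_def] .
 qed (rule \<delta>)
 then interpret J: jordan_splitting_copy ?BL bL ?BN ?pN bN d k s t r q M \<theta> \<delta> .
 show "lie_algebra_in_rep_alpha3 M \<delta>"
  by (rule J.lie_algebra_in_rep_alpha3_M)
 have "(\<lambda>u v. interp (g23_bracket u v)) = bN"
  by (intro ext) (simp add: bN_def)
 then show "\<exists>\<Psi>. lie_copy (basis_superalg ?BN ?pN (\<lambda>u v. interp (g23_bracket u v))) (semisimplification M \<delta>) \<Psi>"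
  using J.semisimplification_copy by (metis (no_types, lifting))
qed

lemma sum_less_Suc: "(\<Sum>i<Suc 5. g i) = g 0 + g 1 + g 2 + g 3 + g 4 + (g (5 :: nat) :: 'c :: comm_monoid_add)"
 "(\<Sum>i<Suc 2. h i) = h 0 + h 1 + (h (2 :: nat) :: 'd :: comm_monoid_add)"
 by (simp_all only: sum.lessThan_Suc sum_less_5 sum_less_2)

text \<open>Injectivity of the Cartan matrix with 1 added to the diagonal entry of index 2, the
  correction that makes the singular matrix invertible modulo 3. Multiples of 3 are inserted so that
  each unknown becomes a combination of rows and of unknowns already known to vanish.\<close>

lemma e6_kernel:
 fixes x :: "nat \<Rightarrow> 'k :: field"
 assumes three: "(3 :: 'k) = 0"
  and r: "2 * x 0 - x 2 = 0" "2 * x 1 - x 3 = 0" "- x 0 + 2 * x 2 - x 3 + x 2 = 0" "- x 1 - x 2 + 2 * x 3 - x 4 = 0"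
   "- x 3 + 2 * x 4 - x 5 = 0" "- x 4 + 2 * x 5 = 0"
  and "j \<le> 5"
 shows "x j = 0"
proof -
 have "x 3 = 3 * x 5 - (- x 3 + 2 * x 4 - x 5) - 2 * (- x 4 + 2 * x 5)"
  by (simp add: algebra_simps)
 then have x3: "x 3 = 0"
  unfolding r three by simp
 have "x 0 = 3 * x 2 - (- x 0 + 2 * x 2 - x 3 + x 2) - x 3"
  by (simp add: algebra_simps)
 then have x0: "x 0 = 0"
  unfolding r three unfolding x3 by simp
 have x2: "x 2 = 0"
  using r(1) x0 by simp
 have "x 1 = 3 * x 1 - (2 * x 1 - x 3) - x 3"
  by (simp add: algebra_simps)
 then have x1: "x 1 = 0"
  unfolding r three unfolding x3 by simp
 have x4: "x 4 = 0"
  using r(4) x1 x2 x3 by simp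
 have "x 5 = 3 * x 5 - (- x 4 + 2 * x 5) - x 4"
  by (simp add: algebra_simps)
 then have "x 5 = 0"
  unfolding r three unfolding x4 by simp
 then show ?thesis
  using assms(8) x0 x1 x2 x3 x4 unfolding le_5 by blast
qed

theorem corollary4p4p1:
 fixes D :: "('k :: alg_closed_field, 'h) cartan_datum"
  and D' :: "('k, 'h') cartan_datum"
 assumes char: "CHAR('k) = 3"
  and e6: "cartan_realization D"
   "cartan_matrix D = mat_of_rows_list 6
     [[ 2,  0, -1,  0,  0,  0],
     [ 0,  2,  0, -1,  0,  0],
     [-1,  0,  2, -1,  0,  0],
     [ 0, -1, -1,  2, -1,  0],
     [ 0,  0,  0, -1,  2, -1],
     [ 0,  0,  0,  0, -1,  2]]"
   "\<forall>i<6. parity D i = 0"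
  and g23: "cartan_realization D'"
   "cartan_matrix D' = mat_of_rows_list 3
     [[ 0, -1,  0],
     [-1,  0, -1],
     [ 0, -1,  0]]"
   "\<forall>i<3. parity D' i = 1"
 defines "G \<equiv> contragredient D"
 defines "x \<equiv> superalg_center (derived_superalg G)
         +>\<^bsub>derived_superalg G\<^esub> (chev_e D 0 \<oplus>\<^bsub>G\<^esub> chev_e D 1 \<oplus>\<^bsub>G\<^esub> chev_e D 5)"
 defines "d \<equiv> (\<lambda>y. x \<otimes>\<^bsub>derived_mod_center G\<^esub> y)"
 shows "lie_algebra_in_rep_alpha3 (derived_mod_center G) d \<and>
     lie_superalgebra_isomorphic (semisimplification (derived_mod_center G) d)
      (derived_mod_center (contragredient D'))"
proof -
 interpret E: root_model e6.roots "\<lambda>_. 0" e6.N e6_ev e6_cor 5 "TYPE('k)" e6_simple e6_height e6_degree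
  by (rule e6_root_model[OF char])
 interpret R: root_model "set g23_roots" g23_parity g23_N g23_ev g23_cor 2 "TYPE('k)" g23_simple g23_height g23_degree
  by (rule g23_root_model[OF char])
 have three: "(3 :: 'k) = 0"
  using of_nat_CHAR[where 'a = 'k] char by simp
 let ?A = "[[ 2,  0, -1,  0,  0,  0], [ 0,  2,  0, -1,  0,  0], [-1,  0,  2, -1,  0,  0],
  [ 0, -1, -1,  2, -1,  0], [ 0,  0,  0, -1,  2, -1], [ 0,  0,  0,  0, -1,  2]] :: int list list"
 let ?A' = "[[ 0, -1,  0], [-1,  0, -1], [ 0, -1,  0]] :: int list list"
 have A: "cartan_matrix D $$ (i, j) = ?A ! i ! j" if "i \<le> 5" "j \<le> 5" for i j
  using that by (simp add: e6(2) mat_of_rows_list_def)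
 have A': "cartan_matrix D' $$ (i, j) = ?A' ! i ! j" if "i \<le> 2" "j \<le> 2" for i j
  using that by (simp add: g23(2) mat_of_rows_list_def)
 have "\<exists>\<xi>. lie_copy (derived_mod_center G) E.quot.L \<xi> \<and> x \<in> carrier (derived_mod_center G) \<and>
   \<xi> x = E.e 0 + E.e 1 + E.e 5"
 proof -
  have dim: "dim_row (cartan_matrix D) = Suc 5"
   by (simp add: e6(2) mat_of_rows_list_def)
  have par_D: "parity D i = 0" if "i \<le> 5" for i
   using e6(3) that by simp
  have entry: "3 dvd cartan_matrix D $$ (i, j) - (\<Sum>k<5. e6_cor (e6_simple i) k * e6_ev k (e6_simple j))"
   if "i \<le> 5" "j \<le> 5" for i j
   using that unfolding A[OF that] le_5 sum_less_5 by (elim disjE; simp add: e6_cor_def e6_ev_def e6_simple_def)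
  have ev: "e6_ev (Suc 5) (e6_simple j) = (if j = 2 then 1 else 0)" if "j \<le> 5" for j
   using that unfolding le_5 by (auto simp: e6_ev_def e6_simple_def)
  \<comment> \<open>The Cartan matrix sends this vector to (3, 0, -3, 0, 3, -3), so it is a kernel
    vector modulo 3. Its entry at index 2 is a unit, which permits k = 2.\<close>
  define z :: "nat \<Rightarrow> int" where "z j = [1, 0, -1, 0, 1, -1] ! j" for j
  have z: "3 dvd (\<Sum>j<Suc 5. cartan_matrix D $$ (i, j) * z j)" if "i \<le> 5" for i
   using that unfolding sum_less_Suc le_5 by (auto simp: A z_def)
  have z2: "\<not> 3 dvd z 2"
   by (simp add: z_def)
  have inj: "\<forall>x :: nat \<Rightarrow> 'k. (\<forall>i<Suc 5.
   (\<Sum>j<Suc 5. of_int (cartan_matrix D $$ (i, j)) * x j) + (if i = 2 then x 2 else 0) = 0) \<longrightarrow> (\<forall>j<Suc 5. x j = 0)"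
  proof (intro allI impI)
   fix x :: "nat \<Rightarrow> 'k" and j
   assume "\<forall>i<Suc 5. (\<Sum>j<Suc 5. of_int (cartan_matrix D $$ (i, j)) * x j) + (if i = 2 then x 2 else 0) = 0"
   then have row: "(\<Sum>j<Suc 5. of_int (cartan_matrix D $$ (i, j)) * x j) + (if i = 2 then x 2 else 0) = 0" if "i \<le> 5" for i
    using that by (simp only: less_Suc_eq_le)
   assume "j < Suc 5"
   show "x j = 0"
   proof (rule e6_kernel[OF three])
    show "2 * x 0 - x 2 = 0" "2 * x 1 - x 3 = 0" "- x 0 + 2 * x 2 - x 3 + x 2 = 0" "- x 1 - x 2 + 2 * x 3 - x 4 = 0"
     "- x 3 + 2 * x 4 - x 5 = 0" "- x 4 + 2 * x 5 = 0"
     using row[of 0] row[of 1] row[of 2] row[of 3] row[of 4] row[of 5] unfolding sum_less_Suc by (simp_all add: A)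
   qed (use \<open>j < Suc 5\<close> in simp)
  qed
  have two: "(2 :: nat) \<le> 5"
   by simp
  show ?thesis
  proof (rule E.contragredient_copy_model[where z = z and k = 2, OF e6(1) dim par_D entry two ev z z2 inj])
   fix \<xi>
   assume \<xi>: "lie_copy (derived_mod_center (contragredient D)) E.quot.L \<xi>"
    "\<And>i j k. \<lbrakk>i \<le> 5; j \<le> 5; k \<le> 5\<rbrakk> \<Longrightarrow>
     superalg_center (derived_superalg (contragredient D)) +>\<^bsub>derived_superalg (contragredient D)\<^esub>
      (chev_e D i \<oplus>\<^bsub>contragredient D\<^esub> chev_e D j \<oplus>\<^bsub>contragredient D\<^esub> chev_e D k)
     \<in> carrier (derived_mod_center (contragredient D)) \<and>
     \<xi> (superalg_center (derived_superalg (contragredient D)) +>\<^bsub>derived_superalg (contragredient D)\<^esub>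
      (chev_e D i \<oplus>\<^bsub>contragredient D\<^esub> chev_e D j \<oplus>\<^bsub>contragredient D\<^esub> chev_e D k)) = E.e i + E.e j + E.e k"
   show ?thesis
    using \<xi>(1) \<xi>(2)[of 0 1 5] unfolding x_def G_def by auto
  qed assumption+
 qed
 then obtain \<xi> where \<xi>: "lie_copy (derived_mod_center G) E.quot.L \<xi>" and x: "x \<in> carrier (derived_mod_center G)"
   "\<xi> x = E.e 0 + E.e 1 + E.e 5"
  by blast
 have "\<exists>\<xi>. lie_copy (derived_mod_center (contragredient D')) R.quot.L \<xi>"
 proof -
  have dim: "dim_row (cartan_matrix D') = Suc 2"
   by (simp add: g23(2) mat_of_rows_list_def)
  have par_D: "parity D' i = g23_parity (g23_simple i)" if "i \<le> 2" for i
  proof -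
   have "parity D' i = 1"
    using g23(3) that by simp
   moreover have "g23_parity (g23_simple i) = 1"
    using that unfolding le_2 by (auto simp: g23_parity_def g23_simple_def g23_odd_def)
   ultimately show ?thesis
    by simp
  qed
  have entry: "3 dvd cartan_matrix D' $$ (i, j) - (\<Sum>k<2. g23_cor (g23_simple i) k * g23_ev k (g23_simple j))"
   if "i \<le> 2" "j \<le> 2" for i j
   using that unfolding A'[OF that] le_2 sum_less_2 by (auto simp: g23_cor_def g23_ev_def g23_simple_def)
  have ev: "g23_ev (Suc 2) (g23_simple j) = (if j = 0 then 1 else 0)" if "j \<le> 2" for j
   using that unfolding le_2 by (auto simp: g23_ev_def g23_simple_def)
  \<comment> \<open>A kernel vector over the integers: the first and the last row of the matrix
    coincide, and it is symmetric. Its first entry permits k = 0.\<close>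
  define z :: "nat \<Rightarrow> int" where "z j = [1, 0, -1] ! j" for j
  have z: "3 dvd (\<Sum>j<Suc 2. cartan_matrix D' $$ (i, j) * z j)" if "i \<le> 2" for i
   using that unfolding sum_less_Suc le_2 by (auto simp: A' z_def)
  have z0: "\<not> 3 dvd z 0"
   by (simp add: z_def)
  have inj: "\<forall>x :: nat \<Rightarrow> 'k. (\<forall>i<Suc 2.
   (\<Sum>j<Suc 2. of_int (cartan_matrix D' $$ (i, j)) * x j) + (if i = 0 then x 0 else 0) = 0) \<longrightarrow> (\<forall>j<Suc 2. x j = 0)"
  proof (intro allI impI)
   fix x :: "nat \<Rightarrow> 'k" and j
   assume "\<forall>i<Suc 2. (\<Sum>j<Suc 2. of_int (cartan_matrix D' $$ (i, j)) * x j) + (if i = 0 then x 0 else 0) = 0"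
   then have row: "(\<Sum>j<Suc 2. of_int (cartan_matrix D' $$ (i, j)) * x j) + (if i = 0 then x 0 else 0) = 0" if "i \<le> 2" for i
    using that by (simp only: less_Suc_eq_le)
   have "x 0 - x 1 = 0" "- x 0 - x 2 = 0" "- x 1 = 0"
    using row[of 0] row[of 1] row[of 2] unfolding sum_less_Suc by (simp_all add: A')
   moreover assume "j < Suc 2"
   ultimately show "x j = 0"
    unfolding less_Suc_eq_le le_2 by auto
  qed
  show ?thesis
   by (rule R.contragredient_copy_model[where z = z and k = 0, OF g23(1) dim par_D entry le0 ev z z0 inj])
    (assumption | rule exI)+
 qed
 then obtain \<xi>' where \<xi>': "lie_copy (derived_mod_center (contragredient D')) R.quot.L \<xi>'"
  by blast
 have par0: "ridx_parity (\<lambda>_ :: e6. 0) = (\<lambda>_. 0)"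
 proof
  show "ridx_parity (\<lambda>_. 0) u = 0" for u :: "e6 ridx"
   by (cases u) auto
 qed
 have bE: "E.quot.b = (\<lambda>u v. interp (e6_bracket u v))"
 proof (intro ext)
  fix u v
  have "E.quot.b u v = interp (root_bracket e6.N e6_ev e6_cor 5 u v)"
   by (rule E.bb_def)
  then show "E.quot.b u v = interp (e6_bracket u v)"
   unfolding e6_N_eq .
 qed
 have bR: "R.quot.b = (\<lambda>u v. interp (g23_bracket u v))"
  by (intro ext) (rule R.bb_def)
 note \<xi>_E = \<xi>[unfolded bE par0]
 have d: "d y \<in> carrier (derived_mod_center G)" "\<xi> (d y) = bi_ext (\<lambda>u v. interp (e6_bracket u v))
   (interp [(R (e6_simple 0), 1), (R (e6_simple 1), 1), (R (e6_simple 5), 1)]) (\<xi> y)"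
  if y: "y \<in> carrier (derived_mod_center G)" for y
 proof -
  have "lie_superalgebra (derived_mod_center G)" and epi: "algebra_epi (derived_mod_center G)
    (basis_superalg (ridx_set 5 e6.roots) (\<lambda>_. 0) (\<lambda>u v. interp (e6_bracket u v))) \<xi>"
   using \<xi>_E unfolding lie_copy_def by blast+
  then interpret M: bracket_algebra "derived_mod_center G"
   by (intro lie_superalgebra_bracket_algebra)
  show "d y \<in> carrier (derived_mod_center G)"
   unfolding d_def by (rule M.bracket_closed[OF x(1) y])
  have "\<xi> x = interp [(R (e6_simple 0), 1), (R (e6_simple 1), 1), (R (e6_simple 5), 1)]"
   unfolding x(2) by (simp add: E.e_def add.assoc)
  with algebra_epiD(5)[OF epi x(1) y] show "\<xi> (d y) = bi_ext (\<lambda>u v. interp (e6_bracket u v))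
    (interp [(R (e6_simple 0), 1), (R (e6_simple 1), 1), (R (e6_simple 5), 1)]) (\<xi> y)"
   unfolding d_def by simp
 qed
 note ss = e6_semisimplification[where M = "derived_mod_center G" and \<theta> = \<xi> and \<delta> = d, OF char \<xi>_E d]
 from ss(2) obtain \<Psi> where \<Psi>: "lie_copy (basis_superalg (ridx_set 2 (set g23_roots)) (ridx_parity g23_parity)
   (\<lambda>u v. interp (g23_bracket u v))) (semisimplification (derived_mod_center G) d) \<Psi>"
  by blast
 \<comment> \<open>Both sides are copies of the same tabulated algebra. The block generators were
   chosen so that the tables agree, hence no further change of basis enters between the two
   maps.\<close>
 have "lie_superalgebra_isomorphic (semisimplification (derived_mod_center G) d) (derived_mod_center (contragredient D'))"
  by (rule lie_copy_isomorphic[OF lie_copy_comp[OF lie_copy_inv[OF \<Psi>] lie_copy_inv[OF \<xi>'[unfolded bR]]]])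
 with ss(1) show ?thesis
  by blast
qed

end
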